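(* Let $W$ be the dihedral group of order $2m$, $m\ge2$, let $k\ge1$, and let $K$ be the quotient field of $\mathbf A^*$. A complete list of pairwise non-isomorphic irreducible representations of $K\check{\mathscr H}^{(k)}_W$ is: (a) the trivial and sign representations $\check\epsilon_+$, $\check\epsilon_-$; (b) for each $\mathbf k'\in\mathrm{SComp}_{n,\le k}$, the two-dimensional representation $\check N^{(k)}_{\mathbf k'}=\check X^{(k)}\big(([2]^ka_{\mathbf k'})^2\big)$; (c) if $m$ is even, two one-dimensional representations $\check\epsilon_1\cong\epsilon_1\otimes\epsilon_+^{\otimes k-1}$ and $\check\epsilon_2\cong\epsilon_2\otimes\epsilon_+^{\otimes k-1}$ given by $\check\epsilon_1:\mathcal P^{(k)}_1\mapsto[2]^k,\ \mathcal P^{(k)}_2\mapsto0$ and $\check\epsilon_2:\mathcal P^{(k)}_1\mapsto0,\ \mathcal P^{(k)}_2\mapsto[2]^k$; (d) if $m$ is even, for each $\mathbf k'\in\mathrm{SComp}_{n,<k}$, the two-dimensional representation $\check N^{1(k)}_{\mathbf k'}=\check X^{(k)}\big(([2]^ka^1_{\mathbf k'})^2\big)$.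
   Context: Let $\mathbf A=\mathbb Z[u,u^{-1}]$, $[2]=u+u^{-1}$, $f=[2]^2$. $W$ is the dihedral group of order $2m$ with simple reflections $S=\{s_1,s_2\}$ and relations $s_1^2=s_2^2=(s_1s_2)^m=\mathrm{id}$. Its Hecke algebra $\mathscr H_W$ is the $\mathbf A$-algebra with free $\mathbf A$-basis $\{T_w:w\in W\}$ and relations $T_vT_w=T_{vw}$ if $\ell(vw)=\ell(v)+\ell(w)$, $(T_s-u)(T_s+u^{-1})=0$ for $s\in S$. Put $C'_s=T_s+u^{-1}$, $C_s=T_s-u$, $C'_i=C'_{s_i}$. For $k\ge1$, $\check{\mathscr H}^{(k)}_W$ is the unital $\mathbf A$-subalgebra of $\mathscr H_W^{\otimes k}$ (tensor product over $\mathbf A$) generated by $\mathcal P^{(k)}_i:=\mathcal P^{(k)}_{s_i}$, $i=1,2$, where $$\mathcal P^{(k)}_s=\sum_{\mathbf a\in\{+,-\}^k,\ |\{i:a_i=-\}|\text{ even}} c_{a_1}\otimes\cdots\otimes c_{a_k},\qquad c_+=C'_s,\ c_-=C_s .$$ $K\check{\mathscr H}^{(k)}_W=K\otimes_{\mathbf A}\check{\mathscr H}^{(k)}_W$. One-dimensional representations of $\mathscr H_W$: $\epsilon_+:C'_s\mapsto[2]$ for $s\in S$; for $m$ even, $\epsilon_1:C'_1\mapsto[2],C'_2\mapsto0$ and $\epsilon_2:C'_1\mapsto0,C'_2\mapsto[2]$. One-dimensional representations of $\check{\mathscr H}^{(k)}_W$: $\check\epsilon_+:\mathcal P^{(k)}_s\mapsto[2]^k$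 and $\check\epsilon_-:\mathcal P^{(k)}_s\mapsto0$ for $s\in S$. Tensor products of $k$ $\mathscr H_W$-modules are $\check{\mathscr H}^{(k)}_W$-modules by restriction. For $c\in K$, $\check X^{(k)}(c)$ denotes $K^2$ (column vectors) with $\mathcal P^{(k)}_1\mapsto\begin{pmatrix}[2]^k&c\\0&0\end{pmatrix}$, $\mathcal P^{(k)}_2\mapsto\begin{pmatrix}0&0\\1&[2]^k\end{pmatrix}$, whenever this defines a module (part of the claim is that it does for the listed values of $c$). Let $\zeta$ be a primitive $m$-th root of unity, $w_j=2+\zeta^j+\zeta^{-j}$, and $n=\frac{m-2}2$ if $m$ is even, $n=\frac{m-1}2$ if $m$ is odd. Fix square roots $\sqrt{w_j}$ and $\sqrt{f-w_j}$, $1\le j\le n$, in a field containing $\mathbf A$ and the $w_j$, and let $\mathbf A^*=\mathbf A[\sqrt{w_1},\dots,\sqrt{w_n},\sqrt{f-w_1},\dots,\sqrt{f-w_n}]$. A signed $n$-composition of $k'$ is $\mathbf k'=(k'_1,\dots,k'_n)\in\mathbb Z^n$ with $\sum_i|k'_i|=k'$; $\mathbf k'$ and $-\mathbf k'$ are called equivalent. $\mathrm{SComp}_{n,k'}$ is the set of equivalence classes of signed $n$-compositions of $k'$; $\mathrm{SComp}_{n,\le k}=\bigcup_{1\le k'\le k}\mathrm{SComp}_{n,k'}$ and $\mathrm{SComp}_{n,<k}=\bigcup_{1\le k'<k}\mathrm{SComp}_{n,k'}$. The multivariate Chebyshev polynomials $T_{\mathbf k},T^1_{\mathbf k}\in\mathbb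 Z[x_1,\dots,x_n,y_1,\dots,y_n]/(x_j^2+y_j^2-1:\ 1\le j\le n)$ express $\cos(k_1\theta_1+\dots+k_n\theta_n)$, resp. $\sin(k_1\theta_1+\dots+k_n\theta_n)$, in terms of $x_j=\cos\theta_j$, $y_j=\sin\theta_j$. Then $a_{\mathbf k}$ and $a^1_{\mathbf k}$ are the values of $T_{\mathbf k}$ and $T^1_{\mathbf k}$ at $x_j=\frac{\sqrt{w_j}}{[2]}$, $y_j=\frac{\sqrt{f-w_j}}{[2]}$. The squares $([2]^ka_{\mathbf k'})^2$, $([2]^ka^1_{\mathbf k'})^2$ depend only on the equivalence class of $\mathbf k'$. *)

theory Defs
  imports
    "HOL-Analysis.Analysis"
    "HOL-Algebra.Algebra"
    "HOL-Library.Poly_Mapping"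
begin

section \<open>Algebras over a commutative ring\<close>

definition univ_ring :: "'a::ring_1 ring" where
  "univ_ring = \<lparr>carrier = UNIV, monoid.mult = (*), one = 1, ring.zero = 0, ring.add = (+)\<rparr>"

text \<open>
  An \<open>'a\<close>-algebra is a ring \<open>B\<close> together with a ring homomorphism \<open>\<eta>\<close> from the commutative
  ring \<open>'a\<close> to the centre of \<open>B\<close>; scalar multiplication is \<open>a \<cdot> x = \<eta> a \<otimes> x\<close>.
\<close>

definition is_algebra :: "('a::comm_ring_1 \<Rightarrow> 'b) \<Rightarrow> ('b, 'm) ring_scheme \<Rightarrow> bool" where
  "is_algebra \<eta> B \<longleftrightarrow> ring B \<and> \<eta> \<in> ring_hom univ_ring B \<and>
     (\<forall>a. \<forall>x\<in>carrier B. \<eta> a \<otimes>\<^bsub>B\<^esub> x = x \<otimes>\<^bsub>B\<^esub> \<eta> a)"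

definition generated_subalgebra ::
    "('a::comm_ring_1 \<Rightarrow> 'b) \<Rightarrow> ('b, 'm) ring_scheme \<Rightarrow> 'b set \<Rightarrow> ('b, 'm) ring_scheme" where
  "generated_subalgebra \<eta> B S = B\<lparr>carrier := generate_ring B (range \<eta> \<union> S)\<rparr>"


section \<open>Tensor products of algebras\<close>

text \<open>
  The monoid ring \<open>\<int>[G]\<close>.  A tensor product of \<open>'a\<close>-algebras is obtained from the monoid ring of
  the product of their multiplicative monoids by dividing out the relations of
  multiadditivity and of balancedness over \<open>'a\<close>.
\<close>

definition monoid_ring :: "('g, 'm) monoid_scheme \<Rightarrow> ('g \<Rightarrow>\<^sub>0 int) ring" where
  "monoid_ring G =
     \<lparr>carrier = {p. Poly_Mapping.keys p \<subseteq> carrier G},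
      monoid.mult = (\<lambda>p q. \<Sum>x\<in>Poly_Mapping.keys p. \<Sum>y\<in>Poly_Mapping.keys q.
         Poly_Mapping.single (x \<otimes>\<^bsub>G\<^esub> y) (Poly_Mapping.lookup p x * Poly_Mapping.lookup q y)),
      one = Poly_Mapping.single \<one>\<^bsub>G\<^esub> 1, ring.zero = 0, ring.add = (+)\<rparr>"

subsection \<open>The tensor product of two algebras\<close>

definition tensor2_relations ::
    "('a \<Rightarrow> 'b) \<Rightarrow> ('b, 'm) ring_scheme \<Rightarrow> ('a \<Rightarrow> 'c) \<Rightarrow> ('c, 'n) ring_scheme
      \<Rightarrow> ('b \<times> 'c \<Rightarrow>\<^sub>0 int) set" where
  "tensor2_relations \<beta> B \<gamma> C =
     {frag_of (x \<oplus>\<^bsub>B\<^esub> x', y) - frag_of (x, y) - frag_of (x', y) | x x' y.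
        x \<in> carrier B \<and> x' \<in> carrier B \<and> y \<in> carrier C} \<union>
     {frag_of (x, y \<oplus>\<^bsub>C\<^esub> y') - frag_of (x, y) - frag_of (x, y') | x y y'.
        x \<in> carrier B \<and> y \<in> carrier C \<and> y' \<in> carrier C} \<union>
     {frag_of (\<beta> a \<otimes>\<^bsub>B\<^esub> x, y) - frag_of (x, \<gamma> a \<otimes>\<^bsub>C\<^esub> y) | a x y.
        x \<in> carrier B \<and> y \<in> carrier C}"

definition tensor2_ideal ::
    "('a \<Rightarrow> 'b) \<Rightarrow> ('b, 'm) ring_scheme \<Rightarrow> ('a \<Rightarrow> 'c) \<Rightarrow> ('c, 'n) ring_scheme
      \<Rightarrow> ('b \<times> 'c \<Rightarrow>\<^sub>0 int) set" where
  "tensor2_ideal \<beta> B \<gamma> C =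
     genideal (monoid_ring (B \<times>\<times> C)) (tensor2_relations \<beta> B \<gamma> C)"

definition tensor2 ::
    "('a \<Rightarrow> 'b) \<Rightarrow> ('b, 'm) ring_scheme \<Rightarrow> ('a \<Rightarrow> 'c) \<Rightarrow> ('c, 'n) ring_scheme
      \<Rightarrow> ('b \<times> 'c \<Rightarrow>\<^sub>0 int) set ring" where
  "tensor2 \<beta> B \<gamma> C = monoid_ring (B \<times>\<times> C) Quot tensor2_ideal \<beta> B \<gamma> C"

definition pure2 ::
    "('a \<Rightarrow> 'b) \<Rightarrow> ('b, 'm) ring_scheme \<Rightarrow> ('a \<Rightarrow> 'c) \<Rightarrow> ('c, 'n) ring_scheme
      \<Rightarrow> 'b \<Rightarrow> 'c \<Rightarrow> ('b \<times> 'c \<Rightarrow>\<^sub>0 int) set" where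
  "pure2 \<beta> B \<gamma> C x y =
     tensor2_ideal \<beta> B \<gamma> C +>\<^bsub>monoid_ring (B \<times>\<times> C)\<^esub> frag_of (x, y)"

subsection \<open>Tensor powers, with tensor positions \<open>1, \<dots>, k\<close>\<close>

definition power_monoid :: "nat \<Rightarrow> ('h, 'm) ring_scheme \<Rightarrow> (nat \<Rightarrow> 'h) monoid" where
  "power_monoid k H = product_group {1..k} (\<lambda>_. H)"

definition tensor_power_relations ::
    "('a \<Rightarrow> 'h) \<Rightarrow> nat \<Rightarrow> ('h, 'm) ring_scheme \<Rightarrow> ((nat \<Rightarrow> 'h) \<Rightarrow>\<^sub>0 int) set" where
  "tensor_power_relations \<eta> k H =
     {frag_of (h(i := x \<oplus>\<^bsub>H\<^esub> y)) - frag_of (h(i := x)) - frag_of (h(i := y)) | h i x y.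
        h \<in> carrier (power_monoid k H) \<and> i \<in> {1..k} \<and> x \<in> carrier H \<and> y \<in> carrier H} \<union>
     {frag_of (h(i := \<eta> a \<otimes>\<^bsub>H\<^esub> h i)) - frag_of (h(j := \<eta> a \<otimes>\<^bsub>H\<^esub> h j)) | a h i j.
        h \<in> carrier (power_monoid k H) \<and> i \<in> {1..k} \<and> j \<in> {1..k}}"

definition tensor_power_ideal ::
    "('a \<Rightarrow> 'h) \<Rightarrow> nat \<Rightarrow> ('h, 'm) ring_scheme \<Rightarrow> ((nat \<Rightarrow> 'h) \<Rightarrow>\<^sub>0 int) set" where
  "tensor_power_ideal \<eta> k H =
     genideal (monoid_ring (power_monoid k H)) (tensor_power_relations \<eta> k H)"

definition tensor_power ::
    "('a \<Rightarrow> 'h) \<Rightarrow> nat \<Rightarrow> ('h, 'm) ring_scheme \<Rightarrow> ((nat \<Rightarrow> 'h) \<Rightarrow>\<^sub>0 int) set ring" where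
  "tensor_power \<eta> k H = monoid_ring (power_monoid k H) Quot tensor_power_ideal \<eta> k H"

definition pure ::
    "('a \<Rightarrow> 'h) \<Rightarrow> nat \<Rightarrow> ('h, 'm) ring_scheme \<Rightarrow> (nat \<Rightarrow> 'h) \<Rightarrow> ((nat \<Rightarrow> 'h) \<Rightarrow>\<^sub>0 int) set" where
  "pure \<eta> k H h =
     tensor_power_ideal \<eta> k H +>\<^bsub>monoid_ring (power_monoid k H)\<^esub> frag_of (restrict h {1..k})"

text \<open>For \<open>k \<ge> 1\<close> the structure map of the tensor power is \<open>a \<mapsto> \<eta> a \<otimes> 1 \<otimes> \<dots> \<otimes> 1\<close>.\<close>

definition tensor_power_scalar ::
    "('a \<Rightarrow> 'h) \<Rightarrow> nat \<Rightarrow> ('h, 'm) ring_scheme \<Rightarrow> 'a \<Rightarrow> ((nat \<Rightarrow> 'h) \<Rightarrow>\<^sub>0 int) set" where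
  "tensor_power_scalar \<eta> k H a = pure \<eta> k H (\<lambda>i. if i = 1 then \<eta> a else \<one>\<^bsub>H\<^esub>)"

text \<open>
  \<^const>\<open>genideal\<close> and \<^const>\<open>FactRing\<close> are meaningful only over rings; the following lemmas
  establish that the monoid ring of a monoid is one.
\<close>

lemma monoid_ring_carrier [simp]:
  "p \<in> carrier (monoid_ring G) \<longleftrightarrow> Poly_Mapping.keys p \<subseteq> carrier G"
  by (simp add: monoid_ring_def)

lemma monoid_ring_simps [simp]:
  "\<zero>\<^bsub>monoid_ring G\<^esub> = 0" "\<one>\<^bsub>monoid_ring G\<^esub> = frag_of \<one>\<^bsub>G\<^esub>"
  "p \<oplus>\<^bsub>monoid_ring G\<^esub> q = p + q"
  by (simp_all add: monoid_ring_def)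

lemma monoid_ring_mult_superset:
  assumes "finite A" "finite B" "Poly_Mapping.keys p \<subseteq> A" "Poly_Mapping.keys q \<subseteq> B"
  shows "p \<otimes>\<^bsub>monoid_ring G\<^esub> q = (\<Sum>x\<in>A. \<Sum>y\<in>B.
     Poly_Mapping.single (x \<otimes>\<^bsub>G\<^esub> y) (Poly_Mapping.lookup p x * Poly_Mapping.lookup q y))"
proof -
  have "p \<otimes>\<^bsub>monoid_ring G\<^esub> q = (\<Sum>x\<in>Poly_Mapping.keys p. \<Sum>y\<in>Poly_Mapping.keys q.
     Poly_Mapping.single (x \<otimes>\<^bsub>G\<^esub> y) (Poly_Mapping.lookup p x * Poly_Mapping.lookup q y))"
    by (simp add: monoid_ring_def)
  also have "\<dots> = (\<Sum>x\<in>Poly_Mapping.keys p. \<Sum>y\<in>B.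
     Poly_Mapping.single (x \<otimes>\<^bsub>G\<^esub> y) (Poly_Mapping.lookup p x * Poly_Mapping.lookup q y))"
    by (intro sum.cong sum.mono_neutral_left) (use assms in \<open>auto simp: in_keys_iff\<close>)
  also have "\<dots> = (\<Sum>x\<in>A. \<Sum>y\<in>B.
     Poly_Mapping.single (x \<otimes>\<^bsub>G\<^esub> y) (Poly_Mapping.lookup p x * Poly_Mapping.lookup q y))"
    by (intro sum.mono_neutral_left) (use assms in \<open>auto simp: in_keys_iff\<close>)
  finally show ?thesis .
qed

lemma monoid_ring_add_mult:
  "(p + q) \<otimes>\<^bsub>monoid_ring G\<^esub> r = p \<otimes>\<^bsub>monoid_ring G\<^esub> r + q \<otimes>\<^bsub>monoid_ring G\<^esub> r"
proof -
  let ?A = "Poly_Mapping.keys p \<union> Poly_Mapping.keys q" and ?B = "Poly_Mapping.keys r"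
  have k: "Poly_Mapping.keys (p + q) \<subseteq> ?A" by (rule Poly_Mapping.keys_add)
  show ?thesis
    using k by (simp add: monoid_ring_mult_superset[of ?A ?B] lookup_add distrib_right
        single_add sum.distrib)
qed

lemma monoid_ring_mult_add:
  "r \<otimes>\<^bsub>monoid_ring G\<^esub> (p + q) = r \<otimes>\<^bsub>monoid_ring G\<^esub> p + r \<otimes>\<^bsub>monoid_ring G\<^esub> q"
proof -
  let ?A = "Poly_Mapping.keys p \<union> Poly_Mapping.keys q" and ?B = "Poly_Mapping.keys r"
  have k: "Poly_Mapping.keys (p + q) \<subseteq> ?A" by (rule Poly_Mapping.keys_add)
  show ?thesis
    using k by (simp add: monoid_ring_mult_superset[of ?B ?A] lookup_add distrib_left
        single_add sum.distrib)
qed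

lemma monoid_ring_zero_mult [simp]:
  "0 \<otimes>\<^bsub>monoid_ring G\<^esub> r = 0" "r \<otimes>\<^bsub>monoid_ring G\<^esub> 0 = 0"
  by (simp_all add: monoid_ring_def)

lemma monoid_ring_mult_single:
  "Poly_Mapping.single x a \<otimes>\<^bsub>monoid_ring G\<^esub> Poly_Mapping.single y b
     = Poly_Mapping.single (x \<otimes>\<^bsub>G\<^esub> y) (a * b)"
  by (simp add: monoid_ring_mult_superset[of "{x}" "{y}"])

lemma monoid_ring_induct [consumes 1, case_names zero single add]:
  assumes "p \<in> carrier (monoid_ring G)"
    and "P 0"
    and "\<And>x a. x \<in> carrier G \<Longrightarrow> P (Poly_Mapping.single x a)"
    and "\<And>p q. P p \<Longrightarrow> P q \<Longrightarrow> P (p + q)"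
  shows "P p"
proof -
  have "finite A \<Longrightarrow> A \<subseteq> carrier G \<Longrightarrow>
          P (\<Sum>x\<in>A. Poly_Mapping.single x (Poly_Mapping.lookup p x))" for A
    by (induction A rule: finite_induct) (use assms(2-4) in auto)
  moreover have "(\<Sum>x\<in>Poly_Mapping.keys p. Poly_Mapping.single x (Poly_Mapping.lookup p x)) = p"
    by (intro poly_mapping_eqI)
      (auto simp: lookup_sum lookup_single in_keys_iff when_def sum.delta)
  ultimately show ?thesis
    using assms(1) by (metis finite_keys monoid_ring_carrier)
qed

lemma ring_monoid_ring:
  assumes "monoid G"
  shows "ring (monoid_ring G)"
proof -
  interpret monoid G by fact
  have closed: "p \<otimes>\<^bsub>monoid_ring G\<^esub> q \<in> carrier (monoid_ring G)"
    if "p \<in> carrier (monoid_ring G)" "q \<in> carrier (monoid_ring G)" for p q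
    using that
  proof (induction p rule: monoid_ring_induct)
    case (single x a)
    show ?case using single(2,1)
    proof (induction q rule: monoid_ring_induct)
      case (add p q)
      then show ?case
        using Poly_Mapping.keys_add by (fastforce simp: monoid_ring_mult_add)
    qed (auto simp: monoid_ring_mult_single split: if_splits)
  next
    case (add p q)
    then show ?case
      using Poly_Mapping.keys_add by (fastforce simp: monoid_ring_add_mult)
  qed auto
  have assoc: "(p \<otimes>\<^bsub>monoid_ring G\<^esub> q) \<otimes>\<^bsub>monoid_ring G\<^esub> r
      = p \<otimes>\<^bsub>monoid_ring G\<^esub> (q \<otimes>\<^bsub>monoid_ring G\<^esub> r)"
    if "p \<in> carrier (monoid_ring G)" "q \<in> carrier (monoid_ring G)"
      "r \<in> carrier (monoid_ring G)" for p q r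
    using that
  proof (induction p rule: monoid_ring_induct)
    case p: (single x a)
    show ?case using p(2,3,1)
    proof (induction q rule: monoid_ring_induct)
      case q: (single y b)
      show ?case using q(2,1,3)
      proof (induction r rule: monoid_ring_induct)
        case (single z c)
        then show ?case by (simp add: monoid_ring_mult_single m_assoc mult.assoc)
      qed (auto simp: monoid_ring_mult_add)
    qed (auto simp: monoid_ring_mult_add monoid_ring_add_mult)
  qed (auto simp: monoid_ring_add_mult)
  have one: "frag_of \<one>\<^bsub>G\<^esub> \<otimes>\<^bsub>monoid_ring G\<^esub> p = p" "p \<otimes>\<^bsub>monoid_ring G\<^esub> frag_of \<one>\<^bsub>G\<^esub> = p"
    if "p \<in> carrier (monoid_ring G)" for p
    using that
    by (induction p rule: monoid_ring_induct)
       (auto simp: monoid_ring_mult_add monoid_ring_add_mult monoid_ring_mult_single)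
  show ?thesis
  proof (rule ringI)
    show "abelian_group (monoid_ring G)"
    proof (rule abelian_groupI)
      fix p assume "p \<in> carrier (monoid_ring G)"
      then show "\<exists>q\<in>carrier (monoid_ring G). q \<oplus>\<^bsub>monoid_ring G\<^esub> p = \<zero>\<^bsub>monoid_ring G\<^esub>"
        by (intro bexI[of _ "- p"]) auto
    qed (use Poly_Mapping.keys_add in \<open>fastforce simp: algebra_simps\<close>)+
    show "monoid (monoid_ring G)"
      by (rule monoidI) (use closed assoc one in \<open>auto split: if_splits\<close>)
  qed (simp_all add: monoid_ring_add_mult monoid_ring_mult_add)
qed


section \<open>Representations over a field\<close>

text \<open>
  For a \<open>'k\<close>-algebra \<open>B\<close> with structure map \<open>\<kappa>\<close>, representations act on an entire type \<open>'v\<close>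
  made into a \<open>'k\<close>-vector space by \<open>sc\<close>.
\<close>

definition is_rep ::
    "('k::field \<Rightarrow> 'b) \<Rightarrow> ('b, 'm) ring_scheme \<Rightarrow> ('k \<Rightarrow> 'v::ab_group_add \<Rightarrow> 'v)
      \<Rightarrow> ('b \<Rightarrow> 'v \<Rightarrow> 'v) \<Rightarrow> bool" where
  "is_rep \<kappa> B sc \<rho> \<longleftrightarrow>
     vector_space sc \<and>
     (\<forall>x\<in>carrier B. Vector_Spaces.linear sc sc (\<rho> x)) \<and>
     (\<forall>x\<in>carrier B. \<forall>y\<in>carrier B. \<forall>v. \<rho> (x \<oplus>\<^bsub>B\<^esub> y) v = \<rho> x v + \<rho> y v) \<and>
     (\<forall>x\<in>carrier B. \<forall>y\<in>carrier B. \<forall>v. \<rho> (x \<otimes>\<^bsub>B\<^esub> y) v = \<rho> x (\<rho> y v)) \<and>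
     (\<forall>v. \<rho> \<one>\<^bsub>B\<^esub> v = v) \<and>
     (\<forall>c v. \<rho> (\<kappa> c) v = sc c v)"

definition irreducible_rep ::
    "('k::field \<Rightarrow> 'b) \<Rightarrow> ('b, 'm) ring_scheme \<Rightarrow> ('k \<Rightarrow> 'v::ab_group_add \<Rightarrow> 'v)
      \<Rightarrow> ('b \<Rightarrow> 'v \<Rightarrow> 'v) \<Rightarrow> bool" where
  "irreducible_rep \<kappa> B sc \<rho> \<longleftrightarrow>
     is_rep \<kappa> B sc \<rho> \<and> (\<exists>v::'v. v \<noteq> 0) \<and>
     (\<forall>U. module.subspace sc U \<and> (\<forall>x\<in>carrier B. \<forall>v\<in>U. \<rho> x v \<in> U) \<longrightarrow> U = {0} \<or> U = UNIV)"

definition rep_iso ::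
    "('b, 'm) ring_scheme
      \<Rightarrow> ('k::field \<Rightarrow> 'v::ab_group_add \<Rightarrow> 'v) \<Rightarrow> ('b \<Rightarrow> 'v \<Rightarrow> 'v)
      \<Rightarrow> ('k \<Rightarrow> 'w::ab_group_add \<Rightarrow> 'w) \<Rightarrow> ('b \<Rightarrow> 'w \<Rightarrow> 'w) \<Rightarrow> bool" where
  "rep_iso B sc \<rho> sc' \<rho>' \<longleftrightarrow>
     (\<exists>f. Vector_Spaces.linear sc sc' f \<and> bij f \<and> (\<forall>x\<in>carrier B. \<forall>v. f (\<rho> x v) = \<rho>' x (f v)))"


section \<open>The Hecke algebra of a dihedral group\<close>

type_synonym laurent = "int \<Rightarrow>\<^sub>0 int"

text \<open>
  \<open>\<int>[u, u\<^sup>-\<^sup>1]\<close> is the group ring of the additive group \<open>\<int>\<close>; multiplication is the convolution of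
  finitely supported functions.
\<close>

definition u_pow :: "int \<Rightarrow> laurent" where
  "u_pow i = Poly_Mapping.single i 1"

definition quantum_two :: laurent where
  "quantum_two = u_pow 1 + u_pow (-1)"

text \<open>
  A group of order \<open>2m\<close> generated by \<open>s1\<close>, \<open>s2\<close> subject to (at least) the dihedral relations is the
  dihedral group, since these relations present a group of order \<open>2m\<close>.
\<close>

locale dihedral = group W for W :: "('w, 'x) monoid_scheme" (structure) +
  fixes m :: nat and s1 s2 :: 'w
  assumes s1_closed: "s1 \<in> carrier W" and s2_closed: "s2 \<in> carrier W"
    and s1_s1: "s1 \<otimes> s1 = \<one>" and s2_s2: "s2 \<otimes> s2 = \<one>"
    and braid: "(s1 \<otimes> s2) [^] m = \<one>"
    and generated: "generate W {s1, s2} = carrier W"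
    and order_W: "order W = 2 * m"

definition word_length :: "('w, 'x) monoid_scheme \<Rightarrow> 'w set \<Rightarrow> 'w \<Rightarrow> nat" where
  "word_length W S w =
     (LEAST l. \<exists>xs. length xs = l \<and> set xs \<subseteq> S \<and> foldr (\<lambda>x y. x \<otimes>\<^bsub>W\<^esub> y) xs \<one>\<^bsub>W\<^esub> = w)"

definition is_basis ::
    "('a::comm_ring_1 \<Rightarrow> 'h) \<Rightarrow> ('h, 'm) ring_scheme \<Rightarrow> 'w set \<Rightarrow> ('w \<Rightarrow> 'h) \<Rightarrow> bool" where
  "is_basis \<eta> H I T \<longleftrightarrow> finite I \<and> T \<in> I \<rightarrow> carrier H \<and>
     (\<forall>h\<in>carrier H. \<exists>!c. c \<in> I \<rightarrow>\<^sub>E UNIV \<and> h = (\<Oplus>\<^bsub>H\<^esub>w\<in>I. \<eta> (c w) \<otimes>\<^bsub>H\<^esub> T w))"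

locale hecke_algebra =
  fixes W :: "('w, 'x) monoid_scheme" and S :: "'w set"
    and H :: "('h, 'y) ring_scheme" (structure) and \<eta> :: "laurent \<Rightarrow> 'h" and T :: "'w \<Rightarrow> 'h"
  assumes algebra_H: "is_algebra \<eta> H"
    and basis_T: "is_basis \<eta> H (carrier W) T"
    and T_mult: "\<lbrakk>v \<in> carrier W; w \<in> carrier W;
          word_length W S (v \<otimes>\<^bsub>W\<^esub> w) = word_length W S v + word_length W S w\<rbrakk>
        \<Longrightarrow> T v \<otimes> T w = T (v \<otimes>\<^bsub>W\<^esub> w)"
    and T_quadratic: "s \<in> S \<Longrightarrow> (T s \<ominus> \<eta> (u_pow 1)) \<otimes> (T s \<oplus> \<eta> (u_pow (-1))) = \<zero>"

definition C_plus :: "('h, 'y) ring_scheme \<Rightarrow> (laurent \<Rightarrow> 'h) \<Rightarrow> ('w \<Rightarrow> 'h) \<Rightarrow> 'w \<Rightarrow> 'h" where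
  "C_plus H \<eta> T s = T s \<oplus>\<^bsub>H\<^esub> \<eta> (u_pow (-1))"

definition C_minus :: "('h, 'y) ring_scheme \<Rightarrow> (laurent \<Rightarrow> 'h) \<Rightarrow> ('w \<Rightarrow> 'h) \<Rightarrow> 'w \<Rightarrow> 'h" where
  "C_minus H \<eta> T s = T s \<ominus>\<^bsub>H\<^esub> \<eta> (u_pow 1)"


section \<open>The nonstandard Hecke algebra\<close>

text \<open>A sign vector is a function \<open>{1..k} \<rightarrow> bool\<close>, with \<open>True\<close> for \<open>+\<close>.\<close>

definition nsP ::
    "('h, 'y) ring_scheme \<Rightarrow> (laurent \<Rightarrow> 'h) \<Rightarrow> ('w \<Rightarrow> 'h) \<Rightarrow> nat \<Rightarrow> 'w
      \<Rightarrow> ((nat \<Rightarrow> 'h) \<Rightarrow>\<^sub>0 int) set" where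
  "nsP H \<eta> T k s =
     (\<Oplus>\<^bsub>tensor_power \<eta> k H\<^esub>a\<in>{a \<in> {1..k} \<rightarrow>\<^sub>E (UNIV::bool set). even (card {i\<in>{1..k}. \<not> a i})}.
        pure \<eta> k H (\<lambda>i. if a i then C_plus H \<eta> T s else C_minus H \<eta> T s))"

definition nonstandard_hecke ::
    "('h, 'y) ring_scheme \<Rightarrow> (laurent \<Rightarrow> 'h) \<Rightarrow> ('w \<Rightarrow> 'h) \<Rightarrow> nat \<Rightarrow> 'w \<Rightarrow> 'w
      \<Rightarrow> ((nat \<Rightarrow> 'h) \<Rightarrow>\<^sub>0 int) set ring" where
  "nonstandard_hecke H \<eta> T k s1 s2 =
     generated_subalgebra (tensor_power_scalar \<eta> k H) (tensor_power \<eta> k H)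
       {nsP H \<eta> T k s1, nsP H \<eta> T k s2}"

type_synonym ('k, 'h) KH_elem = "('k \<times> ((nat \<Rightarrow> 'h) \<Rightarrow>\<^sub>0 int) set \<Rightarrow>\<^sub>0 int) set"

text \<open>Scalar extension along \<open>\<phi>: \<int>[u, u\<^sup>-\<^sup>1] \<rightarrow> K\<close>, its pure tensors and its structure map.\<close>

definition K_nonstandard_hecke ::
    "(laurent \<Rightarrow> 'k::field) \<Rightarrow> ('h, 'y) ring_scheme \<Rightarrow> (laurent \<Rightarrow> 'h) \<Rightarrow> ('w \<Rightarrow> 'h) \<Rightarrow> nat
      \<Rightarrow> 'w \<Rightarrow> 'w \<Rightarrow> ('k, 'h) KH_elem ring" where
  "K_nonstandard_hecke \<phi> H \<eta> T k s1 s2 =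
     tensor2 \<phi> univ_ring (tensor_power_scalar \<eta> k H) (nonstandard_hecke H \<eta> T k s1 s2)"

definition K_pure ::
    "(laurent \<Rightarrow> 'k::field) \<Rightarrow> ('h, 'y) ring_scheme \<Rightarrow> (laurent \<Rightarrow> 'h) \<Rightarrow> ('w \<Rightarrow> 'h) \<Rightarrow> nat
      \<Rightarrow> 'w \<Rightarrow> 'w \<Rightarrow> 'k \<Rightarrow> ((nat \<Rightarrow> 'h) \<Rightarrow>\<^sub>0 int) set \<Rightarrow> ('k, 'h) KH_elem" where
  "K_pure \<phi> H \<eta> T k s1 s2 =
     pure2 \<phi> univ_ring (tensor_power_scalar \<eta> k H) (nonstandard_hecke H \<eta> T k s1 s2)"

definition K_scalar ::
    "(laurent \<Rightarrow> 'k::field) \<Rightarrow> ('h, 'y) ring_scheme \<Rightarrow> (laurent \<Rightarrow> 'h) \<Rightarrow> ('w \<Rightarrow> 'h) \<Rightarrow> nat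
      \<Rightarrow> 'w \<Rightarrow> 'w \<Rightarrow> 'k \<Rightarrow> ('k, 'h) KH_elem" where
  "K_scalar \<phi> H \<eta> T k s1 s2 c =
     K_pure \<phi> H \<eta> T k s1 s2 c \<one>\<^bsub>nonstandard_hecke H \<eta> T k s1 s2\<^esub>"


section \<open>One-dimensional modules and their tensor products\<close>

text \<open>A one-dimensional \<open>H\<close>-module over \<open>K\<close> is given by its character \<open>\<psi>: H \<rightarrow> K\<close>.\<close>

definition is_character ::
    "(laurent \<Rightarrow> 'k::field) \<Rightarrow> ('h, 'y) ring_scheme \<Rightarrow> (laurent \<Rightarrow> 'h) \<Rightarrow> ('h \<Rightarrow> 'k) \<Rightarrow> bool" where
  "is_character \<phi> H \<eta> \<psi> \<longleftrightarrow> \<psi> \<in> ring_hom H univ_ring \<and> (\<forall>a. \<psi> (\<eta> a) = \<phi> a)"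

text \<open>
  With \<open>K \<otimes> \<dots> \<otimes> K\<close> identified with \<open>K\<close>, an element \<open>h\<^sub>1 \<otimes> \<dots> \<otimes> h\<^sub>k\<close> acts on the tensor product of the
  modules with characters \<open>\<psi> 1, \<dots>, \<psi> k\<close> by the product of the scalars \<open>\<psi> i (h\<^sub>i)\<close>.  The resulting
  homomorphism \<open>\<Phi>\<close> is restricted to the nonstandard Hecke algebra and extended \<open>K\<close>-linearly.
\<close>

definition is_tensor_module ::
    "(laurent \<Rightarrow> 'k::field) \<Rightarrow> ('h, 'y) ring_scheme \<Rightarrow> (laurent \<Rightarrow> 'h) \<Rightarrow> ('w \<Rightarrow> 'h) \<Rightarrow> nat
      \<Rightarrow> 'w \<Rightarrow> 'w \<Rightarrow> (nat \<Rightarrow> 'h \<Rightarrow> 'k) \<Rightarrow> (('k, 'h) KH_elem \<Rightarrow> 'k \<Rightarrow> 'k) \<Rightarrow> bool" where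
  "is_tensor_module \<phi> H \<eta> T k s1 s2 \<psi> \<rho> \<longleftrightarrow>
     is_rep (K_scalar \<phi> H \<eta> T k s1 s2) (K_nonstandard_hecke \<phi> H \<eta> T k s1 s2) (*) \<rho> \<and>
     (\<exists>\<Phi> \<in> ring_hom (tensor_power \<eta> k H) univ_ring.
        (\<forall>h \<in> {1..k} \<rightarrow> carrier H. \<Phi> (pure \<eta> k H h) = (\<Prod>i=1..k. \<psi> i (h i))) \<and>
        (\<forall>c v. \<forall>x\<in>carrier (nonstandard_hecke H \<eta> T k s1 s2).
           \<rho> (K_pure \<phi> H \<eta> T k s1 s2 c x) v = c * \<Phi> x * v))"


section \<open>Signed compositions\<close>

text \<open>A signed \<open>n\<close>-composition is a function supported on \<open>{1..n}\<close>.\<close>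

definition signed_comps :: "nat \<Rightarrow> nat \<Rightarrow> (nat \<Rightarrow> int) set" where
  "signed_comps n k = {c. (\<forall>i. i \<notin> {1..n} \<longrightarrow> c i = 0) \<and> (\<Sum>i=1..n. \<bar>c i\<bar>) = int k}"

definition SComp :: "nat \<Rightarrow> nat \<Rightarrow> (nat \<Rightarrow> int) set set" where
  "SComp n k = signed_comps n k //
     {(c, d). c \<in> signed_comps n k \<and> d \<in> signed_comps n k \<and> (d = c \<or> d = (\<lambda>i. - c i))}"

definition SComp_le :: "nat \<Rightarrow> nat \<Rightarrow> (nat \<Rightarrow> int) set set" where
  "SComp_le n k = (\<Union>k'\<in>{1..k}. SComp n k')"

definition SComp_less :: "nat \<Rightarrow> nat \<Rightarrow> (nat \<Rightarrow> int) set set" where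
  "SComp_less n k = (\<Union>k'\<in>{1..<k}. SComp n k')"


section \<open>Multivariate Chebyshev polynomials\<close>

datatype cheb_var = ChebX nat | ChebY nat

type_synonym cheb_poly = "(cheb_var \<Rightarrow>\<^sub>0 nat) \<Rightarrow>\<^sub>0 int"

definition pvar :: "cheb_var \<Rightarrow> cheb_poly" where
  "pvar v = Poly_Mapping.single (Poly_Mapping.single v 1) 1"

definition monom_eval :: "(cheb_var \<Rightarrow> 'r::comm_ring_1) \<Rightarrow> (cheb_var \<Rightarrow>\<^sub>0 nat) \<Rightarrow> 'r" where
  "monom_eval e t = (\<Prod>v\<in>Poly_Mapping.keys t. e v ^ Poly_Mapping.lookup t v)"

definition peval :: "(cheb_var \<Rightarrow> 'r::comm_ring_1) \<Rightarrow> cheb_poly \<Rightarrow> 'r" where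
  "peval e p = (\<Sum>t\<in>Poly_Mapping.keys p. of_int (Poly_Mapping.lookup p t) * monom_eval e t)"

text \<open>
  Pairs \<open>(c, s)\<close> stand for \<open>(cos \<theta>, sin \<theta>)\<close>, and \<open>angle_add\<close> is given by the addition theorems.
  The resulting polynomials are representatives of the residue classes modulo
  \<open>x\<^sub>j\<^sup>2 + y\<^sub>j\<^sup>2 - 1\<close>; see \<open>peval_chebT\<close> and \<open>peval_chebT1\<close> for the characteristic property.
\<close>

fun angle_add :: "'r::comm_ring_1 \<times> 'r \<Rightarrow> 'r \<times> 'r \<Rightarrow> 'r \<times> 'r" where
  "angle_add (c, s) (c', s') = (c * c' - s * s', s * c' + c * s')"

fun angle_nat :: "nat \<Rightarrow> 'r::comm_ring_1 \<times> 'r \<Rightarrow> 'r \<times> 'r" where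
  "angle_nat 0 a = (1, 0)"
| "angle_nat (Suc k) a = angle_add a (angle_nat k a)"

definition angle_int :: "int \<Rightarrow> 'r::comm_ring_1 \<times> 'r \<Rightarrow> 'r \<times> 'r" where
  "angle_int k a =
     (if k \<ge> 0 then angle_nat (nat k) a else angle_nat (nat (- k)) (fst a, - snd a))"

primrec cheb_pair :: "nat \<Rightarrow> (nat \<Rightarrow> int) \<Rightarrow> cheb_poly \<times> cheb_poly" where
  "cheb_pair 0 k = (1, 0)"
| "cheb_pair (Suc n) k =
     angle_add (cheb_pair n k) (angle_int (k (Suc n)) (pvar (ChebX (Suc n)), pvar (ChebY (Suc n))))"

definition chebT :: "nat \<Rightarrow> (nat \<Rightarrow> int) \<Rightarrow> cheb_poly" where
  "chebT n k = fst (cheb_pair n k)"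

definition chebT1 :: "nat \<Rightarrow> (nat \<Rightarrow> int) \<Rightarrow> cheb_poly" where
  "chebT1 n k = snd (cheb_pair n k)"

lemma peval_superset:
  assumes "finite A" "Poly_Mapping.keys p \<subseteq> A"
  shows "peval e p = (\<Sum>t\<in>A. of_int (Poly_Mapping.lookup p t) * monom_eval e t)"
  unfolding peval_def
  by (intro sum.mono_neutral_left) (use assms in \<open>auto simp: in_keys_iff\<close>)

lemma peval_add: "peval e (p + q) = peval e p + peval e q"
  using Poly_Mapping.keys_add[of p q]
  by (simp add: peval_superset[of "Poly_Mapping.keys p \<union> Poly_Mapping.keys q"] lookup_add
      distrib_right sum.distrib)

lemma peval_0 [simp]: "peval e 0 = 0"
  by (simp add: peval_def)

lemma peval_uminus: "peval e (- p) = - peval e p"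
  using peval_add[of e p "- p"] by (simp add: eq_neg_iff_add_eq_0 add.commute)

lemma peval_diff: "peval e (p - q) = peval e p - peval e q"
  using peval_add[of e p "- q"] by (simp add: peval_uminus)

lemma peval_single: "peval e (Poly_Mapping.single t a) = of_int a * monom_eval e t"
  by (simp add: peval_superset[of "{t}"])

lemma peval_1 [simp]: "peval e 1 = 1"
  by (simp flip: single_one add: peval_single monom_eval_def)

lemma peval_pvar [simp]: "peval e (pvar v) = e v"
  by (simp add: pvar_def peval_single monom_eval_def)

lemma monom_eval_superset:
  assumes "finite A" "Poly_Mapping.keys t \<subseteq> A"
  shows "monom_eval e t = (\<Prod>v\<in>A. e v ^ Poly_Mapping.lookup t v)"
  unfolding monom_eval_def
  by (intro prod.mono_neutral_left) (use assms in \<open>auto simp: in_keys_iff\<close>)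

lemma monom_eval_add: "monom_eval e (s + t) = monom_eval e s * monom_eval e t"
  using Poly_Mapping.keys_add[of s t]
  by (simp add: monom_eval_superset[of "Poly_Mapping.keys s \<union> Poly_Mapping.keys t"] lookup_add
      power_add prod.distrib)

lemma peval_sum: "peval e (\<Sum>i\<in>A. f i) = (\<Sum>i\<in>A. peval e (f i))"
  by (induction A rule: infinite_finite_induct) (auto simp: peval_add)

lemma poly_mapping_as_sum:
  "p = (\<Sum>t\<in>Poly_Mapping.keys p. Poly_Mapping.single t (Poly_Mapping.lookup p t))"
  by (intro poly_mapping_eqI)
    (auto simp: lookup_sum lookup_single in_keys_iff when_def sum.delta)

lemma peval_mult: "peval e (p * q) = peval e p * peval e q"
proof -
  have "peval e (p * q) =
      peval e ((\<Sum>t\<in>Poly_Mapping.keys p. Poly_Mapping.single t (Poly_Mapping.lookup p t)) *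
               (\<Sum>t\<in>Poly_Mapping.keys q. Poly_Mapping.single t (Poly_Mapping.lookup q t)))"
    by (simp flip: poly_mapping_as_sum)
  also have "\<dots> = peval e p * peval e q"
    by (simp add: sum_product peval_sum mult_single peval_single monom_eval_add
        peval_def[of e p] peval_def[of e q] mult_ac)
  finally show ?thesis .
qed

lemma peval_angle_add:
  "map_prod (peval e) (peval e) (angle_add a b) =
     angle_add (map_prod (peval e) (peval e) a) (map_prod (peval e) (peval e) b)"
  by (cases a; cases b) (simp add: peval_add peval_diff peval_mult)

lemma peval_angle_nat:
  "map_prod (peval e) (peval e) (angle_nat k a) = angle_nat k (map_prod (peval e) (peval e) a)"
  by (induction k) (simp_all add: peval_angle_add)

lemma peval_angle_int:
  "map_prod (peval e) (peval e) (angle_int k a) = angle_int k (map_prod (peval e) (peval e) a)"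
  by (cases a) (simp add: angle_int_def peval_angle_nat peval_uminus)

lemma angle_nat_cos_sin:
  fixes \<theta> :: real
  shows "angle_nat k (cos \<theta>, sin \<theta>) = (cos (real k * \<theta>), sin (real k * \<theta>))"
  by (induction k) (simp_all add: cos_add sin_add algebra_simps)

lemma angle_int_cos_sin:
  fixes \<theta> :: real
  shows "angle_int k (cos \<theta>, sin \<theta>) = (cos (of_int k * \<theta>), sin (of_int k * \<theta>))"
  using angle_nat_cos_sin[of "nat (- k)" "- \<theta>"]
  by (auto simp: angle_int_def angle_nat_cos_sin)

lemma peval_cheb_pair:
  fixes \<theta> :: "nat \<Rightarrow> real"
  shows "map_prod (peval (case_cheb_var (\<lambda>j. cos (\<theta> j)) (\<lambda>j. sin (\<theta> j))))
                  (peval (case_cheb_var (\<lambda>j. cos (\<theta> j)) (\<lambda>j. sin (\<theta> j)))) (cheb_pair n k)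
     = (cos (\<Sum>j=1..n. of_int (k j) * \<theta> j), sin (\<Sum>j=1..n. of_int (k j) * \<theta> j))"
  by (induction n)
    (simp_all add: peval_angle_add peval_angle_int angle_int_cos_sin cos_add sin_add)

lemma peval_chebT:
  fixes \<theta> :: "nat \<Rightarrow> real"
  shows "peval (case_cheb_var (\<lambda>j. cos (\<theta> j)) (\<lambda>j. sin (\<theta> j))) (chebT n k)
           = cos (\<Sum>j=1..n. of_int (k j) * \<theta> j)"
  using peval_cheb_pair[of \<theta> n k] by (cases "cheb_pair n k") (simp add: chebT_def)

lemma peval_chebT1:
  fixes \<theta> :: "nat \<Rightarrow> real"
  shows "peval (case_cheb_var (\<lambda>j. cos (\<theta> j)) (\<lambda>j. sin (\<theta> j))) (chebT1 n k)
           = sin (\<Sum>j=1..n. of_int (k j) * \<theta> j)"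
  using peval_cheb_pair[of \<theta> n k] by (cases "cheb_pair n k") (simp add: chebT1_def)


section \<open>The field \<open>K\<close> and the list of representations\<close>

definition half_index :: "nat \<Rightarrow> nat" where
  "half_index m = (if even m then (m - 2) div 2 else (m - 1) div 2)"

definition primitive_root :: "nat \<Rightarrow> 'l::field \<Rightarrow> bool" where
  "primitive_root m \<zeta> \<longleftrightarrow> \<zeta> ^ m = 1 \<and> (\<forall>d\<in>{1..<m}. \<zeta> ^ d \<noteq> 1)"

definition w_val :: "'l::field \<Rightarrow> nat \<Rightarrow> 'l" where
  "w_val \<zeta> j = 2 + \<zeta> ^ j + inverse (\<zeta> ^ j)"

text \<open>
  \<open>K\<close> is the type \<open>'k\<close>, containing \<open>\<int>[u, u\<^sup>-\<^sup>1]\<close> through the embedding \<open>\<phi>\<close>.  As \<open>\<zeta>\<close> need not lie in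
  \<open>K\<close>, it is taken from an extension field \<open>'l\<close> of \<open>K\<close>, with embedding \<open>\<iota>\<close>.
  \<open>sw j\<close> and \<open>sf j\<close> are the chosen square roots of \<open>w\<^sub>j\<close> and \<open>f - w\<^sub>j\<close>.
\<close>

locale splitting_field =
  fixes m n :: nat and \<phi> :: "laurent \<Rightarrow> 'k::field" and \<iota> :: "'k \<Rightarrow> 'l::field" and \<zeta> :: 'l
    and sw sf :: "nat \<Rightarrow> 'k"
  assumes phi_hom: "\<phi> \<in> ring_hom univ_ring univ_ring" and phi_inj: "inj \<phi>"
    and iota_hom: "\<iota> \<in> ring_hom univ_ring univ_ring"
    and zeta: "primitive_root m \<zeta>"
    and sw: "j \<in> {1..n} \<Longrightarrow> \<iota> ((sw j)\<^sup>2) = w_val \<zeta> j"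
    and sf: "j \<in> {1..n} \<Longrightarrow> (sf j)\<^sup>2 = \<phi> (quantum_two\<^sup>2) - (sw j)\<^sup>2"
    and quotient_field: "\<exists>p q. p \<in> generate_ring univ_ring (range \<phi> \<union> sw ` {1..n} \<union> sf ` {1..n}) \<and>
          q \<in> generate_ring univ_ring (range \<phi> \<union> sw ` {1..n} \<union> sf ` {1..n}) \<and>
          q \<noteq> 0 \<and> x = p / q"

text \<open>The evaluation point \<open>x\<^sub>j = \<surd>w\<^sub>j / [2]\<close>, \<open>y\<^sub>j = \<surd>(f - w\<^sub>j) / [2]\<close>.\<close>

definition cheb_point ::
    "(laurent \<Rightarrow> 'k::field) \<Rightarrow> (nat \<Rightarrow> 'k) \<Rightarrow> (nat \<Rightarrow> 'k) \<Rightarrow> cheb_var \<Rightarrow> 'k" where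
  "cheb_point \<phi> sw sf =
     case_cheb_var (\<lambda>j. sw j / \<phi> quantum_two) (\<lambda>j. sf j / \<phi> quantum_two)"

definition a_val ::
    "(laurent \<Rightarrow> 'k::field) \<Rightarrow> (nat \<Rightarrow> 'k) \<Rightarrow> (nat \<Rightarrow> 'k) \<Rightarrow> nat \<Rightarrow> (nat \<Rightarrow> int) \<Rightarrow> 'k" where
  "a_val \<phi> sw sf n k = peval (cheb_point \<phi> sw sf) (chebT n k)"

definition a1_val ::
    "(laurent \<Rightarrow> 'k::field) \<Rightarrow> (nat \<Rightarrow> 'k) \<Rightarrow> (nat \<Rightarrow> 'k) \<Rightarrow> nat \<Rightarrow> (nat \<Rightarrow> int) \<Rightarrow> 'k" where
  "a1_val \<phi> sw sf n k = peval (cheb_point \<phi> sw sf) (chebT1 n k)"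

definition X_mat1 :: "'k::field \<Rightarrow> 'k \<Rightarrow> 'k^2^2" where
  "X_mat1 q c = vector [vector [q, c], vector [0, 0]]"

definition X_mat2 :: "'k::field \<Rightarrow> 'k^2^2" where
  "X_mat2 q = vector [vector [0, 0], vector [1, q]]"

datatype label1 = EpsPlus | EpsMinus | Eps1 | Eps2

datatype label2 = LabN "(nat \<Rightarrow> int) set" | LabN1 "(nat \<Rightarrow> int) set"

definition labels1 :: "nat \<Rightarrow> label1 set" where
  "labels1 m = {EpsPlus, EpsMinus} \<union> (if even m then {Eps1, Eps2} else {})"

definition labels2 :: "nat \<Rightarrow> nat \<Rightarrow> label2 set" where
  "labels2 m k = LabN ` SComp_le (half_index m) k \<union>
     (if even m then LabN1 ` SComp_less (half_index m) k else {})"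

text \<open>The scalars by which the two generators act, where \<open>q = [2]\<^sup>k\<close>.\<close>

fun eps_val1 :: "'k::field \<Rightarrow> label1 \<Rightarrow> 'k" where
  "eps_val1 q EpsPlus = q" | "eps_val1 q EpsMinus = 0" | "eps_val1 q Eps1 = q" | "eps_val1 q Eps2 = 0"

fun eps_val2 :: "'k::field \<Rightarrow> label1 \<Rightarrow> 'k" where
  "eps_val2 q EpsPlus = q" | "eps_val2 q EpsMinus = 0" | "eps_val2 q Eps1 = 0" | "eps_val2 q Eps2 = q"

end

theory Submission
  imports Defs "HOL-Computational_Algebra.Computational_Algebra"
    "HOL-Algebra.Algebraic_Closure_Type" "HOL-Library.Function_Algebras"
begin

text \<open>
  Write \<open>T\<^sub>s = d + b r\<^sub>s\<close> with \<open>2d = u - u\<^sup>-\<^sup>1\<close>, \<open>2b = [2]\<close>, so that \<open>r\<^sub>s\<^sup>2 = 1\<close>.  Then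
  \<open>2\<P>\<^sub>s = [2]\<^sup>k (1 + r\<^sub>s \<otimes> \<dots> \<otimes> r\<^sub>s)\<close>, and the algebra generated by \<open>\<P>\<^sub>1\<close> and \<open>\<P>\<^sub>2\<close> is a quotient
  of the group algebra of the infinite dihedral group.  Its element
  \<open>Y = [2]\<^sup>k (\<P>\<^sub>1 + \<P>\<^sub>2) - \<P>\<^sub>1 \<P>\<^sub>2 - \<P>\<^sub>2 \<P>\<^sub>1\<close> is central, hence acts on an irreducible module by a scalar, and
  this scalar determines the module up to at most four one-dimensional exceptions.  Over the algebraic
  closure, \<open>r\<^sub>1 r\<^sub>2\<close> has on the regular module the eigenvalues \<open>1\<close>, \<open>-1\<close> (for even \<open>m\<close>) and
  \<open>exp (\<plusminus> 2i \<theta>\<^sub>j)\<close> with \<open>cos \<theta>\<^sub>j = \<surd>w\<^sub>j / [2]\<close>.  So on the tensor power the eigenvalues of \<open>Y\<close> are given by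
  products of \<open>k\<close> such numbers, which yields the list.  The listed modules are distinct because the
  numbers \<open>exp (2i \<theta>\<^sub>j)\<close> are multiplicatively independent, also modulo \<open>-1\<close>: as polynomials in the
  transcendental \<open>f\<close> the \<open>f - w\<^sub>j\<close> are pairwise non-associated primes, so their square roots are
  independent, and for each \<open>j\<close> there is an automorphism inverting \<open>exp (2i \<theta>\<^sub>j)\<close> and fixing the others.
\<close>

section \<open>Monoid rings modulo additive relations\<close>

text \<open>\<open>KH\<close> is only known as a quotient of a monoid ring, so computing in it
  directly is hopeless; everything is read off from scalar-valued additive maps. Matrix coefficients
  of two-dimensional Hecke modules multiply to functionals on the tensor power, which extend to
  \<open>KH\<close>. The m weights with two coefficients each give 2m functionals, the rank of the
  Hecke algebra, so they span its coordinates; clearing fractions then shows that they separate the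
  points of \<open>KH\<close>. Hence identities in \<open>KH\<close> may be tested on scalars. In
  particular some product of factors Y - y vanishes, which gives Y-eigenvectors in any nonzero
  module, whatever its dimension. The ranges in the list count tensor positions: a weight is a
  product of k numbers, cancellation only shortens a composition, and a sign -1 takes up one
  position, which leaves fewer than k for the composition. The sign exchanges cosine and sine, hence
  the second family. The exponentials need a square root of -1 that may lie outside K, whereas the
  listed matrices have entries in K. They are found as the unique matrices describing the action on
  two functionals with values in the closure.\<close>

definition frag_sum :: "('g \<Rightarrow> 'r::comm_ring_1) \<Rightarrow> ('g \<Rightarrow>\<^sub>0 int) \<Rightarrow> 'r" where
  "frag_sum F p = (\<Sum>x\<in>Poly_Mapping.keys p. of_int (Poly_Mapping.lookup p x) * F x)"

lemma frag_sum_superset: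
  assumes "finite A" "Poly_Mapping.keys p \<subseteq> A"
  shows "frag_sum F p = (\<Sum>x\<in>A. of_int (Poly_Mapping.lookup p x) * F x)"
  unfolding frag_sum_def
  by (intro sum.mono_neutral_left) (use assms in \<open>auto simp: in_keys_iff\<close>)

lemma frag_sum_add: "frag_sum F (p + q) = frag_sum F p + frag_sum F q"
  using Poly_Mapping.keys_add[of p q]
  by (simp add: frag_sum_superset[of "Poly_Mapping.keys p \<union> Poly_Mapping.keys q"] lookup_add
      distrib_right sum.distrib)

lemma frag_sum_0 [simp]: "frag_sum F 0 = 0"
  by (simp add: frag_sum_def)

lemma frag_sum_uminus: "frag_sum F (- p) = - frag_sum F p"
  using frag_sum_add[of F p "- p"] by (simp add: eq_neg_iff_add_eq_0 add.commute)

lemma frag_sum_diff: "frag_sum F (p - q) = frag_sum F p - frag_sum F q"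
  using frag_sum_add[of F p "- q"] by (simp add: frag_sum_uminus)

lemma frag_sum_single: "frag_sum F (Poly_Mapping.single x a) = of_int a * F x"
  by (simp add: frag_sum_superset[of "{x}"])

lemma monoid_ring_mult_diff:
  "r \<otimes>\<^bsub>monoid_ring G\<^esub> (p - q) = r \<otimes>\<^bsub>monoid_ring G\<^esub> p - r \<otimes>\<^bsub>monoid_ring G\<^esub> q"
  using monoid_ring_mult_add[where r = r and p = "p - q" and q = q and G = G] by (simp add: algebra_simps)

lemma monoid_ring_diff_mult:
  "(p - q) \<otimes>\<^bsub>monoid_ring G\<^esub> r = p \<otimes>\<^bsub>monoid_ring G\<^esub> r - q \<otimes>\<^bsub>monoid_ring G\<^esub> r"
  using monoid_ring_add_mult[where r = r and p = "p - q" and q = q and G = G] by (simp add: algebra_simps)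

text \<open>Both the tensor power and the scalar extension divide a monoid ring by relations of two
  shapes only: a = b + c, listed in \<open>R3\<close>, and a = b, listed in \<open>R2\<close>, with
  a, b, c in the monoid. Treating the two shapes once gives the calculus and the additive universal
  property for both rings.\<close>

locale presented_ring = monoid G for G :: "('g, 'm) monoid_scheme" +
  fixes R3 :: "('g \<times> 'g \<times> 'g) set" and R2 :: "('g \<times> 'g) set"
  assumes R3_closed: "(a, b, c) \<in> R3 \<Longrightarrow> a \<in> carrier G \<and> b \<in> carrier G \<and> c \<in> carrier G"
    and R2_closed: "(a, b) \<in> R2 \<Longrightarrow> a \<in> carrier G \<and> b \<in> carrier G"
begin

definition rels :: "('g \<Rightarrow>\<^sub>0 int) set" where
  "rels = {frag_of a - frag_of b - frag_of c | a b c. (a, b, c) \<in> R3} \<union>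
     {frag_of a - frag_of b | a b. (a, b) \<in> R2}"

definition Q :: "('g \<Rightarrow>\<^sub>0 int) set ring" where
  "Q = monoid_ring G Quot genideal (monoid_ring G) rels"

definition proj :: "('g \<Rightarrow>\<^sub>0 int) \<Rightarrow> ('g \<Rightarrow>\<^sub>0 int) set" where
  "proj p = genideal (monoid_ring G) rels +>\<^bsub>monoid_ring G\<^esub> p"

abbreviation cl :: "'g \<Rightarrow> ('g \<Rightarrow>\<^sub>0 int) set" where "cl g \<equiv> proj (frag_of g)"

sublocale MR: ring "monoid_ring G"
  by (rule ring_monoid_ring) (rule monoid_axioms)

lemma frag_of_closed: "g \<in> carrier G \<Longrightarrow> frag_of g \<in> carrier (monoid_ring G)"
  by simp

lemma diff_closed:
  assumes "p \<in> carrier (monoid_ring G)" "q \<in> carrier (monoid_ring G)"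
  shows "p - q \<in> carrier (monoid_ring G)"
  using assms keys_diff[of p q] by auto

lemma rels_closed: "rels \<subseteq> carrier (monoid_ring G)"
  unfolding rels_def using R3_closed R2_closed
  by (auto simp del: monoid_ring_carrier intro!: diff_closed frag_of_closed)

sublocale I: ideal "genideal (monoid_ring G) rels" "monoid_ring G"
  by (rule MR.genideal_ideal) (rule rels_closed)

sublocale Q: ring Q
  unfolding Q_def by (rule I.quotient_is_ring)

sublocale proj: ring_hom_ring "monoid_ring G" Q proj
  unfolding Q_def proj_def[abs_def] by (rule I.rcos_ring_hom_ring)

lemma cl_closed [intro, simp]: "g \<in> carrier G \<Longrightarrow> cl g \<in> carrier Q"
  by (intro proj.hom_closed frag_of_closed)

lemma cl_mult: "g \<in> carrier G \<Longrightarrow> h \<in> carrier G \<Longrightarrow> cl g \<otimes>\<^bsub>Q\<^esub> cl h = cl (g \<otimes>\<^bsub>G\<^esub> h)"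
  using proj.hom_mult[of "frag_of g" "frag_of h"] by (simp add: monoid_ring_mult_single)

lemma cl_one: "cl \<one>\<^bsub>G\<^esub> = \<one>\<^bsub>Q\<^esub>"
  using proj.hom_one by simp

lemma carrier_Q: "x \<in> carrier Q \<longleftrightarrow> (\<exists>p\<in>carrier (monoid_ring G). x = proj p)"
  by (auto simp: Q_def proj_def FactRing_def A_RCOSETS_def' a_r_coset_def' simp del: monoid_ring_carrier)

lemma proj_eq_iff:
  assumes "p \<in> carrier (monoid_ring G)" "q \<in> carrier (monoid_ring G)"
  shows "proj p = proj q \<longleftrightarrow> p - q \<in> genideal (monoid_ring G) rels"
proof -
  have "a_inv (monoid_ring G) q = - q"
    using assms(2) by (intro MR.minus_equality) auto
  then have "p \<ominus>\<^bsub>monoid_ring G\<^esub> q = p - q"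
    by (simp add: a_minus_def)
  then show ?thesis
    using MR.quotient_eq_iff_same_a_r_cos[OF I.is_ideal assms] by (simp add: proj_def)
qed

lemma cl_R3: "(a, b, c) \<in> R3 \<Longrightarrow> cl a = cl b \<oplus>\<^bsub>Q\<^esub> cl c"
proof -
  assume *: "(a, b, c) \<in> R3"
  then have "frag_of a - frag_of b - frag_of c \<in> rels"
    by (auto simp: rels_def)
  then have "frag_of a - (frag_of b + frag_of c) \<in> genideal (monoid_ring G) rels"
    using MR.genideal_self[OF rels_closed] by (auto simp: diff_diff_eq)
  then have "cl a = proj (frag_of b \<oplus>\<^bsub>monoid_ring G\<^esub> frag_of c)"
    using R3_closed[OF *] by (subst proj_eq_iff)
      (auto simp del: monoid_ring_carrier monoid_ring_simps(3) simp: frag_of_closed,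
        auto simp: frag_of_closed)
  then show ?thesis
    using R3_closed[OF *] by (simp only: proj.hom_add frag_of_closed)
qed

lemma cl_R2: "(a, b) \<in> R2 \<Longrightarrow> cl a = cl b"
proof -
  assume *: "(a, b) \<in> R2"
  then have "frag_of a - frag_of b \<in> rels"
    by (auto simp: rels_def)
  then show ?thesis
    using R2_closed[OF *] MR.genideal_self[OF rels_closed] 
    by (subst proj_eq_iff) (auto simp del: monoid_ring_carrier simp: frag_of_closed)
qed

text \<open>Integer coefficients are repeated sums and zero is a class plus its negative, so classes
  of monoid elements, sums and negatives reach the whole quotient.\<close>

lemma Q_induct [consumes 1, case_names cl add neg]:
  assumes "x \<in> carrier Q"
    and cl: "\<And>g. g \<in> carrier G \<Longrightarrow> P (cl g)"
    and add: "\<And>x y. x \<in> carrier Q \<Longrightarrow> y \<in> carrier Q \<Longrightarrow> P x \<Longrightarrow> P y \<Longrightarrow> P (x \<oplus>\<^bsub>Q\<^esub> y)"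
    and neg: "\<And>x. x \<in> carrier Q \<Longrightarrow> P x \<Longrightarrow> P (\<ominus>\<^bsub>Q\<^esub> x)"
  shows "P x"
proof -
  have zero: "P \<zero>\<^bsub>Q\<^esub>"
    using add[OF _ _ cl neg[OF _ cl], of "\<one>\<^bsub>G\<^esub>" "\<one>\<^bsub>G\<^esub>"] by (simp add: Q.r_neg)
  obtain p where p: "p \<in> carrier (monoid_ring G)" and x: "x = proj p"
    using assms(1) carrier_Q by blast
  from p have "p \<in> carrier (monoid_ring G) \<and> P (proj p)"
  proof (induction p rule: monoid_ring_induct)
    case zero
    then show ?case using \<open>P \<zero>\<^bsub>Q\<^esub>\<close> proj.hom_zero by auto
  next
    case (single g a)
    have nat: "P (proj (Poly_Mapping.single g (int n))) \<and>
        Poly_Mapping.single g (int n) \<in> carrier (monoid_ring G)" for n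
    proof (induction n)
      case 0
      then show ?case using zero proj.hom_zero by auto
    next
      case (Suc n)
      have "Poly_Mapping.single g (int (Suc n)) =
          frag_of g \<oplus>\<^bsub>monoid_ring G\<^esub> Poly_Mapping.single g (int n)"
        by (simp add: single_add)
      then show ?case
        using Suc single
        by (auto simp del: monoid_ring_simps(3) monoid_ring_carrier
            simp: proj.hom_add frag_of_closed intro!: add cl)
    qed
    show ?case
    proof (cases "a \<ge> 0")
      case True
      then show ?thesis using nat[of "nat a"] by auto
    next
      case False
      have "Poly_Mapping.single g a = a_inv (monoid_ring G) (Poly_Mapping.single g (int (nat (-a))))"
        using False single by (intro MR.minus_equality[symmetric]) (auto simp flip: single_add)
      then show ?thesis
        using nat[of "nat (-a)"] single by (auto simp del: monoid_ring_carrier simp: proj.hom_a_inv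
          intro!: neg)
    qed
  next
    case (add p q)
    then show ?case
      using assms(3)[of "proj p" "proj q"] proj.hom_add[of p q] MR.add.m_closed[of p q]
      by (auto simp del: monoid_ring_carrier)
  qed
  then show ?thesis using x by simp
qed

text \<open>
  The elements \<open>p\<close> with \<open>F (h \<cdot> p \<cdot> h') = 0\<close> for all \<open>h\<close> and \<open>h'\<close> form a two-sided ideal, so it
  suffices to test the translates of the defining relations.
\<close>

lemma lift_exists:
  fixes F :: "'g \<Rightarrow> 'r::comm_ring_1"
  assumes F3: "\<And>a b c h h'. (a, b, c) \<in> R3 \<Longrightarrow> h \<in> carrier G \<Longrightarrow> h' \<in> carrier G \<Longrightarrow>
      F (h \<otimes>\<^bsub>G\<^esub> a \<otimes>\<^bsub>G\<^esub> h') = F (h \<otimes>\<^bsub>G\<^esub> b \<otimes>\<^bsub>G\<^esub> h') + F (h \<otimes>\<^bsub>G\<^esub> c \<otimes>\<^bsub>G\<^esub> h')"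
    and F2: "\<And>a b h h'. (a, b) \<in> R2 \<Longrightarrow> h \<in> carrier G \<Longrightarrow> h' \<in> carrier G \<Longrightarrow>
      F (h \<otimes>\<^bsub>G\<^esub> a \<otimes>\<^bsub>G\<^esub> h') = F (h \<otimes>\<^bsub>G\<^esub> b \<otimes>\<^bsub>G\<^esub> h')"
  shows "\<exists>\<Phi>. (\<forall>x\<in>carrier Q. \<forall>y\<in>carrier Q. \<Phi> (x \<oplus>\<^bsub>Q\<^esub> y) = \<Phi> x + \<Phi> y) \<and>
      (\<forall>g\<in>carrier G. \<Phi> (cl g) = F g)"
proof -
  let ?M = "monoid_ring G"
  define J where "J = {p \<in> carrier ?M. \<forall>h\<in>carrier G. \<forall>h'\<in>carrier G.
      frag_sum F (frag_of h \<otimes>\<^bsub>?M\<^esub> p \<otimes>\<^bsub>?M\<^esub> frag_of h') = 0}"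
  have J0: "frag_sum F p = 0" if "p \<in> J" for p
  proof -
    have "frag_of \<one>\<^bsub>G\<^esub> \<otimes>\<^bsub>?M\<^esub> p \<otimes>\<^bsub>?M\<^esub> frag_of \<one>\<^bsub>G\<^esub> = p"
      using that MR.l_one[of p] MR.r_one[of p] by (simp add: J_def)
    then show ?thesis using that unfolding J_def by (metis (mono_tags, lifting) mem_Collect_eq one_closed)
  qed
  have mult_l: "frag_sum F (frag_of h \<otimes>\<^bsub>?M\<^esub> (x \<otimes>\<^bsub>?M\<^esub> p) \<otimes>\<^bsub>?M\<^esub> frag_of h') = 0"
    if "p \<in> J" "x \<in> carrier ?M" "h \<in> carrier G" "h' \<in> carrier G" for p x h h'
    using that(2,1,3,4)
  proof (induction x rule: monoid_ring_induct)
    case (single g a)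
    have p: "p \<in> carrier ?M" using single by (simp add: J_def)
    have gs: "Poly_Mapping.single g a \<in> carrier ?M" using single by simp
    have sc: "Poly_Mapping.single (h \<otimes>\<^bsub>G\<^esub> g) a \<otimes>\<^bsub>?M\<^esub> r =
        (\<Sum>y\<in>Poly_Mapping.keys r. Poly_Mapping.single (h \<otimes>\<^bsub>G\<^esub> g \<otimes>\<^bsub>G\<^esub> y) (a * Poly_Mapping.lookup r y))" for r
      by (simp add: monoid_ring_mult_superset[of "{h \<otimes>\<^bsub>G\<^esub> g}" "Poly_Mapping.keys r"])
    have fs: "frag_sum F (\<Sum>y\<in>A. f y) = (\<Sum>y\<in>A. frag_sum F (f y))" for A and f :: "'z \<Rightarrow> _"
      by (induction A rule: infinite_finite_induct) (auto simp: frag_sum_add)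
    have key: "frag_sum F (Poly_Mapping.single (h \<otimes>\<^bsub>G\<^esub> g) a \<otimes>\<^bsub>?M\<^esub> r) =
        of_int a * frag_sum F (frag_of (h \<otimes>\<^bsub>G\<^esub> g) \<otimes>\<^bsub>?M\<^esub> r)" for r
      by (simp add: monoid_ring_mult_superset[of "{h \<otimes>\<^bsub>G\<^esub> g}" "Poly_Mapping.keys r"] fs
          frag_sum_single sum_distrib_left mult_ac)
    have "frag_of h \<otimes>\<^bsub>?M\<^esub> (Poly_Mapping.single g a \<otimes>\<^bsub>?M\<^esub> p) \<otimes>\<^bsub>?M\<^esub> frag_of h' =
        (frag_of h \<otimes>\<^bsub>?M\<^esub> Poly_Mapping.single g a) \<otimes>\<^bsub>?M\<^esub> (p \<otimes>\<^bsub>?M\<^esub> frag_of h')"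
      using p gs single frag_of_closed by (simp add: MR.m_assoc del: monoid_ring_carrier)
    also have "frag_of h \<otimes>\<^bsub>?M\<^esub> Poly_Mapping.single g a = Poly_Mapping.single (h \<otimes>\<^bsub>G\<^esub> g) a"
      by (simp add: monoid_ring_mult_single)
    finally have "frag_sum F (frag_of h \<otimes>\<^bsub>?M\<^esub> (Poly_Mapping.single g a \<otimes>\<^bsub>?M\<^esub> p) \<otimes>\<^bsub>?M\<^esub> frag_of h') =
        of_int a * frag_sum F (frag_of (h \<otimes>\<^bsub>G\<^esub> g) \<otimes>\<^bsub>?M\<^esub> p \<otimes>\<^bsub>?M\<^esub> frag_of h')"
      using p single frag_of_closed by (simp add: key MR.m_assoc del: monoid_ring_carrier)
    also have "\<dots> = 0" using single by (simp add: J_def)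
    finally show ?case .
  qed (auto simp: monoid_ring_add_mult monoid_ring_mult_add frag_sum_add)
  have mult_r: "frag_sum F (frag_of h \<otimes>\<^bsub>?M\<^esub> (p \<otimes>\<^bsub>?M\<^esub> x) \<otimes>\<^bsub>?M\<^esub> frag_of h') = 0"
    if "p \<in> J" "x \<in> carrier ?M" "h \<in> carrier G" "h' \<in> carrier G" for p x h h'
    using that(2,1,3,4)
  proof (induction x rule: monoid_ring_induct)
    case (single g a)
    have p: "p \<in> carrier ?M" using single by (simp add: J_def)
    have gs: "Poly_Mapping.single g a \<in> carrier ?M" using single by simp
    have fs: "frag_sum F (\<Sum>y\<in>A. f y) = (\<Sum>y\<in>A. frag_sum F (f y))" for A and f :: "'z \<Rightarrow> _"
      by (induction A rule: infinite_finite_induct) (auto simp: frag_sum_add)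
    have key: "frag_sum F (r \<otimes>\<^bsub>?M\<^esub> Poly_Mapping.single (g \<otimes>\<^bsub>G\<^esub> h') a) =
        of_int a * frag_sum F (r \<otimes>\<^bsub>?M\<^esub> frag_of (g \<otimes>\<^bsub>G\<^esub> h'))" for r
      by (simp add: monoid_ring_mult_superset[of "Poly_Mapping.keys r" "{g \<otimes>\<^bsub>G\<^esub> h'}"] fs
          frag_sum_single sum_distrib_left mult_ac)
    have "frag_of h \<otimes>\<^bsub>?M\<^esub> (p \<otimes>\<^bsub>?M\<^esub> Poly_Mapping.single g a) \<otimes>\<^bsub>?M\<^esub> frag_of h' =
        (frag_of h \<otimes>\<^bsub>?M\<^esub> p) \<otimes>\<^bsub>?M\<^esub> (Poly_Mapping.single g a \<otimes>\<^bsub>?M\<^esub> frag_of h')"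
      using p gs single frag_of_closed by (simp add: MR.m_assoc del: monoid_ring_carrier)
    also have "Poly_Mapping.single g a \<otimes>\<^bsub>?M\<^esub> frag_of h' = Poly_Mapping.single (g \<otimes>\<^bsub>G\<^esub> h') a"
      by (simp add: monoid_ring_mult_single)
    finally have "frag_sum F (frag_of h \<otimes>\<^bsub>?M\<^esub> (p \<otimes>\<^bsub>?M\<^esub> Poly_Mapping.single g a) \<otimes>\<^bsub>?M\<^esub> frag_of h') =
        of_int a * frag_sum F (frag_of h \<otimes>\<^bsub>?M\<^esub> p \<otimes>\<^bsub>?M\<^esub> frag_of (g \<otimes>\<^bsub>G\<^esub> h'))"
      by (simp add: key)
    also have "\<dots> = 0" using single by (simp add: J_def)
    finally show ?case .
  qed (auto simp: monoid_ring_add_mult monoid_ring_mult_add frag_sum_add)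
  have "ideal J ?M"
  proof (rule idealI)
    show "subgroup J (add_monoid ?M)"
    proof
      show "J \<subseteq> carrier (add_monoid ?M)" by (auto simp: J_def)
      show "x \<otimes>\<^bsub>add_monoid ?M\<^esub> y \<in> J" if "x \<in> J" "y \<in> J" for x y
        using that MR.add.m_closed[of x y]
        by (auto simp: J_def monoid_ring_add_mult monoid_ring_mult_add frag_sum_add)
      show "\<one>\<^bsub>add_monoid ?M\<^esub> \<in> J" by (simp add: J_def)
      show "inv\<^bsub>add_monoid ?M\<^esub> x \<in> J" if "x \<in> J" for x
      proof -
        have "inv\<^bsub>add_monoid ?M\<^esub> x = - x"
          using that MR.minus_equality[of "- x" x] by (simp add: a_inv_def J_def)
        moreover have "- x = 0 - x" by simp
        moreover have "0 - x \<in> carrier ?M"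
          using that by (auto simp: J_def)
        ultimately show ?thesis
          using that by (simp add: J_def monoid_ring_diff_mult monoid_ring_mult_diff frag_sum_diff
              del: diff_0 monoid_ring_carrier)
      qed
    qed
    show "x \<otimes>\<^bsub>?M\<^esub> p \<in> J" "p \<otimes>\<^bsub>?M\<^esub> x \<in> J" if "p \<in> J" "x \<in> carrier ?M" for p x
      using mult_l[OF that] mult_r[OF that] that MR.m_closed[of x p] MR.m_closed[of p x]
      by (auto simp: J_def)
  qed (rule MR.ring_axioms)
  moreover have "rels \<subseteq> J"
  proof
    fix r assume r: "r \<in> rels"
    then have "r \<in> carrier ?M" using rels_closed by blast
    with r show "r \<in> J"
      unfolding rels_def J_def
      by (auto simp: monoid_ring_diff_mult monoid_ring_mult_diff frag_sum_diff
          monoid_ring_mult_single frag_sum_single F3 F2)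
  qed
  ultimately have "genideal ?M rels \<subseteq> J" by (rule MR.genideal_minimal)
  then have wd: "frag_sum F p = frag_sum F q"
    if "proj p = proj q" "p \<in> carrier ?M" "q \<in> carrier ?M" for p q
    using that J0[of "p - q"] proj_eq_iff[of p q] by (auto simp: frag_sum_diff)
  \<comment> \<open>\<open>wd\<close> makes the choice of representative harmless. The lift is asked
    to be additive only: the matrix coefficients for which it is used are in general not
    multiplicative.\<close>
  define rep where "rep x = (SOME p. p \<in> carrier ?M \<and> proj p = x)" for x
  have rep: "rep x \<in> carrier ?M \<and> proj (rep x) = x" if "x \<in> carrier Q" for x
  proof -
    have "\<exists>p. p \<in> carrier ?M \<and> proj p = x" using that carrier_Q[of x] by blast
    from someI_ex[OF this] show ?thesis by (simp only: rep_def)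
  qed
  have "frag_sum F (rep (x \<oplus>\<^bsub>Q\<^esub> y)) = frag_sum F (rep x) + frag_sum F (rep y)"
    if "x \<in> carrier Q" "y \<in> carrier Q" for x y
  proof -
    have "proj (rep x \<oplus>\<^bsub>?M\<^esub> rep y) = x \<oplus>\<^bsub>Q\<^esub> y"
      using rep that by (simp only: proj.hom_add)
    then have "frag_sum F (rep (x \<oplus>\<^bsub>Q\<^esub> y)) = frag_sum F (rep x \<oplus>\<^bsub>?M\<^esub> rep y)"
      using rep that MR.add.m_closed[of "rep x" "rep y"] by (intro wd) (simp_all del: monoid_ring_simps(3))
    then show ?thesis by (simp add: frag_sum_add)
  qed
  moreover have "frag_sum F (rep (cl g)) = F g" if "g \<in> carrier G" for g
    using wd[of "rep (cl g)" "frag_of g"] rep[of "cl g"] that by (simp add: frag_sum_single)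
  ultimately show ?thesis by (intro exI[of _ "\<lambda>x. frag_sum F (rep x)"]) auto
qed

end

section \<open>Dihedral groups and their Hecke algebras\<close>

lemma univ_ring_simps [simp]:
  "carrier univ_ring = UNIV" "x \<otimes>\<^bsub>univ_ring\<^esub> y = x * y" "\<one>\<^bsub>univ_ring\<^esub> = 1"
  "\<zero>\<^bsub>univ_ring\<^esub> = 0" "x \<oplus>\<^bsub>univ_ring\<^esub> y = x + y"
  by (simp_all add: univ_ring_def)

lemma ring_univ_ring: "ring (univ_ring :: 'a::ring_1 ring)"
proof (rule ringI)
  show "abelian_group (univ_ring :: 'a ring)"
    by (rule abelian_groupI) (auto simp: algebra_simps intro: exI[of _ "- x" for x])
  show "monoid (univ_ring :: 'a ring)"
    by (rule monoidI) (auto simp: algebra_simps)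
qed (auto simp: algebra_simps)

text \<open>One recursion serves both readings of the braid relation: words in the group and
  products of operators on a module.\<close>

primrec alt :: "nat \<Rightarrow> ('a \<Rightarrow> 'a) \<Rightarrow> ('a \<Rightarrow> 'a) \<Rightarrow> 'a \<Rightarrow> 'a" where
  "alt 0 f g x = x"
| "alt (Suc n) f g x = f (alt n g f x)"

section \<open>Alternating words in a finite dihedral group\<close>

locale finite_dihedral = dihedral W m s1 s2
  for W :: "('w, 'x) monoid_scheme" (structure) and m s1 s2 +
  assumes m_ge_2: "m \<ge> 2"
begin

lemma m_pos: "m > 0"
  using m_ge_2 by simp

definition wA :: "nat \<Rightarrow> 'w" where "wA n = alt n (\<lambda>x. s1 \<otimes> x) (\<lambda>x. s2 \<otimes> x) \<one>"
definition wB :: "nat \<Rightarrow> 'w" where "wB n = alt n (\<lambda>x. s2 \<otimes> x) (\<lambda>x. s1 \<otimes> x) \<one>"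

lemma wAB_0 [simp]: "wA 0 = \<one>" "wB 0 = \<one>"
  by (simp_all add: wA_def wB_def)

lemma wAB_Suc: "wA (Suc n) = s1 \<otimes> wB n" "wB (Suc n) = s2 \<otimes> wA n"
  by (simp_all add: wA_def wB_def)

lemma wAB_closed [simp]: "wA n \<in> carrier W" "wB n \<in> carrier W"
proof -
  have "wA n \<in> carrier W \<and> wB n \<in> carrier W"
    by (induction n) (auto simp: wAB_Suc s1_closed s2_closed)
  then show "wA n \<in> carrier W" "wB n \<in> carrier W" by auto
qed

lemma wAB_Suc_right:
  "wA (Suc n) = wA n \<otimes> (if even n then s1 else s2) \<and> wB (Suc n) = wB n \<otimes> (if even n then s2 else s1)"
proof (induction n)
  case 0
  then show ?case by (simp add: wAB_Suc s1_closed s2_closed)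
next
  case (Suc n)
  then show ?case
    by (simp only: wAB_Suc(1)[of "Suc n"] wAB_Suc(2)[of "Suc n"])
      (auto simp: wAB_Suc s1_closed s2_closed simp flip: m_assoc)
qed

lemma wA_even: "wA (2 * i) = (s1 \<otimes> s2) [^] i"
proof (induction i)
  case (Suc i)
  have "wA (2 * Suc i) = s1 \<otimes> (s2 \<otimes> wA (2 * i))"
    by (simp add: wAB_Suc)
  then show ?case
    using Suc by (metis m_assoc m_closed nat_pow_Suc2 s1_closed s2_closed wAB_closed(1))
qed simp

lemma s1_cancel [simp]: "x \<in> carrier W \<Longrightarrow> s1 \<otimes> (s1 \<otimes> x) = x"
  by (metis l_one m_assoc s1_closed s1_s1)

lemma s_cancel_right:
  "x \<in> carrier W \<Longrightarrow> x \<otimes> s1 \<otimes> s1 = x" "x \<in> carrier W \<Longrightarrow> x \<otimes> s2 \<otimes> s2 = x"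
  by (simp_all add: m_assoc s1_closed s2_closed s1_s1 s2_s2)

text \<open>The alternating words of length at most \<open>2m\<close> run around the Cayley graph in both directions.\<close>

lemma wB_2m: "wB (2 * m) = \<one>"
proof -
  have "s1 \<otimes> wB (2 * m) = wA (2 * m) \<otimes> s1"
    using wAB_Suc_right[of "2 * m"] by (simp add: wAB_Suc)
  also have "\<dots> = s1" using braid by (simp add: wA_even s1_closed)
  finally show ?thesis
    by (metis s1_cancel s1_closed s1_s1 wAB_closed(2))
qed

lemma wA_eq_wB: "n \<le> 2 * m \<Longrightarrow> wA n = wB (2 * m - n)"
proof (induction n)
  case 0
  then show ?case by (simp add: wB_2m)
next
  case (Suc n)
  define p where "p = 2 * m - Suc n"
  have p: "2 * m - n = Suc p" "even p \<longleftrightarrow> odd n" using Suc.prems by (auto simp: p_def)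
  have "wA (Suc n) = wB (Suc p) \<otimes> (if even n then s1 else s2)"
    using Suc p wAB_Suc_right[of n] by simp
  also have "\<dots> = wB p"
    using p(2) wAB_Suc_right[of p] by (auto simp: s_cancel_right)
  finally show ?case by (simp add: p_def)
qed

lemma wB_eq_wA: "n \<le> 2 * m \<Longrightarrow> wB n = wA (2 * m - n)"
  using wA_eq_wB[of "2 * m - n"] by simp

text \<open>\<open>min n (2 * m - n)\<close> is the distance from the identity on a cycle with 2m
  vertices. A generator moves to a neighbouring vertex, so the distance grows by at most
  one.\<close>

lemma mult_wA:
  assumes "n < 2 * m"
  shows "\<exists>p<2 * m. s1 \<otimes> wA n = wA p \<and> min p (2 * m - p) \<le> Suc (min n (2 * m - n))"
    and "\<exists>p<2 * m. s2 \<otimes> wA n = wA p \<and> min p (2 * m - p) \<le> Suc (min n (2 * m - n))"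
proof -
  show "\<exists>p<2 * m. s1 \<otimes> wA n = wA p \<and> min p (2 * m - p) \<le> Suc (min n (2 * m - n))"
  proof (cases "n \<le> 1")
    case True
    then show ?thesis
      using m_pos assms by (intro exI[of _ "1 - n"]) (auto simp: le_Suc_eq wAB_Suc)
  next
    case False
    then obtain i where "n = Suc i" "i > 0" by (cases n) auto
    then show ?thesis
      using assms by (intro exI[of _ "2 * m - i"]) (auto simp: wAB_Suc wB_eq_wA)
  qed
  show "\<exists>p<2 * m. s2 \<otimes> wA n = wA p \<and> min p (2 * m - p) \<le> Suc (min n (2 * m - n))"
    using assms by (intro exI[of _ "2 * m - Suc n"])
      (auto simp: wAB_Suc(2)[symmetric] wB_eq_wA)
qed

lemma word_wA:
  assumes "set xs \<subseteq> {s1, s2}"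
  shows "\<exists>n<2 * m. foldr (\<lambda>x y. x \<otimes> y) xs \<one> = wA n \<and> min n (2 * m - n) \<le> length xs"
  using assms
proof (induction xs)
  case Nil
  then show ?case using m_pos by (intro exI[of _ 0]) auto
next
  case (Cons x xs)
  then obtain n where n: "n < 2 * m" "foldr (\<lambda>x y. x \<otimes> y) xs \<one> = wA n"
      "min n (2 * m - n) \<le> length xs"
    by auto
  have "\<exists>p<2 * m. x \<otimes> wA n = wA p \<and> min p (2 * m - p) \<le> Suc (min n (2 * m - n))"
    using mult_wA[OF n(1)] Cons.prems by auto
  then obtain p where p: "p < 2 * m" "x \<otimes> wA n = wA p" "min p (2 * m - p) \<le> Suc (min n (2 * m - n))"
    by blast
  have "min p (2 * m - p) \<le> length (x # xs)"
    using p(3) n(3) unfolding list.size by linarith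
  then show ?case
    using p n by (intro exI[of _ p]) (simp del: min_le_iff_disj)
qed

lemma carrier_eq_wA: "carrier W = wA ` {..<2 * m}"
proof
  show "carrier W \<subseteq> wA ` {..<2 * m}"
  proof
    fix w assume "w \<in> carrier W"
    then have "w \<in> generate W {s1, s2}" by (simp add: generated)
    \<comment> \<open>Stated for all translates \<open>w \<otimes> wA n\<close>, so that products of
      two elements pass through the induction; n = 0 gives back w itself.\<close>
    then have "\<forall>n<2 * m. w \<otimes> wA n \<in> wA ` {..<2 * m}"
    proof induction
      case one
      then show ?case by auto
    next
      case (incl h)
      then show ?case using mult_wA by (auto; blast)
    next
      case (inv h)
      have "inv s1 = s1" "inv s2 = s2"
        by (simp_all add: inv_equality s1_closed s2_closed s1_s1 s2_s2)
      then have "inv h = h" using inv by auto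
      then show ?case using mult_wA inv by (auto; blast)
    next
      case (eng h h')
      have "h \<in> carrier W" "h' \<in> carrier W"
        using eng.hyps by (simp_all add: generated)
      then show ?case
        using eng.IH by (auto simp: m_assoc image_iff)
    qed
    then have "0 < 2 * m \<longrightarrow> w \<otimes> wA 0 \<in> wA ` {..<2 * m}" by blast
    then show "w \<in> wA ` {..<2 * m}" using \<open>w \<in> carrier W\<close> m_pos by simp
  qed
qed auto

lemma finite_carrier_W: "finite (carrier W)"
  unfolding carrier_eq_wA by simp

text \<open>2m words cover a group of order 2m. The relations alone would also admit proper
  quotients.\<close>

lemma inj_wA: "inj_on wA {..<2 * m}"
  using order_W carrier_eq_wA by (intro eq_card_imp_inj_on) (simp_all add: order_def)

lemma word_wAB:
  "\<exists>xs. length xs = n \<and> set xs \<subseteq> {s1, s2} \<and> foldr (\<lambda>x y. x \<otimes> y) xs \<one> = wA n"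
  "\<exists>xs. length xs = n \<and> set xs \<subseteq> {s1, s2} \<and> foldr (\<lambda>x y. x \<otimes> y) xs \<one> = wB n"
proof -
  have "(\<exists>xs. length xs = n \<and> set xs \<subseteq> {s1, s2} \<and> foldr (\<lambda>x y. x \<otimes> y) xs \<one> = wA n) \<and>
    (\<exists>xs. length xs = n \<and> set xs \<subseteq> {s1, s2} \<and> foldr (\<lambda>x y. x \<otimes> y) xs \<one> = wB n)"
  proof (induction n)
    case (Suc n)
    then obtain xs ys where xs: "length xs = n" "set xs \<subseteq> {s1, s2}" "foldr (\<lambda>x y. x \<otimes> y) xs \<one> = wA n"
      and ys: "length ys = n" "set ys \<subseteq> {s1, s2}" "foldr (\<lambda>x y. x \<otimes> y) ys \<one> = wB n"
      by blast
    have "length (s1 # ys) = Suc n \<and> set (s1 # ys) \<subseteq> {s1, s2} \<and>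
        foldr (\<lambda>x y. x \<otimes> y) (s1 # ys) \<one> = wA (Suc n)"
      using ys by (simp add: wAB_Suc)
    moreover have "length (s2 # xs) = Suc n \<and> set (s2 # xs) \<subseteq> {s1, s2} \<and>
        foldr (\<lambda>x y. x \<otimes> y) (s2 # xs) \<one> = wB (Suc n)"
      using xs by (simp add: wAB_Suc)
    ultimately show ?case by blast
  qed simp
  then show "\<exists>xs. length xs = n \<and> set xs \<subseteq> {s1, s2} \<and> foldr (\<lambda>x y. x \<otimes> y) xs \<one> = wA n"
    "\<exists>xs. length xs = n \<and> set xs \<subseteq> {s1, s2} \<and> foldr (\<lambda>x y. x \<otimes> y) xs \<one> = wB n" by auto
qed

text \<open>By \<open>word_wA\<close> any word for the element is at least as long as its distance
  from the identity on the cycle, and up to the middle of the cycle that distance is n.\<close>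

lemma word_length_wAB:
  assumes "n \<le> m"
  shows "word_length W {s1, s2} (wA n) = n" "word_length W {s1, s2} (wB n) = n"
proof -
  show "word_length W {s1, s2} (wA n) = n"
    unfolding word_length_def
  proof (rule Least_equality)
    show "\<exists>xs. length xs = n \<and> set xs \<subseteq> {s1, s2} \<and> foldr (\<lambda>x y. x \<otimes> y) xs \<one> = wA n"
      by (rule word_wAB)
    fix l assume "\<exists>xs. length xs = l \<and> set xs \<subseteq> {s1, s2} \<and> foldr (\<lambda>x y. x \<otimes> y) xs \<one> = wA n"
    then obtain xs where xs: "length xs = l" "set xs \<subseteq> {s1, s2}" "foldr (\<lambda>x y. x \<otimes> y) xs \<one> = wA n"
      by blast
    obtain p where "p < 2 * m" "wA n = wA p" "min p (2 * m - p) \<le> l"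
      using word_wA[OF xs(2)] xs by auto
    moreover have "n = p"
      using inj_onD[OF inj_wA, of n p] calculation assms m_pos by auto
    ultimately show "n \<le> l" using assms by auto
  qed
  show "word_length W {s1, s2} (wB n) = n"
  \<comment> \<open>For n = 0 the index 2m - n falls outside the range on which \<open>wA\<close> is
    injective.\<close>
  proof (cases "n = 0")
    case True
    then show ?thesis using \<open>word_length W {s1, s2} (wA n) = n\<close> by simp
  next
    case False
    show ?thesis
      unfolding word_length_def
    proof (rule Least_equality)
      show "\<exists>xs. length xs = n \<and> set xs \<subseteq> {s1, s2} \<and> foldr (\<lambda>x y. x \<otimes> y) xs \<one> = wB n"
        by (rule word_wAB)
      fix l assume "\<exists>xs. length xs = l \<and> set xs \<subseteq> {s1, s2} \<and> foldr (\<lambda>x y. x \<otimes> y) xs \<one> = wB n"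
      then obtain xs where xs: "length xs = l" "set xs \<subseteq> {s1, s2}" "foldr (\<lambda>x y. x \<otimes> y) xs \<one> = wB n"
        by blast
      obtain p where "p < 2 * m" "wB n = wA p" "min p (2 * m - p) \<le> l"
        using word_wA[OF xs(2)] xs by auto
      moreover have "2 * m - n = p"
        using inj_onD[OF inj_wA, of "2 * m - n" p] calculation assms m_pos False
        by (auto simp: wB_eq_wA)
      ultimately show "n \<le> l" using assms by auto
    qed
  qed
qed

text \<open>The bound for \<open>wB\<close> is strict because \<open>wA m\<close> and
  \<open>wB m\<close> are the same longest element.\<close>

lemma carrier_cases:
  assumes "w \<in> carrier W"
  obtains n where "n \<le> m" "w = wA n" | n where "n < m" "w = wB n"
proof -
  obtain n where n: "n < 2 * m" "w = wA n" using assms carrier_eq_wA by auto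
  show thesis
  proof (cases "n \<le> m")
    case False
    then show ?thesis using n wA_eq_wB[of n] by (intro that(2)[of "2 * m - n"]) auto
  qed (use n that in blast)
qed

lemma wA_m: "wA m = wB m"
  using wA_eq_wB[of m] by simp

end

section \<open>Coordinates, induction principles and cyclic modules of the Hecke algebra\<close>

locale dihedral_hecke = finite_dihedral W m s1 s2 + hecke_algebra W "{s1, s2}" H \<eta> T
  for W :: "('w, 'x) monoid_scheme" (structure) and m s1 s2
    and H :: "('h, 'y) ring_scheme" and \<eta> :: "laurent \<Rightarrow> 'h" and T :: "'w \<Rightarrow> 'h"
begin

sublocale H: ring H
  using algebra_H by (simp add: is_algebra_def)

lemma eta_hom: "\<eta> \<in> ring_hom univ_ring H"
  using algebra_H by (simp add: is_algebra_def)

lemma eta_closed [simp]: "\<eta> a \<in> carrier H"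
  using ring_hom_closed[OF eta_hom] by simp

lemma eta_add: "\<eta> (a + b) = \<eta> a \<oplus>\<^bsub>H\<^esub> \<eta> b"
  using ring_hom_add[OF eta_hom] by simp

lemma eta_mult: "\<eta> (a * b) = \<eta> a \<otimes>\<^bsub>H\<^esub> \<eta> b"
  using ring_hom_mult[OF eta_hom] by simp

lemma eta_one [simp]: "\<eta> 1 = \<one>\<^bsub>H\<^esub>"
  using ring_hom_one[OF eta_hom] by simp

lemma eta_zero [simp]: "\<eta> 0 = \<zero>\<^bsub>H\<^esub>"
  using ring_hom_zero[OF eta_hom ring_univ_ring H.ring_axioms] by simp

lemma eta_uminus: "\<eta> (- a) = \<ominus>\<^bsub>H\<^esub> \<eta> a"
  by (rule H.minus_equality[symmetric]) (auto simp flip: eta_add)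

lemma eta_diff: "\<eta> (a - b) = \<eta> a \<ominus>\<^bsub>H\<^esub> \<eta> b"
  using eta_add[of a "- b"] by (simp add: eta_uminus a_minus_def)

lemma eta_central: "x \<in> carrier H \<Longrightarrow> x \<otimes>\<^bsub>H\<^esub> \<eta> a = \<eta> a \<otimes>\<^bsub>H\<^esub> x"
  using algebra_H by (simp add: is_algebra_def)

lemma T_closed [simp]: "w \<in> carrier W \<Longrightarrow> T w \<in> carrier H"
  using basis_T by (auto simp: is_basis_def)

definition coef :: "'h \<Rightarrow> 'w \<Rightarrow> laurent" where
  "coef h = (THE c. c \<in> carrier W \<rightarrow>\<^sub>E UNIV \<and> h = (\<Oplus>\<^bsub>H\<^esub>w\<in>carrier W. \<eta> (c w) \<otimes>\<^bsub>H\<^esub> T w))"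

lemma coef_expansion:
  assumes "h \<in> carrier H"
  shows "h = (\<Oplus>\<^bsub>H\<^esub>w\<in>carrier W. \<eta> (coef h w) \<otimes>\<^bsub>H\<^esub> T w)"
proof -
  have "\<exists>!c. c \<in> carrier W \<rightarrow>\<^sub>E UNIV \<and> h = (\<Oplus>\<^bsub>H\<^esub>w\<in>carrier W. \<eta> (c w) \<otimes>\<^bsub>H\<^esub> T w)"
    using basis_T assms by (simp add: is_basis_def)
  from theI'[OF this] show ?thesis by (simp add: coef_def)
qed

lemma coef_unique:
  assumes "h = (\<Oplus>\<^bsub>H\<^esub>w\<in>carrier W. \<eta> (c w) \<otimes>\<^bsub>H\<^esub> T w)" "w \<in> carrier W"
  shows "coef h w = c w"
proof -
  have h: "h \<in> carrier H"
    unfolding assms(1) by (intro H.finsum_closed) auto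
  have ex1: "\<exists>!c. c \<in> carrier W \<rightarrow>\<^sub>E UNIV \<and> h = (\<Oplus>\<^bsub>H\<^esub>w\<in>carrier W. \<eta> (c w) \<otimes>\<^bsub>H\<^esub> T w)"
    using basis_T h by (simp add: is_basis_def)
  have "h = (\<Oplus>\<^bsub>H\<^esub>w\<in>carrier W. \<eta> (restrict c (carrier W) w) \<otimes>\<^bsub>H\<^esub> T w)"
    unfolding assms(1) by (intro H.finsum_cong') auto
  then have "coef h = restrict c (carrier W)"
    unfolding coef_def by (intro the1_equality[OF ex1]) auto
  then show ?thesis using assms(2) by simp
qed

lemma coef_add:
  assumes "h \<in> carrier H" "h' \<in> carrier H" "w \<in> carrier W"
  shows "coef (h \<oplus>\<^bsub>H\<^esub> h') w = coef h w + coef h' w"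
proof (rule coef_unique)
  have "h \<oplus>\<^bsub>H\<^esub> h' = (\<Oplus>\<^bsub>H\<^esub>w\<in>carrier W. \<eta> (coef h w) \<otimes>\<^bsub>H\<^esub> T w) \<oplus>\<^bsub>H\<^esub>
      (\<Oplus>\<^bsub>H\<^esub>w\<in>carrier W. \<eta> (coef h' w) \<otimes>\<^bsub>H\<^esub> T w)"
    using coef_expansion assms by simp
  also have "\<dots> = (\<Oplus>\<^bsub>H\<^esub>w\<in>carrier W. \<eta> (coef h w) \<otimes>\<^bsub>H\<^esub> T w \<oplus>\<^bsub>H\<^esub> \<eta> (coef h' w) \<otimes>\<^bsub>H\<^esub> T w)"
    by (intro H.finsum_addf[symmetric]) auto
  also have "\<dots> = (\<Oplus>\<^bsub>H\<^esub>w\<in>carrier W. \<eta> (coef h w + coef h' w) \<otimes>\<^bsub>H\<^esub> T w)"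
    by (intro H.finsum_cong') (auto simp: eta_add H.l_distr)
  finally show "h \<oplus>\<^bsub>H\<^esub> h' = \<dots>" .
qed fact

lemma coef_scale:
  assumes "h \<in> carrier H" "w \<in> carrier W"
  shows "coef (\<eta> a \<otimes>\<^bsub>H\<^esub> h) w = a * coef h w"
proof (rule coef_unique)
  have "\<eta> a \<otimes>\<^bsub>H\<^esub> h = \<eta> a \<otimes>\<^bsub>H\<^esub> (\<Oplus>\<^bsub>H\<^esub>w\<in>carrier W. \<eta> (coef h w) \<otimes>\<^bsub>H\<^esub> T w)"
    using coef_expansion assms by simp
  also have "\<dots> = (\<Oplus>\<^bsub>H\<^esub>w\<in>carrier W. \<eta> a \<otimes>\<^bsub>H\<^esub> (\<eta> (coef h w) \<otimes>\<^bsub>H\<^esub> T w))"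
    by (intro H.finsum_rdistr) (auto simp: finite_carrier_W)
  also have "\<dots> = (\<Oplus>\<^bsub>H\<^esub>w\<in>carrier W. \<eta> (a * coef h w) \<otimes>\<^bsub>H\<^esub> T w)"
    by (intro H.finsum_cong') (auto simp: eta_mult H.m_assoc)
  finally show "\<eta> a \<otimes>\<^bsub>H\<^esub> h = \<dots>" .
qed fact

lemma coef_T:
  assumes "v \<in> carrier W" "w \<in> carrier W"
  shows "coef (T v) w = (if w = v then 1 else 0)"
proof (rule coef_unique)
  have "(\<Oplus>\<^bsub>H\<^esub>w\<in>carrier W. \<eta> (if w = v then 1 else 0) \<otimes>\<^bsub>H\<^esub> T w) =
      (\<Oplus>\<^bsub>H\<^esub>w\<in>carrier W. if v = w then T w else \<zero>\<^bsub>H\<^esub>)"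
    by (intro H.finsum_cong') auto
  also have "\<dots> = T v"
    using assms by (intro H.finsum_singleton) (auto simp: finite_carrier_W)
  finally show "T v = (\<Oplus>\<^bsub>H\<^esub>w\<in>carrier W. \<eta> (if w = v then 1 else 0) \<otimes>\<^bsub>H\<^esub> T w)" ..
qed fact

lemma H_basis_induct [consumes 1, case_names T scale add]:
  assumes "h \<in> carrier H"
    and T: "\<And>w. w \<in> carrier W \<Longrightarrow> P (T w)"
    and scale: "\<And>a h. h \<in> carrier H \<Longrightarrow> P h \<Longrightarrow> P (\<eta> a \<otimes>\<^bsub>H\<^esub> h)"
    and add: "\<And>h h'. h \<in> carrier H \<Longrightarrow> h' \<in> carrier H \<Longrightarrow> P h \<Longrightarrow> P h' \<Longrightarrow> P (h \<oplus>\<^bsub>H\<^esub> h')"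
  shows "P h"
proof -
  have "P (\<eta> 0 \<otimes>\<^bsub>H\<^esub> T \<one>)" by (intro scale T) auto
  then have zero: "P \<zero>\<^bsub>H\<^esub>" by simp
  have "finite A \<Longrightarrow> A \<subseteq> carrier W \<Longrightarrow> P (\<Oplus>\<^bsub>H\<^esub>w\<in>A. \<eta> (coef h w) \<otimes>\<^bsub>H\<^esub> T w)" for A
  proof (induction A rule: finite_induct)
    case (insert x A)
    then have "(\<Oplus>\<^bsub>H\<^esub>w\<in>insert x A. \<eta> (coef h w) \<otimes>\<^bsub>H\<^esub> T w) =
        \<eta> (coef h x) \<otimes>\<^bsub>H\<^esub> T x \<oplus>\<^bsub>H\<^esub> (\<Oplus>\<^bsub>H\<^esub>w\<in>A. \<eta> (coef h w) \<otimes>\<^bsub>H\<^esub> T w)"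
      by (intro H.finsum_insert) auto
    then show ?case
      using insert by (auto intro!: add scale T H.finsum_closed)
  qed (simp add: zero)
  from this[of "carrier W"] show ?thesis
    using coef_expansion[OF assms(1)] finite_carrier_W by simp
qed

lemma T_wAB:
  assumes "n < m"
  shows "T s1 \<otimes>\<^bsub>H\<^esub> T (wB n) = T (wA (Suc n))" "T s2 \<otimes>\<^bsub>H\<^esub> T (wA n) = T (wB (Suc n))"
proof -
  have s: "wA (Suc 0) = s1" "wB (Suc 0) = s2" by (simp_all add: wAB_Suc s1_closed s2_closed)
  have l1: "word_length W {s1, s2} s1 = 1" "word_length W {s1, s2} s2 = 1"
    using word_length_wAB[of "Suc 0"] assms by (simp_all add: s)
  show "T s1 \<otimes>\<^bsub>H\<^esub> T (wB n) = T (wA (Suc n))"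
    unfolding wAB_Suc using assms word_length_wAB[of n] l1 word_length_wAB[of "Suc n"]
    by (intro T_mult) (auto simp: s1_closed wAB_Suc(1)[symmetric])
  show "T s2 \<otimes>\<^bsub>H\<^esub> T (wA n) = T (wB (Suc n))"
    unfolding wAB_Suc using assms word_length_wAB[of n] l1 word_length_wAB[of "Suc n"]
    by (intro T_mult) (auto simp: s2_closed wAB_Suc(2)[symmetric])
qed

text \<open>The product rule with first factor of length 0 makes \<open>T \<one>\<close> a left unit
  on the basis; linearity extends this to H, and the unit of H is then the test element.\<close>

lemma T_one: "T \<one> = \<one>\<^bsub>H\<^esub>"
proof -
  have "T \<one> \<otimes>\<^bsub>H\<^esub> h = h" if "h \<in> carrier H" for h
    using that
  proof (induction h rule: H_basis_induct)
    case (T w)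
    have "word_length W {s1, s2} \<one> = 0"
      using word_length_wAB(1)[of 0] by simp
    then show ?case using T T_mult[of \<one> w] by simp
  next
    case (scale a h)
    then have "T \<one> \<otimes>\<^bsub>H\<^esub> (\<eta> a \<otimes>\<^bsub>H\<^esub> h) = \<eta> a \<otimes>\<^bsub>H\<^esub> (T \<one> \<otimes>\<^bsub>H\<^esub> h)"
      by (metis H.m_assoc eta_central T_closed eta_closed one_closed)
    then show ?case using scale by simp
  qed (simp add: H.r_distr)
  from this[of "\<one>\<^bsub>H\<^esub>"] show ?thesis by simp
qed

lemma T_square:
  assumes "s \<in> {s1, s2}"
  shows "T s \<otimes>\<^bsub>H\<^esub> T s = \<eta> (u_pow 1 - u_pow (-1)) \<otimes>\<^bsub>H\<^esub> T s \<oplus>\<^bsub>H\<^esub> \<one>\<^bsub>H\<^esub>"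
proof -
  have s: "s \<in> carrier W" using assms s1_closed s2_closed by auto
  have uu: "\<eta> (u_pow 1) \<otimes>\<^bsub>H\<^esub> \<eta> (u_pow (-1)) = \<one>\<^bsub>H\<^esub>"
    by (simp add: u_pow_def mult_single flip: eta_mult)
  define t where "t = T s"
  have t: "t \<in> carrier H" using s by (simp add: t_def)
  have "\<zero>\<^bsub>H\<^esub> = (t \<ominus>\<^bsub>H\<^esub> \<eta> (u_pow 1)) \<otimes>\<^bsub>H\<^esub> (t \<oplus>\<^bsub>H\<^esub> \<eta> (u_pow (-1)))"
    using T_quadratic[OF assms] by (simp add: t_def)
  also have "\<dots> = (t \<otimes>\<^bsub>H\<^esub> t \<ominus>\<^bsub>H\<^esub> \<eta> (u_pow 1) \<otimes>\<^bsub>H\<^esub> t) \<oplus>\<^bsub>H\<^esub> (\<eta> (u_pow (-1)) \<otimes>\<^bsub>H\<^esub> t \<ominus>\<^bsub>H\<^esub> \<one>\<^bsub>H\<^esub>)"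
    using t by (simp add: H.l_distr H.r_distr a_minus_def H.l_minus H.r_minus uu eta_central[OF t])
  finally have 0: "(t \<otimes>\<^bsub>H\<^esub> t \<ominus>\<^bsub>H\<^esub> \<eta> (u_pow 1) \<otimes>\<^bsub>H\<^esub> t) \<oplus>\<^bsub>H\<^esub> (\<eta> (u_pow (-1)) \<otimes>\<^bsub>H\<^esub> t \<ominus>\<^bsub>H\<^esub> \<one>\<^bsub>H\<^esub>) = \<zero>\<^bsub>H\<^esub>" ..
  have cancel: "x = y \<ominus>\<^bsub>H\<^esub> z \<oplus>\<^bsub>H\<^esub> e"
    if "(x \<ominus>\<^bsub>H\<^esub> y) \<oplus>\<^bsub>H\<^esub> (z \<ominus>\<^bsub>H\<^esub> e) = \<zero>\<^bsub>H\<^esub>"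
      "x \<in> carrier H" "y \<in> carrier H" "z \<in> carrier H" "e \<in> carrier H" for x y z e
  proof -
    have "x = ((x \<ominus>\<^bsub>H\<^esub> y) \<oplus>\<^bsub>H\<^esub> (z \<ominus>\<^bsub>H\<^esub> e)) \<oplus>\<^bsub>H\<^esub> (y \<ominus>\<^bsub>H\<^esub> z \<oplus>\<^bsub>H\<^esub> e)"
      using that(2-) by (simp add: a_minus_def H.a_ac H.r_neg1 H.r_neg2 H.r_neg)
    then show ?thesis using that by simp
  qed
  have "t \<otimes>\<^bsub>H\<^esub> t = \<eta> (u_pow 1) \<otimes>\<^bsub>H\<^esub> t \<ominus>\<^bsub>H\<^esub> \<eta> (u_pow (-1)) \<otimes>\<^bsub>H\<^esub> t \<oplus>\<^bsub>H\<^esub> \<one>\<^bsub>H\<^esub>"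
    using t by (intro cancel[OF 0]) auto
  also have "\<dots> = \<eta> (u_pow 1 - u_pow (-1)) \<otimes>\<^bsub>H\<^esub> t \<oplus>\<^bsub>H\<^esub> \<one>\<^bsub>H\<^esub>"
    using t by (simp add: eta_diff a_minus_def H.l_distr H.l_minus)
  finally show ?thesis by (simp add: t_def)
qed

text \<open>Up to length m each basis element arises from a shorter one by left multiplication with
  \<open>T s1\<close> or \<open>T s2\<close>, so these two maps and linear combinations reach all of
  H from the unit.\<close>

lemma H_induct [consumes 1, case_names one scale add T1 T2]:
  assumes "h \<in> carrier H"
    and one: "P \<one>\<^bsub>H\<^esub>"
    and scale: "\<And>a h. h \<in> carrier H \<Longrightarrow> P h \<Longrightarrow> P (\<eta> a \<otimes>\<^bsub>H\<^esub> h)"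
    and add: "\<And>h h'. h \<in> carrier H \<Longrightarrow> h' \<in> carrier H \<Longrightarrow> P h \<Longrightarrow> P h' \<Longrightarrow> P (h \<oplus>\<^bsub>H\<^esub> h')"
    and T1: "\<And>h. h \<in> carrier H \<Longrightarrow> P h \<Longrightarrow> P (T s1 \<otimes>\<^bsub>H\<^esub> h)"
    and T2: "\<And>h. h \<in> carrier H \<Longrightarrow> P h \<Longrightarrow> P (T s2 \<otimes>\<^bsub>H\<^esub> h)"
  shows "P h"
  using assms(1)
proof (induction h rule: H_basis_induct)
  case (T w)
  have "n \<le> m \<Longrightarrow> P (T (wA n)) \<and> P (T (wB n))" for n
  proof (induction n)
    case 0
    then show ?case by (simp add: T_one one)
  next
    case (Suc n)
    then have "P (T s1 \<otimes>\<^bsub>H\<^esub> T (wB n))" "P (T s2 \<otimes>\<^bsub>H\<^esub> T (wA n))"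
      by (auto intro!: T1 T2)
    then show ?case using Suc.prems T_wAB[of n] by simp
  qed
  note * = this
  from T show ?case
    by (cases rule: carrier_cases) (use * in auto)
qed (use scale add in auto)

text \<open>
  Cyclic left modules of the Hecke algebra: the operators \<open>M1\<close>, \<open>M2\<close> need only satisfy the braid relation
  on the generating vector.
\<close>

lemma module_map_exists:
  fixes sc :: "laurent \<Rightarrow> 'v::ab_group_add \<Rightarrow> 'v"
  assumes M1: "Modules.module_hom sc sc M1" and M2: "Modules.module_hom sc sc M2"
    and sq1: "\<And>x. M1 (M1 x) = sc (u_pow 1 - u_pow (-1)) (M1 x) + x"
    and sq2: "\<And>x. M2 (M2 x) = sc (u_pow 1 - u_pow (-1)) (M2 x) + x"
    and br: "alt m M1 M2 v0 = alt m M2 M1 v0"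
  obtains v where "\<And>h h'. h \<in> carrier H \<Longrightarrow> h' \<in> carrier H \<Longrightarrow> v (h \<oplus>\<^bsub>H\<^esub> h') = v h + v h'"
    "\<And>a h. h \<in> carrier H \<Longrightarrow> v (\<eta> a \<otimes>\<^bsub>H\<^esub> h) = sc a (v h)"
    "\<And>h. h \<in> carrier H \<Longrightarrow> v (T s1 \<otimes>\<^bsub>H\<^esub> h) = M1 (v h)"
    "\<And>h. h \<in> carrier H \<Longrightarrow> v (T s2 \<otimes>\<^bsub>H\<^esub> h) = M2 (v h)"
    "v \<one>\<^bsub>H\<^esub> = v0"
proof -
  interpret M1: Modules.module_hom sc sc M1 by fact
  interpret M2: Modules.module_hom sc sc M2 by fact
  \<comment> \<open>The value on a basis element is the alternating operator word along a reduced
    expression. Only the longest element has two reduced expressions, and there \<open>br\<close>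
    identifies the two values.\<close>
  define val where "val w = (let n = the_inv_into {..<2 * m} wA w in
      if n \<le> m then alt n M1 M2 v0 else alt (2 * m - n) M2 M1 v0)" for w
  have val_wA: "val (wA n) = alt n M1 M2 v0" if "n \<le> m" for n
    using that m_pos the_inv_into_f_f[OF inj_wA, of n] by (simp add: val_def)
  have val_wB: "val (wB n) = alt n M2 M1 v0" if "n \<le> m" for n
  proof (cases "n = 0 \<or> n = m")
    case True
    then show ?thesis
    proof
      assume "n = m"
      then show ?thesis using val_wA[of m] br by (simp add: wA_m)
    qed (use val_wA[of 0] in simp)
  next
    case False
    then have "\<not> 2 * m - n \<le> m" using that by linarith
    then show ?thesis
      using False that the_inv_into_f_f[OF inj_wA, of "2 * m - n"] by (simp add: val_def wB_eq_wA Let_def)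
  qed
  define v where "v h = (\<Sum>w\<in>carrier W. sc (coef h w) (val w))" for h
  have add: "v (h \<oplus>\<^bsub>H\<^esub> h') = v h + v h'" if "h \<in> carrier H" "h' \<in> carrier H" for h h'
    using that by (simp add: v_def coef_add M1.m1.scale_left_distrib sum.distrib)
  have scale: "v (\<eta> a \<otimes>\<^bsub>H\<^esub> h) = sc a (v h)" if "h \<in> carrier H" for a h
    using that by (simp add: v_def coef_scale M1.m1.scale_sum_right)
  have vT: "v (T w) = val w" if "w \<in> carrier W" for w
  proof -
    have "v (T w) = (\<Sum>w'\<in>carrier W. if w' = w then val w else 0)"
      unfolding v_def using that by (intro sum.cong) (auto simp: coef_T)
    then show ?thesis using that finite_carrier_W by simp
  qed
  have v1: "v (T s1 \<otimes>\<^bsub>H\<^esub> h) = M1 (v h)" if "h \<in> carrier H" for h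
    using that
  proof (induction h rule: H_basis_induct)
    case (T w)
    have B: "v (T s1 \<otimes>\<^bsub>H\<^esub> T (wB n)) = M1 (v (T (wB n)))" if "n < m" for n
      using that by (simp add: T_wAB vT val_wA val_wB)
    have A: "v (T s1 \<otimes>\<^bsub>H\<^esub> T (wA n)) = M1 (v (T (wA n)))" if "n \<le> m" for n
    proof (cases n)
      case 0
      then show ?thesis using B[of 0] m_pos by simp
    next
      case (Suc i)
      then have "T s1 \<otimes>\<^bsub>H\<^esub> T (wA n) = (T s1 \<otimes>\<^bsub>H\<^esub> T s1) \<otimes>\<^bsub>H\<^esub> T (wB i)"
        using that by (simp add: T_wAB(1)[symmetric] H.m_assoc s1_closed)
      also have "\<dots> = \<eta> (u_pow 1 - u_pow (-1)) \<otimes>\<^bsub>H\<^esub> T (wA n) \<oplus>\<^bsub>H\<^esub> T (wB i)"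
        using that Suc by (simp add: T_square H.l_distr H.m_assoc T_wAB(1) s1_closed)
      finally show ?thesis
        using that Suc by (simp add: add scale vT val_wA val_wB sq1)
    qed
    from T show ?case
    proof (cases rule: carrier_cases)
      case (1 n)
      then show ?thesis using A[of n] by simp
    next
      case (2 n)
      then show ?thesis using B[of n] by simp
    qed
  next
    case (scale a h)
    have "T s1 \<otimes>\<^bsub>H\<^esub> (\<eta> a \<otimes>\<^bsub>H\<^esub> h) = \<eta> a \<otimes>\<^bsub>H\<^esub> (T s1 \<otimes>\<^bsub>H\<^esub> h)"
      using scale(1) by (simp add: eta_central s1_closed flip: H.m_assoc)
    then show ?case using scale by (simp add: \<open>\<And>h a. h \<in> carrier H \<Longrightarrow> v (\<eta> a \<otimes>\<^bsub>H\<^esub> h) = sc a (v h)\<close> M1.scale s1_closed)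
  qed (simp add: add H.r_distr M1.add s1_closed)
  have v2: "v (T s2 \<otimes>\<^bsub>H\<^esub> h) = M2 (v h)" if "h \<in> carrier H" for h
    using that
  proof (induction h rule: H_basis_induct)
    case (T w)
    have A: "v (T s2 \<otimes>\<^bsub>H\<^esub> T (wA n)) = M2 (v (T (wA n)))" if "n < m" for n
      using that by (simp add: T_wAB vT val_wA val_wB)
    have B: "v (T s2 \<otimes>\<^bsub>H\<^esub> T (wB n)) = M2 (v (T (wB n)))" if "n \<le> m" for n
    proof (cases n)
      case 0
      then show ?thesis using A[of 0] m_pos by simp
    next
      case (Suc i)
      then have "T s2 \<otimes>\<^bsub>H\<^esub> T (wB n) = (T s2 \<otimes>\<^bsub>H\<^esub> T s2) \<otimes>\<^bsub>H\<^esub> T (wA i)"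
        using that by (simp add: T_wAB(2)[symmetric] H.m_assoc s2_closed)
      also have "\<dots> = \<eta> (u_pow 1 - u_pow (-1)) \<otimes>\<^bsub>H\<^esub> T (wB n) \<oplus>\<^bsub>H\<^esub> T (wA i)"
        using that Suc by (simp add: T_square H.l_distr H.m_assoc T_wAB(2) s2_closed)
      finally show ?thesis
        using that Suc by (simp add: add scale vT val_wA val_wB sq2)
    qed
    from T show ?case
    proof (cases rule: carrier_cases)
      case (1 n)
      then show ?thesis using A[of n] B[of m] by (cases "n = m") (simp_all add: wA_m)
    next
      case (2 n)
      then show ?thesis using B[of n] by simp
    qed
  next
    case (scale a h)
    have "T s2 \<otimes>\<^bsub>H\<^esub> (\<eta> a \<otimes>\<^bsub>H\<^esub> h) = \<eta> a \<otimes>\<^bsub>H\<^esub> (T s2 \<otimes>\<^bsub>H\<^esub> h)"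
      using scale(1) by (simp add: eta_central s2_closed flip: H.m_assoc)
    then show ?case using scale by (simp add: \<open>\<And>h a. h \<in> carrier H \<Longrightarrow> v (\<eta> a \<otimes>\<^bsub>H\<^esub> h) = sc a (v h)\<close> M2.scale s2_closed)
  qed (simp add: add H.r_distr M2.add s2_closed)
  have "v \<one>\<^bsub>H\<^esub> = v0"
    using vT[of \<one>] val_wA[of 0] by (simp add: T_one)
  with add scale v1 v2 show ?thesis by (intro that[of v]) simp_all
qed

end

section \<open>Multiplicative independence in multiquadratic extensions\<close>

text \<open>Subfields are plain subsets of one field type, so that a chain of extensions stays
  inside that type. Closure under \<open>inverse\<close> may include 0, as
  \<open>inverse 0 = 0\<close>.\<close>

definition subfld :: "'e::field set \<Rightarrow> bool" where
  "subfld F \<longleftrightarrow> 1 \<in> F \<and> (\<forall>x\<in>F. \<forall>y\<in>F. x - y \<in> F \<and> x * y \<in> F) \<and> (\<forall>x\<in>F. inverse x \<in> F)"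

lemma subfldD:
  assumes "subfld F"
  shows "1 \<in> F" "0 \<in> F" "x \<in> F \<Longrightarrow> - x \<in> F" "x \<in> F \<Longrightarrow> inverse x \<in> F"
    "x \<in> F \<Longrightarrow> y \<in> F \<Longrightarrow> x + y \<in> F" "x \<in> F \<Longrightarrow> y \<in> F \<Longrightarrow> x - y \<in> F"
    "x \<in> F \<Longrightarrow> y \<in> F \<Longrightarrow> x * y \<in> F" "x \<in> F \<Longrightarrow> y \<in> F \<Longrightarrow> x / y \<in> F"
    "x \<in> F \<Longrightarrow> x ^ i \<in> F"
proof -
  show 1: "1 \<in> F" and diff: "\<And>x y. x \<in> F \<Longrightarrow> y \<in> F \<Longrightarrow> x - y \<in> F"
    and mult: "\<And>x y. x \<in> F \<Longrightarrow> y \<in> F \<Longrightarrow> x * y \<in> F" and inv: "\<And>x. x \<in> F \<Longrightarrow> inverse x \<in> F"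
    using assms by (auto simp: subfld_def)
  show 0: "0 \<in> F" using diff[OF 1 1] by simp
  show neg: "- x \<in> F" if "x \<in> F" for x using diff[OF 0 that] by simp
  show "x + y \<in> F" if "x \<in> F" "y \<in> F" for x y using diff[OF that(1) neg[OF that(2)]] by simp
  show "x / y \<in> F" if "x \<in> F" "y \<in> F" for x y using mult[OF that(1) inv[OF that(2)]] by (simp add: divide_inverse)
  show "x ^ i \<in> F" if "x \<in> F" for x i using that 1 mult by (induction i) auto
qed

lemma subfld_sum: "subfld F \<Longrightarrow> (\<And>i. i \<in> A \<Longrightarrow> f i \<in> F) \<Longrightarrow> sum f A \<in> F"
  by (induction A rule: infinite_finite_induct) (auto intro: subfldD)

lemma subfld_prod: "subfld F \<Longrightarrow> (\<And>i. i \<in> A \<Longrightarrow> f i \<in> F) \<Longrightarrow> prod f A \<in> F"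
  by (induction A rule: infinite_finite_induct) (auto intro: subfldD)

text \<open>For \<open>s\<^sup>2\<close> in F this is the field F(s).\<close>

definition adjoin :: "'e::field set \<Rightarrow> 'e \<Rightarrow> 'e set" where
  "adjoin F s = {a + b * s | a b. a \<in> F \<and> b \<in> F}"

lemma subset_adjoin: "subfld F \<Longrightarrow> F \<subseteq> adjoin F s"
  unfolding adjoin_def using subfldD(2) by force

lemma adjoin_mem: "subfld F \<Longrightarrow> s \<in> adjoin F s"
  unfolding adjoin_def using subfldD(1,2) by force

lemma subfld_adjoin:
  assumes F: "subfld F" and s: "s\<^sup>2 \<in> F"
  shows "subfld (adjoin F s)"
proof (cases "s \<in> F")
  case True
  then have "adjoin F s = F"
    using subset_adjoin[OF F, of s] F by (auto simp: adjoin_def intro: subfldD)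
  then show ?thesis using F by simp
next
  case False
  note D = subfldD[OF F]
  have I: "a + b * s \<in> adjoin F s" if "a \<in> F" "b \<in> F" for a b
    using that by (auto simp: adjoin_def)
  show ?thesis
    unfolding subfld_def
  proof (intro conjI ballI)
    show "1 \<in> adjoin F s" using subset_adjoin[OF F] D(1) by blast
    fix x y assume "x \<in> adjoin F s" "y \<in> adjoin F s"
    then obtain a b c d where abcd: "a \<in> F" "b \<in> F" "c \<in> F" "d \<in> F" "x = a + b * s" "y = c + d * s"
      by (auto simp: adjoin_def)
    have "x - y = (a - c) + (b - d) * s" "x * y = (a * c + b * d * s\<^sup>2) + (a * d + b * c) * s"
      by (simp_all add: abcd algebra_simps power2_eq_square)
    then show "x - y \<in> adjoin F s" "x * y \<in> adjoin F s"
      using abcd(1-4) s by (simp_all only:) (auto intro!: I D)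
  next
    fix x assume "x \<in> adjoin F s"
    then obtain a b where ab: "a \<in> F" "b \<in> F" "x = a + b * s"
      by (auto simp: adjoin_def)
    show "inverse x \<in> adjoin F s"
    proof (cases "x = 0")
      case True
      then show ?thesis using subset_adjoin[OF F] D(2) by auto
    next
      case x: False
      have "a - b * s \<noteq> 0"
      proof
        assume "a - b * s = 0"
        moreover have "b = 0" if "a = b * s"
        proof (rule ccontr)
          assume "b \<noteq> 0"
          then have "s = a / b" using that by simp
          then show False using False D(8)[OF ab(1,2)] by simp
        qed
        ultimately show False using x ab by auto
      qed
      then have "(a + b * s) * (a - b * s) \<noteq> 0" using x ab by simp
      also have "(a + b * s) * (a - b * s) = a\<^sup>2 - b\<^sup>2 * s\<^sup>2"
        by (simp add: algebra_simps power2_eq_square)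
      finally have nz: "a\<^sup>2 - b\<^sup>2 * s\<^sup>2 \<noteq> 0" .
      \<comment> \<open>Rationalising with the conjugate: N is the norm of x, nonzero because x is
        nonzero and s lies outside F.\<close>
      define N where "N = a\<^sup>2 - b\<^sup>2 * s\<^sup>2"
      have "x * (a - b * s) = N"
        by (simp add: N_def ab algebra_simps power2_eq_square)
      then have "inverse x = a / N + (- b / N) * s"
        using nz x by (simp add: N_def[symmetric] field_simps)
      moreover have "a / N + (- b / N) * s \<in> adjoin F s"
        unfolding N_def by (intro I D(3,6,7,8) ab(1,2) s D(9)[OF ab(1)] D(9)[OF ab(2)])
      ultimately show ?thesis by simp
    qed
  qed
qed

text \<open>For squares \<open>(s i)\<^sup>2\<close> in F this is their independence modulo squares
  of F, Kummer's condition for the square roots to generate an extension of full degree.\<close>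

definition sqrt_indep :: "'e::field set \<Rightarrow> ('i \<Rightarrow> 'e) \<Rightarrow> 'i set \<Rightarrow> bool" where
  "sqrt_indep F s J \<longleftrightarrow> (\<forall>I\<subseteq>J. I \<noteq> {} \<longrightarrow> (\<forall>x\<in>F. x\<^sup>2 \<noteq> (\<Prod>i\<in>I. (s i)\<^sup>2)))"

text \<open>If (a + b s_j)^2 lies in F, then 2ab = 0, since otherwise s_j would lie in F. The case b
  = 0 contradicts independence for I itself; a = 0 contradicts it for I with j added, the square
  root being b s_j^2.\<close>

lemma sqrt_indep_adjoin:
  assumes F: "subfld F" and two: "(2::'e::field) \<noteq> 0" and fin: "finite J"
    and s: "\<And>i. i \<in> insert j J \<Longrightarrow> (s i :: 'e)\<^sup>2 \<in> F" and j: "j \<notin> J"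
    and indep: "sqrt_indep F s (insert j J)"
  shows "sqrt_indep (adjoin F (s j)) s J"
  unfolding sqrt_indep_def
proof (intro allI impI ballI notI)
  fix I x assume I: "I \<subseteq> J" "I \<noteq> {}" and x: "x \<in> adjoin F (s j)" and eq: "x\<^sup>2 = (\<Prod>i\<in>I. (s i)\<^sup>2)"
  obtain a b where ab: "a \<in> F" "b \<in> F" "x = a + b * s j"
    using x by (auto simp: adjoin_def)
  note D = subfldD[OF F]
  define d where "d = (\<Prod>i\<in>I. (s i)\<^sup>2)"
  have d: "d \<in> F" using I s by (auto simp: d_def intro!: subfld_prod F)
  have sj: "s j \<notin> F"
  proof
    assume "s j \<in> F"
    then show False using indep unfolding sqrt_indep_def by (auto dest!: spec[of _ "{j}"])
  qed
  have *: "d = (a\<^sup>2 + b\<^sup>2 * (s j)\<^sup>2) + 2 * a * b * s j"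
    using eq by (simp add: d_def ab power2_eq_square algebra_simps)
  have twoF: "2 \<in> F" using D(5)[OF D(1) D(1)] by simp
  have "2 * a * b = 0"
  proof (rule ccontr)
    assume nz: "2 * a * b \<noteq> 0"
    then have "s j = (d - (a\<^sup>2 + b\<^sup>2 * (s j)\<^sup>2)) / (2 * a * b)"
      using * by (simp add: field_simps)
    also have "\<dots> \<in> F" using ab d s[of j] twoF by (auto intro!: D)
    finally show False using sj by simp
  qed
  then consider "a = 0" | "b = 0" using two by auto
  then show False
  proof cases
    case 1
    have fI: "finite I" "j \<notin> I" using I fin j finite_subset by auto
    have "(b * (s j)\<^sup>2)\<^sup>2 = (\<Prod>i\<in>insert j I. (s i)\<^sup>2)"
      using * 1 fI by (simp add: d_def power2_eq_square algebra_simps)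
    moreover have "b * (s j)\<^sup>2 \<in> F" using ab s[of j] by (auto intro!: D)
    ultimately show False using indep I unfolding sqrt_indep_def
      by (metis insert_mono insert_not_empty)
  next
    case 2
    then have "a\<^sup>2 = (\<Prod>i\<in>I. (s i)\<^sup>2)" using * by (simp add: d_def)
    then show False using indep I ab(1) unfolding sqrt_indep_def by blast
  qed
qed

text \<open>Adjoining the roots from J one at a time preserves independence, so \<open>s j\<close>
  stays outside the field obtained. Over that field the conjugation s_j -> -s_j fixes all the other
  roots.\<close>

lemma sqrt_indep_extend:
  assumes "finite J" "subfld F" "(2::'e::field) \<noteq> 0" "j \<notin> J"
    "\<And>i. i \<in> insert j J \<Longrightarrow> (s i :: 'e)\<^sup>2 \<in> F" "sqrt_indep F s (insert j J)"
  shows "\<exists>F'. subfld F' \<and> F \<subseteq> F' \<and> s ` J \<subseteq> F' \<and> s j \<notin> F'"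
  using assms
proof (induction J arbitrary: F rule: finite_induct)
  case empty
  have "s j \<notin> F"
  proof
    assume "s j \<in> F"
    then show False using empty unfolding sqrt_indep_def by (auto dest!: spec[of _ "{j}"])
  qed
  then show ?case using empty by blast
next
  case (insert k J)
  let ?F = "adjoin F (s k)"
  have sub: "F \<subseteq> ?F" by (rule subset_adjoin) fact
  have "sqrt_indep ?F s (insert j J)"
    by (rule sqrt_indep_adjoin) (use insert in \<open>auto simp: insert_commute\<close>)
  moreover have "subfld ?F" using insert by (intro subfld_adjoin) auto
  ultimately have "\<exists>F'. subfld F' \<and> ?F \<subseteq> F' \<and> s ` J \<subseteq> F' \<and> s j \<notin> F'"
    using insert sub by (intro insert.IH) auto
  then show ?case using sub adjoin_mem[OF insert.prems(1)] by blast
qed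

text \<open>Conjugation A + B s -> A - B s respects products. Comparing powers is all that is needed
  later, so no automorphism has to be constructed.\<close>

lemma conj_power:
  assumes F: "subfld F" and AB: "A \<in> F" "B \<in> F" "(s::'e::field)\<^sup>2 \<in> F"
  shows "\<exists>P\<in>F. \<exists>Q\<in>F. (A + B * s) ^ k = P + Q * s \<and> (A - B * s) ^ k = P - Q * s"
proof (induction k)
  case 0
  then show ?case using subfldD(1,2)[OF F] by force
next
  case (Suc k)
  then obtain P Q where PQ: "P \<in> F" "Q \<in> F" "(A + B * s) ^ k = P + Q * s" "(A - B * s) ^ k = P - Q * s"
    by blast
  have "A * P + B * Q * s\<^sup>2 \<in> F" "A * Q + B * P \<in> F" using AB PQ by (auto intro!: subfldD[OF F])
  moreover have "(A + B * s) ^ Suc k = (A * P + B * Q * s\<^sup>2) + (A * Q + B * P) * s"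
    "(A - B * s) ^ Suc k = (A * P + B * Q * s\<^sup>2) - (A * Q + B * P) * s"
    unfolding power_Suc PQ by (simp_all add: algebra_simps power2_eq_square)
  ultimately show ?case by blast
qed

definition polys_over :: "'e::field set \<Rightarrow> 'e poly set" where
  "polys_over F = {p. \<forall>i. poly.coeff p i \<in> F}"

lemma polys_over_closed:
  assumes F: "subfld F"
  shows "1 \<in> polys_over F" "0 \<in> polys_over F"
    "p \<in> polys_over F \<Longrightarrow> q \<in> polys_over F \<Longrightarrow> p + q \<in> polys_over F"
    "p \<in> polys_over F \<Longrightarrow> q \<in> polys_over F \<Longrightarrow> p - q \<in> polys_over F"
    "p \<in> polys_over F \<Longrightarrow> q \<in> polys_over F \<Longrightarrow> p * q \<in> polys_over F"
    "p \<in> polys_over F \<Longrightarrow> p ^ k \<in> polys_over F"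
    "a \<in> F \<Longrightarrow> b \<in> F \<Longrightarrow> [:a, b:] \<in> polys_over F"
    "(\<And>i. i \<in> I \<Longrightarrow> g i \<in> polys_over F) \<Longrightarrow> prod g I \<in> polys_over F"
proof -
  note D = subfldD[OF F]
  show one: "1 \<in> polys_over F" and "0 \<in> polys_over F"
    using D by (auto simp: polys_over_def coeff_1)
  show "p + q \<in> polys_over F" "p - q \<in> polys_over F" if "p \<in> polys_over F" "q \<in> polys_over F" for p q
    using that D by (auto simp: polys_over_def)
  show mult: "p * q \<in> polys_over F" if "p \<in> polys_over F" "q \<in> polys_over F" for p q
    using that by (auto simp: polys_over_def coeff_mult intro!: subfld_sum[OF F] D(7))
  show "p ^ k \<in> polys_over F" if "p \<in> polys_over F" for p k
    using that one mult by (induction k) auto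
  show "[:a, b:] \<in> polys_over F" if "a \<in> F" "b \<in> F" for a b
    using that D by (auto simp: polys_over_def coeff_pCons split: nat.split)
  show "prod g I \<in> polys_over F" if "\<And>i. i \<in> I \<Longrightarrow> g i \<in> polys_over F" for I and g :: "'z \<Rightarrow> _"
    using that by (induction I rule: infinite_finite_induct) (auto intro: one mult)
qed

text \<open>A vanishing denominator only contributes the value 0, so it is not excluded.\<close>

definition rational_functions :: "'e::field set \<Rightarrow> 'e \<Rightarrow> 'e set" where
  "rational_functions F t = {poly p t / poly q t | p q. p \<in> polys_over F \<and> q \<in> polys_over F}"

lemma subfld_rational_functions:
  assumes F: "subfld F"
  shows "subfld (rational_functions F t)" "F \<subseteq> rational_functions F t" "t \<in> rational_functions F t"
proof -
  note P = polys_over_closed[OF F]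
  have I: "poly p t / poly q t \<in> rational_functions F t" if "p \<in> polys_over F" "q \<in> polys_over F" for p q
    using that by (auto simp: rational_functions_def)
  show "subfld (rational_functions F t)"
    unfolding subfld_def
  proof (intro conjI ballI)
    show "1 \<in> rational_functions F t" using I[OF P(1) P(1)] by simp
    fix x y assume "x \<in> rational_functions F t" "y \<in> rational_functions F t"
    then obtain p q p' q' where pq: "p \<in> polys_over F" "q \<in> polys_over F" "p' \<in> polys_over F" "q' \<in> polys_over F"
        "x = poly p t / poly q t" "y = poly p' t / poly q' t"
      by (auto simp: rational_functions_def)
    show "x * y \<in> rational_functions F t"
      using I[of "p * p'" "q * q'"] pq P by simp
    show "x - y \<in> rational_functions F t"
    proof (cases "poly q t = 0 \<or> poly q' t = 0")
      case True
      then show ?thesis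
        using I[of p q] I[of "0 - p'" q'] P(4)[OF P(2), of p'] pq by auto
    next
      case False
      then have "x - y = poly (p * q' - p' * q) t / poly (q * q') t"
        by (simp add: pq field_simps)
      then show ?thesis using I[of "p * q' - p' * q" "q * q'"] pq P by simp
    qed
  next
    fix x assume "x \<in> rational_functions F t"
    then show "inverse x \<in> rational_functions F t"
      using I by (auto simp: rational_functions_def)
  qed
  have *: "poly p t \<in> rational_functions F t" if "p \<in> polys_over F" for p
    using I[OF that P(1)] by simp
  show "F \<subseteq> rational_functions F t"
    using *[OF P(7)[OF _ subfldD(2)[OF F]]] by auto
  show "t \<in> rational_functions F t"
    using *[of "[:0, 1:]"] P subfldD[OF F] by auto
qed

text \<open>The order of vanishing at one of the \<open>w i\<close> is odd for the product and even for a square.\<close>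

lemma sqrt_indep_rational_functions:
  assumes F: "subfld F" and trans: "\<And>p. p \<in> polys_over F \<Longrightarrow> poly p t = 0 \<Longrightarrow> p = 0"
    and fin: "finite J" and w: "w ` J \<subseteq> F" and inj: "inj_on w J"
    and s: "\<And>i. i \<in> J \<Longrightarrow> (s i)\<^sup>2 = t - w i"
  shows "sqrt_indep (rational_functions F t) s J"
  unfolding sqrt_indep_def
proof (intro allI impI ballI notI)
  fix I x assume I: "I \<subseteq> J" "I \<noteq> {}" and x: "x \<in> rational_functions F t" and eq: "x\<^sup>2 = (\<Prod>i\<in>I. (s i)\<^sup>2)"
  note P = polys_over_closed[OF F]
  obtain p q where pq: "p \<in> polys_over F" "q \<in> polys_over F" "x = poly p t / poly q t"
    using x by (auto simp: rational_functions_def)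
  have fI: "finite I" using I fin finite_subset by auto
  define g where "g = (\<Prod>i\<in>I. [:- w i, 1:])"
  have g: "g \<in> polys_over F"
    using I w subfldD[OF F] unfolding g_def by (auto intro!: P)
  have gt: "poly g t = (\<Prod>i\<in>I. (s i)\<^sup>2)"
    using I s unfolding g_def poly_prod by (intro prod.cong) auto
  have g0: "g \<noteq> 0" using fI by (simp add: g_def)
  have "x \<noteq> 0"
  proof
    assume "x = 0"
    then have "poly g t = 0" using gt eq by simp
    then show False using trans[OF g] g0 by simp
  qed
  then have nz: "poly q t \<noteq> 0" "poly p t \<noteq> 0" using pq by auto
  have "p\<^sup>2 - g * q\<^sup>2 = 0"
  proof (rule trans)
    show "p\<^sup>2 - g * q\<^sup>2 \<in> polys_over F" using pq g by (auto intro!: P)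
    show "poly (p\<^sup>2 - g * q\<^sup>2) t = 0"
      using eq gt nz by (simp add: pq power_divide field_simps)
  qed
  then have eq': "p\<^sup>2 = g * q\<^sup>2" by simp
  obtain i where i: "i \<in> I" using I by auto
  have pq0: "p \<noteq> 0" "q \<noteq> 0" using nz by auto
  have gi: "g = [:- w i, 1:] * (\<Prod>j\<in>I - {i}. [:- w j, 1:])"
    unfolding g_def using fI i by (simp add: prod.remove)
  have "poly (\<Prod>j\<in>I - {i}. [:- w j, 1:]) (w i) \<noteq> 0"
    using fI inj I i by (auto simp: poly_prod inj_on_def)
  \<comment> \<open>The \<open>w i\<close> are distinct, so exactly one linear factor of
    \<open>g\<close> vanishes at this point. Orders may be compared because \<open>eq'\<close> is an
    identity of polynomials, by the transcendence of \<open>t\<close>.\<close>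
  then have "Polynomial.order (w i) g = 1"
    using g0 unfolding gi by (subst order_mult) (auto simp: order_0I order_power_n_n[of _ 1, simplified])
  moreover have "Polynomial.order (w i) (p\<^sup>2) = 2 * Polynomial.order (w i) p"
    "Polynomial.order (w i) (g * q\<^sup>2) = Polynomial.order (w i) g + 2 * Polynomial.order (w i) q"
    using pq0 g0 by (simp_all add: order_mult power2_eq_square)
  ultimately have "2 * Polynomial.order (w i) p = 1 + 2 * Polynomial.order (w i) q"
    using eq' by simp
  then show False by presburger
qed

text \<open>
  The nontrivial automorphism over the field generated by the other square roots inverts one
  factor of the product and fixes all the others.
\<close>

lemma multiplicative_independence:
  fixes s r w :: "'i \<Rightarrow> 'e::field" and k :: "'i \<Rightarrow> int"
  assumes F: "subfld F" and trans: "\<And>p. p \<in> polys_over F \<Longrightarrow> poly p t = 0 \<Longrightarrow> p = 0"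
    and closed: "\<And>x p. p \<in> polys_over F \<Longrightarrow> p \<noteq> 0 \<Longrightarrow> poly p x = 0 \<Longrightarrow> x \<in> F"
    and two: "(2::'e) \<noteq> 0"
    and fin: "finite J" and r: "r ` J \<subseteq> F" and w: "\<And>i. i \<in> J \<Longrightarrow> w i = (r i)\<^sup>2" and inj: "inj_on w J"
    and w0: "\<And>i. i \<in> J \<Longrightarrow> w i \<noteq> 0"
    and s: "\<And>i. i \<in> J \<Longrightarrow> (s i)\<^sup>2 = t - w i" and ii: "ii\<^sup>2 = - 1"
    and la: "\<And>i. i \<in> J \<Longrightarrow> la i = (r i + ii * s i)\<^sup>2 / t"
    and eq: "(\<Prod>i\<in>J. la i powi k i) = e" and e: "e \<in> F" and j: "j \<in> J"
  shows "k j = 0"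
proof (rule ccontr)
  assume kj: "k j \<noteq> 0"
  note D = subfldD[OF F] and P = polys_over_closed[OF F]
  have iF: "ii \<in> F"
  proof (rule closed)
    show "[:0, 1:] * [:0, 1:] + 1 \<in> polys_over F" by (intro P(1,3,5,7) D(1,2))
    show "[:0, 1:] * [:0, 1:] + 1 \<noteq> (0 :: 'e poly)" by (auto simp: one_pCons)
    show "poly ([:0, 1:] * [:0, 1:] + 1) ii = 0" using ii by (simp add: power2_eq_square)
  qed
  have wF: "w ` J \<subseteq> F" using w r D by auto
  have tF: "t \<notin> F"
  proof
    assume "t \<in> F"
    then have "[:- t, 1:] \<in> polys_over F" using D by (auto intro!: P)
    from trans[OF this] show False by simp
  qed
  then have t0: "t \<noteq> 0" using D by auto
  let ?R = "rational_functions F t"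
  note R = subfld_rational_functions[OF F, of t]
  have ind: "sqrt_indep ?R s J"
    using s by (intro sqrt_indep_rational_functions[OF F trans fin wF inj]) auto
  have sR: "(s i)\<^sup>2 \<in> ?R" if "i \<in> J" for i
    using s[OF that] R wF that subfldD(6)[OF R(1)] by auto
  obtain F' where F': "subfld F'" "?R \<subseteq> F'" "s ` (J - {j}) \<subseteq> F'" "s j \<notin> F'"
    using sqrt_indep_extend[of "J - {j}" ?R j s] fin R(1) two sR ind j by (auto simp: insert_absorb)
  note D' = subfldD[OF F'(1)]
  have FF': "F \<subseteq> F'" using R F' by auto
  have tF': "t \<in> F'" using R F' by auto
  \<comment> \<open>With t = r^2 + s^2 the number la = (r + i s)^2 / t is cos 2\<theta> + i sin
    2\<theta>, and its conjugate in s is its inverse.\<close>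
  have expand: "la i = ((r i)\<^sup>2 - (s i)\<^sup>2) / t + (2 * ii * r i / t) * s i"
    "1 = (((r i)\<^sup>2 - (s i)\<^sup>2) / t + (2 * ii * r i / t) * s i) * (((r i)\<^sup>2 - (s i)\<^sup>2) / t - (2 * ii * r i / t) * s i)" if "i \<in> J" for i
  proof -
    have t: "t = (r i)\<^sup>2 + (s i)\<^sup>2" using s[OF that] w[OF that] by simp
    show "la i = ((r i)\<^sup>2 - (s i)\<^sup>2) / t + (2 * ii * r i / t) * s i"
      unfolding la[OF that] using t0 ii by (simp add: field_simps power2_sum power_mult_distrib)
    have "((r i)\<^sup>2 - (s i)\<^sup>2)\<^sup>2 - (2 * ii * r i * s i)\<^sup>2 = t\<^sup>2"
      unfolding t by (simp add: power_mult_distrib ii) (simp add: power2_eq_square algebra_simps)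
    moreover have "(x / t + c / t * y) * (x / t - c / t * y) = (x\<^sup>2 - (c * y)\<^sup>2) / t\<^sup>2" for x c y
      by (simp add: power2_eq_square algebra_simps diff_divide_distrib)
    ultimately show "1 = (((r i)\<^sup>2 - (s i)\<^sup>2) / t + (2 * ii * r i / t) * s i) * (((r i)\<^sup>2 - (s i)\<^sup>2) / t - (2 * ii * r i / t) * s i)"
      using t0 by simp
  qed
  define A where "A = ((r j)\<^sup>2 - (s j)\<^sup>2) / t"
  define B where "B = 2 * ii * r j / t"
  have lj: "la j = A + B * s j" and AB1: "(A + B * s j) * (A - B * s j) = 1"
    using expand[OF j] by (simp_all add: A_def B_def)
  have two': "2 \<in> F'" using D'(5)[OF D'(1) D'(1)] by simp
  have m: "r j \<in> F'" "(r j)\<^sup>2 \<in> F'" "(s j)\<^sup>2 \<in> F'" "ii \<in> F'"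
    using sR[OF j] F'(2) r j FF' iF by (auto intro: D')
  then have AB: "A \<in> F'" "B \<in> F'" "(s j)\<^sup>2 \<in> F'"
    unfolding A_def B_def by (intro D'(6,7,8) m tF' two' | assumption)+
  have lF': "la i \<in> F'" if "i \<in> J - {j}" for i
  proof -
    have "r i \<in> F'" "s i \<in> F'" using that r F' FF' by auto
    then show ?thesis using la[of i] that iF FF' tF' by (auto intro!: D')
  qed
  have powiF': "x powi l \<in> F'" if "x \<in> F'" for x l
    using that by (auto simp: power_int_def intro!: D')
  define C where "C = (\<Prod>i\<in>J - {j}. la i powi k i)"
  have C: "C \<in> F'" unfolding C_def by (intro subfld_prod F' powiF' lF')
  have l0: "la i \<noteq> 0" if "i \<in> J" for i
    using expand[OF that] by auto
  have C0: "C \<noteq> 0" using fin l0 by (simp add: C_def)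
  have "la j powi k j = e / C"
    using eq C0 fin j by (simp add: C_def prod.remove field_simps)
  then have powF: "la j powi k j \<in> F'" using e FF' C by (auto intro!: D')
  define N where "N = nat \<bar>k j\<bar>"
  have N: "N > 0" using kj by (simp add: N_def)
  have "la j ^ N = la j powi k j \<or> la j ^ N = inverse (la j powi k j)"
    using l0[OF j] unfolding N_def by (auto simp: power_int_def power_inverse abs_if)
  then have lN: "la j ^ N \<in> F'" using powF D'(4)[OF powF] by auto
  obtain p q where pq: "p \<in> F'" "q \<in> F'" "(A + B * s j) ^ N = p + q * s j" "(A - B * s j) ^ N = p - q * s j"
    using conj_power[OF F'(1) AB, of N] by blast
  \<comment> \<open>A power of \<open>la j\<close> that lies in \<open>F'\<close> has no component
    along \<open>s j\<close>, so it equals its conjugate. The conjugate is its inverse, hence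
    \<open>la j\<close> is a root of unity.\<close>
  have "q = 0"
  proof (rule ccontr)
    assume "q \<noteq> 0"
    then have "s j = (la j ^ N - p) / q" using pq lj by simp
    moreover have "(la j ^ N - p) / q \<in> F'" by (intro D'(6,8) lN pq(1,2))
    ultimately show False using F'(4) by simp
  qed
  then have "(A + B * s j) ^ N * (A + B * s j) ^ N = (A + B * s j) ^ N * (A - B * s j) ^ N"
    using pq by simp
  also have "\<dots> = 1" by (simp add: AB1 flip: power_mult_distrib)
  finally have root: "la j ^ (2 * N) = 1"
    by (simp add: lj mult_2 power_add)
  \<comment> \<open>A root of unity is a root of a polynomial over \<open>F\<close>, hence an
    element of \<open>F\<close>. Then t = 4 w_j / (la_j + 1/la_j + 2) would also lie in
    \<open>F\<close>, contrary to \<open>tF\<close>.\<close>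
  have "la j \<in> F"
  proof (rule closed)
    show "[:0, 1:] ^ (2 * N) - 1 \<in> polys_over F" by (intro P(1,4,6,7) D(1,2))
    have "poly ([:0, 1:] ^ (2 * N) - 1) 0 \<noteq> (0 :: 'e)" using N by (simp add: poly_power zero_power)
    then show "[:0, 1:] ^ (2 * N) - 1 \<noteq> (0 :: 'e poly)" by (metis poly_0)
    show "poly ([:0, 1:] ^ (2 * N) - 1) (la j) = 0" using root by (simp add: poly_power)
  qed
  have "(4::'e) = 2 * 2" by simp
  then have "(4::'e) \<noteq> 0" using two by (metis mult_eq_0_iff)
  then have four: "4 * w j \<noteq> 0" using w0[OF j] by simp
  have "inverse (la j) = A - B * s j"
    using AB1 lj by (metis inverse_unique)
  then have "la j + inverse (la j) + 2 = 2 * A + 2" by (simp add: lj)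
  also have "\<dots> = 4 * w j / t"
    unfolding A_def s[OF j] w[OF j] using t0 by (simp add: field_simps)
  finally have eq_t: "la j + inverse (la j) + 2 = 4 * w j / t" .
  define g where "g = la j + inverse (la j) + 2"
  have "g \<noteq> 0" "g * t = 4 * w j" using eq_t four t0 by (simp_all add: g_def)
  then have "t = 4 * w j / g" by (simp add: eq_divide_eq mult.commute)
  moreover have "4 \<in> F" "2 \<in> F" using D(5)[OF D(1) D(1)] D(7)[of 2 2] by simp_all
  ultimately have "t \<in> F" using \<open>la j \<in> F\<close> wF j by (auto simp: g_def intro!: D)
  then show False using tF by simp
qed

section \<open>Elements algebraic over a subfield, and the field of constants\<close>

lemma ring_of_type_simps [simp]:
  "carrier ring_of_type_algebra = UNIV" "x \<otimes>\<^bsub>ring_of_type_algebra\<^esub> y = x * y"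
  "\<one>\<^bsub>ring_of_type_algebra\<^esub> = 1" "\<zero>\<^bsub>ring_of_type_algebra\<^esub> = 0"
  "x \<oplus>\<^bsub>ring_of_type_algebra\<^esub> y = x + y"
  by (simp_all add: ring_of_type_algebra_def)

context
  fixes R :: "'e::field ring"
  defines "R \<equiv> ring_of_type_algebra"
begin

interpretation R: field R
  unfolding R_def by (rule field_from_type_algebra)

lemma R_simps: "carrier R = UNIV" "x \<otimes>\<^bsub>R\<^esub> y = x * y" "\<one>\<^bsub>R\<^esub> = 1" "\<zero>\<^bsub>R\<^esub> = 0" "x \<oplus>\<^bsub>R\<^esub> y = x + y"
  by (simp_all add: R_def)

lemma R_uminus: "\<ominus>\<^bsub>R\<^esub> x = - x"
  by (rule R.minus_equality) (simp_all add: R_simps)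

lemma R_inv: "x \<noteq> 0 \<Longrightarrow> inv\<^bsub>R\<^esub> x = inverse x"
  by (rule R.comm_inv_char) (simp_all add: R_simps)

lemma R_pow: "x [^]\<^bsub>R\<^esub> (n::nat) = x ^ n"
  by (induction n) (simp_all add: R_simps mult.commute)

text \<open>Coefficient lists of the locale-based polynomials begin with the leading coefficient,
  hence the reversal.\<close>

lemma eval_R: "R.eval xs x = poly (Poly (rev xs)) x"
  by (induction xs) (simp_all add: R_simps R_pow Poly_append poly_monom)

lemma subfield_R: "subfield F R \<longleftrightarrow> subfld F"
proof
  assume sub: "subfield F R"
  note E = subringE[OF subfieldE(1)[OF sub]]
  have "inverse x \<in> F" if "x \<in> F" for x
    using R.subfield_m_inv(1)[OF sub, of x] that E(2)
    by (cases "x = 0") (auto simp: R_simps R_inv)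
  then show "subfld F"
    using E(3,5-7) unfolding subfld_def
    by (auto simp: R_simps R_uminus diff_conv_add_uminus simp del: add_uminus_conv_diff)
next
  assume F: "subfld F"
  note D = subfldD[OF F]
  show "subfield F R"
    by (rule R.subfieldI'[OF R.subringI])
      (auto simp: R_simps R_uminus R_inv intro: D)
qed

lemma algebraic_R:
  assumes F: "subfld F"
  shows "(R.algebraic over F) x \<longleftrightarrow> (\<exists>p\<in>polys_over F. p \<noteq> 0 \<and> poly p x = 0)"
proof
  have sub: "subring F R" using F subfield_R subfieldE(1) by blast
  assume "(R.algebraic over F) x"
  then obtain p where p: "p \<in> carrier (F[X]\<^bsub>R\<^esub>)" "p \<noteq> []" "R.eval p x = \<zero>\<^bsub>R\<^esub>"
    using R.algebraicE[OF sub] by (auto simp: R_simps)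
  have pF: "set p \<subseteq> F" "hd p \<noteq> 0"
    using p by (auto simp: univ_poly_def polynomial_def R_simps)
  have "Poly (rev p) \<noteq> 0"
  proof
    assume "Poly (rev p) = 0"
    then have "poly.coeff (Poly (rev p)) (length p - 1) = 0" by simp
    then show False using p(2) pF(2) by (simp add: nth_default_def rev_nth hd_conv_nth)
  qed
  moreover have "Poly (rev p) \<in> polys_over F"
    using pF subfldD(2)[OF F] by (auto simp: polys_over_def nth_default_def rev_nth)
  ultimately show "\<exists>p\<in>polys_over F. p \<noteq> 0 \<and> poly p x = 0"
    using p(3) by (auto simp: eval_R R_simps)
next
  assume "\<exists>p\<in>polys_over F. p \<noteq> 0 \<and> poly p x = 0"
  then obtain p where p: "p \<in> polys_over F" "p \<noteq> 0" "poly p x = 0" by blast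
  show "(R.algebraic over F) x"
  proof (rule R.algebraicI)
    have "set (coeffs p) \<subseteq> F"
      using p(1) by (auto simp: polys_over_def coeffs_def)
    then show "rev (coeffs p) \<in> carrier (F[X]\<^bsub>R\<^esub>)"
      using p(2) by (auto simp: univ_poly_def polynomial_def R_simps hd_rev last_coeffs_eq_coeff_degree)
    show "rev (coeffs p) \<noteq> []" using p(2) by simp
    show "R.eval (rev (coeffs p)) x = \<zero>\<^bsub>R\<^esub>" using p(3) by (simp add: eval_R R_simps)
  qed
qed

text \<open>The coefficients of p generate a finite extension of F, and x is finite over that
  extension; so x lies in a ring of finite dimension over F.\<close>

lemma algebraic_trans:
  assumes F: "subfld F" and p: "p \<in> polys_over {x. (R.algebraic over F) x}" "p \<noteq> 0" "poly p x = 0"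
  shows "(R.algebraic over F) x"
proof -
  define xs where "xs = coeffs p"
  have F': "subfield F R" using F subfield_R by blast
  have alg: "\<And>y. y \<in> set xs \<Longrightarrow> (R.algebraic over F) y"
    using p(1) by (auto simp: xs_def polys_over_def coeffs_def split: if_splits)
  have xs: "set xs \<subseteq> carrier R" "set (x # xs) \<subseteq> carrier R" by (simp_all add: R_simps)
  let ?L = "R.finite_extension F xs"
  have L: "subfield ?L R" by (rule R.finite_extension_is_subfield[OF F' xs(1) alg])
  have fL: "R.finite_dimension F ?L" by (rule R.finite_extension_finite_dimension(1)[OF F' xs(1) alg])
  have "set xs \<subseteq> ?L" by (rule R.finite_extension_mem[OF subfieldE(1)[OF F'] xs(1)])
  then have "p \<in> polys_over ?L"
    using forall_coeffs_conv[of "\<lambda>c. c \<in> ?L" p] subfldD(2)[of ?L] L subfield_R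
    unfolding polys_over_def xs_def by blast
  then have "(R.algebraic over ?L) x"
    using p algebraic_R[of ?L] L subfield_R by blast
  then have "R.finite_dimension ?L (R.simple_extension ?L x)"
    using R.finite_dimension_simple_extension[OF L] by (simp add: R_simps)
  then have "R.finite_dimension F (R.simple_extension ?L x)"
    using R.telescopic_base_dim(1)[OF F' L fL] by blast
  moreover have "subring (R.simple_extension ?L x) R"
    by (rule R.simple_extension_is_subring[OF subfieldE(1)[OF L]]) (simp add: R_simps)
  moreover have "x \<in> R.simple_extension ?L x"
    by (rule R.simple_extension_mem[OF subfieldE(1)[OF L]]) (simp add: R_simps)
  ultimately show ?thesis
    using R.finite_dimension_imp_algebraic[OF F'] by blast
qed

lemma subfld_algebraics: "subfld F \<Longrightarrow> subfld {x. (R.algebraic over F) x}"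
  using R.subfield_of_algebraics[of F] by (simp add: subfield_R R_simps)

end

text \<open>Constant polynomials are included, so this forces characteristic zero.\<close>

definition transcendental_over_int :: "'e::field \<Rightarrow> bool" where
  "transcendental_over_int t \<longleftrightarrow>
     (\<forall>p :: int poly. (\<Sum>i\<le>Polynomial.degree p. of_int (poly.coeff p i) * t ^ i) = 0 \<longrightarrow> p = 0)"

lemma of_int_eq_0:
  assumes "transcendental_over_int (t::'e::field)" "of_int a = (0::'e)"
  shows "a = 0"
  using assms unfolding transcendental_over_int_def by (auto dest!: spec[of _ "[:a:]"])

text \<open>The prime field, here a copy of the rationals, because \<open>of_int_eq_0\<close>
  excludes positive characteristic.\<close>

lemma subfld_fractions:
  assumes t: "transcendental_over_int (t::'e::field)"
  shows "subfld {of_int a / of_int b :: 'e | a b. b \<noteq> 0 \<and> (of_int b :: 'e) \<noteq> 0}" (is "subfld ?F")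
  unfolding subfld_def
proof (intro conjI ballI)
  note nz = of_int_eq_0[OF t]
  show "1 \<in> ?F" by (auto intro!: exI[of _ 1])
  fix x y assume "x \<in> ?F" "y \<in> ?F"
  then obtain a b c d where *: "b \<noteq> 0" "(of_int b :: 'e) \<noteq> 0" "d \<noteq> 0" "(of_int d :: 'e) \<noteq> 0"
      "x = of_int a / of_int b" "y = of_int c / of_int d" by auto
  have I: "of_int a / of_int b \<in> ?F" if "b \<noteq> 0" "(of_int b :: 'e) \<noteq> 0" for a b
    using that by blast
  have "x - y = of_int (a * d - c * b) / of_int (b * d)"
    using *(2,4) by (simp add: *(5,6) diff_frac_eq)
  moreover have "of_int (a * d - c * b) / of_int (b * d) \<in> ?F"
    using *(1-4) by (intro I) simp_all
  ultimately show "x - y \<in> ?F" by simp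
  have "x * y = of_int (a * c) / of_int (b * d)"
    by (simp add: *(5,6))
  moreover have "of_int (a * c) / of_int (b * d) \<in> ?F"
    using *(1-4) by (intro I) simp_all
  ultimately show "x * y \<in> ?F" by simp
next
  note nz = of_int_eq_0[OF t]
  fix x assume "x \<in> ?F"
  then obtain a b where *: "b \<noteq> 0" "(of_int b :: 'e) \<noteq> 0" "x = of_int a / of_int b" by auto
  show "inverse x \<in> ?F"
  proof (cases "a = 0")
    case True
    then have "inverse x = of_int 0 / of_int 1" using * by simp
    then show ?thesis by (intro CollectI exI[of _ 0] exI[of _ 1]) simp
  next
    case False
    then have "(of_int a :: 'e) \<noteq> 0" using nz by blast
    then show ?thesis using * False by (intro CollectI exI[of _ b] exI[of _ a]) simp
  qed
qed

lemma clear_denominators: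
  fixes p :: "'e::field poly"
  assumes "p \<in> polys_over {of_int a / of_int b :: 'e | a b. b \<noteq> 0 \<and> (of_int b :: 'e) \<noteq> 0}"
  shows "\<exists>D q. (of_int D :: 'e) \<noteq> 0 \<and> Polynomial.smult (of_int D) p = map_poly of_int q"
  using assms
proof (induction p)
  case 0
  then show ?case by (intro exI[of _ 1] exI[of _ 0]) auto
next
  case (pCons c p)
  have "poly.coeff (pCons c p) 0 \<in> {of_int a / of_int b :: 'e | a b. b \<noteq> 0 \<and> (of_int b :: 'e) \<noteq> 0}"
    using pCons.prems unfolding polys_over_def by blast
  then obtain a b where ab: "b \<noteq> 0" "(of_int b :: 'e) \<noteq> 0" "c = of_int a / of_int b" by auto
  have "poly.coeff (pCons c p) (Suc i) \<in> {of_int a / of_int b :: 'e | a b. b \<noteq> 0 \<and> (of_int b :: 'e) \<noteq> 0}" for i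
    using pCons.prems unfolding polys_over_def by blast
  then have "p \<in> polys_over {of_int a / of_int b :: 'e | a b. b \<noteq> 0 \<and> (of_int b :: 'e) \<noteq> 0}"
    unfolding polys_over_def by simp
  from pCons.IH[OF this] obtain D q where Dq: "(of_int D :: 'e) \<noteq> 0" "Polynomial.smult (of_int D) p = map_poly of_int q"
    by blast
  have "Polynomial.smult (of_int (D * b)) (pCons c p) =
      pCons (of_int (D * a)) (Polynomial.smult (of_int b) (Polynomial.smult (of_int D) p))"
    using ab by (simp add: mult_ac)
  also have "\<dots> = map_poly of_int (pCons (D * a) (Polynomial.smult b q))"
    by (intro poly_eqI) (auto simp: Dq coeff_map_poly coeff_pCons split: nat.split)
  finally show ?case using Dq(1) ab by (intro exI[of _ "D * b"]) auto
qed

text \<open>F consists of the elements algebraic over the prime field. Transitivity makes it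
  algebraically closed in the ambient field, and a polynomial over the fractions that kills t would
  turn into an integer polynomial after clearing denominators.\<close>

lemma exists_field_of_constants:
  assumes t: "transcendental_over_int (t::'e::field)"
  shows "\<exists>F. subfld F \<and> t \<notin> F \<and> (\<forall>x p. p \<in> polys_over F \<longrightarrow> p \<noteq> 0 \<longrightarrow> poly p x = 0 \<longrightarrow> x \<in> F)"
proof -
  let ?Q = "{of_int a / of_int b :: 'e | a b. b \<noteq> 0 \<and> (of_int b :: 'e) \<noteq> 0}"
  let ?F = "{x. (ring.algebraic ring_of_type_algebra over ?Q) x}"
  note Q = subfld_fractions[OF t]
  have "t \<notin> ?F"
  proof
    assume "t \<in> ?F"
    then obtain p where p: "p \<in> polys_over ?Q" "p \<noteq> 0" "poly p t = 0"
      using algebraic_R[OF Q] by blast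
    obtain D q where Dq: "(of_int D :: 'e) \<noteq> 0" "Polynomial.smult (of_int D) p = map_poly of_int q"
      using clear_denominators[OF p(1)] by blast
    have deg: "Polynomial.degree (map_poly of_int q :: 'e poly) = Polynomial.degree q"
      using of_int_eq_0[OF t, of "Polynomial.lead_coeff q"]
      by (cases "q = 0") (auto intro!: map_poly_degree_eq)
    have "(\<Sum>i\<le>Polynomial.degree q. of_int (poly.coeff q i) * t ^ i) = poly (map_poly of_int q) t"
      by (simp add: poly_altdef deg coeff_map_poly)
    also have "\<dots> = 0" using p(3) by (simp flip: Dq(2))
    finally have "q = 0" using t unfolding transcendental_over_int_def by blast
    then show False using Dq p(2) by simp
  qed
  moreover have "x \<in> ?F" if "p \<in> polys_over ?F" "p \<noteq> 0" "poly p x = 0" for x p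
    using algebraic_trans[OF Q that] by simp
  ultimately show ?thesis using subfld_algebraics[OF Q] by blast
qed

section \<open>The exponentials of the angles and their independence\<close>

context splitting_field
begin

lemma iota_simps [simp]:
  "\<iota> 0 = 0" "\<iota> 1 = 1" "\<iota> (x + y) = \<iota> x + \<iota> y" "\<iota> (x * y) = \<iota> x * \<iota> y"
proof -
  show add: "\<iota> (x + y) = \<iota> x + \<iota> y" for x y using ring_hom_add[OF iota_hom] by simp
  show "\<iota> 1 = 1" "\<iota> (x * y) = \<iota> x * \<iota> y"
    using ring_hom_one[OF iota_hom] ring_hom_mult[OF iota_hom] by simp_all
  show "\<iota> 0 = 0" using add[of 0 0] by (metis add_cancel_left_left add_0)
qed

lemma phi_simps [simp]:
  "\<phi> 0 = 0" "\<phi> 1 = 1" "\<phi> (a + b) = \<phi> a + \<phi> b" "\<phi> (a * b) = \<phi> a * \<phi> b"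
  "\<phi> (- a) = - \<phi> a" "\<phi> (a - b) = \<phi> a - \<phi> b"
proof -
  show add: "\<phi> (x + y) = \<phi> x + \<phi> y" for x y using ring_hom_add[OF phi_hom] by simp
  show "\<phi> 1 = 1" "\<phi> (a * b) = \<phi> a * \<phi> b"
    using ring_hom_one[OF phi_hom] ring_hom_mult[OF phi_hom] by simp_all
  show 0: "\<phi> 0 = 0" using add[of 0 0] by (metis add_cancel_left_left add_0)
  show neg: "\<phi> (- a) = - \<phi> a" for a using add[of a "- a"] 0 by (simp add: eq_neg_iff_add_eq_0 add.commute)
  show "\<phi> (a - b) = \<phi> a - \<phi> b" using add[of a "- b"] neg by simp
qed

lemma phi_eq_0 [simp]: "\<phi> a = 0 \<longleftrightarrow> a = 0"
  using phi_inj phi_simps(1) by (metis injD)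

text \<open>The closure is taken over \<open>'l\<close> because \<zeta> need not lie in K; it also
  supplies the imaginary unit.\<close>

definition emb :: "'k \<Rightarrow> 'l alg_closure" where "emb x = to_ac (\<iota> x)"

lemma emb_simps [simp]:
  "emb 0 = 0" "emb 1 = 1" "emb (x + y) = emb x + emb y" "emb (x * y) = emb x * emb y"
  "emb (- x) = - emb x" "emb (x - y) = emb x - emb y" "emb (inverse x) = inverse (emb x)"
  "emb (x / y) = emb x / emb y" "emb (x ^ i) = emb x ^ i" "emb x = 0 \<longleftrightarrow> x = 0"
  "emb x = emb y \<longleftrightarrow> x = y" "emb (sum f A) = (\<Sum>a\<in>A. emb (f a))" "emb (prod f A) = (\<Prod>a\<in>A. emb (f a))"
proof -
  show 0: "emb 0 = 0" and 1: "emb 1 = 1" and add: "emb (x + y) = emb x + emb y"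
    and mult: "emb (x * y) = emb x * emb y" for x y
    by (simp_all add: emb_def)
  show neg: "emb (- x) = - emb x" for x
    using add[of x "- x"] 0 by (simp add: eq_neg_iff_add_eq_0 add.commute)
  show diff: "emb (x - y) = emb x - emb y" for x y using add[of x "- y"] neg by simp
  show inv: "emb (inverse x) = inverse (emb x)" for x
  proof (cases "x = 0")
    case False
    then have "emb x * emb (inverse x) = 1" by (simp flip: mult add: 1)
    then show ?thesis by (simp add: inverse_unique)
  qed (simp add: 0)
  show "emb (x / y) = emb x / emb y" using mult inv by (simp add: divide_inverse)
  show "emb (x ^ i) = emb x ^ i" by (induction i) (simp_all add: 1 mult)
  show eq0: "emb x = 0 \<longleftrightarrow> x = 0" for x
  proof
    assume "emb x = 0"
    then show "x = 0" using mult[of x "inverse x"] 1 by (cases "x = 0") auto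
  qed (simp add: 0)
  show "emb x = emb y \<longleftrightarrow> x = y" using eq0[of "x - y"] diff by simp
  show "emb (sum f A) = (\<Sum>a\<in>A. emb (f a))" "emb (prod f A) = (\<Prod>a\<in>A. emb (f a))"
    by (induction A rule: infinite_finite_induct) (simp_all add: 0 1 add mult)
qed

text \<open>The powers of u are distinct basis elements of the Laurent ring, and both \<phi> and the
  embedding into the closure are injective. Constant polynomials are covered, so characteristic zero
  comes out here.\<close>

lemma transcendental_u: "transcendental_over_int (emb (\<phi> (u_pow 1)))"
  unfolding transcendental_over_int_def
proof (intro allI impI)
  fix p :: "int poly"
  define u where "u = emb (\<phi> (u_pow 1))"
  have pow: "u_pow 1 ^ i = u_pow (int i)" for i
    by (induction i) (simp_all add: u_pow_def mult_single flip: single_one)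
  have phi_pow: "\<phi> (a ^ i) = \<phi> a ^ i" for a i by (induction i) simp_all
  have phi_sum: "\<phi> (sum f A) = (\<Sum>a\<in>A. \<phi> (f a))" for f and A :: "nat set"
    by (induction A rule: infinite_finite_induct) simp_all
  have int: "emb (\<phi> (Poly_Mapping.single 0 c)) = of_int c" for c
  proof (induction c rule: int_induct[where k = 0])
    case base
    then show ?case by simp
  next
    case (step1 i)
    then show ?case by (simp add: single_add)
  next
    case (step2 i)
    then show ?case by (simp add: single_diff)
  qed
  have *: "emb (\<phi> (Poly_Mapping.single (int i) c)) = of_int c * u ^ i" for i c
  proof -
    have "Poly_Mapping.single (int i) c = Poly_Mapping.single 0 c * u_pow 1 ^ i"
      unfolding pow by (simp add: u_pow_def mult_single)
    then show ?thesis by (simp add: int phi_pow u_def)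
  qed
  assume "(\<Sum>i\<le>Polynomial.degree p. of_int (poly.coeff p i) * emb (\<phi> (u_pow 1)) ^ i) = 0"
  then have "emb (\<phi> (\<Sum>i\<le>Polynomial.degree p. Poly_Mapping.single (int i) (poly.coeff p i))) = 0"
    by (simp add: phi_sum * u_def[symmetric])
  then have 0: "(\<Sum>i\<le>Polynomial.degree p. Poly_Mapping.single (int i) (poly.coeff p i)) = 0"
    by (simp del: phi_simps)
  have "poly.coeff p (Polynomial.degree p) =
      Poly_Mapping.lookup (\<Sum>i\<le>Polynomial.degree p. Poly_Mapping.single (int i) (poly.coeff p i)) (int (Polynomial.degree p))"
    by (simp add: lookup_sum lookup_single when_def sum.delta')
  then show "p = 0" using 0 by simp
qed

lemma of_int_E_eq_0: "of_int a = (0 :: 'l alg_closure) \<Longrightarrow> a = 0"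
  by (rule of_int_eq_0[OF transcendental_u])

lemma two_four_E: "(2 :: 'l alg_closure) \<noteq> 0" "(4 :: 'l alg_closure) \<noteq> 0"
  using of_int_E_eq_0[of 2] of_int_E_eq_0[of 4] by auto

abbreviation bE :: "'l alg_closure" where "bE \<equiv> emb (\<phi> quantum_two)"

lemma bE_nonzero: "bE \<noteq> 0"
proof -
  have "Poly_Mapping.lookup quantum_two 1 = 1"
    by (simp add: quantum_two_def u_pow_def lookup_add lookup_single)
  then show ?thesis by auto
qed

definition imag :: "'l alg_closure" where "imag = (SOME i. i\<^sup>2 = - 1)"

lemma imag: "imag\<^sup>2 = - 1"
proof -
  have "\<exists>i. i\<^sup>2 = (- 1 :: 'l alg_closure)" by (rule nth_root_exists) simp
  from someI_ex[OF this] show ?thesis by (simp only: imag_def)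
qed

text \<open>This is exp(i \<theta>_j) for the angle with cosine \<surd>w_j / [2] and sine \<surd>(f
  - w_j) / [2]. The weights \<open>lam\<close> use twice the angle, the Chebyshev values the angle
  itself.\<close>

definition zz :: "nat \<Rightarrow> 'l alg_closure" where "zz i = (emb (sw i) + imag * emb (sf i)) / bE"

definition lam :: "nat \<Rightarrow> 'l alg_closure" where "lam i = (zz i)\<^sup>2"

lemma sf_E: "i \<in> {1..n} \<Longrightarrow> (emb (sf i))\<^sup>2 = bE\<^sup>2 - (emb (sw i))\<^sup>2"
proof -
  assume "i \<in> {1..n}"
  then have "emb ((sf i)\<^sup>2) = emb (\<phi> (quantum_two\<^sup>2) - (sw i)\<^sup>2)" by (simp only: sf)
  then show ?thesis by (simp add: power2_eq_square)
qed

lemma sw_E: "i \<in> {1..n} \<Longrightarrow> (emb (sw i))\<^sup>2 = to_ac (w_val \<zeta> i)"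
proof -
  assume "i \<in> {1..n}"
  then have "to_ac (\<iota> ((sw i)\<^sup>2)) = to_ac (w_val \<zeta> i)" by (simp only: sw)
  then show ?thesis by (simp add: emb_def power2_eq_square)
qed

lemma zz_norm: "i \<in> {1..n} \<Longrightarrow> zz i * ((emb (sw i) - imag * emb (sf i)) / bE) = 1"
proof -
  assume i: "i \<in> {1..n}"
  have "(emb (sw i) + imag * emb (sf i)) * (emb (sw i) - imag * emb (sf i)) =
      (emb (sw i))\<^sup>2 - imag\<^sup>2 * (emb (sf i))\<^sup>2"
    by (simp add: algebra_simps power2_eq_square)
  also have "\<dots> = bE\<^sup>2" using sf_E[OF i] imag by simp
  finally show ?thesis
    using bE_nonzero by (simp add: zz_def power2_eq_square)
qed

lemma zz_nonzero: "i \<in> {1..n} \<Longrightarrow> zz i \<noteq> 0"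
  using zz_norm by fastforce

lemma inverse_zz: "i \<in> {1..n} \<Longrightarrow> inverse (zz i) = (emb (sw i) - imag * emb (sf i)) / bE"
  by (rule inverse_unique) (rule zz_norm)

text \<open>lam + 1/lam + 2 is the square of 2 cos \<theta>_j. Since w_j = 2 + \<zeta>^j +
  \<zeta>^(-j), this is later the trace condition for the braid relation.\<close>

lemma lam_sum: "i \<in> {1..n} \<Longrightarrow> bE\<^sup>2 * (lam i + inverse (lam i) + 2) = 4 * to_ac (w_val \<zeta> i)"
proof -
  assume i: "i \<in> {1..n}"
  have "lam i + inverse (lam i) + 2 = (zz i + inverse (zz i))\<^sup>2"
    using zz_nonzero[OF i] by (simp add: lam_def power2_sum power_inverse)
  also have "zz i + inverse (zz i) = 2 * emb (sw i) / bE"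
    unfolding inverse_zz[OF i] by (simp add: zz_def flip: add_divide_distrib)
  finally show ?thesis
    using bE_nonzero sw_E[OF i] by (simp add: power_divide power_mult_distrib)
qed

context
  assumes m_ge_2: "m \<ge> 2" and n_def: "n = half_index m"
begin

lemma two_n_less: "2 * n < m"
  using m_ge_2 n_def by (auto simp: half_index_def elim!: evenE oddE)

lemma zeta_power: "\<zeta> ^ m = 1" "0 < d \<Longrightarrow> d < m \<Longrightarrow> \<zeta> ^ d \<noteq> 1" "\<zeta> \<noteq> 0"
proof -
  show 1: "\<zeta> ^ m = 1" and "0 < d \<Longrightarrow> d < m \<Longrightarrow> \<zeta> ^ d \<noteq> 1"
    using zeta by (auto simp: primitive_root_def)
  show "\<zeta> \<noteq> 0" using 1 m_ge_2 by (auto simp: power_0_left)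
qed

text \<open>x + 1/x determines x up to inversion, and inversion is impossible for powers i and l
  with 0 < i + l < m.\<close>

lemma inj_w_val: "inj_on (w_val \<zeta>) {1..n}"
proof (rule inj_onI)
  fix i l assume il: "i \<in> {1..n}" "l \<in> {1..n}" and eq: "w_val \<zeta> i = w_val \<zeta> l"
  define x y where "x = \<zeta> ^ i" and "y = \<zeta> ^ l"
  have nz: "x \<noteq> 0" "y \<noteq> 0" using zeta_power(3) by (auto simp: x_def y_def)
  have "x + inverse x = y + inverse y" using eq by (simp add: w_val_def x_def y_def add.assoc)
  then have "x * x * y + y = y * y * x + x" using nz by (simp add: field_simps)
  then have "(x - y) * (x * y - 1) = 0" by (simp add: algebra_simps)
  moreover have "x * y \<noteq> 1"
    using zeta_power(2)[of "i + l"] il two_n_less by (simp add: x_def y_def power_add)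
  ultimately have xy: "x = y" by simp
  have *: "i = l" if "i \<le> l" "i \<in> {1..n}" "l \<in> {1..n}" "\<zeta> ^ i = \<zeta> ^ l" for i l
  proof (rule ccontr)
    assume "i \<noteq> l"
    have "\<zeta> ^ l = \<zeta> ^ i * \<zeta> ^ (l - i)" 
      by (metis le_add_diff_inverse power_add that(1))
    then have "\<zeta> ^ (l - i) = 1" using that zeta_power(3) by simp
    moreover have "0 < l - i" "l - i < m" using that \<open>i \<noteq> l\<close> two_n_less by simp_all
    ultimately show False using zeta_power(2) by blast
  qed
  show "i = l"
    using *[of i l] *[of l i] il xy by (cases "i \<le> l") (auto simp: x_def y_def)
qed

text \<open>2 + x + 1/x = (1 + x)^2 / x vanishes only at x = -1, which would give \<zeta>^(2i) = 1
  with 0 < 2i < m.\<close>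

lemma w_val_nonzero: "i \<in> {1..n} \<Longrightarrow> w_val \<zeta> i \<noteq> 0"
proof
  assume i: "i \<in> {1..n}" and "w_val \<zeta> i = 0"
  define x where "x = \<zeta> ^ i"
  have nz: "x \<noteq> 0" using zeta_power(3) by (auto simp: x_def)
  have "2 + x + inverse x = 0" using \<open>w_val \<zeta> i = 0\<close> by (simp add: w_val_def x_def)
  then have "(2 + x + inverse x) * x = 0" by simp
  then have "(x + 1) * (x + 1) = 0" using nz by (simp add: algebra_simps)
  then have "x = - 1" by (simp add: eq_neg_iff_add_eq_0)
  then have "\<zeta> ^ (2 * i) = 1" by (simp add: x_def mult_2 power_add)
  then show False using zeta_power(2)[of "2 * i"] i two_n_less by auto
qed

text \<open>Instance of \<open>multiplicative_independence\<close> with t = f = [2]^2 over the field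
  of constants. That field contains \<zeta>, all w_j and their square roots, as these are algebraic
  over the rationals, whereas f is transcendental over it.\<close>

lemma lam_independent:
  assumes eq: "(\<Prod>i\<in>{1..n}. lam i powi k i) = e" and e: "e \<in> {1, - 1}" and i: "i \<in> {1..n}"
  shows "k i = 0"
proof -
  define u where "u = emb (\<phi> (u_pow 1))"
  have bu: "bE * u = u\<^sup>2 + 1"
  proof -
    have "quantum_two * u_pow 1 = u_pow 1 * u_pow 1 + (1 :: laurent)"
      by (simp add: quantum_two_def u_pow_def distrib_right mult_single flip: single_one)
    then have "emb (\<phi> (quantum_two * u_pow 1)) = emb (\<phi> (u_pow 1 * u_pow 1 + 1))" by (simp only:)
    then show ?thesis by (simp add: u_def power2_eq_square)
  qed
  obtain F where F: "subfld F" "u \<notin> F"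
    and cl: "\<And>x p. p \<in> polys_over F \<Longrightarrow> p \<noteq> 0 \<Longrightarrow> poly p x = 0 \<Longrightarrow> x \<in> F"
    using exists_field_of_constants[OF transcendental_u] unfolding u_def by blast
  note D = subfldD[OF F(1)] and P = polys_over_closed[OF F(1)]
  have sqrtF: "x \<in> F" if "x\<^sup>2 \<in> F" for x
  proof (rule cl)
    have "[:0, 1:] * [:0, 1:] - [:x\<^sup>2, 0:] \<in> polys_over F" by (intro P(4,5,7) D(1,2) that)
    then show "[:- (x\<^sup>2), 0, 1:] \<in> polys_over F" by simp
  qed (auto simp: power2_eq_square)
  have z: "to_ac \<zeta> \<in> F"
  proof (rule cl)
    show "[:0, 1:] ^ m - 1 \<in> polys_over F" by (intro P(1,4,6,7) D(1,2))
    have "poly ([:0, 1:] ^ m - 1) 0 \<noteq> (0 :: 'l alg_closure)"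
      using m_ge_2 by (simp add: poly_power zero_power)
    then show "[:0, 1:] ^ m - 1 \<noteq> (0 :: 'l alg_closure poly)" by (metis poly_0)
    show "poly ([:0, 1:] ^ m - 1) (to_ac \<zeta>) = 0"
      using zeta_power(1) by (simp add: poly_power flip: to_ac_power)
  qed
  have wF: "to_ac (w_val \<zeta> i) \<in> F" for i
    using z D(5)[OF D(1) D(1)] by (auto simp: w_val_def intro!: D)
  have trans: "p = 0" if "p \<in> polys_over F" "poly p (bE\<^sup>2) = 0" for p
  proof (rule ccontr)
    assume "p \<noteq> 0"
    then have b: "bE\<^sup>2 \<in> F" using cl that by blast
    \<comment> \<open>Since [2] u = u^2 + 1, u is a root of (X^2 + 1)^2 - [2]^2 X^2; were [2]^2 a
      constant, u would be one as well. The constant term 1 shows that the polynomial is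
      nonzero.\<close>
    define g where "g = ([:0, 1:] * [:0, 1:] + 1) ^ 2 - [:bE\<^sup>2, 0:] * ([:0, 1:] * [:0, 1:])"
    have "g \<in> polys_over F" unfolding g_def by (intro P(1,3-7) D(1,2) b)
    moreover have "g \<noteq> 0"
    proof
      assume "g = 0"
      then have "poly g 0 = 0" by simp
      then show False by (simp add: g_def)
    qed
    moreover have "poly g u = 0"
    proof -
      have "poly g u = (u\<^sup>2 + 1)\<^sup>2 - bE\<^sup>2 * u\<^sup>2" by (simp add: g_def power2_eq_square)
      also have "\<dots> = 0" unfolding bu[symmetric] by (simp add: power_mult_distrib)
      finally show ?thesis .
    qed
    ultimately show False using cl F(2) by blast
  qed
  have rF: "(\<lambda>i. emb (sw i)) ` {1..n} \<subseteq> F"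
  proof
    fix x assume "x \<in> (\<lambda>i. emb (sw i)) ` {1..n}"
    then obtain i where "i \<in> {1..n}" "x = emb (sw i)" by blast
    then have "x\<^sup>2 \<in> F" using wF[of i] sw_E[of i] by simp
    then show "x \<in> F" by (rule sqrtF)
  qed
  have inj: "inj_on (\<lambda>i. to_ac (w_val \<zeta> i)) {1..n}"
    using inj_w_val unfolding inj_on_def to_ac_eq_iff .
  have eF: "e \<in> F" using e D(1) D(3)[OF D(1)] by blast
  show ?thesis
    by (rule multiplicative_independence[where J = "{1..n}" and t = "bE\<^sup>2"
        and r = "\<lambda>i. emb (sw i)" and s = "\<lambda>i. emb (sf i)" and w = "\<lambda>i. to_ac (w_val \<zeta> i)"
        and la = lam and ii = imag and k = k and e = e, OF F(1) trans cl two_four_E(1) _ rF _ inj _ _ imag _ eq eF i])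
      (simp_all add: sw_E sf_E w_val_nonzero lam_def zz_def power_divide)
qed

end

text \<open>exp(2i (k_1 \<theta>_1 + ... + k_n \<theta>_n)), the square of the exponential whose
  cosine and sine parts are the two Chebyshev values.\<close>

definition La :: "(nat \<Rightarrow> int) \<Rightarrow> 'l alg_closure" where "La k = (\<Prod>i\<in>{1..n}. lam i powi k i)"

lemma lam_nonzero: "i \<in> {1..n} \<Longrightarrow> lam i \<noteq> 0"
  using zz_nonzero by (simp add: lam_def)

lemma La_nonzero: "La k \<noteq> 0"
  using lam_nonzero by (simp add: La_def)

text \<open>For \<epsilon> with square -1 the combination c + \<epsilon> s turns the addition
  theorems into products. Taking \<epsilon> = \<open>imag\<close> and \<epsilon> =
  \<open>- imag\<close>, the Chebyshev pair yields Z and its inverse, where Z is the product of the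
  \<open>zz i powi k i\<close>.\<close>

lemma cheb_E:
  "\<exists>Z. Z\<^sup>2 = La k \<and> 2 * emb (a_val \<phi> sw sf n k) = Z + inverse Z \<and>
    2 * imag * emb (a1_val \<phi> sw sf n k) = Z - inverse Z"
proof -
  let ?e = "cheb_point \<phi> sw sf"
  define cx where "cx \<epsilon> a = emb (fst a) + \<epsilon> * emb (snd a)" for \<epsilon> and a :: "'k \<times> 'k"
  have cx_add: "cx \<epsilon> (angle_add a b) = cx \<epsilon> a * cx \<epsilon> b" if "\<epsilon>\<^sup>2 = - 1" for a b \<epsilon>
  proof -
    have e: "\<epsilon> * (\<epsilon> * x) = - x" for x
      using that by (simp add: power2_eq_square flip: mult.assoc)
    show ?thesis by (cases a; cases b) (simp add: cx_def algebra_simps e)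
  qed
  have cx_nat: "cx \<epsilon> (angle_nat l a) = cx \<epsilon> a ^ l" if "\<epsilon>\<^sup>2 = - 1" for a l \<epsilon>
    by (induction l) (simp_all add: cx_add[OF that], simp add: cx_def)
  have cx_int: "cx \<epsilon> (angle_int l a) = cx \<epsilon> a powi l"
    if "\<epsilon>\<^sup>2 = - 1" "cx \<epsilon> a * cx (- \<epsilon>) a = 1" for a l \<epsilon>
  proof -
    have "cx \<epsilon> (fst a, - snd a) = inverse (cx \<epsilon> a)"
      using that(2) by (intro inverse_unique[symmetric]) (simp add: cx_def)
    then show ?thesis
      using cx_nat[OF that(1)] by (auto simp: angle_int_def power_int_def)
  qed
  have pt: "cx imag (?e (ChebX i), ?e (ChebY i)) = zz i"
    "cx (- imag) (?e (ChebX i), ?e (ChebY i)) = inverse (zz i)" if "i \<in> {1..n}" for i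
    unfolding inverse_zz[OF that]
    by (simp_all add: cx_def cheb_point_def zz_def add_divide_distrib diff_divide_distrib)
  have i2: "imag\<^sup>2 = - 1" "(- imag)\<^sup>2 = - 1" using imag by simp_all
  have main: "cx imag (map_prod (peval ?e) (peval ?e) (cheb_pair N k)) = (\<Prod>i\<in>{1..N}. zz i powi k i) \<and>
      cx (- imag) (map_prod (peval ?e) (peval ?e) (cheb_pair N k)) = (\<Prod>i\<in>{1..N}. inverse (zz i) powi k i)"
    if "N \<le> n" for N
    using that
  proof (induction N)
    case 0
    then show ?case by (simp add: cx_def)
  next
    case (Suc N)
    have S: "Suc N \<in> {1..n}" using Suc.prems by simp
    have "zz (Suc N) * inverse (zz (Suc N)) = 1" using zz_nonzero[OF S] by simp
    then show ?case
      using Suc pt[OF S] i2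
      by (simp add: peval_angle_add peval_angle_int cx_add cx_int mult.commute)
  qed
  define Z where "Z = (\<Prod>i\<in>{1..n}. zz i powi k i)"
  have Zi: "(\<Prod>i\<in>{1..n}. inverse (zz i) powi k i) = inverse Z"
    by (simp add: Z_def power_int_inverse flip: prod_inversef)
  have "cx imag (a_val \<phi> sw sf n k, a1_val \<phi> sw sf n k) = Z \<and>
      cx (- imag) (a_val \<phi> sw sf n k, a1_val \<phi> sw sf n k) = inverse Z"
    using main[of n] unfolding Zi Z_def[symmetric]
    by (cases "cheb_pair n k") (simp add: a_val_def a1_val_def chebT_def chebT1_def)
  then have "emb (a_val \<phi> sw sf n k) + imag * emb (a1_val \<phi> sw sf n k) = Z"
    "emb (a_val \<phi> sw sf n k) - imag * emb (a1_val \<phi> sw sf n k) = inverse Z"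
    by (simp_all add: cx_def)
  moreover have "Z\<^sup>2 = La k"
    unfolding Z_def La_def lam_def power2_eq_square
    by (simp add: power_int_mult_distrib prod.distrib)
  ultimately show ?thesis
    by (intro exI[of _ Z]) (auto simp: algebra_simps)
qed

lemma a_val_E: "4 * emb ((a_val \<phi> sw sf n k)\<^sup>2) = 2 + La k + inverse (La k)"
  and a1_val_E: "4 * emb ((a1_val \<phi> sw sf n k)\<^sup>2) = 2 - La k - inverse (La k)"
proof -
  obtain Z where Z: "Z\<^sup>2 = La k" "2 * emb (a_val \<phi> sw sf n k) = Z + inverse Z"
    "2 * imag * emb (a1_val \<phi> sw sf n k) = Z - inverse Z"
    using cheb_E by blast
  have Z0: "Z \<noteq> 0" using Z(1) La_nonzero[of k] by auto
  have "4 * emb ((a_val \<phi> sw sf n k)\<^sup>2) = (2 * emb (a_val \<phi> sw sf n k))\<^sup>2"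
    by (simp add: power2_eq_square)
  also have "\<dots> = 2 + La k + inverse (La k)"
    unfolding Z(2) Z(1)[symmetric] using Z0 by (simp add: power2_sum power_inverse)
  finally show "4 * emb ((a_val \<phi> sw sf n k)\<^sup>2) = 2 + La k + inverse (La k)" .
  have "4 * emb ((a1_val \<phi> sw sf n k)\<^sup>2) = - (imag\<^sup>2) * (4 * (emb (a1_val \<phi> sw sf n k))\<^sup>2)"
    by (simp add: imag)
  also have "\<dots> = - ((2 * imag * emb (a1_val \<phi> sw sf n k))\<^sup>2)"
    by (simp add: power_mult_distrib)
  also have "\<dots> = 2 - La k - inverse (La k)"
    unfolding Z(3) Z(1)[symmetric] using Z0 by (simp add: power2_diff power_inverse)
  finally show "4 * emb ((a1_val \<phi> sw sf n k)\<^sup>2) = 2 - La k - inverse (La k)" .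
qed

end

section \<open>Functionals on tensor powers\<close>

declare One_nat_def [simp del]

text \<open>Adding the expansions of the products of \<alpha> + \<beta> and of \<alpha> - \<beta>
  cancels the terms with an odd number of \<beta> and doubles the others.\<close>

lemma sum_even_signs:
  fixes \<alpha> \<beta> :: "nat \<Rightarrow> 'r::comm_ring_1"
  shows "2 * (\<Sum>a\<in>{a \<in> {1..k} \<rightarrow>\<^sub>E (UNIV::bool set). even (card {i\<in>{1..k}. \<not> a i})}.
      \<Prod>i=1..k. if a i then \<alpha> i else \<beta> i) = (\<Prod>i=1..k. \<alpha> i + \<beta> i) + (\<Prod>i=1..k. \<alpha> i - \<beta> i)"
proof -
  let ?A = "{1..k} \<rightarrow>\<^sub>E (UNIV::bool set)"
  let ?p = "\<lambda>a. \<Prod>i=1..k. if a i then \<alpha> i else \<beta> i"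
  let ?c = "\<lambda>a. card {i\<in>{1..k}. \<not> a i}"
  have fin: "finite ?A" by (intro finite_PiE) auto
  have expand: "(\<Prod>i=1..k. \<alpha> i + \<gamma> i) = (\<Sum>a\<in>?A. \<Prod>i=1..k. if a i then \<alpha> i else \<gamma> i)" for \<gamma> :: "nat \<Rightarrow> 'r"
    using prod_sum_PiE[of "{1..k}" "\<lambda>_. UNIV :: bool set" "\<lambda>i y. if y then \<alpha> i else \<gamma> i"]
    by (simp add: UNIV_bool add.commute)
  have sign: "(\<Prod>i=1..k. if a i then \<alpha> i else - \<beta> i) = (-1) ^ ?c a * ?p a" for a
  proof -
    have "(\<Prod>i=1..k. if a i then \<alpha> i else - \<beta> i) =
        (\<Prod>i=1..k. (if \<not> a i then - 1 else 1) * (if a i then \<alpha> i else \<beta> i))"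
      by (intro prod.cong) auto
    also have "\<dots> = (\<Prod>i=1..k. if \<not> a i then - 1 else 1) * ?p a"
      by (rule prod.distrib)
    also have "(\<Prod>i=1..k. if \<not> a i then - 1 else (1::'r)) = (\<Prod>i\<in>{i\<in>{1..k}. \<not> a i}. - 1)"
      by (rule prod.inter_filter[symmetric]) simp
    finally show ?thesis by simp
  qed
  have "(\<Prod>i=1..k. \<alpha> i + \<beta> i) + (\<Prod>i=1..k. \<alpha> i - \<beta> i) = (\<Sum>a\<in>?A. ?p a + (-1) ^ ?c a * ?p a)"
    using expand[of \<beta>] expand[of "\<lambda>i. - \<beta> i"] by (simp only: sign sum.distrib diff_conv_add_uminus)
  also have "\<dots> = (\<Sum>a\<in>?A. if even (?c a) then 2 * ?p a else 0)"
    by (intro sum.cong refl) simp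
  also have "\<dots> = (\<Sum>a\<in>{a\<in>?A. even (?c a)}. 2 * ?p a)"
    by (rule sum.inter_filter[OF fin, symmetric])
  also have "\<dots> = 2 * (\<Sum>a\<in>{a\<in>?A. even (?c a)}. ?p a)"
    by (rule sum_distrib_left[symmetric])
  finally show ?thesis by simp
qed

section \<open>Pure tensors, scalars and multilinear functionals\<close>

locale tensor_hecke = dihedral_hecke W m s1 s2 H \<eta> T
  for W :: "('w, 'x) monoid_scheme" (structure) and m s1 s2
    and H :: "('h, 'y) ring_scheme" and \<eta> :: "laurent \<Rightarrow> 'h" and T :: "'w \<Rightarrow> 'h" +
  fixes k :: nat
  assumes k_pos: "k \<ge> 1"
begin

abbreviation PM where "PM \<equiv> power_monoid k H"
abbreviation TT where "TT \<equiv> tensor_power \<eta> k H"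

lemma PM_simps [simp]:
  "carrier PM = {1..k} \<rightarrow>\<^sub>E carrier H" "g \<otimes>\<^bsub>PM\<^esub> h = (\<lambda>i\<in>{1..k}. g i \<otimes>\<^bsub>H\<^esub> h i)"
  "\<one>\<^bsub>PM\<^esub> = (\<lambda>i\<in>{1..k}. \<one>\<^bsub>H\<^esub>)"
  by (simp_all add: power_monoid_def product_group_def)

lemma monoid_PM: "monoid PM"
proof (rule monoidI)
  show "x \<otimes>\<^bsub>PM\<^esub> y \<otimes>\<^bsub>PM\<^esub> z = x \<otimes>\<^bsub>PM\<^esub> (y \<otimes>\<^bsub>PM\<^esub> z)"
    if "x \<in> carrier PM" "y \<in> carrier PM" "z \<in> carrier PM" for x y z
    using that by (intro ext) (auto simp: PiE_iff H.m_assoc restrict_def)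
  show "\<one>\<^bsub>PM\<^esub> \<otimes>\<^bsub>PM\<^esub> x = x" "x \<otimes>\<^bsub>PM\<^esub> \<one>\<^bsub>PM\<^esub> = x" if "x \<in> carrier PM" for x
    using that by (auto simp: PiE_iff restrict_def extensional_def intro!: ext)
qed (auto simp: PiE_iff)

definition R3 :: "((nat \<Rightarrow> 'h) \<times> (nat \<Rightarrow> 'h) \<times> (nat \<Rightarrow> 'h)) set" where
  "R3 = {(h(i := x \<oplus>\<^bsub>H\<^esub> y), h(i := x), h(i := y)) | h i x y.
     h \<in> carrier PM \<and> i \<in> {1..k} \<and> x \<in> carrier H \<and> y \<in> carrier H}"

definition R2 :: "((nat \<Rightarrow> 'h) \<times> (nat \<Rightarrow> 'h)) set" where
  "R2 = {(h(i := \<eta> a \<otimes>\<^bsub>H\<^esub> h i), h(j := \<eta> a \<otimes>\<^bsub>H\<^esub> h j)) | a h i j.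
     h \<in> carrier PM \<and> i \<in> {1..k} \<and> j \<in> {1..k}}"

lemma fun_upd_PM: "h \<in> carrier PM \<Longrightarrow> i \<in> {1..k} \<Longrightarrow> x \<in> carrier H \<Longrightarrow> h(i := x) \<in> carrier PM"
  by (auto simp: PiE_iff extensional_def)

lemma PM_nth: "h \<in> carrier PM \<Longrightarrow> i \<in> {1..k} \<Longrightarrow> h i \<in> carrier H"
  by auto

sublocale TP: presented_ring PM R3 R2
proof (intro presented_ring.intro monoid_PM presented_ring_axioms.intro)
  fix a b c assume "(a, b, c) \<in> R3"
  then obtain h i x y where "a = h(i := x \<oplus>\<^bsub>H\<^esub> y)" "b = h(i := x)" "c = h(i := y)"
      "h \<in> carrier PM" "i \<in> {1..k}" "x \<in> carrier H" "y \<in> carrier H"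
    unfolding R3_def by blast
  then show "a \<in> carrier PM \<and> b \<in> carrier PM \<and> c \<in> carrier PM"
    by (simp only: fun_upd_PM H.add.m_closed)
next
  fix a b assume "(a, b) \<in> R2"
  then obtain h i j l where "a = h(i := \<eta> l \<otimes>\<^bsub>H\<^esub> h i)" "b = h(j := \<eta> l \<otimes>\<^bsub>H\<^esub> h j)"
      "h \<in> carrier PM" "i \<in> {1..k}" "j \<in> {1..k}"
    unfolding R2_def by blast
  then show "a \<in> carrier PM \<and> b \<in> carrier PM"
    by (simp only: fun_upd_PM H.m_closed eta_closed PM_nth)
qed

lemma TP_rels: "TP.rels = tensor_power_relations \<eta> k H"
proof -
  have "{frag_of a - frag_of b - frag_of c | a b c. (a, b, c) \<in> R3} =
      {frag_of (h(i := x \<oplus>\<^bsub>H\<^esub> y)) - frag_of (h(i := x)) - frag_of (h(i := y)) | h i x y.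
        h \<in> carrier PM \<and> i \<in> {1..k} \<and> x \<in> carrier H \<and> y \<in> carrier H}"
    unfolding R3_def by blast
  moreover have "{frag_of a - frag_of b | a b. (a, b) \<in> R2} =
      {frag_of (h(i := \<eta> a \<otimes>\<^bsub>H\<^esub> h i)) - frag_of (h(j := \<eta> a \<otimes>\<^bsub>H\<^esub> h j)) | a h i j.
        h \<in> carrier PM \<and> i \<in> {1..k} \<and> j \<in> {1..k}}"
    unfolding R2_def by blast
  ultimately show ?thesis
    unfolding TP.rels_def tensor_power_relations_def by (rule arg_cong2[where f = "(\<union>)"])
qed

lemma TP_Q: "TP.Q = TT"
  by (simp add: TP.Q_def tensor_power_def tensor_power_ideal_def TP_rels)

lemma TP_cl: "TP.cl (restrict h {1..k}) = pure \<eta> k H h"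
  by (simp add: TP.proj_def pure_def tensor_power_ideal_def TP_rels)

lemma cl_eq_pure: "h \<in> carrier PM \<Longrightarrow> TP.cl h = pure \<eta> k H h"
  using TP_cl[of h] by (simp add: PiE_restrict)

sublocale TT: ring TT
  using TP.Q.ring_axioms by (simp add: TP_Q)

abbreviation pur :: "(nat \<Rightarrow> 'h) \<Rightarrow> ((nat \<Rightarrow> 'h) \<Rightarrow>\<^sub>0 int) set" where "pur \<equiv> pure \<eta> k H"

lemma pur_cong: "(\<And>i. i \<in> {1..k} \<Longrightarrow> h i = h' i) \<Longrightarrow> pur h = pur h'"
  unfolding pure_def by (metis restrict_ext)

lemma pur_closed [simp]: "h \<in> {1..k} \<rightarrow> carrier H \<Longrightarrow> pur h \<in> carrier TT"
  using TP.cl_closed[of "restrict h {1..k}"] by (auto simp: TP_cl TP_Q)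

lemma pur_mult:
  assumes "g \<in> {1..k} \<rightarrow> carrier H" "h \<in> {1..k} \<rightarrow> carrier H"
  shows "pur g \<otimes>\<^bsub>TT\<^esub> pur h = pur (\<lambda>i. g i \<otimes>\<^bsub>H\<^esub> h i)"
proof -
  have "TP.cl (restrict g {1..k}) \<otimes>\<^bsub>TP.Q\<^esub> TP.cl (restrict h {1..k}) =
      TP.cl (restrict g {1..k} \<otimes>\<^bsub>PM\<^esub> restrict h {1..k})"
    using assms by (intro TP.cl_mult) auto
  also have "restrict g {1..k} \<otimes>\<^bsub>PM\<^esub> restrict h {1..k} = restrict (\<lambda>i. g i \<otimes>\<^bsub>H\<^esub> h i) {1..k}"
    by auto
  finally show ?thesis by (simp only: TP_cl TP_Q)
qed

lemma pur_one: "pur (\<lambda>_. \<one>\<^bsub>H\<^esub>) = \<one>\<^bsub>TT\<^esub>"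
  using TP.cl_one TP_cl[of "\<lambda>_. \<one>\<^bsub>H\<^esub>"] by (simp add: TP_Q)

lemma pur_add:
  assumes "h \<in> {1..k} \<rightarrow> carrier H" "i \<in> {1..k}" "x \<in> carrier H" "y \<in> carrier H"
  shows "pur (h(i := x \<oplus>\<^bsub>H\<^esub> y)) = pur (h(i := x)) \<oplus>\<^bsub>TT\<^esub> pur (h(i := y))"
proof -
  let ?h = "restrict h {1..k}"
  have h: "?h \<in> carrier PM" using assms by auto
  have up: "pur (?h(i := z)) = pur (h(i := z))" for z
    by (rule pur_cong) auto
  have "(?h(i := x \<oplus>\<^bsub>H\<^esub> y), ?h(i := x), ?h(i := y)) \<in> R3"
    using h assms unfolding R3_def by blast
  from TP.cl_R3[OF this] show ?thesis
    using h assms by (simp only: cl_eq_pure fun_upd_PM H.add.m_closed up TP_Q)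
qed

lemma pur_scale_any:
  assumes "h \<in> {1..k} \<rightarrow> carrier H" "i \<in> {1..k}" "j \<in> {1..k}"
  shows "pur (h(i := \<eta> a \<otimes>\<^bsub>H\<^esub> h i)) = pur (h(j := \<eta> a \<otimes>\<^bsub>H\<^esub> h j))"
proof -
  let ?h = "restrict h {1..k}"
  have h: "?h \<in> carrier PM" using assms by auto
  have up: "pur (?h(i := z)) = pur (h(i := z))" for z i
    by (rule pur_cong) auto
  have "(?h(i := \<eta> a \<otimes>\<^bsub>H\<^esub> ?h i), ?h(j := \<eta> a \<otimes>\<^bsub>H\<^esub> ?h j)) \<in> R2"
    using h assms unfolding R2_def by blast
  from TP.cl_R2[OF this] have "pur (?h(i := \<eta> a \<otimes>\<^bsub>H\<^esub> ?h i)) = pur (?h(j := \<eta> a \<otimes>\<^bsub>H\<^esub> ?h j))"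
    using h assms by (simp only: cl_eq_pure fun_upd_PM H.m_closed eta_closed PM_nth)
  then show ?thesis using assms by (simp add: up)
qed

lemma TT_induct [consumes 1, case_names pur add neg]:
  assumes "x \<in> carrier TT"
    and "\<And>h. h \<in> {1..k} \<rightarrow> carrier H \<Longrightarrow> P (pur h)"
    and "\<And>x y. x \<in> carrier TT \<Longrightarrow> y \<in> carrier TT \<Longrightarrow> P x \<Longrightarrow> P y \<Longrightarrow> P (x \<oplus>\<^bsub>TT\<^esub> y)"
    and "\<And>x. x \<in> carrier TT \<Longrightarrow> P x \<Longrightarrow> P (\<ominus>\<^bsub>TT\<^esub> x)"
  shows "P x"
  using assms(1)[folded TP_Q]
proof (induction x rule: TP.Q_induct)
  case (cl g)
  then have "TP.cl g = pur g" by (rule cl_eq_pure)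
  moreover have "P (pur g)" using cl by (intro assms(2)) auto
  ultimately show ?case by simp
qed (use assms(3,4) TP_Q in auto)

definition additive :: "(((nat \<Rightarrow> 'h) \<Rightarrow>\<^sub>0 int) set \<Rightarrow> 'r::ab_group_add) \<Rightarrow> bool" where
  "additive \<Phi> \<longleftrightarrow> (\<forall>x\<in>carrier TT. \<forall>y\<in>carrier TT. \<Phi> (x \<oplus>\<^bsub>TT\<^esub> y) = \<Phi> x + \<Phi> y)"

lemma additiveD:
  assumes "additive \<Phi>"
  shows "x \<in> carrier TT \<Longrightarrow> y \<in> carrier TT \<Longrightarrow> \<Phi> (x \<oplus>\<^bsub>TT\<^esub> y) = \<Phi> x + \<Phi> y"
    "\<Phi> \<zero>\<^bsub>TT\<^esub> = 0" "x \<in> carrier TT \<Longrightarrow> \<Phi> (\<ominus>\<^bsub>TT\<^esub> x) = - \<Phi> x"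
proof -
  show add: "\<Phi> (x \<oplus>\<^bsub>TT\<^esub> y) = \<Phi> x + \<Phi> y" if "x \<in> carrier TT" "y \<in> carrier TT" for x y
    using assms that by (simp add: additive_def)
  show 0: "\<Phi> \<zero>\<^bsub>TT\<^esub> = 0" using add[of "\<zero>\<^bsub>TT\<^esub>" "\<zero>\<^bsub>TT\<^esub>"] by simp
  show "\<Phi> (\<ominus>\<^bsub>TT\<^esub> x) = - \<Phi> x" if "x \<in> carrier TT" for x
    using add[of x "\<ominus>\<^bsub>TT\<^esub> x"] that 0 by (simp add: TT.r_neg eq_neg_iff_add_eq_0 add.commute)
qed

lemma additive_finsum:
  assumes "additive \<Phi>" "f \<in> A \<rightarrow> carrier TT" "finite A"
  shows "\<Phi> (\<Oplus>\<^bsub>TT\<^esub>a\<in>A. f a) = (\<Sum>a\<in>A. \<Phi> (f a))"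
  using assms(3,2)
  by (induction A rule: finite_induct) (auto simp: additiveD[OF assms(1)] TT.finsum_closed)

text \<open>The values lie in any commutative ring that receives the Laurent scalars through
  \<open>ph\<close>. One notion thus covers coordinates, where \<open>ph\<close> is the identity,
  characters with values in K, and matrix coefficients with values in the closure.\<close>

definition semilinear :: "(laurent \<Rightarrow> 'r::comm_ring_1) \<Rightarrow> ('h \<Rightarrow> 'r) \<Rightarrow> bool" where
  "semilinear ph f \<longleftrightarrow> (\<forall>x\<in>carrier H. \<forall>y\<in>carrier H. f (x \<oplus>\<^bsub>H\<^esub> y) = f x + f y) \<and>
     (\<forall>a. \<forall>x\<in>carrier H. f (\<eta> a \<otimes>\<^bsub>H\<^esub> x) = ph a * f x)"

definition semilinear_family :: "(laurent \<Rightarrow> 'r::comm_ring_1) \<Rightarrow> (nat \<Rightarrow> 'h \<Rightarrow> 'r) \<Rightarrow> bool" where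
  "semilinear_family ph f \<longleftrightarrow> (\<forall>i\<in>{1..k}. semilinear ph (f i))"

lemma semilinear_familyD: "semilinear_family ph f \<Longrightarrow> i \<in> {1..k} \<Longrightarrow> semilinear ph (f i)"
  by (simp add: semilinear_family_def)

text \<open>\<open>TP.lift_exists\<close> asks for the relations after translation on both sides. A
  translate acts position by position, so additivity in one position survives, and a scalar can be
  pulled out of any position because it is central in H.\<close>

lemma tensor_functional_exists:
  fixes f :: "nat \<Rightarrow> 'h \<Rightarrow> 'r::comm_ring_1"
  assumes f: "semilinear_family ph f"
  shows "\<exists>\<Phi>. additive \<Phi> \<and> (\<forall>h\<in>{1..k} \<rightarrow> carrier H. \<Phi> (pur h) = (\<Prod>i=1..k. f i (h i)))"
proof -
  define F where "F h = (\<Prod>i=1..k. f i (h i))" for h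
  have F_upd: "F (\<lambda>p\<in>{1..k}. if p = i then z else h p) = f i z * (\<Prod>p\<in>{1..k} - {i}. f p (h p))"
    if "i \<in> {1..k}" for h i z
    unfolding F_def using that
    by (subst prod.remove[of _ i]) (auto intro!: arg_cong2[where f = "(*)"] prod.cong)
  have upd: "g \<otimes>\<^bsub>PM\<^esub> h(i := z) \<otimes>\<^bsub>PM\<^esub> g' =
      (\<lambda>p\<in>{1..k}. if p = i then g i \<otimes>\<^bsub>H\<^esub> z \<otimes>\<^bsub>H\<^esub> g' i else g p \<otimes>\<^bsub>H\<^esub> h p \<otimes>\<^bsub>H\<^esub> g' p)" for g h g' i z
    by (auto intro!: ext)
  have F_scale: "F (g \<otimes>\<^bsub>PM\<^esub> h(i := \<eta> a \<otimes>\<^bsub>H\<^esub> h i) \<otimes>\<^bsub>PM\<^esub> g') = ph a * F (g \<otimes>\<^bsub>PM\<^esub> h \<otimes>\<^bsub>PM\<^esub> g')"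
    if "g \<in> carrier PM" "h \<in> carrier PM" "g' \<in> carrier PM" "i \<in> {1..k}" for g h g' i a
  proof -
    have c: "g i \<in> carrier H" "h i \<in> carrier H" "g' i \<in> carrier H" using that by auto
    have "g i \<otimes>\<^bsub>H\<^esub> (\<eta> a \<otimes>\<^bsub>H\<^esub> h i) \<otimes>\<^bsub>H\<^esub> g' i = \<eta> a \<otimes>\<^bsub>H\<^esub> (g i \<otimes>\<^bsub>H\<^esub> h i \<otimes>\<^bsub>H\<^esub> g' i)"
      using c eta_central[OF c(1)] by (simp flip: H.m_assoc)
    then have "F (g \<otimes>\<^bsub>PM\<^esub> h(i := \<eta> a \<otimes>\<^bsub>H\<^esub> h i) \<otimes>\<^bsub>PM\<^esub> g') = ph a * F (g \<otimes>\<^bsub>PM\<^esub> h(i := h i) \<otimes>\<^bsub>PM\<^esub> g')"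
      unfolding upd F_upd[OF that(4)] using semilinear_familyD[OF f that(4)] c by (simp add: semilinear_def mult.assoc)
    then show ?thesis by (simp del: PM_simps)
  qed
  have "\<exists>\<Phi>. (\<forall>x\<in>carrier TP.Q. \<forall>y\<in>carrier TP.Q. \<Phi> (x \<oplus>\<^bsub>TP.Q\<^esub> y) = \<Phi> x + \<Phi> y) \<and>
      (\<forall>g\<in>carrier PM. \<Phi> (TP.cl g) = F g)"
  proof (rule TP.lift_exists)
    fix a b c g g' assume abc: "(a, b, c) \<in> R3" and g: "g \<in> carrier PM" "g' \<in> carrier PM"
    obtain h i x y where *: "a = h(i := x \<oplus>\<^bsub>H\<^esub> y)" "b = h(i := x)" "c = h(i := y)"
        "h \<in> carrier PM" "i \<in> {1..k}" "x \<in> carrier H" "y \<in> carrier H"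
      using abc unfolding R3_def by blast
    have c: "g i \<in> carrier H" "g' i \<in> carrier H" using g * by auto
    show "F (g \<otimes>\<^bsub>PM\<^esub> a \<otimes>\<^bsub>PM\<^esub> g') = F (g \<otimes>\<^bsub>PM\<^esub> b \<otimes>\<^bsub>PM\<^esub> g') + F (g \<otimes>\<^bsub>PM\<^esub> c \<otimes>\<^bsub>PM\<^esub> g')"
      unfolding * upd F_upd[OF *(5)] using semilinear_familyD[OF f *(5)] c *
      by (simp add: H.r_distr H.l_distr semilinear_def distrib_right)
  next
    fix a b g g' assume ab: "(a, b) \<in> R2" and g: "g \<in> carrier PM" "g' \<in> carrier PM"
    then show "F (g \<otimes>\<^bsub>PM\<^esub> a \<otimes>\<^bsub>PM\<^esub> g') = F (g \<otimes>\<^bsub>PM\<^esub> b \<otimes>\<^bsub>PM\<^esub> g')"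
      unfolding R2_def using F_scale by (auto simp del: PM_simps)
  qed
  then obtain \<Phi> where \<Phi>: "\<And>x y. x \<in> carrier TT \<Longrightarrow> y \<in> carrier TT \<Longrightarrow> \<Phi> (x \<oplus>\<^bsub>TT\<^esub> y) = \<Phi> x + \<Phi> y"
      "\<And>g. g \<in> carrier PM \<Longrightarrow> \<Phi> (TP.cl g) = F g"
    unfolding TP_Q by blast
  have "\<Phi> (pur h) = (\<Prod>i=1..k. f i (h i))" if "h \<in> {1..k} \<rightarrow> carrier H" for h
    using \<Phi>(2)[of "restrict h {1..k}"] that by (auto simp: TP_cl F_def)
  then show ?thesis using \<Phi>(1) unfolding additive_def by blast
qed

definition tfun :: "(nat \<Rightarrow> 'h \<Rightarrow> 'r::comm_ring_1) \<Rightarrow> ((nat \<Rightarrow> 'h) \<Rightarrow>\<^sub>0 int) set \<Rightarrow> 'r" where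
  "tfun f = (SOME \<Phi>. additive \<Phi> \<and> (\<forall>h\<in>{1..k} \<rightarrow> carrier H. \<Phi> (pur h) = (\<Prod>i=1..k. f i (h i))))"

lemma tfun:
  assumes "semilinear_family ph f"
  shows "additive (tfun f)" "h \<in> {1..k} \<rightarrow> carrier H \<Longrightarrow> tfun f (pur h) = (\<Prod>i=1..k. f i (h i))"
  using someI_ex[OF tensor_functional_exists[OF assms]] unfolding tfun_def by blast+

abbreviation scal :: "laurent \<Rightarrow> ((nat \<Rightarrow> 'h) \<Rightarrow>\<^sub>0 int) set" where "scal \<equiv> tensor_power_scalar \<eta> k H"

lemma one_in_k: "1 \<in> {1..k}" using k_pos by simp

lemma scal_closed [simp]: "scal a \<in> carrier TT"
  unfolding tensor_power_scalar_def by (intro pur_closed) auto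

lemma scal_pur:
  assumes "h \<in> {1..k} \<rightarrow> carrier H" "i \<in> {1..k}"
  shows "scal a \<otimes>\<^bsub>TT\<^esub> pur h = pur (h(i := \<eta> a \<otimes>\<^bsub>H\<^esub> h i))"
    "pur h \<otimes>\<^bsub>TT\<^esub> scal a = pur (h(i := \<eta> a \<otimes>\<^bsub>H\<^esub> h i))"
proof -
  have c: "h j \<in> carrier H" if "j \<in> {1..k}" for j using assms that by auto
  have "scal a \<otimes>\<^bsub>TT\<^esub> pur h = pur (\<lambda>i. (if i = 1 then \<eta> a else \<one>\<^bsub>H\<^esub>) \<otimes>\<^bsub>H\<^esub> h i)"
    unfolding tensor_power_scalar_def using assms by (intro pur_mult) auto
  also have "\<dots> = pur (h(1 := \<eta> a \<otimes>\<^bsub>H\<^esub> h 1))"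
    using c by (intro pur_cong) auto
  also have "\<dots> = pur (h(i := \<eta> a \<otimes>\<^bsub>H\<^esub> h i))"
    using assms one_in_k by (intro pur_scale_any)
  finally show 1: "scal a \<otimes>\<^bsub>TT\<^esub> pur h = pur (h(i := \<eta> a \<otimes>\<^bsub>H\<^esub> h i))" .
  have "pur h \<otimes>\<^bsub>TT\<^esub> scal a = pur (\<lambda>i. h i \<otimes>\<^bsub>H\<^esub> (if i = 1 then \<eta> a else \<one>\<^bsub>H\<^esub>))"
    unfolding tensor_power_scalar_def using assms by (intro pur_mult) auto
  also have "\<dots> = pur (h(1 := \<eta> a \<otimes>\<^bsub>H\<^esub> h 1))"
    using c by (intro pur_cong) (auto simp: eta_central)
  also have "\<dots> = pur (h(i := \<eta> a \<otimes>\<^bsub>H\<^esub> h i))"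
    using assms one_in_k by (intro pur_scale_any)
  finally show "pur h \<otimes>\<^bsub>TT\<^esub> scal a = pur (h(i := \<eta> a \<otimes>\<^bsub>H\<^esub> h i))" .
qed

lemma scal_central: "x \<in> carrier TT \<Longrightarrow> scal a \<otimes>\<^bsub>TT\<^esub> x = x \<otimes>\<^bsub>TT\<^esub> scal a"
proof (induction x rule: TT_induct)
  case (pur h)
  then show ?case using scal_pur[OF pur one_in_k] by simp
qed (simp_all add: TT.l_distr TT.r_distr TT.l_minus TT.r_minus)

lemma scal_one: "scal 1 = \<one>\<^bsub>TT\<^esub>"
  unfolding pur_one[symmetric] tensor_power_scalar_def by (intro pur_cong) simp

lemma scal_add: "scal (a + b) = scal a \<oplus>\<^bsub>TT\<^esub> scal b"
proof -
  have "scal a = pur ((\<lambda>_. \<one>\<^bsub>H\<^esub>)(1 := \<eta> a))" for a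
    unfolding tensor_power_scalar_def by (intro pur_cong) simp
  then show ?thesis using pur_add[of "\<lambda>_. \<one>\<^bsub>H\<^esub>" 1 "\<eta> a" "\<eta> b"] k_pos by (simp add: eta_add)
qed

lemma scal_mult: "scal (a * b) = scal a \<otimes>\<^bsub>TT\<^esub> scal b"
  unfolding tensor_power_scalar_def
  by (subst pur_mult) (auto intro!: pur_cong simp: eta_mult)

lemma tfun_scal:
  assumes f: "semilinear_family ph f" and x: "x \<in> carrier TT"
  shows "tfun f (scal a \<otimes>\<^bsub>TT\<^esub> x) = ph a * tfun f x"
  using x
proof (induction x rule: TT_induct)
  case (pur h)
  have h1: "h 1 \<in> carrier H" using pur one_in_k by blast
  have "h(1 := \<eta> a \<otimes>\<^bsub>H\<^esub> h 1) \<in> {1..k} \<rightarrow> carrier H" using pur h1 by auto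
  then have "tfun f (scal a \<otimes>\<^bsub>TT\<^esub> pur h) = (\<Prod>i=1..k. f i ((h(1 := \<eta> a \<otimes>\<^bsub>H\<^esub> h 1)) i))"
    unfolding scal_pur(1)[OF pur one_in_k] by (rule tfun(2)[OF f])
  also have "\<dots> = f 1 (\<eta> a \<otimes>\<^bsub>H\<^esub> h 1) * (\<Prod>i\<in>{1..k} - {1}. f i (h i))"
    using one_in_k by (subst prod.remove[of _ 1]) auto
  also have "\<dots> = ph a * (f 1 (h 1) * (\<Prod>i\<in>{1..k} - {1}. f i (h i)))"
    using semilinear_familyD[OF f one_in_k] h1 by (simp add: semilinear_def mult.assoc)
  also have "f 1 (h 1) * (\<Prod>i\<in>{1..k} - {1}. f i (h i)) = (\<Prod>i=1..k. f i (h i))"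
    using one_in_k by (subst (2) prod.remove[of _ 1]) auto
  finally show ?case using tfun(2)[OF f pur] by simp
qed (simp_all add: TT.r_distr TT.r_minus additiveD[OF tfun(1)[OF f]] algebra_simps)

lemma nsP_closed [simp]:
  assumes "s \<in> {s1, s2}"
  shows "nsP H \<eta> T k s \<in> carrier TT"
proof -
  have "s \<in> carrier W" using assms s1_closed s2_closed by auto
  then show ?thesis
    unfolding nsP_def C_plus_def C_minus_def
    by (intro TT.finsum_closed) (auto intro!: pur_closed)
qed

text \<open>
  If \<open>T s\<close> acts on \<open>f i\<close> as \<open>(u - 1/u + [2] \<mu> i r) / 2\<close> with \<open>r\<close> exchanging \<open>f i\<close> and \<open>f' i\<close>, then the sum
  over even sign vectors telescopes to \<open>[2]^k (1 + r \<otimes> \<dots> \<otimes> r) / 2\<close>.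
\<close>

lemma tfun_nsP:
  fixes ph :: "laurent \<Rightarrow> 'r::comm_ring_1"
  assumes f: "semilinear_family ph f" and f': "semilinear_family ph f'"
    and ph: "\<And>a b. ph (a + b) = ph a + ph b" and s: "s \<in> {s1, s2}"
    and act: "\<And>i h. i \<in> {1..k} \<Longrightarrow> h \<in> carrier H \<Longrightarrow>
      f i (T s \<otimes>\<^bsub>H\<^esub> h) = \<gamma> i * f i h + \<mu> i * f' i h"
    and \<gamma>: "\<And>i. i \<in> {1..k} \<Longrightarrow> 2 * \<gamma> i = ph (u_pow 1) - ph (u_pow (-1))"
    and y: "y \<in> carrier TT"
  shows "2 * tfun f (nsP H \<eta> T k s \<otimes>\<^bsub>TT\<^esub> y) =
     ph quantum_two ^ k * tfun f y + (\<Prod>i=1..k. 2 * \<mu> i) * tfun f' y"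
  using y
proof (induction y rule: TT_induct)
  case (pur h)
  have sW: "s \<in> carrier W" using s s1_closed s2_closed by auto
  have hc: "h i \<in> carrier H" if "i \<in> {1..k}" for i using pur that by auto
  let ?A = "{a \<in> {1..k} \<rightarrow>\<^sub>E (UNIV::bool set). even (card {i\<in>{1..k}. \<not> a i})}"
  let ?C = "\<lambda>a i. if a i then C_plus H \<eta> T s else C_minus H \<eta> T s"
  have C: "C_plus H \<eta> T s \<in> carrier H" "C_minus H \<eta> T s \<in> carrier H"
    using sW by (simp_all add: C_plus_def C_minus_def)
  have fin: "finite ?A" by (rule finite_subset[of _ "{1..k} \<rightarrow>\<^sub>E UNIV"]) (auto intro!: finite_PiE)
  have ph_neg: "ph (- a) = - ph a" for a
    using ph[of a "- a"] ph[of 0 0] by (simp add: eq_neg_iff_add_eq_0 add.commute)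
  define \<alpha> where "\<alpha> i = (\<gamma> i + ph (u_pow (-1))) * f i (h i) + \<mu> i * f' i (h i)" for i
  define \<beta> where "\<beta> i = (\<gamma> i - ph (u_pow 1)) * f i (h i) + \<mu> i * f' i (h i)" for i
  have fp: "f i (C_plus H \<eta> T s \<otimes>\<^bsub>H\<^esub> h i) = \<alpha> i" if "i \<in> {1..k}" for i
    using semilinear_familyD[OF f that] hc[OF that] sW act[OF that hc[OF that]]
    by (simp add: C_plus_def H.l_distr semilinear_def \<alpha>_def algebra_simps)
  have fm: "f i (C_minus H \<eta> T s \<otimes>\<^bsub>H\<^esub> h i) = \<beta> i" if "i \<in> {1..k}" for i
    using semilinear_familyD[OF f that] hc[OF that] sW act[OF that hc[OF that]]
    by (simp add: C_minus_def a_minus_def H.l_distr semilinear_def \<beta>_def algebra_simps ph_neg flip: eta_uminus)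
  have "nsP H \<eta> T k s \<otimes>\<^bsub>TT\<^esub> pur h = (\<Oplus>\<^bsub>TT\<^esub>a\<in>?A. pur (?C a) \<otimes>\<^bsub>TT\<^esub> pur h)"
    unfolding nsP_def using fin pur C by (intro TT.finsum_ldistr) (auto intro!: pur_closed)
  also have "\<dots> = (\<Oplus>\<^bsub>TT\<^esub>a\<in>?A. pur (\<lambda>i. ?C a i \<otimes>\<^bsub>H\<^esub> h i))"
    using C pur hc by (intro TT.finsum_cong' refl) (auto intro!: pur_closed pur_mult)
  finally have "tfun f (nsP H \<eta> T k s \<otimes>\<^bsub>TT\<^esub> pur h) = (\<Sum>a\<in>?A. tfun f (pur (\<lambda>i. ?C a i \<otimes>\<^bsub>H\<^esub> h i)))"
    using C hc fin by (simp only:) (intro additive_finsum tfun(1)[OF f], auto intro!: pur_closed)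
  also have "\<dots> = (\<Sum>a\<in>?A. \<Prod>i=1..k. f i (?C a i \<otimes>\<^bsub>H\<^esub> h i))"
    using C hc by (intro sum.cong refl tfun(2)[OF f]) auto
  also have "\<dots> = (\<Sum>a\<in>?A. \<Prod>i=1..k. if a i then \<alpha> i else \<beta> i)"
    by (intro sum.cong prod.cong refl) (simp add: fp fm)
  finally have "2 * tfun f (nsP H \<eta> T k s \<otimes>\<^bsub>TT\<^esub> pur h) = (\<Prod>i=1..k. \<alpha> i + \<beta> i) + (\<Prod>i=1..k. \<alpha> i - \<beta> i)"
    by (simp only: sum_even_signs)
  \<comment> \<open>By the choice of \<gamma> the sum \<alpha> + \<beta> loses its part along f,
    while the difference \<alpha> - \<beta> is [2] f. One product therefore contributes r tensor ...
    tensor r and the other the identity.\<close>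
  also have "(\<Prod>i=1..k. \<alpha> i + \<beta> i) = (\<Prod>i=1..k. 2 * \<mu> i * f' i (h i))"
  proof (intro prod.cong refl)
    fix i assume "i \<in> {1..k}"
    have "\<alpha> i + \<beta> i = (2 * \<gamma> i - (ph (u_pow 1) - ph (u_pow (-1)))) * f i (h i) + 2 * \<mu> i * f' i (h i)"
      by (simp add: \<alpha>_def \<beta>_def algebra_simps)
    then show "\<alpha> i + \<beta> i = 2 * \<mu> i * f' i (h i)" using \<gamma>[OF \<open>i \<in> {1..k}\<close>] by simp
  qed
  also have "\<dots> = (\<Prod>i=1..k. 2 * \<mu> i) * (\<Prod>i=1..k. f' i (h i))"
    by (simp add: prod.distrib)
  also have "(\<Prod>i=1..k. \<alpha> i - \<beta> i) = (\<Prod>i=1..k. ph quantum_two * f i (h i))"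
    by (intro prod.cong refl) (simp add: \<alpha>_def \<beta>_def quantum_two_def ph algebra_simps)
  also have "\<dots> = ph quantum_two ^ k * (\<Prod>i=1..k. f i (h i))"
    by (simp add: prod.distrib)
  finally show ?case
    using tfun(2)[OF f pur] tfun(2)[OF f' pur] by (simp add: add.commute)
qed (simp_all add: TT.r_distr TT.r_minus nsP_closed[OF s] additiveD[OF tfun(1)[OF f]] additiveD[OF tfun(1)[OF f']] algebra_simps)

section \<open>Coordinates of the tensor power\<close>

definition crd :: "(nat \<Rightarrow> 'w) \<Rightarrow> ((nat \<Rightarrow> 'h) \<Rightarrow>\<^sub>0 int) set \<Rightarrow> laurent" where
  "crd \<beta> = tfun (\<lambda>i h. coef h (\<beta> i))"

abbreviation tensor_index :: "(nat \<Rightarrow> 'w) set" where "tensor_index \<equiv> {1..k} \<rightarrow>\<^sub>E carrier W"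

lemma finite_tensor_index: "finite tensor_index"
  by (intro finite_PiE) (auto simp: finite_carrier_W)

lemma semilinear_coef: "w \<in> carrier W \<Longrightarrow> semilinear (\<lambda>a. a) (\<lambda>h. coef h w)"
  by (simp add: semilinear_def coef_add coef_scale)

lemma crd:
  assumes "\<beta> \<in> tensor_index"
  shows "additive (crd \<beta>)" "h \<in> {1..k} \<rightarrow> carrier H \<Longrightarrow> crd \<beta> (pur h) = (\<Prod>i=1..k. coef (h i) (\<beta> i))"
    "x \<in> carrier TT \<Longrightarrow> crd \<beta> (scal a \<otimes>\<^bsub>TT\<^esub> x) = a * crd \<beta> x"
proof -
  have *: "semilinear_family (\<lambda>a. a) (\<lambda>i h. coef h (\<beta> i))"
    using assms by (auto simp: semilinear_family_def PiE_iff intro!: semilinear_coef)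
  show "additive (crd \<beta>)" "h \<in> {1..k} \<rightarrow> carrier H \<Longrightarrow> crd \<beta> (pur h) = (\<Prod>i=1..k. coef (h i) (\<beta> i))"
    "x \<in> carrier TT \<Longrightarrow> crd \<beta> (scal a \<otimes>\<^bsub>TT\<^esub> x) = a * crd \<beta> x"
    unfolding crd_def using tfun[OF *] tfun_scal[OF *] by auto
qed

definition expand :: "((nat \<Rightarrow> 'h) \<Rightarrow>\<^sub>0 int) set \<Rightarrow> ((nat \<Rightarrow> 'h) \<Rightarrow>\<^sub>0 int) set" where
  "expand x = (\<Oplus>\<^bsub>TT\<^esub>\<beta>\<in>tensor_index. scal (crd \<beta> x) \<otimes>\<^bsub>TT\<^esub> pur (\<lambda>i. T (\<beta> i)))"

lemma basis_closed: "\<beta> \<in> tensor_index \<Longrightarrow> pur (\<lambda>i. T (\<beta> i)) \<in> carrier TT"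
  by (intro pur_closed) (auto simp: PiE_iff)

lemma expand_closed: "expand x \<in> carrier TT"
  unfolding expand_def using basis_closed by (intro TT.finsum_closed) auto

lemma expand_add:
  assumes "x \<in> carrier TT" "y \<in> carrier TT"
  shows "expand (x \<oplus>\<^bsub>TT\<^esub> y) = expand x \<oplus>\<^bsub>TT\<^esub> expand y"
proof -
  have "expand (x \<oplus>\<^bsub>TT\<^esub> y) = (\<Oplus>\<^bsub>TT\<^esub>\<beta>\<in>tensor_index. scal (crd \<beta> x) \<otimes>\<^bsub>TT\<^esub> pur (\<lambda>i. T (\<beta> i)) \<oplus>\<^bsub>TT\<^esub>
      scal (crd \<beta> y) \<otimes>\<^bsub>TT\<^esub> pur (\<lambda>i. T (\<beta> i)))"
    unfolding expand_def using assms basis_closed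
    by (intro TT.finsum_cong' refl) (simp_all add: additiveD[OF crd(1)] scal_add TT.l_distr)
  also have "\<dots> = expand x \<oplus>\<^bsub>TT\<^esub> expand y"
    unfolding expand_def using basis_closed by (intro TT.finsum_addf) auto
  finally show ?thesis .
qed

lemma expand_scal:
  assumes "x \<in> carrier TT"
  shows "expand (scal a \<otimes>\<^bsub>TT\<^esub> x) = scal a \<otimes>\<^bsub>TT\<^esub> expand x"
proof -
  have "expand (scal a \<otimes>\<^bsub>TT\<^esub> x) =
      (\<Oplus>\<^bsub>TT\<^esub>\<beta>\<in>tensor_index. scal a \<otimes>\<^bsub>TT\<^esub> (scal (crd \<beta> x) \<otimes>\<^bsub>TT\<^esub> pur (\<lambda>i. T (\<beta> i))))"
    unfolding expand_def using assms basis_closed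
    by (intro TT.finsum_cong' refl) (simp_all add: crd(3) scal_mult TT.m_assoc)
  also have "\<dots> = scal a \<otimes>\<^bsub>TT\<^esub> expand x"
    unfolding expand_def using basis_closed finite_tensor_index
    by (intro TT.finsum_rdistr[symmetric]) auto
  finally show ?thesis .
qed

lemma scal_zero: "scal 0 = \<zero>\<^bsub>TT\<^esub>"
  using scal_add[of 0 0] by (metis TT.add.l_cancel_one' add_0 scal_closed)

lemma expand_basis:
  assumes "\<beta> \<in> tensor_index"
  shows "expand (pur (\<lambda>i. T (\<beta> i))) = pur (\<lambda>i. T (\<beta> i))"
proof -
  have c: "crd \<beta>' (pur (\<lambda>i. T (\<beta> i))) = (if \<beta>' = \<beta> then 1 else 0)" if "\<beta>' \<in> tensor_index" for \<beta>'
  proof -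
    have "crd \<beta>' (pur (\<lambda>i. T (\<beta> i))) = (\<Prod>i=1..k. coef (T (\<beta> i)) (\<beta>' i))"
      using assms by (intro crd(2)[OF that]) (auto simp: PiE_iff)
    also have "\<dots> = (\<Prod>i=1..k. if \<beta>' i = \<beta> i then 1 else 0)"
      using assms that by (intro prod.cong refl coef_T) auto
    also have "\<dots> = (if \<beta>' = \<beta> then 1 else 0)"
    proof (cases "\<beta>' = \<beta>")
      case False
      have "\<exists>i\<in>{1..k}. \<beta>' i \<noteq> \<beta> i"
      proof (rule ccontr)
        assume "\<not> (\<exists>i\<in>{1..k}. \<beta>' i \<noteq> \<beta> i)"
        then have "\<beta>' = \<beta>" using assms that by (intro PiE_ext[of \<beta>' _ _ \<beta>]) auto
        with False show False ..
      qed
      then have "(\<Prod>i=1..k. if \<beta>' i = \<beta> i then 1 else (0::laurent)) = 0"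
        by (intro prod_zero) auto
      with False show ?thesis by simp
    qed simp
    finally show ?thesis .
  qed
  have "expand (pur (\<lambda>i. T (\<beta> i))) =
      (\<Oplus>\<^bsub>TT\<^esub>\<beta>'\<in>tensor_index. if \<beta> = \<beta>' then pur (\<lambda>i. T (\<beta>' i)) else \<zero>\<^bsub>TT\<^esub>)"
    unfolding expand_def using basis_closed
    by (intro TT.finsum_cong' refl) (auto simp: c scal_one scal_zero)
  also have "\<dots> = pur (\<lambda>i. T (\<beta> i))"
    using assms finite_tensor_index basis_closed by (intro TT.finsum_singleton) auto
  finally show ?thesis .
qed

text \<open>The induction moves a border through the positions: those beyond N already hold basis
  elements, and linearity in position N lowers the border. For N = k the condition is
  vacuous.\<close>

lemma expand_pur:
  "N \<le> k \<Longrightarrow> h \<in> {1..k} \<rightarrow> carrier H \<Longrightarrow> (\<And>i. N < i \<Longrightarrow> i \<le> k \<Longrightarrow> h i \<in> T ` carrier W) \<Longrightarrow>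
     expand (pur h) = pur h"
proof (induction N arbitrary: h)
  case 0
  then have "\<forall>i\<in>{1..k}. \<exists>w. w \<in> carrier W \<and> h i = T w"
    by (auto simp: image_iff Bex_def)
  then obtain \<beta> where \<beta>: "\<forall>i\<in>{1..k}. \<beta> i \<in> carrier W \<and> h i = T (\<beta> i)"
    using bchoice[of "{1..k}" "\<lambda>i w. w \<in> carrier W \<and> h i = T w"] by blast
  have h: "pur h = pur (\<lambda>i. T (restrict \<beta> {1..k} i))" using \<beta> by (intro pur_cong) auto
  show ?case
    unfolding h using \<beta> by (intro expand_basis) auto
next
  case (Suc N)
  let ?i = "Suc N"
  have i: "?i \<in> {1..k}" using Suc.prems by simp
  have up: "h(?i := x) \<in> {1..k} \<rightarrow> carrier H" if "x \<in> carrier H" for x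
    using Suc.prems that by auto
  have "expand (pur (h(?i := x))) = pur (h(?i := x))" if "x \<in> carrier H" for x
    using that
  proof (induction x rule: H_basis_induct)
    case (T w)
    show ?case
    proof (rule Suc.IH)
      show "(h(?i := T w)) i \<in> T ` carrier W" if "N < i" "i \<le> k" for i
        using T Suc.prems(3)[of i] that by (cases "i = ?i") auto
    qed (use Suc.prems T up in auto)
  next
    case (scale a x)
    have *: "pur (h(?i := \<eta> a \<otimes>\<^bsub>H\<^esub> x)) = scal a \<otimes>\<^bsub>TT\<^esub> pur (h(?i := x))"
      using scal_pur(1)[OF up[OF scale(1)] i, of a] by simp
    show ?case
      unfolding * using expand_scal[OF pur_closed[OF up[OF scale(1)]], of a] scale(2) by (simp only:)
  next
    case (add x y)
    then show ?case
      using pur_add[OF Suc.prems(2) i, of x y]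
        expand_add[OF pur_closed[OF up[OF add(1)]] pur_closed[OF up[OF add(2)]]] by (simp only:)
  qed
  moreover have "h ?i \<in> carrier H" using Suc.prems(2) i by blast
  ultimately have "expand (pur (h(?i := h ?i))) = pur (h(?i := h ?i))" by blast
  then show ?case by simp
qed

lemma expand_eq: "x \<in> carrier TT \<Longrightarrow> expand x = x"
proof (induction x rule: TT_induct)
  case (pur h)
  then show ?case by (intro expand_pur[of k]) auto
next
  case (add x y)
  then show ?case by (simp add: expand_add)
next
  case (neg x)
  have "expand (x \<oplus>\<^bsub>TT\<^esub> \<ominus>\<^bsub>TT\<^esub> x) = expand x \<oplus>\<^bsub>TT\<^esub> expand (\<ominus>\<^bsub>TT\<^esub> x)"
    using neg by (intro expand_add) auto
  moreover have "expand \<zero>\<^bsub>TT\<^esub> = \<zero>\<^bsub>TT\<^esub>"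
    using expand_scal[of x 0] neg expand_closed by (simp add: scal_zero)
  ultimately have "x \<oplus>\<^bsub>TT\<^esub> expand (\<ominus>\<^bsub>TT\<^esub> x) = \<zero>\<^bsub>TT\<^esub>"
    using neg by (simp add: TT.r_neg)
  then show ?case
    using neg expand_closed by (intro TT.minus_equality[symmetric]) (simp_all add: TT.a_comm)
qed

text \<open>\<open>expand_eq\<close> rebuilds an element from its coordinates. The flatness argument
  uses this to find a nonzero coordinate of a nonzero element.\<close>

lemma crd_separating:
  assumes "x \<in> carrier TT" "\<And>\<beta>. \<beta> \<in> tensor_index \<Longrightarrow> crd \<beta> x = 0"
  shows "x = \<zero>\<^bsub>TT\<^esub>"
proof -
  have "expand x = (\<Oplus>\<^bsub>TT\<^esub>\<beta>\<in>tensor_index. \<zero>\<^bsub>TT\<^esub>)"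
    unfolding expand_def using basis_closed
    by (intro TT.finsum_cong' refl) (simp_all add: assms(2) scal_zero)
  then show ?thesis using expand_eq[OF assms(1)] by simp
qed

end

section \<open>The two-dimensional modules of the Hecke algebra\<close>

text \<open>A Vandermonde argument: the relations extend from powers to all polynomials, and a
  polynomial vanishing on L except at y isolates \<open>\<gamma> y\<close>.\<close>

lemma powers_independent:
  fixes \<gamma> :: "'e::field \<Rightarrow> 'e"
  assumes "finite L" "\<And>i. (\<Sum>x\<in>L. \<gamma> x * x ^ i) = 0" "y \<in> L"
  shows "\<gamma> y = 0"
proof -
  have *: "(\<Sum>x\<in>L. \<gamma> x * poly p x) = 0" for p
  proof -
    have "(\<Sum>x\<in>L. \<gamma> x * poly p x) = (\<Sum>x\<in>L. \<Sum>i\<le>Polynomial.degree p. poly.coeff p i * (\<gamma> x * x ^ i))"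
      by (simp add: poly_altdef sum_distrib_left mult_ac)
    also have "\<dots> = (\<Sum>i\<le>Polynomial.degree p. poly.coeff p i * (\<Sum>x\<in>L. \<gamma> x * x ^ i))"
      by (subst sum.swap) (simp add: sum_distrib_left)
    finally show ?thesis by (simp add: assms(2))
  qed
  define p where "p = (\<Prod>x\<in>L - {y}. [:- x, 1:])"
  have "(\<Sum>x\<in>L. \<gamma> x * poly p x) = \<gamma> y * poly p y + (\<Sum>x\<in>L - {y}. \<gamma> x * poly p x)"
    using assms by (simp add: sum.remove)
  also have "(\<Sum>x\<in>L - {y}. \<gamma> x * poly p x) = 0"
    using assms(1) by (intro sum.neutral) (auto simp: p_def poly_prod)
  finally have "\<gamma> y * poly p y = 0" using * by simp
  moreover have "poly p y \<noteq> 0" using assms(1) by (auto simp: p_def poly_prod)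
  ultimately show ?thesis by simp
qed

text \<open>Independent rows, at least as many as there are columns, span the whole row space; a
  unit vector outside their span would give too many independent vectors. It turns independence of
  matrix coefficients into formulas for coordinates.\<close>

lemma independent_rows_span:
  fixes a :: "'i \<Rightarrow> 'w \<Rightarrow> 'e::field"
  assumes fin: "finite I" "finite Y" and card: "card Y \<le> card I"
    and indep: "\<And>c i. (\<And>w. w \<in> Y \<Longrightarrow> (\<Sum>i\<in>I. c i * a i w) = 0) \<Longrightarrow> i \<in> I \<Longrightarrow> c i = 0"
    and w0: "w0 \<in> Y"
  shows "\<exists>\<alpha>. \<forall>w\<in>Y. (\<Sum>i\<in>I. \<alpha> i * a i w) = (if w = w0 then 1 else 0)"
proof -
  define scl :: "'e \<Rightarrow> ('w \<Rightarrow> 'e) \<Rightarrow> 'w \<Rightarrow> 'e" where "scl c f = (\<lambda>w. c * f w)" for c f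
  interpret V: vector_space scl
    by unfold_locales (auto simp: scl_def algebra_simps fun_eq_iff)
  define b where "b i = (\<lambda>w. if w \<in> Y then a i w else 0)" for i
  define e where "e v = (\<lambda>w. if w = v then 1 else (0::'e))" for v :: 'w
  have sum_app: "(\<Sum>x\<in>A. g x) w = (\<Sum>x\<in>A. g x w)" for A and g :: "'z \<Rightarrow> 'w \<Rightarrow> 'e" and w
    by (induction A rule: infinite_finite_induct) auto
  have inj: "inj_on b I"
  proof (rule inj_onI, rule ccontr)
    fix i j assume ij: "i \<in> I" "j \<in> I" "b i = b j" "i \<noteq> j"
    define c where "c l = (if l = i then 1 else if l = j then - 1 else (0::'e))" for l
    have "(\<Sum>l\<in>I. c l * a l w) = 0" if "w \<in> Y" for w
    proof -
      have "(\<Sum>l\<in>I. c l * a l w) = (\<Sum>l\<in>{i, j}. c l * a l w)"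
        using fin ij by (intro sum.mono_neutral_right) (auto simp: c_def)
      also have "\<dots> = a i w - a j w" using ij by (simp add: c_def)
      also have "\<dots> = 0" using fun_cong[OF ij(3), of w] that by (simp add: b_def)
      finally show ?thesis .
    qed
    from indep[OF this ij(1)] show False by (simp add: c_def)
  qed
  have ind: "V.independent (b ` I)"
  proof (subst V.independent_explicit_finite_subsets, intro allI impI ballI)
    fix A u v assume A: "A \<subseteq> b ` I" "finite A" "(\<Sum>v\<in>A. scl (u v) v) = 0" "v \<in> A"
    define c where "c i = (if b i \<in> A then u (b i) else 0)" for i
    have "(\<Sum>i\<in>I. c i * a i w) = 0" if "w \<in> Y" for w
    proof -
      have "0 = (\<Sum>v\<in>A. scl (u v) v) w" using A(3) by simp
      also have "\<dots> = (\<Sum>v\<in>A. u v * v w)" by (simp add: sum_app scl_def)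
      also have "\<dots> = (\<Sum>v\<in>b ` I. if v \<in> A then u v * v w else 0)"
        using A fin by (intro sum.mono_neutral_cong_left) auto
      also have "\<dots> = (\<Sum>i\<in>I. c i * a i w)"
        using that by (subst sum.reindex[OF inj]) (auto intro!: sum.cong simp: c_def b_def)
      finally show ?thesis ..
    qed
    then have "c i = 0" if "i \<in> I" for i using indep that by blast
    moreover obtain i where "i \<in> I" "v = b i" using A by auto
    ultimately show "u v = 0" using A(4) by (force simp: c_def)
  qed
  have sub: "b ` I \<subseteq> V.span (e ` Y)"
  proof
    fix v assume "v \<in> b ` I"
    then obtain i where i: "v = b i" by blast
    have "v = (\<Sum>w\<in>Y. scl (a i w) (e w))"
      using fin by (auto simp: fun_eq_iff sum_app scl_def e_def i b_def if_distrib sum.delta cong: if_cong)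
    also have "\<dots> \<in> V.span (e ` Y)"
      by (intro V.span_sum V.span_scale V.span_base) auto
    finally show "v \<in> V.span (e ` Y)" .
  qed
  have "e w0 \<in> V.span (b ` I)"
  proof (rule ccontr)
    assume *: "e w0 \<notin> V.span (b ` I)"
    then have "V.independent (insert (e w0) (b ` I))" by (rule V.independent_insertI[OF _ ind])
    moreover have "insert (e w0) (b ` I) \<subseteq> V.span (e ` Y)" using sub w0 by (auto intro: V.span_base)
    ultimately have "card (insert (e w0) (b ` I)) \<le> card (e ` Y)"
      using V.independent_span_bound[of "e ` Y"] fin by blast
    moreover have "e w0 \<notin> b ` I" using * V.span_base by blast
    ultimately have "Suc (card I) \<le> card (e ` Y)" using fin card_image[OF inj] by simp
    also have "\<dots> \<le> card Y" by (rule card_image_le) (rule fin)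
    finally show False using card by simp
  qed
  then obtain r where r: "e w0 = (\<Sum>v\<in>b ` I. scl (r v) v)"
    using V.span_finite[of "b ` I"] fin by auto
  have "(\<Sum>i\<in>I. r (b i) * a i w) = (if w = w0 then 1 else 0)" if "w \<in> Y" for w
  proof -
    have "(if w = w0 then 1 else 0) = e w0 w" by (simp add: e_def)
    also have "\<dots> = (\<Sum>v\<in>b ` I. r v * v w)" by (simp add: r sum_app scl_def)
    also have "\<dots> = (\<Sum>i\<in>I. r (b i) * a i w)"
      using that by (subst sum.reindex[OF inj]) (auto intro!: sum.cong simp: b_def)
    finally show ?thesis ..
  qed
  then show ?thesis by (intro exI[of _ "\<lambda>i. r (b i)"]) auto
qed

text \<open>
  The recurrence satisfied by the difference of the two alternating products, with characteristic
  roots the eigenvalues \<open>y\<close>, \<open>1/y\<close> of the product of the two generators.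
\<close>

lemma alternating_recurrence:
  fixes d :: "nat \<Rightarrow> 'e::field"
  assumes rec: "\<And>i. d (i + 4) = (y + inverse y) * d (i + 2) - d i"
    and d0: "d 0 = 0" and d3: "d 3 = (y + inverse y + 1) * d 1"
    and y: "y \<noteq> 0" "y\<^sup>2 \<noteq> 1" "y ^ m = 1"
  shows "d m = 0"
proof -
  define z where "z = inverse y"
  have yz: "y * z = 1" using y by (simp add: z_def)
  have zy: "z * y = 1" using y by (simp add: z_def)
  have yyz: "y * (z * x) = x" "z * (y * x) = x" for x
    using yz zy by (simp_all flip: mult.assoc)
  have rec': "d (Suc (Suc (Suc (Suc i)))) = (y + z) * d (Suc (Suc i)) - d i" for i
    using rec[of i] by (simp add: z_def numeral_eq_Suc)
  have nz: "y - z \<noteq> 0"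
  proof
    assume "y - z = 0"
    then have "y * y = 1" using yz by simp
    then show False using y by (simp add: power2_eq_square)
  qed
  \<comment> \<open>The recurrence preserves parity, so even and odd indices get separate closed
    forms, the odd one starting with \<open>d 3\<close>. The factor y - z avoids a division.\<close>
  have even: "(y - z) * d (2 * l) = (y ^ l - z ^ l) * d 2 \<and> (y - z) * d (2 * Suc l) = (y ^ Suc l - z ^ Suc l) * d 2" for l
  proof (induction l)
    case 0
    then show ?case by (simp add: d0)
  next
    case (Suc l)
    have "(y - z) * d (2 * Suc (Suc l)) = (y + z) * ((y - z) * d (2 * Suc l)) - (y - z) * d (2 * l)"
      by (simp add: rec' algebra_simps)
    also have "\<dots> = ((y + z) * (y ^ Suc l - z ^ Suc l) - (y ^ l - z ^ l)) * d 2"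
      using Suc by (simp only:) (simp add: algebra_simps)
    also have "(y + z) * (y ^ Suc l - z ^ Suc l) - (y ^ l - z ^ l) = y ^ Suc (Suc l) - z ^ Suc (Suc l)"
      by (simp add: algebra_simps yyz)
    finally show ?case using Suc by blast
  qed
  have odd: "(y - z) * d (Suc (2 * l)) = (y ^ Suc l - z ^ Suc l + y ^ l - z ^ l) * d 1 \<and>
      (y - z) * d (Suc (2 * Suc l)) = (y ^ Suc (Suc l) - z ^ Suc (Suc l) + y ^ Suc l - z ^ Suc l) * d 1" for l
  proof (induction l)
    case 0
    have "d (Suc (2 * Suc 0)) = (y + z + 1) * d 1"
      using d3 by (simp add: z_def numeral_3_eq_3)
    then show ?case by (simp add: algebra_simps One_nat_def)
  next
    case (Suc l)
    have "(y - z) * d (Suc (2 * Suc (Suc l))) = (y + z) * ((y - z) * d (Suc (2 * Suc l))) - (y - z) * d (Suc (2 * l))"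
      by (simp add: rec' algebra_simps)
    also have "\<dots> = ((y + z) * (y ^ Suc (Suc l) - z ^ Suc (Suc l) + y ^ Suc l - z ^ Suc l) -
        (y ^ Suc l - z ^ Suc l + y ^ l - z ^ l)) * d 1"
      using Suc by (simp only:) (simp add: algebra_simps)
    also have "(y + z) * (y ^ Suc (Suc l) - z ^ Suc (Suc l) + y ^ Suc l - z ^ Suc l) -
        (y ^ Suc l - z ^ Suc l + y ^ l - z ^ l) =
        y ^ Suc (Suc (Suc l)) - z ^ Suc (Suc (Suc l)) + y ^ Suc (Suc l) - z ^ Suc (Suc l)"
      by (simp add: algebra_simps yyz)
    finally show ?case using Suc by blast
  qed
  have zpow: "y ^ i * z ^ i = 1" for i using yz by (simp flip: power_mult_distrib)
  \<comment> \<open>\<open>y ^ m = 1\<close> identifies y^i with z^j for complementary exponents,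
    and this makes both closed forms vanish at m.\<close>
  have half: "y ^ i = z ^ j" if "i + j = m" for i j
  proof -
    have "y ^ i = y ^ i * (y ^ j * z ^ j)" by (simp add: zpow)
    also have "\<dots> = y ^ m * z ^ j" by (simp add: that[symmetric] power_add)
    finally show ?thesis using y by simp
  qed
  show ?thesis
  proof (cases "even m")
    case True
    then obtain l where l: "m = 2 * l" by auto
    have "(y - z) * d m = 0" using even[of l] half[of l l] l by simp
    then show ?thesis using nz by simp
  next
    case False
    then obtain l where l: "m = Suc (2 * l)" by (auto elim: oddE)
    have "(y - z) * d m = 0" using odd[of l] half[of "Suc l" l] half[of l "Suc l"] l by simp
    then show ?thesis using nz by simp
  qed
qed

section \<open>Two-dimensional Hecke modules over the algebraic closure\<close>

locale nonstandard = tensor_hecke W m s1 s2 H \<eta> T k + splitting_field m n \<phi> \<iota> \<zeta> sw sf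
  for W :: "('w, 'x) monoid_scheme" (structure) and m s1 s2
    and H :: "('h, 'y) ring_scheme" and \<eta> :: "laurent \<Rightarrow> 'h" and T :: "'w \<Rightarrow> 'h" and k
    and n and \<phi> :: "laurent \<Rightarrow> 'k::field" and \<iota> :: "'k \<Rightarrow> 'l::field" and \<zeta> sw sf +
  assumes n_def: "n = half_index m"
begin

lemmas lam_indep = lam_independent[OF m_ge_2 n_def]

abbreviation ph :: "laurent \<Rightarrow> 'l alg_closure" where "ph a \<equiv> emb (\<phi> a)"

definition dH :: "'l alg_closure" where "dH = ph (u_pow 1 - u_pow (-1)) / 2"
definition bH :: "'l alg_closure" where "bH = bE / 2"

lemma two_dH: "ph (u_pow 1 - u_pow (-1)) = 2 * dH" and two_bH: "bE = 2 * bH"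
  using two_four_E by (simp_all add: dH_def bH_def del: phi_simps emb_simps)

text \<open>[2]^2 - (u - 1/u)^2 = 4, divided by 4. This is the quadratic relation of T_s rewritten
  for the involution r_s.\<close>

lemma bH_square: "bH * bH = dH * dH + 1"
proof -
  have "u_pow 1 * u_pow (-1) = (1 :: laurent)"
    by (simp add: u_pow_def mult_single flip: single_one)
  then have uu: "ph (u_pow 1) * ph (u_pow (-1)) = 1" by (simp flip: phi_simps(4) emb_simps(4))
  have "bE * bE = (ph (u_pow 1 - u_pow (-1))) * (ph (u_pow 1 - u_pow (-1))) + 4"
    using uu by (simp add: quantum_two_def algebra_simps)
  then have "4 * (bH * bH) = 4 * (dH * dH + 1)"
    unfolding two_dH two_bH by (simp add: algebra_simps)
  then show ?thesis using two_four_E(2) mult_left_cancel by blast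
qed

text \<open>r_1 swaps the two coordinates and r_2 swaps them with the factors \<open>la\<close> and
  its inverse, so that r_1 r_2 is diagonal with entries \<open>la\<close> and its inverse.\<close>

definition N1 :: "'l alg_closure \<times> 'l alg_closure \<Rightarrow> 'l alg_closure \<times> 'l alg_closure" where
  "N1 v = (dH * fst v + bH * snd v, dH * snd v + bH * fst v)"

definition N2 :: "'l alg_closure \<Rightarrow> 'l alg_closure \<times> 'l alg_closure \<Rightarrow> 'l alg_closure \<times> 'l alg_closure" where
  "N2 la v = (dH * fst v + bH * inverse la * snd v, dH * snd v + bH * la * fst v)"

lemma N1_swap: "N1 v = N2 1 v"
  by (simp add: N1_def N2_def)

text \<open>Each product rule also appears with a trailing factor, so that it still applies after
  products have been reassociated to the right.\<close>

lemma field_facts: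
  assumes "la \<noteq> 0"
  shows "la * inverse la = 1" "la * (inverse la * x) = x"
    "bH * bH = dH * dH + 1" "bH * (bH * x) = dH * (dH * x) + x"
  using assms bH_square by (simp_all add: distrib_right flip: mult.assoc)

definition scE :: "laurent \<Rightarrow> 'l alg_closure \<times> 'l alg_closure \<Rightarrow> 'l alg_closure \<times> 'l alg_closure" where
  "scE a v = (ph a * fst v, ph a * snd v)"

lemma module_scE: "Modules.module scE"
  by unfold_locales (auto simp: scE_def algebra_simps)

lemma module_hom_N2: "Modules.module_hom scE scE (N2 la)"
proof -
  interpret Modules.module scE by (rule module_scE)
  show ?thesis
    by unfold_locales (auto simp: scE_def N2_def algebra_simps)
qed

lemma N2_square:
  assumes "la \<noteq> 0"
  shows "N2 la (N2 la v) = scE (u_pow 1 - u_pow (-1)) (N2 la v) + v"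
proof -
  define lb where "lb = inverse la"
  note lm = field_facts[OF assms, folded lb_def]
  show ?thesis
    by (cases v) (simp add: N2_def scE_def two_dH lb_def[symmetric] lm algebra_simps
        del: phi_simps emb_simps)
qed

text \<open>For \<open>la = 1\<close> the two operators agree. For \<open>la = - 1\<close> one has
  r_2 = -r_1, so they commute, and alternating words of equal even length coincide.\<close>

lemma braid_char:
  assumes "la = 1 \<or> la = - 1 \<and> even m"
  shows "alt m N1 (N2 la) v = alt m (N2 la) N1 v"
proof (cases "la = 1")
  case True
  then have "N1 = N2 la" using N1_swap by auto
  then show ?thesis by simp
next
  case False
  then have l: "la = - 1" "even m" using assms by auto
  have "alt (2 * i) N1 (N2 la) v = alt (2 * i) (N2 la) N1 v" for i
  proof (induction i)
    case (Suc i)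
    have "N1 (N2 la w) = N2 la (N1 w)" for w
      by (simp add: N1_def N2_def l algebra_simps)
    then show ?case using Suc by simp
  qed simp
  then show ?thesis using l(2) by (auto elim: evenE)
qed

text \<open>The products \<open>N1 (N2 la)\<close> and \<open>N2 la N1\<close> both have determinant
  1 and, by the hypothesis on \<open>la\<close>, trace y + 1/y. By Cayley-Hamilton the alternating
  words satisfy the recurrence of \<open>alternating_recurrence\<close>, which is applied to each
  coordinate.\<close>

lemma braid_generic:
  assumes l: "la \<noteq> 0" and y: "y \<noteq> 0" "y\<^sup>2 \<noteq> 1" "y ^ m = 1"
    and t: "bE\<^sup>2 * (la + inverse la + 2) = 4 * (2 + y + inverse y)"
  shows "alt m N1 (N2 la) v = alt m (N2 la) N1 v"
proof -
  define lb where "lb = inverse la"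
  define t' where "t' = y + inverse y"
  note lm = field_facts[OF l, folded lb_def]
  have "4 * (bH * bH * (la + lb + 2)) = 4 * (2 + t')"
    using t unfolding two_bH power2_eq_square lb_def t'_def by (simp add: mult_ac add_ac)
  then have "bH * bH * (la + lb + 2) = 2 + t'"
    using two_four_E(2) mult_left_cancel by blast
  then have t: "t' = bH * bH * (la + lb) + 2 * dH * dH"
    by (simp add: lm algebra_simps)
  \<comment> \<open>Matrix entries of \<open>N1\<close> after \<open>N2 la\<close>; in the opposite
    order the two diagonal entries change places.\<close>
  define A B C D where "A = bH * bH * la + dH * dH" and "B = bH * dH * (1 + lb)"
    and "C = bH * dH * (1 + la)" and "D = bH * bH * lb + dH * dH"
  have g: "N1 (N2 la (p, r)) = (A * p + B * r, C * p + D * r)"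
    "N2 la (N1 (p, r)) = (D * p + B * r, C * p + A * r)" for p r
    by (simp_all add: N1_def N2_def lb_def[symmetric] A_def B_def C_def D_def lm algebra_simps)
  have tr: "t' = A + D" by (simp add: t A_def D_def algebra_simps)
  have "A * D = 1 + B * C"
    by (simp add: A_def B_def C_def D_def lm algebra_simps)
  then have det: "A * D = 1 + B * C" "A * (D * x) = x + B * (C * x)" for x
    by (simp_all add: distrib_right flip: mult.assoc)
  have char: "fst (N1 (N2 la (N1 (N2 la w)))) = t' * fst (N1 (N2 la w)) - fst w \<and>
      snd (N1 (N2 la (N1 (N2 la w)))) = t' * snd (N1 (N2 la w)) - snd w \<and>
      fst (N2 la (N1 (N2 la (N1 w)))) = t' * fst (N2 la (N1 w)) - fst w \<and>
      snd (N2 la (N1 (N2 la (N1 w)))) = t' * snd (N2 la (N1 w)) - snd w" for w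
    by (cases w) (simp add: g tr det algebra_simps)
  have three: "fst (N1 (N2 la (N1 v))) - fst (N2 la (N1 (N2 la v))) = (t' + 1) * (fst (N1 v) - fst (N2 la v)) \<and>
     snd (N1 (N2 la (N1 v))) - snd (N2 la (N1 (N2 la v))) = (t' + 1) * (snd (N1 v) - snd (N2 la v))"
    by (cases v) (simp add: N1_def N2_def lb_def[symmetric] t lm algebra_simps)
  have zero: "pr (alt m N1 (N2 la) v) - pr (alt m (N2 la) N1 v) = 0" if pr: "pr = fst \<or> pr = snd" for pr
  proof (rule alternating_recurrence[where y = y and d = "\<lambda>i. pr (alt i N1 (N2 la) v) - pr (alt i (N2 la) N1 v)"])
    show "pr (alt (i + 4) N1 (N2 la) v) - pr (alt (i + 4) (N2 la) N1 v) =
        (y + inverse y) * (pr (alt (i + 2) N1 (N2 la) v) - pr (alt (i + 2) (N2 la) N1 v)) -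
        (pr (alt i N1 (N2 la) v) - pr (alt i (N2 la) N1 v))" for i
      using pr char[of "alt i N1 (N2 la) v"] char[of "alt i (N2 la) N1 v"] unfolding t'_def[symmetric]
      by (auto simp: numeral_eq_Suc right_diff_distrib)
    show "pr (alt 3 N1 (N2 la) v) - pr (alt 3 (N2 la) N1 v) =
        (y + inverse y + 1) * (pr (alt 1 N1 (N2 la) v) - pr (alt 1 (N2 la) N1 v))"
      using pr three unfolding t'_def[symmetric] by (auto simp: numeral_3_eq_3 One_nat_def)
  qed (use y in auto)
  show ?thesis using zero[of fst] zero[of snd] by (simp add: prod_eq_iff)
qed

text \<open>The admissible weights, m in number by \<open>card_LAM\<close>. A weight and its inverse
  give modules that differ by exchanging the coordinates, but the coefficients belong to different
  generating vectors, so both are needed for the count.\<close>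

definition LAM :: "'l alg_closure set" where
  "LAM = {1} \<union> (if even m then {- 1} else {}) \<union> lam ` {1..n} \<union> (\<lambda>i. inverse (lam i)) ` {1..n}"

lemma finite_LAM: "finite LAM"
  by (simp add: LAM_def)

lemma La_add: "La (\<lambda>i. c i + c' i) = La c * La c'"
  unfolding La_def prod.distrib[symmetric]
  by (intro prod.cong refl power_int_add) (auto simp: lam_nonzero)

lemma La_single: "i \<in> {1..n} \<Longrightarrow> La (\<lambda>j. if j = i then c else 0) = lam i powi c"
  unfolding La_def by (simp add: if_distrib[of "\<lambda>e. _ powi e"] prod.delta cong: if_cong)

lemma La_uminus: "La (\<lambda>i. - c i) = inverse (La c)"
  by (simp add: La_def power_int_minus flip: prod_inversef)

lemma La_independent: "La c \<in> {1, - 1} \<Longrightarrow> i \<in> {1..n} \<Longrightarrow> c i = 0"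
  using lam_indep[of c "La c" i] by (simp add: La_def)

lemma lam_distinct:
  assumes "i \<in> {1..n}"
  shows "lam i \<noteq> 1" "lam i \<noteq> - 1" "inverse (lam i) \<noteq> 1" "inverse (lam i) \<noteq> - 1"
    "l \<in> {1..n} \<Longrightarrow> lam i = lam l \<Longrightarrow> i = l" "l \<in> {1..n} \<Longrightarrow> lam i \<noteq> inverse (lam l)"
proof -
  show 1: "lam i \<noteq> 1" "lam i \<noteq> - 1"
    using La_single[OF assms, of 1] La_independent[of "\<lambda>j. if j = i then 1 else 0" i] assms by auto
  show "inverse (lam i) \<noteq> 1" using 1(1) by simp
  show "inverse (lam i) \<noteq> - 1" using 1(2) by (metis inverse_inverse_eq inverse_minus_eq inverse_1)
  have two: "La (\<lambda>j. (if j = i then 1 else 0) + (if j = l then c else 0)) = lam i * lam l powi c" if "l \<in> {1..n}" for l c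
    unfolding La_add using La_single[OF assms, of 1] La_single[OF that, of c] by simp
  show "i = l" if "l \<in> {1..n}" "lam i = lam l"
  proof (rule ccontr)
    assume "i \<noteq> l"
    have "La (\<lambda>j. (if j = i then 1 else 0) + (if j = l then - 1 else 0)) = 1"
      unfolding two[OF that(1)] using that lam_nonzero[OF that(1)] by (simp add: power_int_minus)
    then have "(if i = i then 1 else 0) + (if i = l then - 1 else 0) = (0::int)"
      using La_independent[OF _ assms, of "\<lambda>j. (if j = i then 1 else 0) + (if j = l then - 1 else 0)"] by simp
    then show False using \<open>i \<noteq> l\<close> by simp
  qed
  show "lam i \<noteq> inverse (lam l)" if "l \<in> {1..n}"
  proof
    assume "lam i = inverse (lam l)"
    then have "La (\<lambda>j. (if j = i then 1 else 0) + (if j = l then 1 else 0)) = 1"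
      unfolding two[OF that(1)] using lam_nonzero[OF that(1)] by simp
    then have "(if i = i then 1 else 0) + (if i = l then 1 else 0) = (0::int)"
      using La_independent[OF _ assms, of "\<lambda>j. (if j = i then 1 else 0) + (if j = l then 1 else 0)"] by simp
    then show False by (simp split: if_splits)
  qed
qed

lemma card_LAM: "card LAM = m"
proof -
  have "1 \<noteq> (- 1 :: 'l alg_closure)"
  proof
    assume "1 = (- 1 :: 'l alg_closure)"
    then have "1 + 1 = (0 :: 'l alg_closure)" by (simp add: eq_neg_iff_add_eq_0)
    then show False using two_four_E(1) by simp
  qed
  then have c1: "card ({1} \<union> (if even m then {- 1 :: 'l alg_closure} else {})) = (if even m then 2 else 1)"
    by (auto simp: card_insert_if)
  have inj: "inj_on lam {1..n}" by (rule inj_onI) (rule lam_distinct(5))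
  then have inj': "inj_on (\<lambda>i. inverse (lam i)) {1..n}" unfolding inj_on_def inverse_eq_iff_eq .
  have "card LAM = card ({1} \<union> (if even m then {- 1 :: 'l alg_closure} else {}) \<union> lam ` {1..n}) + card ((\<lambda>i. inverse (lam i)) ` {1..n})"
    unfolding LAM_def
  proof (intro card_Un_disjoint)
    show "({1} \<union> (if even m then {- 1} else {}) \<union> lam ` {1..n}) \<inter> (\<lambda>i. inverse (lam i)) ` {1..n} = {}"
    proof -
      have "inverse (lam i) \<notin> {1} \<union> (if even m then {- 1} else {}) \<union> lam ` {1..n}" if "i \<in> {1..n}" for i
        using lam_distinct(3,4)[OF that] lam_distinct(6)[OF _ that] by (auto split: if_splits) metis+
      then show ?thesis by (intro equals0I) (elim IntE imageE, simp only:)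
    qed
  qed auto
  also have "card ({1} \<union> (if even m then {- 1 :: 'l alg_closure} else {}) \<union> lam ` {1..n}) =
      card ({1} \<union> (if even m then {- 1 :: 'l alg_closure} else {})) + card (lam ` {1..n})"
  proof (intro card_Un_disjoint)
    show "({1} \<union> (if even m then {- 1} else {})) \<inter> lam ` {1..n} = {}"
    proof -
      have "lam i \<notin> {1} \<union> (if even m then {- 1} else {})" if "i \<in> {1..n}" for i
        using lam_distinct(1,2)[OF that] by auto
      then show ?thesis by (intro equals0I) (elim IntE imageE, simp only:)
    qed
  qed auto
  finally have "card LAM = (if even m then 2 else 1) + 2 * n"
    using card_image[OF inj] card_image[OF inj'] c1 by simp
  also have "\<dots> = m"
    using m_ge_2 n_def by (auto simp: half_index_def elim!: evenE oddE)
  finally show ?thesis .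
qed

lemma LAM_nonzero: "la \<in> LAM \<Longrightarrow> la \<noteq> 0"
  using lam_nonzero by (auto simp: LAM_def split: if_splits)

text \<open>For the weights lam_i and 1/lam_i the eigenvalue y of the product of the two generators
  is \<zeta>^i, and \<open>lam_sum\<close> is the required trace condition. The weights 1 and -1
  fall under \<open>braid_char\<close>.\<close>

lemma braid_LAM:
  assumes "la \<in> LAM"
  shows "alt m N1 (N2 la) v = alt m (N2 la) N1 v"
proof -
  have gen: "alt m N1 (N2 la) v = alt m (N2 la) N1 v"
    if i: "i \<in> {1..n}" and la: "la = lam i \<or> la = inverse (lam i)" for i
  proof (rule braid_generic[where y = "to_ac (\<zeta> ^ i)"])
    note z = zeta_power[OF m_ge_2 n_def] and nm = two_n_less[OF m_ge_2 n_def]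
    show "la \<noteq> 0" using la lam_nonzero[OF i] by auto
    show "to_ac (\<zeta> ^ i) \<noteq> 0" using z(3) by simp
    have "(\<zeta> ^ i)\<^sup>2 \<noteq> 1" using z(2)[of "i * 2"] i nm by (simp add: power_mult[symmetric])
    then show "(to_ac (\<zeta> ^ i))\<^sup>2 \<noteq> 1" by (metis to_ac_1 to_ac_eq_iff to_ac_power)
    have "(\<zeta> ^ i) ^ m = 1" using z(1) by (metis mult.commute power_mult power_one)
    then show "to_ac (\<zeta> ^ i) ^ m = 1" by (metis to_ac_1 to_ac_power)
    show "bE\<^sup>2 * (la + inverse la + 2) = 4 * (2 + to_ac (\<zeta> ^ i) + inverse (to_ac (\<zeta> ^ i)))"
      using lam_sum[OF i] la by (auto simp: w_val_def add.commute)
  qed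
  consider "la = 1" | "la = - 1" "even m" | i where "i \<in> {1..n}" "la = lam i \<or> la = inverse (lam i)"
    using assms by (auto simp: LAM_def split: if_splits)
  then show ?thesis
  proof cases
    case 1
    then show ?thesis by (intro braid_char) simp
  next
    case 2
    then show ?thesis by (intro braid_char) simp
  next
    case (3 i)
    then show ?thesis by (rule gen)
  qed
qed

text \<open>The orbit map h -> h (1, 0) of the module with weight \<open>la\<close>;
  \<open>hf\<close> names its two coordinates.\<close>

definition hv :: "'l alg_closure \<Rightarrow> 'h \<Rightarrow> 'l alg_closure \<times> 'l alg_closure" where
  "hv la = (SOME v. (\<forall>h\<in>carrier H. \<forall>h'\<in>carrier H. v (h \<oplus>\<^bsub>H\<^esub> h') = v h + v h') \<and>
     (\<forall>a. \<forall>h\<in>carrier H. v (\<eta> a \<otimes>\<^bsub>H\<^esub> h) = scE a (v h)) \<and>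
     (\<forall>h\<in>carrier H. v (T s1 \<otimes>\<^bsub>H\<^esub> h) = N1 (v h)) \<and>
     (\<forall>h\<in>carrier H. v (T s2 \<otimes>\<^bsub>H\<^esub> h) = N2 la (v h)) \<and> v \<one>\<^bsub>H\<^esub> = (1, 0))"

lemma hv:
  assumes "la \<in> LAM"
  shows "h \<in> carrier H \<Longrightarrow> h' \<in> carrier H \<Longrightarrow> hv la (h \<oplus>\<^bsub>H\<^esub> h') = hv la h + hv la h'"
    "h \<in> carrier H \<Longrightarrow> hv la (\<eta> a \<otimes>\<^bsub>H\<^esub> h) = scE a (hv la h)"
    "h \<in> carrier H \<Longrightarrow> hv la (T s1 \<otimes>\<^bsub>H\<^esub> h) = N1 (hv la h)"
    "h \<in> carrier H \<Longrightarrow> hv la (T s2 \<otimes>\<^bsub>H\<^esub> h) = N2 la (hv la h)"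
    "hv la \<one>\<^bsub>H\<^esub> = (1, 0)"
proof -
  have N: "N1 = N2 1" using N1_swap by auto
  have 1: "Modules.module_hom scE scE N1" "N1 (N1 v) = scE (u_pow 1 - u_pow (-1)) (N1 v) + v" for v
    unfolding N by (rule module_hom_N2) (rule N2_square, simp)
  obtain v where "\<And>h h'. h \<in> carrier H \<Longrightarrow> h' \<in> carrier H \<Longrightarrow> v (h \<oplus>\<^bsub>H\<^esub> h') = v h + v h'"
    "\<And>a h. h \<in> carrier H \<Longrightarrow> v (\<eta> a \<otimes>\<^bsub>H\<^esub> h) = scE a (v h)"
    "\<And>h. h \<in> carrier H \<Longrightarrow> v (T s1 \<otimes>\<^bsub>H\<^esub> h) = N1 (v h)"
    "\<And>h. h \<in> carrier H \<Longrightarrow> v (T s2 \<otimes>\<^bsub>H\<^esub> h) = N2 la (v h)"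
    "v \<one>\<^bsub>H\<^esub> = (1, 0)"
    using module_map_exists[OF 1(1) module_hom_N2 1(2) N2_square[OF LAM_nonzero[OF assms]] braid_LAM[OF assms]]
    by blast
  then have "\<exists>v. (\<forall>h\<in>carrier H. \<forall>h'\<in>carrier H. v (h \<oplus>\<^bsub>H\<^esub> h') = v h + v h') \<and>
     (\<forall>a. \<forall>h\<in>carrier H. v (\<eta> a \<otimes>\<^bsub>H\<^esub> h) = scE a (v h)) \<and>
     (\<forall>h\<in>carrier H. v (T s1 \<otimes>\<^bsub>H\<^esub> h) = N1 (v h)) \<and>
     (\<forall>h\<in>carrier H. v (T s2 \<otimes>\<^bsub>H\<^esub> h) = N2 la (v h)) \<and> v \<one>\<^bsub>H\<^esub> = (1, 0)"
    by blast
  note * = someI_ex[OF this, folded hv_def]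
  show "h \<in> carrier H \<Longrightarrow> h' \<in> carrier H \<Longrightarrow> hv la (h \<oplus>\<^bsub>H\<^esub> h') = hv la h + hv la h'"
    "h \<in> carrier H \<Longrightarrow> hv la (\<eta> a \<otimes>\<^bsub>H\<^esub> h) = scE a (hv la h)"
    "h \<in> carrier H \<Longrightarrow> hv la (T s1 \<otimes>\<^bsub>H\<^esub> h) = N1 (hv la h)"
    "h \<in> carrier H \<Longrightarrow> hv la (T s2 \<otimes>\<^bsub>H\<^esub> h) = N2 la (hv la h)"
    "hv la \<one>\<^bsub>H\<^esub> = (1, 0)"
    using * by blast+
qed

definition hf :: "'l alg_closure \<Rightarrow> bool \<Rightarrow> 'h \<Rightarrow> 'l alg_closure" where
  "hf la c h = (if c then fst (hv la h) else snd (hv la h))"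

lemma hf:
  assumes "la \<in> LAM"
  shows "semilinear ph (hf la c)"
    "h \<in> carrier H \<Longrightarrow> hf la c (T s1 \<otimes>\<^bsub>H\<^esub> h) = dH * hf la c h + bH * hf la (\<not> c) h"
    "h \<in> carrier H \<Longrightarrow> hf la c (T s2 \<otimes>\<^bsub>H\<^esub> h) =
       dH * hf la c h + bH * (if c then inverse la else la) * hf la (\<not> c) h"
    "hf la True \<one>\<^bsub>H\<^esub> = 1" "hf la False \<one>\<^bsub>H\<^esub> = 0"
  unfolding semilinear_def hf_def
  by (simp_all add: hv[OF assms] scE_def N1_def N2_def mult.assoc)

abbreviation hf_index :: "('l alg_closure \<times> bool) set" where "hf_index \<equiv> LAM \<times> UNIV"

text \<open>A relation on the basis holds on all of H. Evaluating it on powers of [2]^2 r_1 r_2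
  gives the power sums of the weights, and a further r_1 moves the second coordinate into view, so
  \<open>powers_independent\<close> applies to both halves.\<close>

lemma hf_independent:
  assumes c: "\<And>w. w \<in> carrier W \<Longrightarrow> (\<Sum>i\<in>hf_index. c i * hf (fst i) (snd i) (T w)) = 0"
    and i: "i \<in> hf_index"
  shows "c i = 0"
proof -
  have zero: "(\<Sum>i\<in>hf_index. c i * hf (fst i) (snd i) h) = 0" if "h \<in> carrier H" for h
    using that
  proof (induction h rule: H_basis_induct)
    case (scale a h)
    have "(\<Sum>i\<in>hf_index. c i * hf (fst i) (snd i) (\<eta> a \<otimes>\<^bsub>H\<^esub> h)) =
        ph a * (\<Sum>i\<in>hf_index. c i * hf (fst i) (snd i) h)"
      unfolding sum_distrib_left using hf(1) scale(1)
      by (intro sum.cong refl) (auto simp: semilinear_def)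
    then show ?case using scale by simp
  next
    case (add h h')
    have "(\<Sum>i\<in>hf_index. c i * hf (fst i) (snd i) (h \<oplus>\<^bsub>H\<^esub> h')) =
        (\<Sum>i\<in>hf_index. c i * hf (fst i) (snd i) h) + (\<Sum>i\<in>hf_index. c i * hf (fst i) (snd i) h')"
      unfolding sum.distrib[symmetric] using hf(1) add(1,2)
      by (intro sum.cong refl) (auto simp: semilinear_def distrib_left)
    then show ?case using add by simp
  qed (rule c)
  \<comment> \<open>2 T_s - (u - 1/u) = [2] r_s, so \<open>g s\<close> acts as [2] r_s without any
    division by 2 in H.\<close>
  define g where "g s h = T s \<otimes>\<^bsub>H\<^esub> h \<oplus>\<^bsub>H\<^esub> (T s \<otimes>\<^bsub>H\<^esub> h \<oplus>\<^bsub>H\<^esub> \<eta> (u_pow (-1) - u_pow 1) \<otimes>\<^bsub>H\<^esub> h)" for s h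
  have g_closed: "g s1 h \<in> carrier H" "g s2 h \<in> carrier H" if "h \<in> carrier H" for h
    using that by (simp_all add: g_def s1_closed s2_closed)
  have ph_neg: "ph (u_pow (-1) - u_pow 1) = - (2 * dH)"
    using two_dH by (simp add: algebra_simps)
  have g: "hf la c' (g s1 h) = bE * hf la (\<not> c') h"
    "hf la c' (g s2 h) = bE * (if c' then inverse la else la) * hf la (\<not> c') h"
    if "h \<in> carrier H" "la \<in> LAM" for la c' h
    using that(1) hf(1)[OF that(2), of c'] hf(2,3)[OF that(2,1)]
    unfolding g_def semilinear_def two_bH
    by (simp_all add: s1_closed s2_closed ph_neg algebra_simps del: phi_simps emb_simps)
  define x where "x j = ((\<lambda>h. g s1 (g s2 h)) ^^ j) \<one>\<^bsub>H\<^esub>" for j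
  have x: "x j \<in> carrier H \<and> (\<forall>la\<in>LAM. hf la True (x j) = (bE\<^sup>2) ^ j * la ^ j \<and> hf la False (x j) = 0)" for j
    by (induction j) (auto simp: x_def g_closed g hf power2_eq_square)
  have split: "(\<Sum>i\<in>hf_index. c i * hf (fst i) (snd i) h) =
      (\<Sum>la\<in>LAM. c (la, True) * hf la True h) + (\<Sum>la\<in>LAM. c (la, False) * hf la False h)" for h
  proof -
    have "(\<Sum>i\<in>hf_index. c i * hf (fst i) (snd i) h) = (\<Sum>(la, c')\<in>hf_index. c (la, c') * hf la c' h)"
      by (intro sum.cong) auto
    also have "\<dots> = (\<Sum>la\<in>LAM. \<Sum>c'\<in>UNIV. c (la, c') * hf la c' h)"
      by (rule sum.cartesian_product[symmetric])
    finally show ?thesis by (simp add: UNIV_bool sum.distrib add.commute)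
  qed
  have b: "(bE\<^sup>2) ^ j \<noteq> 0" for j using bE_nonzero by simp
  obtain la c' where i': "i = (la, c')" "la \<in> LAM" using i by auto
  have "c (la, True) = 0"
  proof (rule powers_independent[OF finite_LAM _ i'(2)])
    fix j
    have "(bE\<^sup>2) ^ j * (\<Sum>la\<in>LAM. c (la, True) * la ^ j) = 0"
      using zero[of "x j"] x[of j] unfolding split by (simp add: sum_distrib_left mult_ac)
    then show "(\<Sum>la\<in>LAM. c (la, True) * la ^ j) = 0"
      using b[of j] mult_eq_0_iff by blast
  qed
  moreover have "c (la, False) = 0"
  proof (rule powers_independent[OF finite_LAM _ i'(2)])
    fix j
    have "bE * (bE\<^sup>2) ^ j * (\<Sum>la\<in>LAM. c (la, False) * la ^ j) = 0"
      using zero[of "g s1 (x j)"] x[of j] unfolding split by (simp add: g_closed g sum_distrib_left mult_ac)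
    moreover have "bE * (bE\<^sup>2) ^ j \<noteq> 0" using b[of j] bE_nonzero mult_eq_0_iff by blast
    ultimately show "(\<Sum>la\<in>LAM. c (la, False) * la ^ j) = 0" using mult_eq_0_iff by blast
  qed
  ultimately show ?thesis using i' by (cases c') auto
qed

text \<open>2m independent functionals on a module of rank 2m span its dual over the
  closure.\<close>

lemma coef_combination:
  assumes w0: "w0 \<in> carrier W"
  shows "\<exists>\<alpha>. \<forall>h\<in>carrier H. ph (coef h w0) = (\<Sum>i\<in>hf_index. \<alpha> i * hf (fst i) (snd i) h)"
proof -
  have "card hf_index = 2 * m" by (simp add: card_LAM card_cartesian_product)
  then have card: "card (carrier W) \<le> card hf_index" using order_W by (simp add: order_def)
  have "\<exists>\<alpha>. \<forall>w\<in>carrier W. (\<Sum>i\<in>hf_index. \<alpha> i * hf (fst i) (snd i) (T w)) = (if w = w0 then 1 else 0)"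
    by (rule independent_rows_span[OF _ finite_carrier_W card _ w0])
      (use finite_LAM hf_independent in auto)
  then obtain \<alpha> where \<alpha>: "\<And>w. w \<in> carrier W \<Longrightarrow>
      (\<Sum>i\<in>hf_index. \<alpha> i * hf (fst i) (snd i) (T w)) = (if w = w0 then 1 else 0)" by blast
  have "ph (coef h w0) = (\<Sum>i\<in>hf_index. \<alpha> i * hf (fst i) (snd i) h)" if "h \<in> carrier H" for h
    using that
  proof (induction h rule: H_basis_induct)
    case (T w)
    then show ?case using w0 by (simp add: coef_T \<alpha>)
  next
    case (scale a h)
    have "(\<Sum>i\<in>hf_index. \<alpha> i * hf (fst i) (snd i) (\<eta> a \<otimes>\<^bsub>H\<^esub> h)) =
        ph a * (\<Sum>i\<in>hf_index. \<alpha> i * hf (fst i) (snd i) h)"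
      unfolding sum_distrib_left using hf(1) scale(1)
      by (intro sum.cong refl) (auto simp: semilinear_def)
    then show ?case using scale w0 by (simp add: coef_scale)
  next
    case (add h h')
    have "(\<Sum>i\<in>hf_index. \<alpha> i * hf (fst i) (snd i) (h \<oplus>\<^bsub>H\<^esub> h')) =
        (\<Sum>i\<in>hf_index. \<alpha> i * hf (fst i) (snd i) h) + (\<Sum>i\<in>hf_index. \<alpha> i * hf (fst i) (snd i) h')"
      unfolding sum.distrib[symmetric] using hf(1) add(1,2)
      by (intro sum.cong refl) (auto simp: semilinear_def distrib_left)
    then show ?case using add w0 by (simp add: coef_add)
  qed
  then show ?thesis by blast
qed

section \<open>Matrix coefficients on the tensor power\<close>

definition Ph :: "(nat \<Rightarrow> 'l alg_closure) \<Rightarrow> (nat \<Rightarrow> bool) \<Rightarrow> ((nat \<Rightarrow> 'h) \<Rightarrow>\<^sub>0 int) set \<Rightarrow> 'l alg_closure" where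
  "Ph la c = tfun (\<lambda>i. hf (la i) (c i))"

lemma hf_family: "la \<in> {1..k} \<rightarrow> LAM \<Longrightarrow> semilinear_family ph (\<lambda>i. hf (la i) (c i))"
  using hf(1) by (auto simp: semilinear_family_def)

lemma Ph:
  assumes "la \<in> {1..k} \<rightarrow> LAM"
  shows "additive (Ph la c)" "h \<in> {1..k} \<rightarrow> carrier H \<Longrightarrow> Ph la c (pur h) = (\<Prod>i=1..k. hf (la i) (c i) (h i))"
    "x \<in> carrier TT \<Longrightarrow> Ph la c (scal a \<otimes>\<^bsub>TT\<^esub> x) = ph a * Ph la c x"
  unfolding Ph_def using tfun[OF hf_family[OF assms]] tfun_scal[OF hf_family[OF assms]] by blast+

lemma Ph_one:
  assumes "la \<in> {1..k} \<rightarrow> LAM"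
  shows "Ph la (\<lambda>_. True) \<one>\<^bsub>TT\<^esub> = 1" "Ph la (\<lambda>_. False) \<one>\<^bsub>TT\<^esub> = 0"
proof -
  have l: "la i \<in> LAM" if "i \<in> {1..k}" for i using assms that by auto
  have "Ph la c \<one>\<^bsub>TT\<^esub> = (\<Prod>i=1..k. hf (la i) (c i) \<one>\<^bsub>H\<^esub>)" for c
    unfolding pur_one[symmetric] by (rule Ph(2)[OF assms]) auto
  then show "Ph la (\<lambda>_. True) \<one>\<^bsub>TT\<^esub> = 1" "Ph la (\<lambda>_. False) \<one>\<^bsub>TT\<^esub> = 0"
    using l k_pos by (auto simp: hf)
qed

text \<open>The scalar that appears when r_2, acting in all positions at once, flips every position
  of c; for r_1 it is 1.\<close>

definition flip_weight :: "(nat \<Rightarrow> 'l alg_closure) \<Rightarrow> (nat \<Rightarrow> bool) \<Rightarrow> 'l alg_closure" where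
  "flip_weight la c = (\<Prod>i=1..k. if c i then inverse (la i) else la i)"

lemma flip_weight_not: "flip_weight la (\<lambda>i. \<not> c i) = inverse (flip_weight la c)"
  unfolding flip_weight_def prod_inversef[symmetric] by (intro prod.cong) auto

lemma flip_weight_nonzero: "la \<in> {1..k} \<rightarrow> LAM \<Longrightarrow> flip_weight la c \<noteq> 0"
  using LAM_nonzero by (auto simp: flip_weight_def split: if_splits)

text \<open>The generators flip all positions simultaneously, so they couple c only with its
  complement. The 2^k coordinates thus fall into pairs, which is why only modules of dimension at
  most two occur.\<close>

lemma Ph_nsP:
  assumes la: "la \<in> {1..k} \<rightarrow> LAM" and y: "y \<in> carrier TT"
  shows "2 * Ph la c (nsP H \<eta> T k s1 \<otimes>\<^bsub>TT\<^esub> y) = bE ^ k * (Ph la c y + Ph la (\<lambda>i. \<not> c i) y)"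
    "2 * Ph la c (nsP H \<eta> T k s2 \<otimes>\<^bsub>TT\<^esub> y) = bE ^ k * (Ph la c y + flip_weight la c * Ph la (\<lambda>i. \<not> c i) y)"
proof -
  have l: "la i \<in> LAM" if "i \<in> {1..k}" for i using la that by auto
  have dH2: "2 * dH = ph (u_pow 1) - ph (u_pow (-1))" using two_dH by simp
  have "2 * Ph la c (nsP H \<eta> T k s1 \<otimes>\<^bsub>TT\<^esub> y) =
      bE ^ k * Ph la c y + (\<Prod>i=1..k. 2 * bH) * Ph la (\<lambda>i. \<not> c i) y"
    unfolding Ph_def
    by (rule tfun_nsP[OF hf_family[OF la] hf_family[OF la], where \<gamma> = "\<lambda>_. dH"])
      (use y dH2 hf(2) l in auto)
  then show "2 * Ph la c (nsP H \<eta> T k s1 \<otimes>\<^bsub>TT\<^esub> y) = bE ^ k * (Ph la c y + Ph la (\<lambda>i. \<not> c i) y)"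
    by (simp add: two_bH[symmetric] distrib_left)
  have "2 * Ph la c (nsP H \<eta> T k s2 \<otimes>\<^bsub>TT\<^esub> y) =
      bE ^ k * Ph la c y + (\<Prod>i=1..k. 2 * (bH * (if c i then inverse (la i) else la i))) * Ph la (\<lambda>i. \<not> c i) y"
    unfolding Ph_def
    by (rule tfun_nsP[OF hf_family[OF la] hf_family[OF la], where \<gamma> = "\<lambda>_. dH"])
      (use y dH2 hf(3) l in auto)
  also have "(\<Prod>i=1..k. 2 * (bH * (if c i then inverse (la i) else la i))) = bE ^ k * flip_weight la c"
    unfolding mult.assoc[symmetric] two_bH[symmetric] by (simp add: prod.distrib flip_weight_def)
  finally show "2 * Ph la c (nsP H \<eta> T k s2 \<otimes>\<^bsub>TT\<^esub> y) = bE ^ k * (Ph la c y + flip_weight la c * Ph la (\<lambda>i. \<not> c i) y)"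
    by (simp add: distrib_left mult.assoc)
qed

text \<open>On pure tensors a coordinate is a product of coordinates of the factors, so multiplying
  out the k expansions from \<open>coef_combination\<close> gives the result.\<close>

lemma crd_combination:
  assumes \<beta>: "\<beta> \<in> tensor_index"
  shows "\<exists>\<alpha>. \<forall>x\<in>carrier TT. ph (crd \<beta> x) =
     (\<Sum>\<tau>\<in>{1..k} \<rightarrow>\<^sub>E hf_index. \<alpha> \<tau> * Ph (\<lambda>i. fst (\<tau> i)) (\<lambda>i. snd (\<tau> i)) x)"
proof -
  have "\<forall>i\<in>{1..k}. \<exists>\<alpha>. \<forall>h\<in>carrier H. ph (coef h (\<beta> i)) = (\<Sum>j\<in>hf_index. \<alpha> j * hf (fst j) (snd j) h)"
    using coef_combination PiE_mem[OF \<beta>] by blast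
  from bchoice[OF this] obtain \<alpha> where \<alpha>': "\<forall>i\<in>{1..k}. \<forall>h\<in>carrier H.
      ph (coef h (\<beta> i)) = (\<Sum>j\<in>hf_index. \<alpha> i j * hf (fst j) (snd j) h)" ..
  then have \<alpha>: "ph (coef h (\<beta> i)) = (\<Sum>j\<in>hf_index. \<alpha> i j * hf (fst j) (snd j) h)"
    if "i \<in> {1..k}" "h \<in> carrier H" for i h using that by blast
  let ?S = "{1..k} \<rightarrow>\<^sub>E hf_index"
  have l: "(\<lambda>i. fst (\<tau> i)) \<in> {1..k} \<rightarrow> LAM" if "\<tau> \<in> ?S" for \<tau>
    using that by (auto simp: PiE_iff mem_Times_iff)
  have phprod: "ph (prod f A) = (\<Prod>a\<in>A. ph (f a))" for f and A :: "nat set"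
    by (induction A rule: infinite_finite_induct) auto
  have "ph (crd \<beta> x) = (\<Sum>\<tau>\<in>?S. (\<Prod>i=1..k. \<alpha> i (\<tau> i)) * Ph (\<lambda>i. fst (\<tau> i)) (\<lambda>i. snd (\<tau> i)) x)"
    if "x \<in> carrier TT" for x
    using that
  proof (induction x rule: TT_induct)
    case (pur h)
    have "ph (crd \<beta> (pur h)) = (\<Prod>i=1..k. ph (coef (h i) (\<beta> i)))"
      using crd(2)[OF \<beta> pur] by (simp only: phprod)
    also have "\<dots> = (\<Prod>i=1..k. \<Sum>j\<in>hf_index. \<alpha> i j * hf (fst j) (snd j) (h i))"
      using pur by (intro prod.cong refl \<alpha>) auto
    also have "\<dots> = (\<Sum>\<tau>\<in>?S. \<Prod>i=1..k. \<alpha> i (\<tau> i) * hf (fst (\<tau> i)) (snd (\<tau> i)) (h i))"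
      by (rule prod_sum_PiE) (auto simp: finite_LAM)
    also have "\<dots> = (\<Sum>\<tau>\<in>?S. (\<Prod>i=1..k. \<alpha> i (\<tau> i)) * Ph (\<lambda>i. fst (\<tau> i)) (\<lambda>i. snd (\<tau> i)) (pur h))"
      by (intro sum.cong refl) (simp only: Ph(2)[OF l pur] prod.distrib)
    finally show ?case .
  next
    case (add x y)
    have "(\<Sum>\<tau>\<in>?S. (\<Prod>i=1..k. \<alpha> i (\<tau> i)) * Ph (\<lambda>i. fst (\<tau> i)) (\<lambda>i. snd (\<tau> i)) (x \<oplus>\<^bsub>TT\<^esub> y)) =
       (\<Sum>\<tau>\<in>?S. (\<Prod>i=1..k. \<alpha> i (\<tau> i)) * Ph (\<lambda>i. fst (\<tau> i)) (\<lambda>i. snd (\<tau> i)) x) +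
       (\<Sum>\<tau>\<in>?S. (\<Prod>i=1..k. \<alpha> i (\<tau> i)) * Ph (\<lambda>i. fst (\<tau> i)) (\<lambda>i. snd (\<tau> i)) y)"
      unfolding sum.distrib[symmetric]
      by (intro sum.cong refl) (simp add: additiveD(1)[OF Ph(1)[OF l] add(1,2)] distrib_left)
    then show ?case using add additiveD(1)[OF crd(1)[OF \<beta>] add(1,2)] by simp
  next
    case (neg x)
    have "(\<Sum>\<tau>\<in>?S. (\<Prod>i=1..k. \<alpha> i (\<tau> i)) * Ph (\<lambda>i. fst (\<tau> i)) (\<lambda>i. snd (\<tau> i)) (\<ominus>\<^bsub>TT\<^esub> x)) =
       - (\<Sum>\<tau>\<in>?S. (\<Prod>i=1..k. \<alpha> i (\<tau> i)) * Ph (\<lambda>i. fst (\<tau> i)) (\<lambda>i. snd (\<tau> i)) x)"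
      unfolding sum_negf[symmetric]
      by (intro sum.cong refl) (simp add: additiveD(3)[OF Ph(1)[OF l] neg(1)])
    then show ?case using neg additiveD(3)[OF crd(1)[OF \<beta>] neg(1)] by simp
  qed
  then show ?thesis by (intro exI[of _ "\<lambda>\<tau>. \<Prod>i=1..k. \<alpha> i (\<tau> i)"]) blast
qed

end

section \<open>Scalar extension of the nonstandard Hecke algebra\<close>

context nonstandard
begin

abbreviation p1 where "p1 \<equiv> nsP H \<eta> T k s1"
abbreviation p2 where "p2 \<equiv> nsP H \<eta> T k s2"
abbreviation NH where "NH \<equiv> nonstandard_hecke H \<eta> T k s1 s2"
abbreviation KH where "KH \<equiv> K_nonstandard_hecke \<phi> H \<eta> T k s1 s2"
abbreviation kp where "kp \<equiv> K_pure \<phi> H \<eta> T k s1 s2"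
abbreviation kap where "kap \<equiv> K_scalar \<phi> H \<eta> T k s1 s2"

lemma NH_carrier: "carrier NH = generate_ring TT (range scal \<union> {p1, p2})"
  and NH_simps [simp]: "x \<otimes>\<^bsub>NH\<^esub> y = x \<otimes>\<^bsub>TT\<^esub> y" "x \<oplus>\<^bsub>NH\<^esub> y = x \<oplus>\<^bsub>TT\<^esub> y"
    "\<one>\<^bsub>NH\<^esub> = \<one>\<^bsub>TT\<^esub>" "\<zero>\<^bsub>NH\<^esub> = \<zero>\<^bsub>TT\<^esub>"
  by (simp_all add: nonstandard_hecke_def generated_subalgebra_def)

lemma NH_gens: "range scal \<union> {p1, p2} \<subseteq> carrier TT"
  by auto

lemma NH_subset: "x \<in> carrier NH \<Longrightarrow> x \<in> carrier TT"
  using TT.generate_ring_in_carrier[OF NH_gens] by (simp add: NH_carrier)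

sublocale NH: ring NH
  unfolding nonstandard_hecke_def generated_subalgebra_def by (rule TT.generate_ring_is_ring[OF NH_gens])

lemma NH_uminus: "x \<in> carrier NH \<Longrightarrow> \<ominus>\<^bsub>NH\<^esub> x = \<ominus>\<^bsub>TT\<^esub> x"
  using NH.l_neg[of x] NH_subset[of x] NH_subset[of "\<ominus>\<^bsub>NH\<^esub> x"] NH.a_inv_closed[of x]
  by (intro TT.minus_equality[symmetric]) simp_all

lemma NH_mem: "scal a \<in> carrier NH" "p1 \<in> carrier NH" "p2 \<in> carrier NH"
  unfolding NH_carrier by (auto intro: generate_ring.incl)

abbreviation KG where "KG \<equiv> (univ_ring :: 'k ring) \<times>\<times> NH"

lemma KG_simps [simp]:
  "carrier KG = UNIV \<times> carrier NH" "x \<otimes>\<^bsub>KG\<^esub> y = (fst x * fst y, snd x \<otimes>\<^bsub>NH\<^esub> snd y)"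
  "\<one>\<^bsub>KG\<^esub> = (1, \<one>\<^bsub>NH\<^esub>)"
  by (simp_all add: DirProd_def case_prod_beta)

definition KR3 :: "(('k \<times> ((nat \<Rightarrow> 'h) \<Rightarrow>\<^sub>0 int) set) \<times> ('k \<times> ((nat \<Rightarrow> 'h) \<Rightarrow>\<^sub>0 int) set) \<times> ('k \<times> ((nat \<Rightarrow> 'h) \<Rightarrow>\<^sub>0 int) set)) set" where
  "KR3 = {((c + c', x), (c, x), (c', x)) | c c' x. x \<in> carrier NH} \<union>
     {((c, x \<oplus>\<^bsub>NH\<^esub> x'), (c, x), (c, x')) | c x x'. x \<in> carrier NH \<and> x' \<in> carrier NH}"

definition KR2 :: "(('k \<times> ((nat \<Rightarrow> 'h) \<Rightarrow>\<^sub>0 int) set) \<times> ('k \<times> ((nat \<Rightarrow> 'h) \<Rightarrow>\<^sub>0 int) set)) set" where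
  "KR2 = {((\<phi> a * c, x), (c, scal a \<otimes>\<^bsub>NH\<^esub> x)) | a c x. x \<in> carrier NH}"

sublocale KP: presented_ring KG KR3 KR2
proof (intro presented_ring.intro presented_ring_axioms.intro)
  show "monoid KG"
    by (rule monoidI)
      (auto simp del: NH_simps simp: NH.m_assoc mult.assoc)
  show "a \<in> carrier KG \<and> b \<in> carrier KG \<and> c \<in> carrier KG" if "(a, b, c) \<in> KR3" for a b c
    using that by (auto simp del: NH_simps simp: KR3_def)
  show "a \<in> carrier KG \<and> b \<in> carrier KG" if "(a, b) \<in> KR2" for a b
    using that NH_mem(1) by (auto simp del: NH_simps simp: KR2_def)
qed

lemma KP_rels: "KP.rels = tensor2_relations \<phi> univ_ring scal NH"
proof -
  have "{frag_of a - frag_of b - frag_of c | a b c. (a, b, c) \<in> KR3} =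
      {frag_of (x + x', y) - frag_of (x, y) - frag_of (x', y) | x x' y. y \<in> carrier NH} \<union>
      {frag_of (x, y \<oplus>\<^bsub>NH\<^esub> y') - frag_of (x, y) - frag_of (x, y') | x y y'. y \<in> carrier NH \<and> y' \<in> carrier NH}"
    unfolding KR3_def by blast
  moreover have "{frag_of a - frag_of b | a b. (a, b) \<in> KR2} =
      {frag_of (\<phi> a * x, y) - frag_of (x, scal a \<otimes>\<^bsub>NH\<^esub> y) | a x y. y \<in> carrier NH}"
    unfolding KR2_def by blast
  ultimately show ?thesis
    unfolding KP.rels_def tensor2_relations_def by (simp del: NH_simps)
qed

lemma KP_Q: "KP.Q = KH"
  by (simp add: KP.Q_def K_nonstandard_hecke_def tensor2_def tensor2_ideal_def KP_rels)

lemma KP_cl: "KP.cl (c, x) = kp c x"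
  by (simp add: KP.proj_def K_pure_def pure2_def tensor2_ideal_def KP_rels)

sublocale KH: ring KH
  using KP.Q.ring_axioms by (simp add: KP_Q)

lemma kp_closed [simp]: "x \<in> carrier NH \<Longrightarrow> kp c x \<in> carrier KH"
  using KP.cl_closed[of "(c, x)"] by (simp add: KP_cl KP_Q)

lemma kp_mult: "x \<in> carrier NH \<Longrightarrow> y \<in> carrier NH \<Longrightarrow> kp c x \<otimes>\<^bsub>KH\<^esub> kp d y = kp (c * d) (x \<otimes>\<^bsub>TT\<^esub> y)"
  using KP.cl_mult[of "(c, x)" "(d, y)"] by (simp add: KP_cl KP_Q)

lemma kp_one: "kp 1 \<one>\<^bsub>TT\<^esub> = \<one>\<^bsub>KH\<^esub>"
  using KP.cl_one by (simp add: KP_cl KP_Q)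

lemma kp_add_left: "x \<in> carrier NH \<Longrightarrow> kp (c + d) x = kp c x \<oplus>\<^bsub>KH\<^esub> kp d x"
proof -
  assume "x \<in> carrier NH"
  then have "((c + d, x), (c, x), (d, x)) \<in> KR3" unfolding KR3_def by blast
  from KP.cl_R3[OF this] show ?thesis by (simp only: KP_cl KP_Q)
qed

lemma kp_add_right:
  "x \<in> carrier NH \<Longrightarrow> y \<in> carrier NH \<Longrightarrow> kp c (x \<oplus>\<^bsub>TT\<^esub> y) = kp c x \<oplus>\<^bsub>KH\<^esub> kp c y"
proof -
  assume "x \<in> carrier NH" "y \<in> carrier NH"
  then have "((c, x \<oplus>\<^bsub>NH\<^esub> y), (c, x), (c, y)) \<in> KR3" unfolding KR3_def by blast
  from KP.cl_R3[OF this] show ?thesis by (simp only: KP_cl KP_Q NH_simps)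
qed

lemma kp_scal: "x \<in> carrier NH \<Longrightarrow> kp c (scal a \<otimes>\<^bsub>TT\<^esub> x) = kp (\<phi> a * c) x"
proof -
  assume "x \<in> carrier NH"
  then have "((\<phi> a * c, x), (c, scal a \<otimes>\<^bsub>NH\<^esub> x)) \<in> KR2" unfolding KR2_def by blast
  from KP.cl_R2[OF this] show ?thesis by (simp only: KP_cl KP_Q NH_simps)
qed

lemma kp_zero_left: "x \<in> carrier NH \<Longrightarrow> kp 0 x = \<zero>\<^bsub>KH\<^esub>"
  using kp_add_left[of x 0 0] kp_closed[of x 0] by (metis KH.add.l_cancel_one' add_0)

lemma kp_zero_right: "kp c \<zero>\<^bsub>TT\<^esub> = \<zero>\<^bsub>KH\<^esub>"
  using kp_add_right[of "\<zero>\<^bsub>NH\<^esub>" "\<zero>\<^bsub>NH\<^esub>" c] kp_closed[OF NH.zero_closed, of c] NH.zero_closed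
  by (metis KH.add.l_cancel_one' NH_simps(4) TT.l_zero TT.zero_closed)

lemma kp_minus_left: "x \<in> carrier NH \<Longrightarrow> kp (- c) x = \<ominus>\<^bsub>KH\<^esub> kp c x"
  using kp_add_left[of x "- c" c] kp_zero_left[of x] by (intro KH.minus_equality[symmetric]) auto

lemma kp_minus_right: "x \<in> carrier NH \<Longrightarrow> kp c (\<ominus>\<^bsub>TT\<^esub> x) = \<ominus>\<^bsub>KH\<^esub> kp c x"
proof -
  assume x: "x \<in> carrier NH"
  have m: "\<ominus>\<^bsub>TT\<^esub> x \<in> carrier NH" using NH.a_inv_closed[OF x] NH_uminus[OF x] by metis
  have "kp c (\<ominus>\<^bsub>TT\<^esub> x) \<oplus>\<^bsub>KH\<^esub> kp c x = kp c (\<ominus>\<^bsub>TT\<^esub> x \<oplus>\<^bsub>TT\<^esub> x)"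
    by (rule kp_add_right[OF m x, symmetric])
  also have "\<dots> = \<zero>\<^bsub>KH\<^esub>" using NH_subset[OF x] by (simp add: TT.l_neg kp_zero_right)
  finally show ?thesis using x m by (intro KH.minus_equality[symmetric]) simp_all
qed

lemma kap_eq: "kap c = kp c \<one>\<^bsub>TT\<^esub>"
  by (simp add: K_scalar_def)

lemma one_NH: "\<one>\<^bsub>TT\<^esub> \<in> carrier NH"
  by (simp add: NH_carrier generate_ring.one)

lemma kap_closed [simp]: "kap c \<in> carrier KH"
  unfolding kap_eq by (rule kp_closed) (rule one_NH)

lemma kap_kp: "x \<in> carrier NH \<Longrightarrow> kap c \<otimes>\<^bsub>KH\<^esub> kp d x = kp (c * d) x"
  unfolding kap_eq using kp_mult[OF one_NH] NH_subset by simp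

text \<open>Negatives have no case of their own because they can be moved into the scalar from
  K.\<close>

lemma KH_induct [consumes 1, case_names kp add]:
  assumes "z \<in> carrier KH"
    and kp: "\<And>c x. x \<in> carrier NH \<Longrightarrow> P (kp c x)"
    and add: "\<And>y z. y \<in> carrier KH \<Longrightarrow> z \<in> carrier KH \<Longrightarrow> P y \<Longrightarrow> P z \<Longrightarrow> P (y \<oplus>\<^bsub>KH\<^esub> z)"
  shows "P z"
proof -
  have "P z \<and> P (\<ominus>\<^bsub>KH\<^esub> z)"
    using assms(1)[folded KP_Q]
  proof (induction z rule: KP.Q_induct)
    case (cl g)
    then obtain c x where "g = (c, x)" "x \<in> carrier NH" by auto
    then show ?case using kp[of x c] kp[of x "- c"] by (simp add: KP_cl kp_minus_left)
  next
    case (add x y)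
    then show ?case using assms(3)[of x y] assms(3)[of "\<ominus>\<^bsub>KH\<^esub> x" "\<ominus>\<^bsub>KH\<^esub> y"] by (simp add: KP_Q KH.minus_add)
  next
    case (neg x)
    then show ?case by (simp add: KP_Q)
  qed
  then show ?thesis ..
qed

lemma KH_gen_induct [consumes 1, case_names kap P1 P2 add mult]:
  assumes "z \<in> carrier KH"
    and kap: "\<And>c. P (kap c)" and P1: "P (kp 1 p1)" and P2: "P (kp 1 p2)"
    and add: "\<And>y z. y \<in> carrier KH \<Longrightarrow> z \<in> carrier KH \<Longrightarrow> P y \<Longrightarrow> P z \<Longrightarrow> P (y \<oplus>\<^bsub>KH\<^esub> z)"
    and mult: "\<And>y z. y \<in> carrier KH \<Longrightarrow> z \<in> carrier KH \<Longrightarrow> P y \<Longrightarrow> P z \<Longrightarrow> P (y \<otimes>\<^bsub>KH\<^esub> z)"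
  shows "P z"
  using assms(1)
proof (induction z rule: KH_induct)
  case (kp c x)
  have "P (kp 1 x)"
    using kp[unfolded NH_carrier]
  proof (induction x rule: generate_ring.induct)
    case one
    then show ?case using kap[of 1] by (simp add: kap_eq)
  next
    case (incl h)
    have "kp 1 (scal a) = kap (\<phi> a)" for a
      using kp_scal[OF one_NH, of 1 a] by (simp add: kap_eq)
    then show ?case using incl kap P1 P2 by auto
  next
    case (a_inv h)
    then have h: "h \<in> carrier NH" by (simp add: NH_carrier)
    have "kp 1 (\<ominus>\<^bsub>TT\<^esub> h) = kap (- 1) \<otimes>\<^bsub>KH\<^esub> kp 1 h"
      using kp_minus_right[OF h, of 1] kp_minus_left[OF h, of 1] kap_kp[OF h, of "- 1" 1] by simp
    then show ?case using a_inv h by (simp add: mult kap)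
  next
    case (eng_add h1 h2)
    then have h: "h1 \<in> carrier NH" "h2 \<in> carrier NH" by (simp_all add: NH_carrier)
    then show ?case using eng_add by (simp add: kp_add_right add)
  next
    case (eng_mult h1 h2)
    then have h: "h1 \<in> carrier NH" "h2 \<in> carrier NH" by (simp_all add: NH_carrier)
    then have "kp 1 (h1 \<otimes>\<^bsub>TT\<^esub> h2) = kp 1 h1 \<otimes>\<^bsub>KH\<^esub> kp 1 h2" by (simp add: kp_mult)
    then show ?case using eng_mult h by (simp add: mult)
  qed
  moreover have "kp c x = kap c \<otimes>\<^bsub>KH\<^esub> kp 1 x" using kap_kp[OF kp, of c 1] by simp
  ultimately show ?case using kp by (simp add: mult kap)
qed (rule add)

lemma kap_hom:
  "kap (c + d) = kap c \<oplus>\<^bsub>KH\<^esub> kap d" "kap (c * d) = kap c \<otimes>\<^bsub>KH\<^esub> kap d" "kap 1 = \<one>\<^bsub>KH\<^esub>"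
  "kap (- c) = \<ominus>\<^bsub>KH\<^esub> kap c"
  using kp_add_left[OF one_NH] kap_kp[OF one_NH] kp_one kp_minus_left[OF one_NH] by (simp_all add: kap_eq)

lemma kap_central: "z \<in> carrier KH \<Longrightarrow> z \<otimes>\<^bsub>KH\<^esub> kap c = kap c \<otimes>\<^bsub>KH\<^esub> z"
proof (induction z rule: KH_induct)
  case (kp d x)
  have "kp d x \<otimes>\<^bsub>KH\<^esub> kap c = kp (d * c) x"
    unfolding kap_eq using kp_mult[OF kp one_NH] NH_subset[OF kp] by simp
  then show ?case using kap_kp[OF kp] by (simp add: mult.commute)
qed (simp add: KH.l_distr KH.r_distr)

section \<open>Additive functionals on the scalar extension and their separation of points\<close>

definition kadditive :: "(('k, 'h) KH_elem \<Rightarrow> 'r::ab_group_add) \<Rightarrow> bool" where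
  "kadditive \<Phi> \<longleftrightarrow> (\<forall>y\<in>carrier KH. \<forall>z\<in>carrier KH. \<Phi> (y \<oplus>\<^bsub>KH\<^esub> z) = \<Phi> y + \<Phi> z)"

lemma kadditiveD:
  assumes "kadditive \<Phi>"
  shows "y \<in> carrier KH \<Longrightarrow> z \<in> carrier KH \<Longrightarrow> \<Phi> (y \<oplus>\<^bsub>KH\<^esub> z) = \<Phi> y + \<Phi> z"
    "\<Phi> \<zero>\<^bsub>KH\<^esub> = 0" "z \<in> carrier KH \<Longrightarrow> \<Phi> (\<ominus>\<^bsub>KH\<^esub> z) = - \<Phi> z"
    "y \<in> carrier KH \<Longrightarrow> z \<in> carrier KH \<Longrightarrow> \<Phi> (y \<ominus>\<^bsub>KH\<^esub> z) = \<Phi> y - \<Phi> z"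
proof -
  show add: "\<Phi> (y \<oplus>\<^bsub>KH\<^esub> z) = \<Phi> y + \<Phi> z" if "y \<in> carrier KH" "z \<in> carrier KH" for y z
    using assms that by (simp add: kadditive_def)
  show 0: "\<Phi> \<zero>\<^bsub>KH\<^esub> = 0" using add[of "\<zero>\<^bsub>KH\<^esub>" "\<zero>\<^bsub>KH\<^esub>"] by simp
  show neg: "\<Phi> (\<ominus>\<^bsub>KH\<^esub> z) = - \<Phi> z" if "z \<in> carrier KH" for z
    using add[of z "\<ominus>\<^bsub>KH\<^esub> z"] that 0 by (simp add: KH.r_neg eq_neg_iff_add_eq_0 add.commute)
  show "\<Phi> (y \<ominus>\<^bsub>KH\<^esub> z) = \<Phi> y - \<Phi> z" if "y \<in> carrier KH" "z \<in> carrier KH" for y z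
    using add[of y "\<ominus>\<^bsub>KH\<^esub> z"] that neg by (simp add: a_minus_def)
qed

text \<open>As for the tensor power, the defining relations must survive translation on both sides;
  for the balancing relation this rests on the centrality of \<open>scal\<close>.\<close>

lemma K_functional_exists:
  fixes j :: "'k \<Rightarrow> 'r::comm_ring_1"
  assumes j: "\<And>c d. j (c + d) = j c + j d" "\<And>c d. j (c * d) = j c * j d"
    and F: "additive F" "\<And>a x. x \<in> carrier TT \<Longrightarrow> F (scal a \<otimes>\<^bsub>TT\<^esub> x) = j (\<phi> a) * F x"
  shows "\<exists>\<Phi>. kadditive \<Phi> \<and> (\<forall>c. \<forall>x\<in>carrier NH. \<Phi> (kp c x) = j c * F x)"
proof -
  note N = NH_subset
  have "\<exists>\<Phi>. (\<forall>x\<in>carrier KP.Q. \<forall>y\<in>carrier KP.Q. \<Phi> (x \<oplus>\<^bsub>KP.Q\<^esub> y) = \<Phi> x + \<Phi> y) \<and>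
      (\<forall>g\<in>carrier KG. \<Phi> (KP.cl g) = j (fst g) * F (snd g))"
  proof (rule KP.lift_exists)
    fix a b c g g' assume abc: "(a, b, c) \<in> KR3" and g: "g \<in> carrier KG" "g' \<in> carrier KG"
    have gs: "snd g \<in> carrier TT" "snd g' \<in> carrier TT" using g N by auto
    show "j (fst (g \<otimes>\<^bsub>KG\<^esub> a \<otimes>\<^bsub>KG\<^esub> g')) * F (snd (g \<otimes>\<^bsub>KG\<^esub> a \<otimes>\<^bsub>KG\<^esub> g')) =
        j (fst (g \<otimes>\<^bsub>KG\<^esub> b \<otimes>\<^bsub>KG\<^esub> g')) * F (snd (g \<otimes>\<^bsub>KG\<^esub> b \<otimes>\<^bsub>KG\<^esub> g')) +
        j (fst (g \<otimes>\<^bsub>KG\<^esub> c \<otimes>\<^bsub>KG\<^esub> g')) * F (snd (g \<otimes>\<^bsub>KG\<^esub> c \<otimes>\<^bsub>KG\<^esub> g'))"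
      using abc unfolding KR3_def
    proof (elim UnE CollectE exE conjE)
      fix c1 c2 x assume *: "(a, b, c) = ((c1 + c2, x), (c1, x), (c2, x))" "x \<in> carrier NH"
      then show ?thesis by (simp add: j distrib_left distrib_right)
    next
      fix d x y assume *: "(a, b, c) = ((d, x \<oplus>\<^bsub>NH\<^esub> y), (d, x), (d, y))" "x \<in> carrier NH" "y \<in> carrier NH"
      then have "x \<in> carrier TT" "y \<in> carrier TT" using N by blast+
      then show ?thesis using * gs
        by (simp add: TT.r_distr TT.l_distr additiveD(1)[OF F(1)] distrib_left)
    qed
  next
    fix a b g g' assume ab: "(a, b) \<in> KR2" and g: "g \<in> carrier KG" "g' \<in> carrier KG"
    have gs: "snd g \<in> carrier TT" "snd g' \<in> carrier TT" using g N by auto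
    from ab obtain l d x where *: "a = (\<phi> l * d, x)" "b = (d, scal l \<otimes>\<^bsub>NH\<^esub> x)" "x \<in> carrier NH"
      unfolding KR2_def by blast
    then have x: "x \<in> carrier TT" using N by blast
    have "snd g \<otimes>\<^bsub>TT\<^esub> (scal l \<otimes>\<^bsub>TT\<^esub> x) \<otimes>\<^bsub>TT\<^esub> snd g' = scal l \<otimes>\<^bsub>TT\<^esub> (snd g \<otimes>\<^bsub>TT\<^esub> x \<otimes>\<^bsub>TT\<^esub> snd g')"
      using gs x scal_central[OF gs(1), of l] by (simp flip: TT.m_assoc)
    then show "j (fst (g \<otimes>\<^bsub>KG\<^esub> a \<otimes>\<^bsub>KG\<^esub> g')) * F (snd (g \<otimes>\<^bsub>KG\<^esub> a \<otimes>\<^bsub>KG\<^esub> g')) =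
        j (fst (g \<otimes>\<^bsub>KG\<^esub> b \<otimes>\<^bsub>KG\<^esub> g')) * F (snd (g \<otimes>\<^bsub>KG\<^esub> b \<otimes>\<^bsub>KG\<^esub> g'))"
      using gs x by (simp add: * F(2) j mult_ac)
  qed
  then obtain \<Phi> where \<Phi>: "kadditive \<Phi>" "\<And>g. g \<in> carrier KG \<Longrightarrow> \<Phi> (KP.cl g) = j (fst g) * F (snd g)"
    unfolding KP_Q kadditive_def by blast
  have "\<Phi> (kp c x) = j c * F x" if "x \<in> carrier NH" for c x
    using \<Phi>(2)[of "(c, x)"] that by (simp add: KP_cl)
  then show ?thesis using \<Phi>(1) by blast
qed

text \<open>Lists of terms are used because the argument below is an induction on their
  number.\<close>

definition ksum :: "('k \<times> ((nat \<Rightarrow> 'h) \<Rightarrow>\<^sub>0 int) set) list \<Rightarrow> ('k, 'h) KH_elem" where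
  "ksum ps = foldr (\<lambda>p z. kp (fst p) (snd p) \<oplus>\<^bsub>KH\<^esub> z) ps \<zero>\<^bsub>KH\<^esub>"

lemma ksum_simps [simp]: "ksum [] = \<zero>\<^bsub>KH\<^esub>" "ksum ((c, x) # ps) = kp c x \<oplus>\<^bsub>KH\<^esub> ksum ps"
  by (simp_all add: ksum_def)

lemma ksum_closed [simp]: "snd ` set ps \<subseteq> carrier NH \<Longrightarrow> ksum ps \<in> carrier KH"
  by (induction ps) (auto)

lemma ksum_append:
  "snd ` set ps \<subseteq> carrier NH \<Longrightarrow> snd ` set qs \<subseteq> carrier NH \<Longrightarrow> ksum (ps @ qs) = ksum ps \<oplus>\<^bsub>KH\<^esub> ksum qs"
  by (induction ps) (auto simp: KH.a_assoc)

lemma KH_ksum: "z \<in> carrier KH \<Longrightarrow> \<exists>ps. snd ` set ps \<subseteq> carrier NH \<and> z = ksum ps"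
proof (induction z rule: KH_induct)
  case (kp c x)
  then show ?case by (intro exI[of _ "[(c, x)]"]) simp
next
  case (add y z)
  then obtain ps qs where "snd ` set ps \<subseteq> carrier NH" "y = ksum ps" "snd ` set qs \<subseteq> carrier NH" "z = ksum qs"
    by blast
  then show ?case by (intro exI[of _ "ps @ qs"]) (auto simp: ksum_append image_Un)
qed

text \<open>
  Flatness of \<open>K\<close> over \<open>\<int>[u, 1/u]\<close> in concrete form: a relation that holds in all coordinates is
  shortened by eliminating one of its terms with the help of a nonzero coordinate of that term.
\<close>

lemma ksum_zero:
  assumes "snd ` set ps \<subseteq> carrier NH"
    and "\<And>\<beta>. \<beta> \<in> tensor_index \<Longrightarrow> (\<Sum>(c, x)\<leftarrow>ps. c * \<phi> (crd \<beta> x)) = 0"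
  shows "ksum ps = \<zero>\<^bsub>KH\<^esub>"
  using assms
proof (induction "length ps" arbitrary: ps)
  case 0
  then show ?case by simp
next
  case (Suc l)
  then obtain c0 x0 ps' where ps: "ps = (c0, x0) # ps'" "length ps' = l"
    by (cases ps) auto
  have x0: "x0 \<in> carrier NH" "x0 \<in> carrier TT" and ps': "snd ` set ps' \<subseteq> carrier NH"
    using Suc.prems(1) NH_subset by (auto simp: ps(1))
  show ?case
  proof (cases "\<exists>\<beta>\<in>tensor_index. crd \<beta> x0 \<noteq> 0")
    case False
    then have "x0 = \<zero>\<^bsub>TT\<^esub>" using crd_separating[OF x0(2)] by blast
    moreover have "(\<Sum>(c, x)\<leftarrow>ps'. c * \<phi> (crd \<beta> x)) = 0" if "\<beta> \<in> tensor_index" for \<beta>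
      using Suc.prems(2)[OF that] False that by (simp add: ps(1))
    then have "ksum ps' = \<zero>\<^bsub>KH\<^esub>" using Suc.hyps(1)[of ps'] ps(2) ps' by blast
    ultimately show ?thesis by (simp add: ps(1) kp_zero_right)
  next
    case True
    then obtain \<beta>0 where \<beta>0: "\<beta>0 \<in> tensor_index" "crd \<beta>0 x0 \<noteq> 0" by blast
    define a where "a = crd \<beta>0 x0"
    have a: "\<phi> a \<noteq> 0" using \<beta>0(2) by (simp add: a_def)
    \<comment> \<open>x is replaced by a x - x_\<beta> x0, where x_\<beta> is its coordinate at
      \<open>\<beta>0\<close>, so that this coordinate vanishes; dividing the coefficient by
      \<open>\<phi> a\<close> compensates for the factor a. The new term is formed with Laurent
      scalars only and hence stays in \<open>NH\<close>.\<close>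
    define red where "red = (\<lambda>(c, x). (c / \<phi> a, scal a \<otimes>\<^bsub>TT\<^esub> x \<oplus>\<^bsub>TT\<^esub> scal (- crd \<beta>0 x) \<otimes>\<^bsub>TT\<^esub> x0))"
    have red_closed: "snd (red p) \<in> carrier NH" if "snd p \<in> carrier NH" for p
    proof -
      have "scal a \<otimes>\<^bsub>NH\<^esub> snd p \<oplus>\<^bsub>NH\<^esub> scal (- crd \<beta>0 (snd p)) \<otimes>\<^bsub>NH\<^esub> x0 \<in> carrier NH"
        using that x0 NH_mem(1) by (intro NH.a_closed NH.m_closed)
      then show ?thesis by (simp add: red_def case_prod_beta)
    qed
    have kp_red: "kp (fst (red p)) (snd (red p)) = kp (fst p) (snd p) \<oplus>\<^bsub>KH\<^esub> kp (- (fst p * \<phi> (crd \<beta>0 (snd p)) / \<phi> a)) x0"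
      if "snd p \<in> carrier NH" for p
    proof -
      have c: "scal a \<otimes>\<^bsub>TT\<^esub> snd p \<in> carrier NH" "scal (- crd \<beta>0 (snd p)) \<otimes>\<^bsub>TT\<^esub> x0 \<in> carrier NH"
        using NH.m_closed[OF NH_mem(1) that] NH.m_closed[OF NH_mem(1) x0(1)] by simp_all
      have "kp (fst (red p)) (snd (red p)) = kp (fst p / \<phi> a) (scal a \<otimes>\<^bsub>TT\<^esub> snd p) \<oplus>\<^bsub>KH\<^esub>
          kp (fst p / \<phi> a) (scal (- crd \<beta>0 (snd p)) \<otimes>\<^bsub>TT\<^esub> x0)"
        by (simp add: red_def case_prod_beta kp_add_right[OF c])
      then show ?thesis using a by (simp add: kp_scal[OF that] kp_scal[OF x0(1)] mult.commute)
    qed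
    have sum_red: "ksum (map red qs) = ksum qs \<oplus>\<^bsub>KH\<^esub> kp (- ((\<Sum>(c, x)\<leftarrow>qs. c * \<phi> (crd \<beta>0 x)) / \<phi> a)) x0"
      if "snd ` set qs \<subseteq> carrier NH" for qs
      using that
    proof (induction qs)
      case Nil
      then show ?case using kp_zero_left[OF x0(1)] by simp
    next
      case (Cons p qs)
      obtain c x where p: "p = (c, x)" by (cases p)
      have cl: "x \<in> carrier NH" "snd ` set qs \<subseteq> carrier NH" using Cons.prems by (auto simp: p)
      let ?s = "(\<Sum>(c, x)\<leftarrow>qs. c * \<phi> (crd \<beta>0 x)) / \<phi> a" and ?t = "c * \<phi> (crd \<beta>0 x) / \<phi> a"
      have "ksum (map red (p # qs)) = (kp c x \<oplus>\<^bsub>KH\<^esub> kp (- ?t) x0) \<oplus>\<^bsub>KH\<^esub> (ksum qs \<oplus>\<^bsub>KH\<^esub> kp (- ?s) x0)"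
        using kp_red[of p] Cons.IH[OF cl(2)] cl by (cases "red p") (simp add: p)
      also have "\<dots> = (kp c x \<oplus>\<^bsub>KH\<^esub> ksum qs) \<oplus>\<^bsub>KH\<^esub> (kp (- ?t) x0 \<oplus>\<^bsub>KH\<^esub> kp (- ?s) x0)"
        using cl x0 by (simp add: KH.a_ac)
      also have "kp (- ?t) x0 \<oplus>\<^bsub>KH\<^esub> kp (- ?s) x0 = kp (- (?t + ?s)) x0"
        using kp_add_left[OF x0(1), of "- ?t" "- ?s"] by simp
      finally show ?case by (simp add: p add_divide_distrib)
    qed
    have crd_red: "fst (red p) * \<phi> (crd \<beta> (snd (red p))) =
        fst p * \<phi> (crd \<beta> (snd p)) - fst p * \<phi> (crd \<beta>0 (snd p)) / \<phi> a * \<phi> (crd \<beta> x0)"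
      if "snd p \<in> carrier NH" "\<beta> \<in> tensor_index" for p \<beta>
      using a x0 NH_subset[OF that(1)]
      by (simp add: red_def case_prod_beta additiveD(1)[OF crd(1)[OF that(2)]] crd(3)[OF that(2)] field_simps)
    have sum_crd: "(\<Sum>(c, x)\<leftarrow>map red qs. c * \<phi> (crd \<beta> x)) =
        (\<Sum>(c, x)\<leftarrow>qs. c * \<phi> (crd \<beta> x)) - (\<Sum>(c, x)\<leftarrow>qs. c * \<phi> (crd \<beta>0 x)) / \<phi> a * \<phi> (crd \<beta> x0)"
      if "snd ` set qs \<subseteq> carrier NH" "\<beta> \<in> tensor_index" for qs \<beta>
      using that(1)
    proof (induction qs)
      case (Cons p qs)
      then show ?case using crd_red[of p \<beta>] that(2)
        by (simp add: case_prod_beta add_divide_distrib distrib_right)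
    qed simp
    \<comment> \<open>By the relation at \<open>\<beta>0\<close> the corrections collected along
      \<open>x0\<close> add up exactly to the dropped term \<open>c0\<close>, so the sum is
      unchanged while the list is shorter by one.\<close>
    have s0: "(\<Sum>(c, x)\<leftarrow>ps'. c * \<phi> (crd \<beta>0 x)) = - (c0 * \<phi> a)"
      using Suc.prems(2)[OF \<beta>0(1)] by (simp add: ps(1) a_def eq_neg_iff_add_eq_0 add.commute)
    have "ksum ps = ksum (map red ps')"
      unfolding sum_red[OF ps'] s0 using a x0 ps' by (simp add: ps(1) KH.a_comm)
    also have "\<dots> = \<zero>\<^bsub>KH\<^esub>"
    proof (rule Suc.hyps(1))
      show "snd ` set (map red ps') \<subseteq> carrier NH" using ps' red_closed by auto
      show "(\<Sum>(c, x)\<leftarrow>map red ps'. c * \<phi> (crd \<beta> x)) = 0" if "\<beta> \<in> tensor_index" for \<beta>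
        unfolding sum_crd[OF ps' that] s0 using a Suc.prems(2)[OF that] by (simp add: ps(1) add.commute)
    qed (simp add: ps(2))
    finally show ?thesis .
  qed
qed

definition PhK :: "(nat \<Rightarrow> 'l alg_closure) \<Rightarrow> (nat \<Rightarrow> bool) \<Rightarrow> ('k, 'h) KH_elem \<Rightarrow> 'l alg_closure" where
  "PhK la c = (SOME \<Phi>. kadditive \<Phi> \<and> (\<forall>d. \<forall>x\<in>carrier NH. \<Phi> (kp d x) = emb d * Ph la c x))"

lemma PhK:
  assumes "la \<in> {1..k} \<rightarrow> LAM"
  shows "kadditive (PhK la c)" "x \<in> carrier NH \<Longrightarrow> PhK la c (kp d x) = emb d * Ph la c x"
proof -
  have "\<exists>\<Phi>. kadditive \<Phi> \<and> (\<forall>d. \<forall>x\<in>carrier NH. \<Phi> (kp d x) = emb d * Ph la c x)"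
    by (rule K_functional_exists) (simp_all add: Ph[OF assms])
  from someI_ex[OF this, folded PhK_def]
  show "kadditive (PhK la c)" "x \<in> carrier NH \<Longrightarrow> PhK la c (kp d x) = emb d * Ph la c x" by blast+
qed

lemma PhK_kap:
  assumes "la \<in> {1..k} \<rightarrow> LAM" "z \<in> carrier KH"
  shows "PhK la c (kap d \<otimes>\<^bsub>KH\<^esub> z) = emb d * PhK la c z"
  using assms(2)
proof (induction z rule: KH_induct)
  case (kp e x)
  then show ?case by (simp add: kap_kp PhK(2)[OF assms(1)])
next
  case (add y z)
  then show ?case by (simp add: KH.r_distr kadditiveD[OF PhK(1)[OF assms(1)]] distrib_left)
qed

lemma PhK_one:
  assumes "la \<in> {1..k} \<rightarrow> LAM"
  shows "PhK la (\<lambda>_. True) \<one>\<^bsub>KH\<^esub> = 1" "PhK la (\<lambda>_. False) \<one>\<^bsub>KH\<^esub> = 0"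
  unfolding kp_one[symmetric] PhK(2)[OF assms one_NH] using Ph_one[OF assms] by simp_all

lemma PhK_P:
  assumes la: "la \<in> {1..k} \<rightarrow> LAM" and z: "z \<in> carrier KH"
  shows "2 * PhK la c (kp 1 p1 \<otimes>\<^bsub>KH\<^esub> z) = bE ^ k * (PhK la c z + PhK la (\<lambda>i. \<not> c i) z)"
    "2 * PhK la c (kp 1 p2 \<otimes>\<^bsub>KH\<^esub> z) = bE ^ k * (PhK la c z + flip_weight la c * PhK la (\<lambda>i. \<not> c i) z)"
proof -
  note A = kadditiveD[OF PhK(1)[OF la]]
  have pc: "kp 1 p1 \<in> carrier KH" "kp 1 p2 \<in> carrier KH" using NH_mem by simp_all
  have "2 * PhK la c (kp 1 p1 \<otimes>\<^bsub>KH\<^esub> z) = bE ^ k * (PhK la c z + PhK la (\<lambda>i. \<not> c i) z) \<and>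
    2 * PhK la c (kp 1 p2 \<otimes>\<^bsub>KH\<^esub> z) = bE ^ k * (PhK la c z + flip_weight la c * PhK la (\<lambda>i. \<not> c i) z)"
    using z
  proof (induction z rule: KH_induct)
    case (kp d x)
    have x: "x \<in> carrier TT" by (rule NH_subset[OF kp])
    have m: "p1 \<otimes>\<^bsub>TT\<^esub> x \<in> carrier NH" "p2 \<otimes>\<^bsub>TT\<^esub> x \<in> carrier NH"
      using NH.m_closed[OF NH_mem(2) kp] NH.m_closed[OF NH_mem(3) kp] by simp_all
    have "2 * PhK la c (kp 1 p1 \<otimes>\<^bsub>KH\<^esub> kp d x) = emb d * (2 * Ph la c (p1 \<otimes>\<^bsub>TT\<^esub> x))"
      "2 * PhK la c (kp 1 p2 \<otimes>\<^bsub>KH\<^esub> kp d x) = emb d * (2 * Ph la c (p2 \<otimes>\<^bsub>TT\<^esub> x))"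
      using kp_mult[OF NH_mem(2) kp, of 1 d] kp_mult[OF NH_mem(3) kp, of 1 d] PhK(2)[OF la m(1)] PhK(2)[OF la m(2)]
      by simp_all
    then show ?case unfolding Ph_nsP[OF la x] PhK(2)[OF la kp] by (simp add: algebra_simps)
  next
    case (add y z)
    then show ?case by (simp add: KH.r_distr pc A distrib_left)
  qed
  then show "2 * PhK la c (kp 1 p1 \<otimes>\<^bsub>KH\<^esub> z) = bE ^ k * (PhK la c z + PhK la (\<lambda>i. \<not> c i) z)"
    "2 * PhK la c (kp 1 p2 \<otimes>\<^bsub>KH\<^esub> z) = bE ^ k * (PhK la c z + flip_weight la c * PhK la (\<lambda>i. \<not> c i) z)"
    by blast+
qed

text \<open>Every coordinate is a combination of these functionals by
  \<open>crd_combination\<close>, and \<open>ksum_zero\<close> detects zero on coordinates. From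
  here on, identities in \<open>KH\<close> are reduced to identities between scalars.\<close>

lemma KH_zero:
  assumes z: "z \<in> carrier KH" and zero: "\<And>la c. la \<in> {1..k} \<rightarrow> LAM \<Longrightarrow> PhK la c z = 0"
  shows "z = \<zero>\<^bsub>KH\<^esub>"
proof -
  obtain ps where ps: "snd ` set ps \<subseteq> carrier NH" "z = ksum ps" using KH_ksum[OF z] by blast
  have "(\<Sum>(c, x)\<leftarrow>ps. c * \<phi> (crd \<beta> x)) = 0" if \<beta>: "\<beta> \<in> tensor_index" for \<beta>
  proof -
    let ?S = "{1..k} \<rightarrow>\<^sub>E hf_index"
    obtain \<alpha> where \<alpha>: "\<And>x. x \<in> carrier TT \<Longrightarrow> ph (crd \<beta> x) =
        (\<Sum>\<tau>\<in>?S. \<alpha> \<tau> * Ph (\<lambda>i. fst (\<tau> i)) (\<lambda>i. snd (\<tau> i)) x)"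
      using crd_combination[OF \<beta>] by blast
    have l: "(\<lambda>i. fst (\<tau> i)) \<in> {1..k} \<rightarrow> LAM" if "\<tau> \<in> ?S" for \<tau>
      using that by (auto simp: PiE_iff mem_Times_iff)
    have "emb (\<Sum>(c, x)\<leftarrow>qs. c * \<phi> (crd \<beta> x)) =
        (\<Sum>\<tau>\<in>?S. \<alpha> \<tau> * PhK (\<lambda>i. fst (\<tau> i)) (\<lambda>i. snd (\<tau> i)) (ksum qs))"
      if "snd ` set qs \<subseteq> carrier NH" for qs
      using that
    proof (induction qs)
      case Nil
      have "PhK (\<lambda>i. fst (\<tau> i)) (\<lambda>i. snd (\<tau> i)) \<zero>\<^bsub>KH\<^esub> = 0" if "\<tau> \<in> ?S" for \<tau>
        by (rule kadditiveD(2)[OF PhK(1)[OF l[OF that]]])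
      then show ?case by simp
    next
      case (Cons p qs)
      obtain c x where p: "p = (c, x)" by (cases p)
      have cl: "x \<in> carrier NH" "snd ` set qs \<subseteq> carrier NH" using Cons.prems by (auto simp: p)
      have "emb (\<Sum>(c, x)\<leftarrow>p # qs. c * \<phi> (crd \<beta> x)) = emb c * ph (crd \<beta> x) + emb (\<Sum>(c, x)\<leftarrow>qs. c * \<phi> (crd \<beta> x))"
        by (simp add: p)
      also have "\<dots> = (\<Sum>\<tau>\<in>?S. \<alpha> \<tau> * (emb c * Ph (\<lambda>i. fst (\<tau> i)) (\<lambda>i. snd (\<tau> i)) x) +
          \<alpha> \<tau> * PhK (\<lambda>i. fst (\<tau> i)) (\<lambda>i. snd (\<tau> i)) (ksum qs))"
        unfolding Cons.IH[OF cl(2)] \<alpha>[OF NH_subset[OF cl(1)]] by (simp add: sum_distrib_left sum.distrib mult_ac)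
      also have "\<dots> = (\<Sum>\<tau>\<in>?S. \<alpha> \<tau> * PhK (\<lambda>i. fst (\<tau> i)) (\<lambda>i. snd (\<tau> i)) (ksum (p # qs)))"
      proof (intro sum.cong refl)
        fix \<tau> assume "\<tau> \<in> ?S"
        note L = PhK[OF l[OF this]]
        show "\<alpha> \<tau> * (emb c * Ph (\<lambda>i. fst (\<tau> i)) (\<lambda>i. snd (\<tau> i)) x) +
            \<alpha> \<tau> * PhK (\<lambda>i. fst (\<tau> i)) (\<lambda>i. snd (\<tau> i)) (ksum qs) =
            \<alpha> \<tau> * PhK (\<lambda>i. fst (\<tau> i)) (\<lambda>i. snd (\<tau> i)) (ksum (p # qs))"
          using cl by (simp add: p kadditiveD(1)[OF L(1)] L(2) distrib_left)
      qed
      finally show ?case .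
    qed
    from this[OF ps(1)] have "emb (\<Sum>(c, x)\<leftarrow>ps. c * \<phi> (crd \<beta> x)) = 0"
      using zero l by (simp add: ps(2)[symmetric])
    then show ?thesis by (simp only: emb_simps(10))
  qed
  then show ?thesis using ksum_zero[OF ps(1)] ps(2) by blast
qed

end

section \<open>The central element and its eigenvalues\<close>

context nonstandard
begin

abbreviation P1K where "P1K \<equiv> kp 1 p1"
abbreviation P2K where "P2K \<equiv> kp 1 p2"
abbreviation qK :: 'k where "qK \<equiv> \<phi> quantum_two ^ k"
abbreviation QE :: "'l alg_closure" where "QE \<equiv> emb qK"

lemma QE_eq: "bE ^ k = QE" by simp

lemma qK_nonzero: "qK \<noteq> 0" and QE_nonzero: "QE \<noteq> 0"
  using bE_nonzero by (auto simp del: phi_eq_0)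

lemma PK_closed [simp]: "P1K \<in> carrier KH" "P2K \<in> carrier KH"
  using NH_mem by simp_all

text \<open>Substituting P_s = q (1 + R_s)/2 with R_s = r_s tensor ... tensor r_s and q = [2]^k,
  this is q^2 (2 - R_1 R_2 - R_2 R_1)/4, which is unchanged under conjugation by R_1 and
  R_2.\<close>

definition YK :: "('k, 'h) KH_elem" where
  "YK = kap qK \<otimes>\<^bsub>KH\<^esub> (P1K \<oplus>\<^bsub>KH\<^esub> P2K) \<ominus>\<^bsub>KH\<^esub> (P1K \<otimes>\<^bsub>KH\<^esub> P2K \<oplus>\<^bsub>KH\<^esub> P2K \<otimes>\<^bsub>KH\<^esub> P1K)"

lemma YK_closed [simp]: "YK \<in> carrier KH"
  by (simp add: YK_def)

lemma PhK_P':
  assumes "la \<in> {1..k} \<rightarrow> LAM" "z \<in> carrier KH"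
  shows "2 * PhK la c (P1K \<otimes>\<^bsub>KH\<^esub> z) = QE * (PhK la c z + PhK la (\<lambda>i. \<not> c i) z)"
    "2 * PhK la c (P2K \<otimes>\<^bsub>KH\<^esub> z) = QE * (PhK la c z + flip_weight la c * PhK la (\<lambda>i. \<not> c i) z)"
    "2 * PhK la (\<lambda>i. \<not> c i) (P1K \<otimes>\<^bsub>KH\<^esub> z) = QE * (PhK la (\<lambda>i. \<not> c i) z + PhK la c z)"
    "2 * PhK la (\<lambda>i. \<not> c i) (P2K \<otimes>\<^bsub>KH\<^esub> z) =
       QE * (PhK la (\<lambda>i. \<not> c i) z + inverse (flip_weight la c) * PhK la c z)"
  using PhK_P[OF assms, of c] PhK_P[OF assms, of "\<lambda>i. \<not> c i"] unfolding QE_eq flip_weight_not by simp_all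

lemma KH_eqI:
  assumes "y \<in> carrier KH" "z \<in> carrier KH"
    and "\<And>la c. la \<in> {1..k} \<rightarrow> LAM \<Longrightarrow> PhK la c y = PhK la c z"
  shows "y = z"
proof -
  have "y \<ominus>\<^bsub>KH\<^esub> z = \<zero>\<^bsub>KH\<^esub>"
    using assms by (intro KH_zero) (simp_all add: kadditiveD(4)[OF PhK(1)])
  then show ?thesis using assms(1,2) by simp
qed

text \<open>\<open>PhK_P'\<close> describes 2 P_s = q (1 + R_s), so each generator costs a factor 2:
  identities with two generators are compared after multiplication by 4, those with three after
  multiplication by 8.\<close>

lemma mult_four_cancel: "4 * x = 4 * (y :: 'l alg_closure) \<Longrightarrow> x = y"
  using two_four_E(2) mult_left_cancel by blast

lemma mult_two_cancel: "2 * x = 2 * (y :: 'l alg_closure) \<Longrightarrow> x = y"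
  using two_four_E(1) mult_left_cancel by blast

text \<open>R_1 R_2 and R_2 R_1 flip all positions twice, so they scale each functional, one by the
  flip weight and the other by its inverse.\<close>

lemma PhK_Y:
  assumes la: "la \<in> {1..k} \<rightarrow> LAM" and z: "z \<in> carrier KH"
  shows "4 * PhK la c (YK \<otimes>\<^bsub>KH\<^esub> z) =
    QE * QE * (2 - flip_weight la c - inverse (flip_weight la c)) * PhK la c z"
proof -
  note A = kadditiveD[OF PhK(1)[OF la]]
  define f g where "f = flip_weight la c" and "g = inverse (flip_weight la c)"
  have fg: "f * g = 1" "f * (g * x) = x" for x
    using flip_weight_nonzero[OF la, of c] by (simp_all add: f_def g_def flip: mult.assoc)
  note P = PhK_P'[OF la, of _ c, folded f_def g_def]
  define a a' where "a = PhK la c z" and "a' = PhK la (\<lambda>i. \<not> c i) z"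
  have "YK \<otimes>\<^bsub>KH\<^esub> z = kap qK \<otimes>\<^bsub>KH\<^esub> (P1K \<otimes>\<^bsub>KH\<^esub> z \<oplus>\<^bsub>KH\<^esub> P2K \<otimes>\<^bsub>KH\<^esub> z) \<ominus>\<^bsub>KH\<^esub>
      (P1K \<otimes>\<^bsub>KH\<^esub> (P2K \<otimes>\<^bsub>KH\<^esub> z) \<oplus>\<^bsub>KH\<^esub> P2K \<otimes>\<^bsub>KH\<^esub> (P1K \<otimes>\<^bsub>KH\<^esub> z))"
    unfolding YK_def using z by (simp add: a_minus_def KH.l_distr KH.r_distr KH.l_minus KH.m_assoc)
  then have "PhK la c (YK \<otimes>\<^bsub>KH\<^esub> z) = QE * (PhK la c (P1K \<otimes>\<^bsub>KH\<^esub> z) + PhK la c (P2K \<otimes>\<^bsub>KH\<^esub> z)) -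
      (PhK la c (P1K \<otimes>\<^bsub>KH\<^esub> (P2K \<otimes>\<^bsub>KH\<^esub> z)) + PhK la c (P2K \<otimes>\<^bsub>KH\<^esub> (P1K \<otimes>\<^bsub>KH\<^esub> z)))"
    using z by (simp only: A PhK_kap[OF la] KH.m_closed KH.a_closed PK_closed kap_closed)
  then have "4 * PhK la c (YK \<otimes>\<^bsub>KH\<^esub> z) =
      2 * QE * (2 * PhK la c (P1K \<otimes>\<^bsub>KH\<^esub> z) + 2 * PhK la c (P2K \<otimes>\<^bsub>KH\<^esub> z)) -
      (2 * (2 * PhK la c (P1K \<otimes>\<^bsub>KH\<^esub> (P2K \<otimes>\<^bsub>KH\<^esub> z))) + 2 * (2 * PhK la c (P2K \<otimes>\<^bsub>KH\<^esub> (P1K \<otimes>\<^bsub>KH\<^esub> z))))"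
    by (simp only:) (simp add: algebra_simps)
  also have "2 * (2 * PhK la c (P1K \<otimes>\<^bsub>KH\<^esub> (P2K \<otimes>\<^bsub>KH\<^esub> z))) = QE * (QE * (a + f * a') + QE * (a' + g * a))"
    unfolding P(1)[OF KH.m_closed[OF PK_closed(2) z]] P(2,4)[OF z, symmetric] a_def a'_def
    by (simp add: algebra_simps)
  also have "2 * (2 * PhK la c (P2K \<otimes>\<^bsub>KH\<^esub> (P1K \<otimes>\<^bsub>KH\<^esub> z))) = QE * (QE * (a + a') + f * (QE * (a' + a)))"
    unfolding P(2)[OF KH.m_closed[OF PK_closed(1) z]] P(1,3)[OF z, symmetric] a_def a'_def
    by (simp add: algebra_simps)
  also have "2 * QE * (2 * PhK la c (P1K \<otimes>\<^bsub>KH\<^esub> z) + 2 * PhK la c (P2K \<otimes>\<^bsub>KH\<^esub> z)) =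
      2 * QE * (QE * (a + a') + QE * (a + f * a'))"
    unfolding P(1,2)[OF z] a_def a'_def ..
  finally have "4 * PhK la c (YK \<otimes>\<^bsub>KH\<^esub> z) = QE * QE * (2 - f - g) * a"
    by (simp add: algebra_simps)
  then show ?thesis by (simp only: f_def g_def a_def)
qed

lemma P_square:
  "P1K \<otimes>\<^bsub>KH\<^esub> P1K = kap qK \<otimes>\<^bsub>KH\<^esub> P1K" "P2K \<otimes>\<^bsub>KH\<^esub> P2K = kap qK \<otimes>\<^bsub>KH\<^esub> P2K"
proof -
  have *: "4 * PhK la c (P1K \<otimes>\<^bsub>KH\<^esub> P1K) = 4 * PhK la c (kap qK \<otimes>\<^bsub>KH\<^esub> P1K) \<and>
      4 * PhK la c (P2K \<otimes>\<^bsub>KH\<^esub> P2K) = 4 * PhK la c (kap qK \<otimes>\<^bsub>KH\<^esub> P2K)" if la: "la \<in> {1..k} \<rightarrow> LAM" for la c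
  proof -
    define f g where "f = flip_weight la c" and "g = inverse (flip_weight la c)"
    have fg: "f * g = 1" "f * (g * x) = x" for x
      using flip_weight_nonzero[OF la, of c] by (simp_all add: f_def g_def flip: mult.assoc)
    note P = PhK_P'[OF la, of _ c, folded f_def g_def]
    define a a' where "a = PhK la c \<one>\<^bsub>KH\<^esub>" and "a' = PhK la (\<lambda>i. \<not> c i) \<one>\<^bsub>KH\<^esub>"
    have 1: "2 * PhK la c P1K = QE * (a + a')" "2 * PhK la c P2K = QE * (a + f * a')"
      "2 * PhK la (\<lambda>i. \<not> c i) P1K = QE * (a' + a)" "2 * PhK la (\<lambda>i. \<not> c i) P2K = QE * (a' + g * a)"
      using P[OF KH.one_closed] by (simp_all add: a_def a'_def)
    have four: "4 * x = 2 * (2 * x)" for x :: "'l alg_closure" by simp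
    have "4 * PhK la c (P1K \<otimes>\<^bsub>KH\<^esub> P1K) = QE * (2 * PhK la c P1K + 2 * PhK la (\<lambda>i. \<not> c i) P1K)"
      "4 * PhK la c (P2K \<otimes>\<^bsub>KH\<^esub> P2K) = QE * (2 * PhK la c P2K + f * (2 * PhK la (\<lambda>i. \<not> c i) P2K))"
      unfolding four P(1)[OF PK_closed(1)] P(2)[OF PK_closed(2)] by (simp_all add: algebra_simps)
    moreover have "4 * PhK la c (kap qK \<otimes>\<^bsub>KH\<^esub> P1K) = 2 * (QE * (2 * PhK la c P1K))"
      "4 * PhK la c (kap qK \<otimes>\<^bsub>KH\<^esub> P2K) = 2 * (QE * (2 * PhK la c P2K))"
      unfolding four PhK_kap[OF la PK_closed(1)] PhK_kap[OF la PK_closed(2)] by (simp_all only: mult_ac)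
    ultimately show ?thesis unfolding 1 by (simp add: algebra_simps fg)
  qed
  show "P1K \<otimes>\<^bsub>KH\<^esub> P1K = kap qK \<otimes>\<^bsub>KH\<^esub> P1K" "P2K \<otimes>\<^bsub>KH\<^esub> P2K = kap qK \<otimes>\<^bsub>KH\<^esub> P2K"
    by (rule KH_eqI[OF _ _ mult_four_cancel[OF conjunct1[OF *]]]; simp)
      (rule KH_eqI[OF _ _ mult_four_cancel[OF conjunct2[OF *]]]; simp)
qed

text \<open>Passing to the complement inverts the flip weight f, and 2 - f - 1/f does not change. Y
  therefore acts by one scalar on the pair of functionals that a generator couples.\<close>

lemma YK_commutes_P: "YK \<otimes>\<^bsub>KH\<^esub> P1K = P1K \<otimes>\<^bsub>KH\<^esub> YK" "YK \<otimes>\<^bsub>KH\<^esub> P2K = P2K \<otimes>\<^bsub>KH\<^esub> YK"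
proof -
    have l: "8 * PhK la c (YK \<otimes>\<^bsub>KH\<^esub> P1K) = 8 * PhK la c (P1K \<otimes>\<^bsub>KH\<^esub> YK) \<and>
        8 * PhK la c (YK \<otimes>\<^bsub>KH\<^esub> P2K) = 8 * PhK la c (P2K \<otimes>\<^bsub>KH\<^esub> YK)" if la: "la \<in> {1..k} \<rightarrow> LAM" for la c
    proof -
      define f g where "f = flip_weight la c" and "g = inverse (flip_weight la c)"
      note P = PhK_P'[OF la, of _ c, folded f_def g_def]
      define s where "s = QE * QE * (2 - f - g)"
      have Y: "4 * PhK la c (YK \<otimes>\<^bsub>KH\<^esub> z) = s * PhK la c z"
        "4 * PhK la (\<lambda>i. \<not> c i) (YK \<otimes>\<^bsub>KH\<^esub> z) = s * PhK la (\<lambda>i. \<not> c i) z" if "z \<in> carrier KH" for z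
        using PhK_Y[OF la that, of c] PhK_Y[OF la that, of "\<lambda>i. \<not> c i"]
        unfolding flip_weight_not s_def f_def g_def inverse_inverse_eq by (simp_all only: diff_diff_eq add.commute)
      have eight: "8 * x = 2 * (4 * x)" "8 * x = 4 * (2 * x)" for x :: "'l alg_closure" by simp_all
      have Y1: "YK = YK \<otimes>\<^bsub>KH\<^esub> \<one>\<^bsub>KH\<^esub>" "P1K = P1K \<otimes>\<^bsub>KH\<^esub> \<one>\<^bsub>KH\<^esub>" "P2K = P2K \<otimes>\<^bsub>KH\<^esub> \<one>\<^bsub>KH\<^esub>" by simp_all
      note YY = Y[OF KH.one_closed, folded Y1] and PP = P[OF KH.one_closed, folded Y1]
      have "8 * PhK la c (YK \<otimes>\<^bsub>KH\<^esub> P1K) = s * (2 * PhK la c P1K)"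
        "8 * PhK la c (YK \<otimes>\<^bsub>KH\<^esub> P2K) = s * (2 * PhK la c P2K)"
        unfolding eight(1) Y(1)[OF PK_closed(1)] Y(1)[OF PK_closed(2)] by (simp_all only: mult_ac)
      moreover have "8 * PhK la c (P1K \<otimes>\<^bsub>KH\<^esub> YK) = QE * (4 * PhK la c YK + 4 * PhK la (\<lambda>i. \<not> c i) YK)"
        "8 * PhK la c (P2K \<otimes>\<^bsub>KH\<^esub> YK) = QE * (4 * PhK la c YK + f * (4 * PhK la (\<lambda>i. \<not> c i) YK))"
        unfolding eight(2) P(1)[OF YK_closed] P(2)[OF YK_closed] by (simp_all add: algebra_simps)
      ultimately show ?thesis unfolding YY PP by (simp add: algebra_simps)
    qed
    have eight0: "x = y" if "8 * x = 8 * y" for x y :: "'l alg_closure"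
    proof -
      have "2 * (4 * x) = 2 * (4 * y)" using that by simp
      then show ?thesis by (rule mult_four_cancel[OF mult_two_cancel])
    qed
  show "YK \<otimes>\<^bsub>KH\<^esub> P1K = P1K \<otimes>\<^bsub>KH\<^esub> YK" "YK \<otimes>\<^bsub>KH\<^esub> P2K = P2K \<otimes>\<^bsub>KH\<^esub> YK"
    by (rule KH_eqI[OF _ _ eight0[OF conjunct1[OF l]]]; simp)
      (rule KH_eqI[OF _ _ eight0[OF conjunct2[OF l]]]; simp)
qed

lemma YK_central: "z \<in> carrier KH \<Longrightarrow> YK \<otimes>\<^bsub>KH\<^esub> z = z \<otimes>\<^bsub>KH\<^esub> YK"
proof (induction z rule: KH_gen_induct)
  case (kap c)
  then show ?case by (simp add: kap_central)
next
  case P1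
  then show ?case by (rule YK_commutes_P(1))
next
  case P2
  then show ?case by (rule YK_commutes_P(2))
next
  case (add y z)
  then show ?case by (simp add: KH.l_distr KH.r_distr)
next
  case (mult y z)
  then show ?case using KH.m_assoc by (metis YK_closed)
qed

end

section \<open>Labels and eigenvalues\<close>

lemma signed_comps_uminus: "c \<in> signed_comps n N \<Longrightarrow> (\<lambda>i. - c i) \<in> signed_comps n N"
  by (simp add: signed_comps_def)

lemma SComp_class:
  assumes "\<gamma> \<in> SComp n N" "c \<in> \<gamma>"
  shows "c \<in> signed_comps n N" "\<gamma> = {c, \<lambda>i. - c i}"
proof -
  obtain x where x: "x \<in> signed_comps n N" and
    \<gamma>: "\<gamma> = {d. d \<in> signed_comps n N \<and> (d = x \<or> d = (\<lambda>i. - x i))}"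
    using assms(1) unfolding SComp_def by (auto elim!: quotientE)
  have \<gamma>': "\<gamma> = {x, \<lambda>i. - x i}"
    unfolding \<gamma> using x signed_comps_uminus[OF x] by blast
  show "c \<in> signed_comps n N" using assms(2) \<gamma> by blast
  show "\<gamma> = {c, \<lambda>i. - c i}" using assms(2) unfolding \<gamma>' by auto
qed

lemma SComp_intro: "c \<in> signed_comps n N \<Longrightarrow> {c, \<lambda>i. - c i} \<in> SComp n N"
  unfolding SComp_def by (rule quotientI[where x = c, THEN back_subst[where P = "\<lambda>x. x \<in> _"]])
    (auto intro: signed_comps_uminus)

lemma SComp_nonempty: "\<gamma> \<in> SComp n N \<Longrightarrow> (SOME c. c \<in> \<gamma>) \<in> \<gamma>"
proof -
  assume "\<gamma> \<in> SComp n N"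
  then obtain x where "x \<in> signed_comps n N" and
    "\<gamma> = {d. d \<in> signed_comps n N \<and> (d = x \<or> d = (\<lambda>i. - x i))}"
    unfolding SComp_def by (auto elim!: quotientE)
  then have "x \<in> \<gamma>" by blast
  then show ?thesis unfolding some_in_eq by blast
qed

context nonstandard
begin

lemma inverse_LAM: "la \<in> LAM \<Longrightarrow> inverse la \<in> LAM"
  by (auto simp: LAM_def split: if_splits)

lemma lam_powi_LAM: "i \<in> {1..n} \<Longrightarrow> \<epsilon> = 1 \<or> \<epsilon> = - 1 \<Longrightarrow> lam i powi \<epsilon> \<in> LAM"
  by (auto simp: LAM_def power_int_minus)

text \<open>One more factor changes a single entry by 1 in absolute value; the size rises by one, or
  falls when the factor cancels.\<close>

lemma La_step:
  assumes c: "c \<in> signed_comps n N" and i: "i \<in> {1..n}" and e: "\<epsilon> = 1 \<or> \<epsilon> = - 1"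
  shows "\<exists>N'\<le>Suc N. \<exists>c'\<in>signed_comps n N'. La c * lam i powi \<epsilon> = La c'"
proof -
  define c' where "c' j = c j + (if j = i then \<epsilon> else 0)" for j
  have "(\<Sum>j=1..n. \<bar>c' j\<bar>) \<le> (\<Sum>j=1..n. \<bar>c j\<bar> + (if j = i then 1 else 0))"
    using e by (intro sum_mono) (auto simp: c'_def)
  also have "\<dots> = int (Suc N)"
    using c i by (simp add: sum.distrib signed_comps_def)
  finally have le: "nat (\<Sum>j=1..n. \<bar>c' j\<bar>) \<le> Suc N" by linarith
  have "0 \<le> (\<Sum>j=1..n. \<bar>c' j\<bar>)" by (intro sum_nonneg) auto
  then have "c' \<in> signed_comps n (nat (\<Sum>j=1..n. \<bar>c' j\<bar>))"
    using c i by (auto simp: signed_comps_def c'_def)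
  moreover have "La c' = La c * lam i powi \<epsilon>"
    unfolding c'_def La_add La_single[OF i] ..
  ultimately show ?thesis using le
    by (intro exI[of _ "nat (\<Sum>j=1..n. \<bar>c' j\<bar>)"] conjI bexI[of _ c']) simp_all
qed

text \<open>A pending sign -1 occupies one of the N positions, hence the strict bound in the second
  alternative; another factor -1 leads back to the first.\<close>

lemma prod_LAM:
  assumes "\<And>i. i \<in> {1..N} \<Longrightarrow> \<mu> i \<in> LAM"
  shows "(\<exists>N'\<le>N. \<exists>c\<in>signed_comps n N'. (\<Prod>i=1..N. \<mu> i) = La c) \<or>
    (even m \<and> (\<exists>N'<N. \<exists>c\<in>signed_comps n N'. (\<Prod>i=1..N. \<mu> i) = - La c))"
  using assms
proof (induction N)
  case 0
  have "(\<lambda>_. 0) \<in> signed_comps n 0" by (simp add: signed_comps_def)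
  moreover have "La (\<lambda>_. 0) = 1" by (simp add: La_def)
  ultimately show ?case by (intro disjI1 exI[of _ 0]) auto
next
  case (Suc N)
  have IH: "(\<exists>N'\<le>N. \<exists>c\<in>signed_comps n N'. (\<Prod>i=1..N. \<mu> i) = La c) \<or>
    (even m \<and> (\<exists>N'<N. \<exists>c\<in>signed_comps n N'. (\<Prod>i=1..N. \<mu> i) = - La c))"
    using Suc.prems by (intro Suc.IH) auto
  have prod: "(\<Prod>i=1..Suc N. \<mu> i) = (\<Prod>i=1..N. \<mu> i) * \<mu> (Suc N)"
    by (simp add: mult.commute)
  consider "\<mu> (Suc N) = 1" | "even m" "\<mu> (Suc N) = - 1" |
    i \<epsilon> where "i \<in> {1..n}" "\<epsilon> = 1 \<or> \<epsilon> = - 1" "\<mu> (Suc N) = lam i powi \<epsilon>"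
  proof -
    have "\<mu> (Suc N) \<in> LAM" using Suc.prems by simp
    then consider "\<mu> (Suc N) = 1" | "even m" "\<mu> (Suc N) = - 1" | i where "i \<in> {1..n}" "\<mu> (Suc N) = lam i"
      | i where "i \<in> {1..n}" "\<mu> (Suc N) = inverse (lam i)"
      by (auto simp: LAM_def split: if_splits)
    then show thesis
    proof cases
      case (3 i)
      then show ?thesis by (intro that(3)[of i 1]) auto
    next
      case (4 i)
      then show ?thesis by (intro that(3)[of i "- 1"]) (auto simp: power_int_minus)
    qed (use that in blast)+
  qed
  then show ?case
  proof cases
    case 1
    have "N' \<le> N \<Longrightarrow> N' \<le> Suc N" "N' < N \<Longrightarrow> N' < Suc N" for N' by auto
    then show ?thesis using IH unfolding prod 1 mult_1_right by blast
  next
    case 2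
    from IH show ?thesis
    proof (elim disjE exE conjE bexE)
      fix N' c assume "N' \<le> N" "c \<in> signed_comps n N'" "(\<Prod>i=1..N. \<mu> i) = La c"
      then have "N' < Suc N \<and> c \<in> signed_comps n N' \<and> (\<Prod>i=1..Suc N. \<mu> i) = - La c"
        unfolding prod by (simp add: 2)
      then show ?thesis using 2 by blast
    next
      fix N' c assume "N' < N" "c \<in> signed_comps n N'" "(\<Prod>i=1..N. \<mu> i) = - La c"
      then have "N' \<le> Suc N \<and> c \<in> signed_comps n N' \<and> (\<Prod>i=1..Suc N. \<mu> i) = La c"
        unfolding prod by (simp add: 2)
      then show ?thesis by blast
    qed
  next
    case (3 i \<epsilon>)
    from IH show ?thesis
    proof (elim disjE exE conjE bexE)
      fix N' c assume c: "N' \<le> N" "c \<in> signed_comps n N'" "(\<Prod>i=1..N. \<mu> i) = La c"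
      obtain N'' c' where "N'' \<le> Suc N'" "c' \<in> signed_comps n N''" "La c * lam i powi \<epsilon> = La c'"
        using La_step[OF c(2) 3(1,2)] by blast
      then have "N'' \<le> Suc N \<and> c' \<in> signed_comps n N'' \<and> (\<Prod>i=1..Suc N. \<mu> i) = La c'"
        unfolding prod c(3) 3(3) using c(1) by simp
      then show ?thesis by blast
    next
      fix N' c assume c: "even m" "N' < N" "c \<in> signed_comps n N'" "(\<Prod>i=1..N. \<mu> i) = - La c"
      obtain N'' c' where "N'' \<le> Suc N'" "c' \<in> signed_comps n N''" "La c * lam i powi \<epsilon> = La c'"
        using La_step[OF c(3) 3(1,2)] by blast
      then have "N'' < Suc N \<and> c' \<in> signed_comps n N'' \<and> (\<Prod>i=1..Suc N. \<mu> i) = - La c'"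
        unfolding prod c(4) 3(3) using c(2) by simp
      then show ?thesis using c(1) by blast
    qed
  qed
qed

text \<open>Each factor takes one unit, with the right sign, off a nonzero entry, so a composition
  of N needs exactly N factors.\<close>

lemma La_as_prod:
  "c \<in> signed_comps n N \<Longrightarrow> \<exists>\<mu>. (\<forall>i. \<mu> i \<in> LAM) \<and> (\<Prod>i=1..N. \<mu> i) = La c"
proof (induction N arbitrary: c)
  case 0
  then have "c i = 0" if "i \<in> {1..n}" for i
    using that by (auto simp: signed_comps_def sum_nonneg_eq_0_iff)
  then have "La c = 1" by (simp add: La_def)
  then show ?case by (intro exI[of _ "\<lambda>_. 1"]) (simp add: LAM_def)
next
  case (Suc N)
  have "\<exists>i\<in>{1..n}. c i \<noteq> 0"
  proof (rule ccontr)
    assume "\<not> (\<exists>i\<in>{1..n}. c i \<noteq> 0)"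
    then have "(\<Sum>i=1..n. \<bar>c i\<bar>) = 0" by simp
    then show False using Suc.prems by (simp add: signed_comps_def)
  qed
  then obtain i where i: "i \<in> {1..n}" "c i \<noteq> 0" by blast
  define \<epsilon> where "\<epsilon> = sgn (c i)"
  have e: "\<epsilon> = 1 \<or> \<epsilon> = - 1" using i by (auto simp: \<epsilon>_def sgn_if)
  define c' where "c' j = c j + (if j = i then - \<epsilon> else 0)" for j
  have "(\<Sum>j=1..n. \<bar>c' j\<bar>) = (\<Sum>j=1..n. \<bar>c j\<bar> - (if j = i then 1 else 0))"
    using i by (intro sum.cong) (auto simp: c'_def \<epsilon>_def sgn_if)
  also have "\<dots> = int N"
    using Suc.prems i by (simp add: sum_subtractf signed_comps_def)
  finally have "c' \<in> signed_comps n N"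
    using Suc.prems i by (auto simp: signed_comps_def c'_def)
  from Suc.IH[OF this] obtain \<mu> where \<mu>: "\<And>i. \<mu> i \<in> LAM" "(\<Prod>i=1..N. \<mu> i) = La c'" by blast
  have "La c' = La c * inverse (lam i powi \<epsilon>)"
    unfolding c'_def La_add La_single[OF i(1)] by (simp add: power_int_minus)
  then have L: "La c' * lam i powi \<epsilon> = La c"
    using lam_nonzero[OF i(1)] by simp
  define \<mu>' where "\<mu>' = \<mu>(Suc N := lam i powi \<epsilon>)"
  have "\<mu>' j \<in> LAM" for j using \<mu>(1) lam_powi_LAM[OF i(1) e] by (simp add: \<mu>'_def)
  moreover have "(\<Prod>j=1..Suc N. \<mu>' j) = La c"
  proof -
    have "(\<Prod>j=1..N. \<mu>' j) = (\<Prod>j=1..N. \<mu> j)" by (intro prod.cong) (auto simp: \<mu>'_def)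
    then show ?thesis using L \<mu>(2) by (simp add: \<mu>'_def mult.commute)
  qed
  ultimately show ?case by blast
qed

section \<open>Parameters and weights of the two-dimensional labels\<close>

definition rep_of :: "(nat \<Rightarrow> int) set \<Rightarrow> nat \<Rightarrow> int" where "rep_of \<gamma> = (SOME c. c \<in> \<gamma>)"

definition cpar :: "label2 \<Rightarrow> 'k" where
  "cpar l = (case l of LabN \<gamma> \<Rightarrow> (qK * a_val \<phi> sw sf n (rep_of \<gamma>))\<^sup>2 | LabN1 \<gamma> \<Rightarrow> (qK * a1_val \<phi> sw sf n (rep_of \<gamma>))\<^sup>2)"

text \<open>The number M with c = q^2 (2 + M + 1/M)/4 for the parameter c of the label. The sine
  family is the cosine family with M replaced by -M, so that both can be treated alike.\<close>

definition wt :: "label2 \<Rightarrow> 'l alg_closure" where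
  "wt l = (case l of LabN \<gamma> \<Rightarrow> La (rep_of \<gamma>) | LabN1 \<gamma> \<Rightarrow> - La (rep_of \<gamma>))"

lemma emb_a_val:
  "4 * emb ((qK * a_val \<phi> sw sf n c)\<^sup>2) = QE * QE * (2 + La c + inverse (La c))"
  "4 * emb ((qK * a1_val \<phi> sw sf n c)\<^sup>2) = QE * QE * (2 - La c - inverse (La c))"
  unfolding a_val_E[symmetric] a1_val_E[symmetric] by (simp_all add: power2_eq_square mult_ac)

text \<open>Negating c inverts \<open>La c\<close>, and both squares depend only on
  \<open>La c\<close> plus its inverse.\<close>

lemma a_val_uminus:
  "(qK * a_val \<phi> sw sf n (\<lambda>i. - c i))\<^sup>2 = (qK * a_val \<phi> sw sf n c)\<^sup>2"
  "(qK * a1_val \<phi> sw sf n (\<lambda>i. - c i))\<^sup>2 = (qK * a1_val \<phi> sw sf n c)\<^sup>2"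
proof -
  have "4 * emb ((qK * a_val \<phi> sw sf n (\<lambda>i. - c i))\<^sup>2) = 4 * emb ((qK * a_val \<phi> sw sf n c)\<^sup>2)"
    "4 * emb ((qK * a1_val \<phi> sw sf n (\<lambda>i. - c i))\<^sup>2) = 4 * emb ((qK * a1_val \<phi> sw sf n c)\<^sup>2)"
    unfolding emb_a_val La_uminus inverse_inverse_eq by (simp_all add: algebra_simps)
  then show "(qK * a_val \<phi> sw sf n (\<lambda>i. - c i))\<^sup>2 = (qK * a_val \<phi> sw sf n c)\<^sup>2"
    "(qK * a1_val \<phi> sw sf n (\<lambda>i. - c i))\<^sup>2 = (qK * a1_val \<phi> sw sf n c)\<^sup>2"
    using mult_four_cancel emb_simps(11) by blast+
qed

lemma cpar_class:
  assumes "\<gamma> \<in> SComp n N" "c \<in> \<gamma>"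
  shows "cpar (LabN \<gamma>) = (qK * a_val \<phi> sw sf n c)\<^sup>2" "cpar (LabN1 \<gamma>) = (qK * a1_val \<phi> sw sf n c)\<^sup>2"
proof -
  have "rep_of \<gamma> \<in> \<gamma>" unfolding rep_of_def by (rule SComp_nonempty[OF assms(1)])
  then have "rep_of \<gamma> = c \<or> rep_of \<gamma> = (\<lambda>i. - c i)" using SComp_class(2)[OF assms] by blast
  then show "cpar (LabN \<gamma>) = (qK * a_val \<phi> sw sf n c)\<^sup>2" "cpar (LabN1 \<gamma>) = (qK * a1_val \<phi> sw sf n c)\<^sup>2"
    unfolding cpar_def label2.case using a_val_uminus[of c] by (elim disjE; simp only:)+
qed

lemma cpar_wt: "4 * emb (cpar l) = QE * QE * (2 + wt l + inverse (wt l))"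
  by (cases l) (simp_all only: cpar_def wt_def label2.case emb_a_val,
      simp add: algebra_simps)

lemma labels2_cases:
  assumes "l \<in> labels2 m k"
  obtains \<gamma> c N where "l = LabN \<gamma>" "N \<in> {1..k}" "\<gamma> = {c, \<lambda>i. - c i}" "c \<in> signed_comps n N" "wt l = La c"
  | \<gamma> c N where "l = LabN1 \<gamma>" "even m" "N \<in> {1..<k}" "\<gamma> = {c, \<lambda>i. - c i}" "c \<in> signed_comps n N" "wt l = - La c"
proof -
  from assms consider \<gamma> N where "l = LabN \<gamma>" "N \<in> {1..k}" "\<gamma> \<in> SComp n N"
    | \<gamma> N where "l = LabN1 \<gamma>" "even m" "N \<in> {1..<k}" "\<gamma> \<in> SComp n N"
    unfolding labels2_def SComp_le_def SComp_less_def n_def[symmetric] by (auto split: if_splits)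
  then show thesis
  proof cases
    case (1 \<gamma> N)
    have "rep_of \<gamma> \<in> \<gamma>" unfolding rep_of_def by (rule SComp_nonempty[OF 1(3)])
    then show ?thesis using 1 SComp_class[OF 1(3)] by (intro that(1)[of \<gamma> N "rep_of \<gamma>"]) (simp_all add: wt_def)
  next
    case (2 \<gamma> N)
    have "rep_of \<gamma> \<in> \<gamma>" unfolding rep_of_def by (rule SComp_nonempty[OF 2(4)])
    then show ?thesis using 2 SComp_class[OF 2(4)] by (intro that(2)[of \<gamma> N "rep_of \<gamma>"]) (simp_all add: wt_def)
  qed
qed

lemma signed_comps_eqI:
  assumes "c \<in> signed_comps n N" "d \<in> signed_comps n N'" "\<And>i. i \<in> {1..n} \<Longrightarrow> c i = d i"
  shows "c = d"
proof
  fix i show "c i = d i"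
    using assms by (cases "i \<in> {1..n}") (auto simp: signed_comps_def)
qed

lemma La_nontrivial:
  assumes "c \<in> signed_comps n N" "N \<ge> 1"
  shows "La c \<noteq> 1" "La c \<noteq> - 1"
proof -
  have "La c \<notin> {1, - 1}"
  proof
    assume "La c \<in> {1, - 1}"
    then have "(\<Sum>i=1..n. \<bar>c i\<bar>) = 0" using La_independent[of c] by simp
    then show False using assms by (simp add: signed_comps_def)
  qed
  then show "La c \<noteq> 1" "La c \<noteq> - 1" by simp_all
qed

lemma wt_nontrivial:
  assumes "l \<in> labels2 m k"
  shows "wt l \<noteq> 1" "wt l \<noteq> - 1" "wt l \<noteq> 0"
proof -
  have "wt l \<noteq> 1 \<and> wt l \<noteq> - 1 \<and> wt l \<noteq> 0"
    using assms
  proof (cases rule: labels2_cases)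
    case (1 \<gamma> c N)
    then show ?thesis using La_nontrivial[of c N] La_nonzero[of c] by simp
  next
    case (2 \<gamma> c N)
    then show ?thesis using La_nontrivial[of c N] La_nonzero[of c] by (simp add: minus_equation_iff[of "La c" 1])
  qed
  then show "wt l \<noteq> 1" "wt l \<noteq> - 1" "wt l \<noteq> 0" by simp_all
qed

text \<open>\<open>La\<close> of the difference, or of the sum, of c and d is the sign \<sigma>. By
  independence modulo -1 its exponents vanish, and then \<sigma> = 1; this keeps the cosine and the
  sine family apart.\<close>

lemma La_eq_cases:
  assumes c: "c \<in> signed_comps n N" and d: "d \<in> signed_comps n N'" and s: "\<sigma> \<in> {1, - 1}"
    and eq: "La c = \<sigma> * La d \<or> La c = \<sigma> * inverse (La d)"
  shows "\<sigma> = 1 \<and> (c = d \<or> c = (\<lambda>i. - d i))"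
proof -
  define d' where "d' = (if La c = \<sigma> * La d then d else (\<lambda>i. - d i))"
  have d': "d' = d \<or> d' = (\<lambda>i. - d i)" "La c = \<sigma> * La d'"
    using eq by (simp add: d'_def) (use eq in \<open>cases "La c = \<sigma> * La d"; simp add: d'_def La_uminus\<close>)
  have d'': "d' \<in> signed_comps n N'" using d d'(1) signed_comps_uminus by auto
  have "La (\<lambda>i. c i + - d' i) = \<sigma>"
    unfolding La_add[of c "\<lambda>i. - d' i"] La_uminus d'(2) using La_nonzero[of d'] by simp
  then have "c i + - d' i = 0" if "i \<in> {1..n}" for i
    using La_independent[OF _ that, of "\<lambda>i. c i + - d' i"] s by simp
  then have "c = d'" by (intro signed_comps_eqI[OF c d'']) simp
  moreover have "\<sigma> = 1" using d'(2) La_nonzero[of d'] unfolding \<open>c = d'\<close> by simp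
  ultimately show ?thesis using d'(1) by simp
qed

lemma one_neq_minus_one: "(1 :: 'l alg_closure) \<noteq> - 1"
proof
  assume "(1 :: 'l alg_closure) = - 1"
  then have "1 + 1 = (0 :: 'l alg_closure)" by (simp add: eq_neg_iff_add_eq_0)
  then show False using two_four_E(1) by simp
qed

lemma wt_inject:
  assumes l: "l \<in> labels2 m k" and l': "l' \<in> labels2 m k" and eq: "wt l = wt l' \<or> wt l = inverse (wt l')"
  shows "l = l'"
proof -
  have class_eq: "{c, \<lambda>i. - c i} = {d, \<lambda>i. - d i}" if "c = d \<or> c = (\<lambda>i. - d i)" for c d :: "nat \<Rightarrow> int"
    using that by auto
  have neg: "x = (- 1) * y" if "- x = y" for x y :: "'l alg_closure"
    unfolding that[symmetric] by simp
  from l show ?thesis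
  proof (cases rule: labels2_cases)
    case l1: (1 \<gamma> c N)
    from l' show ?thesis
    proof (cases rule: labels2_cases)
      case (1 \<gamma>' d N')
      then have "La c = 1 * La d \<or> La c = 1 * inverse (La d)" using eq l1 by simp
      from La_eq_cases[OF l1(4) 1(4) _ this] show ?thesis using class_eq l1 1 by simp
    next
      case (2 \<gamma>' d N')
      then have "La c = (- 1) * La d \<or> La c = (- 1) * inverse (La d)" using eq l1 by simp
      from La_eq_cases[OF l1(4) 2(5) _ this] show ?thesis using one_neq_minus_one by simp
    qed
  next
    case l1: (2 \<gamma> c N)
    from l' show ?thesis
    proof (cases rule: labels2_cases)
      case (1 \<gamma>' d N')
      then have "La c = (- 1) * La d \<or> La c = (- 1) * inverse (La d)"
        using eq unfolding l1(6) 1(5) by (blast intro: neg)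
      from La_eq_cases[OF l1(5) 1(4) _ this] show ?thesis using one_neq_minus_one by simp
    next
      case (2 \<gamma>' d N')
      then have "La c = 1 * La d \<or> La c = 1 * inverse (La d)" using eq l1 by simp
      from La_eq_cases[OF l1(5) 2(5) _ this] show ?thesis using class_eq l1 2 by simp
    qed
  qed
qed

text \<open>M + 1/M determines M up to inversion, and inversion stays within one equivalence
  class.\<close>

lemma cpar_inject:
  assumes l: "l \<in> labels2 m k" and l': "l' \<in> labels2 m k" and eq: "cpar l = cpar l'"
  shows "l = l'"
proof (rule wt_inject[OF l l'])
  define M M' where "M = wt l" and "M' = wt l'"
  have nz: "M \<noteq> 0" "M' \<noteq> 0" using wt_nontrivial(3)[OF l] wt_nontrivial(3)[OF l'] by (simp_all add: M_def M'_def)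
  have "QE * QE * (2 + M + inverse M) = QE * QE * (2 + M' + inverse M')"
    using cpar_wt[of l] cpar_wt[of l'] eq by (simp only: M_def M'_def)
  moreover have "QE * QE \<noteq> 0" using QE_nonzero mult_eq_0_iff by blast
  ultimately have "2 + M + inverse M = 2 + M' + inverse M'" using mult_left_cancel by blast
  then have "(M + inverse M) * (M * M') = (M' + inverse M') * (M * M')" by (simp add: add.assoc)
  then have "M * M * M' + M' = M' * M' * M + M"
    using nz by (simp add: algebra_simps)
  then have "(M - M') * (M * M' - 1) = 0" by (simp add: algebra_simps)
  then have "M = M' \<or> M * M' = 1" by simp
  then show "wt l = wt l' \<or> wt l = inverse (wt l')"
    unfolding M_def[symmetric] M'_def[symmetric] using inverse_unique[of M' M] by (auto simp: mult.commute)
qed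

lemma wt_as_prod:
  assumes "l \<in> labels2 m k"
  shows "\<exists>la\<in>{1..k} \<rightarrow> LAM. (\<Prod>i=1..k. la i) = wt l"
proof -
  have extend: "\<exists>la\<in>{1..k} \<rightarrow> LAM. (\<Prod>i=1..k. la i) = \<epsilon> * La c"
    if c: "c \<in> signed_comps n N" and N: "N \<le> k" and e: "\<epsilon> = 1 \<or> (\<epsilon> = - 1 \<and> even m \<and> N < k)" for c N \<epsilon>
  proof -
    obtain \<mu> where \<mu>: "\<And>i. \<mu> i \<in> LAM" "(\<Prod>i=1..N. \<mu> i) = La c" using La_as_prod[OF c] by blast
    \<comment> \<open>Position N + 1 carries the sign, which is available because N < k whenever the
      sign is -1; the remaining positions are padded with 1.\<close>
    define la where "la i = (if i \<le> N then \<mu> i else if i = Suc N then \<epsilon> else 1)" for i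
    have "1 \<in> LAM" "\<epsilon> \<in> LAM" using e by (auto simp: LAM_def)
    then have "la \<in> {1..k} \<rightarrow> LAM" using \<mu>(1) by (simp add: la_def)
    moreover have "(\<Prod>i=1..k. la i) = \<epsilon> * La c"
    proof -
      have split: "{1..k} = {1..N} \<union> {N<..k}" using N by auto
      have "(\<Prod>i=1..k. la i) = (\<Prod>i=1..N. la i) * (\<Prod>i\<in>{N<..k}. la i)"
        unfolding split by (rule prod.union_disjoint) auto
      also have "(\<Prod>i=1..N. la i) = La c" unfolding \<mu>(2)[symmetric] by (intro prod.cong) (auto simp: la_def)
      also have "(\<Prod>i\<in>{N<..k}. la i) = (\<Prod>i\<in>{N<..k}. if i = Suc N then \<epsilon> else 1)"
        by (intro prod.cong) (auto simp: la_def)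
      also have "\<dots> = \<epsilon>" using e by (auto simp: prod.delta)
      finally show ?thesis by (simp add: mult.commute)
    qed
    ultimately show ?thesis by blast
  qed
  from assms show ?thesis
  proof (cases rule: labels2_cases)
    case (1 \<gamma> c N)
    then show ?thesis using extend[OF 1(4), of 1] by simp
  next
    case (2 \<gamma> c N)
    then show ?thesis using extend[OF 2(5), of "- 1"] by simp
  qed
qed

text \<open>The values of q^2 (2 - M - 1/M)/4: 0 for M = 1, q^2 for M = -1, and q^2 - c for the
  weights of the two-dimensional labels.\<close>

definition eigenvalue :: "'k \<Rightarrow> bool" where
  "eigenvalue y \<longleftrightarrow> y = 0 \<or> (even m \<and> y = qK * qK) \<or> (\<exists>l\<in>labels2 m k. y = qK * qK - cpar l)"

text \<open>\<open>prod_LAM\<close> writes the product as plus or minus \<open>La c\<close>. The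
  zero composition accounts for the values 0 and q^2, and every other one for a label.\<close>

lemma eigenvalue_exists:
  assumes "\<And>i. i \<in> {1..k} \<Longrightarrow> \<mu> i \<in> LAM"
  shows "\<exists>y. eigenvalue y \<and> 4 * emb y = QE * QE * (2 - (\<Prod>i=1..k. \<mu> i) - inverse (\<Prod>i=1..k. \<mu> i))"
proof -
  let ?M = "\<Prod>i=1..k. \<mu> i"
  have zero: "La c = 1" if "c \<in> signed_comps n 0" for c
  proof -
    have "c i = 0" if "i \<in> {1..n}" for i
      using that \<open>c \<in> signed_comps n 0\<close> by (auto simp: signed_comps_def sum_nonneg_eq_0_iff)
    then show ?thesis by (simp add: La_def)
  qed
  have four: "4 * emb (qK * qK) = QE * QE * 4" by simp
  have "(\<exists>N'\<le>k. \<exists>c\<in>signed_comps n N'. ?M = La c) \<or>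
    (even m \<and> (\<exists>N'<k. \<exists>c\<in>signed_comps n N'. ?M = - La c))"
    by (rule prod_LAM) (rule assms)
  then show ?thesis
  proof (elim disjE exE conjE bexE)
    fix N c assume *: "N \<le> k" "c \<in> signed_comps n N" "?M = La c"
    show ?thesis
    proof (cases "N = 0")
      case True
      then have "?M = 1" using * zero by simp
      then show ?thesis by (intro exI[of _ 0]) (simp add: eigenvalue_def)
    next
      case False
      let ?\<gamma> = "{c, \<lambda>i. - c i}"
      have \<gamma>: "?\<gamma> \<in> SComp n N" by (rule SComp_intro[OF *(2)])
      then have "LabN ?\<gamma> \<in> labels2 m k"
        using False *(1) unfolding labels2_def SComp_le_def n_def[symmetric]
        by (intro UnI1 imageI UN_I[where a = N] \<gamma>) simp
      moreover have "4 * emb (qK * qK - cpar (LabN ?\<gamma>)) = QE * QE * (2 - ?M - inverse ?M)"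
        unfolding cpar_class(1)[OF \<gamma> insertI1] emb_simps(6) right_diff_distrib[of 4] emb_a_val four *(3)
        by (simp add: algebra_simps)
      ultimately show ?thesis unfolding eigenvalue_def by blast
    qed
  next
    fix N c assume *: "even m" "N < k" "c \<in> signed_comps n N" "?M = - La c"
    show ?thesis
    proof (cases "N = 0")
      case True
      then have "?M = - 1" using * zero by simp
      then have "4 * emb (qK * qK) = QE * QE * (2 - ?M - inverse ?M)" unfolding four by simp
      then show ?thesis using *(1) unfolding eigenvalue_def by blast
    next
      case False
      let ?\<gamma> = "{c, \<lambda>i. - c i}"
      have \<gamma>: "?\<gamma> \<in> SComp n N" by (rule SComp_intro[OF *(3)])
      then have "LabN1 ?\<gamma> \<in> labels2 m k"
        using False *(1,2) unfolding labels2_def SComp_less_def n_def[symmetric] if_P[OF *(1)]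
        by (intro UnI2 imageI UN_I[where a = N] \<gamma>) simp
      moreover have "4 * emb (qK * qK - cpar (LabN1 ?\<gamma>)) = QE * QE * (2 - ?M - inverse ?M)"
        unfolding cpar_class(2)[OF \<gamma> insertI1] emb_simps(6) right_diff_distrib[of 4] emb_a_val four *(4)
        by (simp add: algebra_simps)
      ultimately show ?thesis unfolding eigenvalue_def by blast
    qed
  qed
qed

definition annihilator :: "'k list \<Rightarrow> ('k, 'h) KH_elem" where
  "annihilator ys = foldr (\<lambda>y z. (YK \<ominus>\<^bsub>KH\<^esub> kap y) \<otimes>\<^bsub>KH\<^esub> z) ys \<one>\<^bsub>KH\<^esub>"

lemma annihilator_simps [simp]:
  "annihilator [] = \<one>\<^bsub>KH\<^esub>" "annihilator (y # ys) = (YK \<ominus>\<^bsub>KH\<^esub> kap y) \<otimes>\<^bsub>KH\<^esub> annihilator ys"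
  by (simp_all add: annihilator_def)

lemma annihilator_closed [simp]: "annihilator ys \<in> carrier KH"
  by (induction ys) auto

text \<open>Every functional is an eigenvector for multiplication by Y, with one of finitely many
  eigenvalues, so the factor belonging to its eigenvalue kills it. \<open>KH_zero\<close> then makes
  the product itself vanish.\<close>

lemma annihilator_exists: "\<exists>ys. (\<forall>y\<in>set ys. eigenvalue y) \<and> annihilator ys = \<zero>\<^bsub>KH\<^esub>"
proof -
  let ?Ms = "(\<lambda>\<mu>. \<Prod>i=1..k. \<mu> i) ` ({1..k} \<rightarrow>\<^sub>E LAM)"
  have "\<forall>M\<in>?Ms. \<exists>y. eigenvalue y \<and> 4 * emb y = QE * QE * (2 - M - inverse M)"
    using eigenvalue_exists by (auto simp: PiE_iff)
  from bchoice[OF this] obtain yf where yf: "\<forall>M\<in>?Ms. eigenvalue (yf M) \<and> 4 * emb (yf M) = QE * QE * (2 - M - inverse M)" ..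
  have "finite (yf ` ?Ms)" by (intro finite_imageI finite_PiE) (auto simp: finite_LAM)
  from finite_list[OF this] obtain ys where ys: "set ys = yf ` ?Ms" ..
  have "PhK la c (annihilator ys) = 0" if la: "la \<in> {1..k} \<rightarrow> LAM" for la c
  proof -
    note A = kadditiveD[OF PhK(1)[OF la]]
    have "flip_weight la c = (\<Prod>i=1..k. restrict (\<lambda>i. if c i then inverse (la i) else la i) {1..k} i)"
      unfolding flip_weight_def by (intro prod.cong) auto
    moreover have "restrict (\<lambda>i. if c i then inverse (la i) else la i) {1..k} \<in> {1..k} \<rightarrow>\<^sub>E LAM"
      using la inverse_LAM by (auto simp: Pi_iff)
    ultimately have M: "flip_weight la c \<in> ?Ms" by (rule image_eqI)
    define y0 where "y0 = yf (flip_weight la c)"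
    have y0: "PhK la c (YK \<otimes>\<^bsub>KH\<^esub> z) = emb y0 * PhK la c z" if "z \<in> carrier KH" for z
    proof -
      have "4 * PhK la c (YK \<otimes>\<^bsub>KH\<^esub> z) = 4 * (emb y0 * PhK la c z)"
        unfolding PhK_Y[OF la that] mult.assoc[of 4, symmetric] using yf M by (simp only: y0_def)
      then show ?thesis by (rule mult_four_cancel)
    qed
    have step: "PhK la c ((YK \<ominus>\<^bsub>KH\<^esub> kap y) \<otimes>\<^bsub>KH\<^esub> z) = (emb y0 - emb y) * PhK la c z" if z: "z \<in> carrier KH" for y z
    proof -
      have "(YK \<ominus>\<^bsub>KH\<^esub> kap y) \<otimes>\<^bsub>KH\<^esub> z = YK \<otimes>\<^bsub>KH\<^esub> z \<ominus>\<^bsub>KH\<^esub> kap y \<otimes>\<^bsub>KH\<^esub> z"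
        using z by (simp add: a_minus_def KH.l_distr KH.l_minus)
      then show ?thesis
        using z by (simp only: A(4) KH.m_closed YK_closed kap_closed y0 PhK_kap[OF la] left_diff_distrib)
    qed
    have "PhK la c (annihilator zs) = 0" if "y0 \<in> set zs" for zs
      using that by (induction zs) (auto simp: step)
    moreover have "y0 \<in> set ys" unfolding ys y0_def using M by (rule imageI)
    ultimately show ?thesis .
  qed
  then have "annihilator ys = \<zero>\<^bsub>KH\<^esub>" by (intro KH_zero) simp_all
  moreover have "\<forall>y\<in>set ys. eigenvalue y" unfolding ys using yf by (simp add: ball_simps)
  ultimately show ?thesis by blast
qed

end

no_notation fps_nth (infixl "$" 75)

section \<open>The two-dimensional representations\<close>

context nonstandard
begin

definition wv :: "label2 \<Rightarrow> nat \<Rightarrow> 'l alg_closure" where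
  "wv l = (SOME la. la \<in> {1..k} \<rightarrow> LAM \<and> (\<Prod>i=1..k. la i) = wt l)"

lemma wv:
  assumes "l \<in> labels2 m k"
  shows "wv l \<in> {1..k} \<rightarrow> LAM" "(\<Prod>i=1..k. wv l i) = wt l"
proof -
  have "\<exists>la. la \<in> {1..k} \<rightarrow> LAM \<and> (\<Prod>i=1..k. la i) = wt l" using wt_as_prod[OF assms] by blast
  from someI_ex[OF this] show "wv l \<in> {1..k} \<rightarrow> LAM" "(\<Prod>i=1..k. wv l i) = wt l"
    unfolding wv_def[symmetric] by blast+
qed

text \<open>The functionals \<open>tA l\<close>, \<open>tB l\<close> are the coordinates of an intertwiner to \<open>X(c)\<close> with \<open>c = cpar l\<close>.\<close>

definition tB :: "label2 \<Rightarrow> ('k, 'h) KH_elem \<Rightarrow> 'l alg_closure" where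
  "tB l z = 2 * (PhK (wv l) (\<lambda>_. True) z - PhK (wv l) (\<lambda>_. False) z)"

definition tA :: "label2 \<Rightarrow> ('k, 'h) KH_elem \<Rightarrow> 'l alg_closure" where
  "tA l z = QE * ((1 + inverse (wt l)) * PhK (wv l) (\<lambda>_. False) z - (1 + wt l) * PhK (wv l) (\<lambda>_. True) z)"

lemma tAB_linear:
  assumes l: "l \<in> labels2 m k"
  shows "y \<in> carrier KH \<Longrightarrow> z \<in> carrier KH \<Longrightarrow> tA l (y \<oplus>\<^bsub>KH\<^esub> z) = tA l y + tA l z"
    "y \<in> carrier KH \<Longrightarrow> z \<in> carrier KH \<Longrightarrow> tB l (y \<oplus>\<^bsub>KH\<^esub> z) = tB l y + tB l z"
    "z \<in> carrier KH \<Longrightarrow> tA l (kap c \<otimes>\<^bsub>KH\<^esub> z) = emb c * tA l z"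
    "z \<in> carrier KH \<Longrightarrow> tB l (kap c \<otimes>\<^bsub>KH\<^esub> z) = emb c * tB l z"
  by (simp_all add: tA_def tB_def kadditiveD(1)[OF PhK(1)[OF wv(1)[OF l]]] PhK_kap[OF wv(1)[OF l]])
    (simp_all add: algebra_simps)

text \<open>\<open>tB\<close> is antisymmetric under R_1 and hence vanishes after P_1;
  \<open>tA\<close> is antisymmetric under R_2 and vanishes after P_2. The scaling factors are
  chosen to produce the entries 1 and c of the matrices.\<close>

lemma tAB_P:
  assumes l: "l \<in> labels2 m k" and z: "z \<in> carrier KH"
  shows "tA l (P1K \<otimes>\<^bsub>KH\<^esub> z) = QE * tA l z + emb (cpar l) * tB l z" "tB l (P1K \<otimes>\<^bsub>KH\<^esub> z) = 0"
    "tA l (P2K \<otimes>\<^bsub>KH\<^esub> z) = 0" "tB l (P2K \<otimes>\<^bsub>KH\<^esub> z) = tA l z + QE * tB l z"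
proof -
  define f g where "f = wt l" and "g = inverse (wt l)"
  have fg: "f * g = 1" "f * (g * x) = x" for x
    using wt_nontrivial(3)[OF l] by (simp_all add: f_def g_def flip: mult.assoc)
  have F: "flip_weight (wv l) (\<lambda>_. False) = f" by (simp add: flip_weight_def wv(2)[OF l] f_def)
  define t where "t z = PhK (wv l) (\<lambda>_. True) z" for z
  define s where "s z = PhK (wv l) (\<lambda>_. False) z" for z
  have P: "2 * s (P1K \<otimes>\<^bsub>KH\<^esub> z) = QE * (s z + t z)" "2 * s (P2K \<otimes>\<^bsub>KH\<^esub> z) = QE * (s z + f * t z)"
    "2 * t (P1K \<otimes>\<^bsub>KH\<^esub> z) = QE * (t z + s z)" "2 * t (P2K \<otimes>\<^bsub>KH\<^esub> z) = QE * (t z + g * s z)"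
    using PhK_P'[OF wv(1)[OF l] z, of "\<lambda>_. False"] unfolding F t_def s_def g_def f_def by simp_all
  have C: "4 * emb (cpar l) = QE * QE * (2 + f + g)" unfolding f_def g_def by (rule cpar_wt)
  have tA: "tA l z = QE * ((1 + g) * s z - (1 + f) * t z)" and tB: "tB l z = 2 * t z - 2 * s z" for z
    by (simp_all add: tA_def tB_def f_def g_def s_def t_def algebra_simps)
  have two: "2 * tA l z = QE * ((1 + g) * (2 * s z) - (1 + f) * (2 * t z))" for z
    unfolding tA by (simp only: algebra_simps)
  show "tB l (P1K \<otimes>\<^bsub>KH\<^esub> z) = 0" unfolding tB P by (simp add: add.commute)
  have "2 * tA l (P2K \<otimes>\<^bsub>KH\<^esub> z) = 2 * 0" unfolding two P by (simp add: algebra_simps fg)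
  then show "tA l (P2K \<otimes>\<^bsub>KH\<^esub> z) = 0" by (rule mult_two_cancel)
  show "tB l (P2K \<otimes>\<^bsub>KH\<^esub> z) = tA l z + QE * tB l z" unfolding tB P tA by (simp add: algebra_simps)
  have "4 * tA l (P1K \<otimes>\<^bsub>KH\<^esub> z) = 2 * (2 * tA l (P1K \<otimes>\<^bsub>KH\<^esub> z))" by simp
  also have "2 * tA l (P1K \<otimes>\<^bsub>KH\<^esub> z) = QE * ((1 + g) * (QE * (s z + t z)) - (1 + f) * (QE * (t z + s z)))"
    unfolding two P ..
  also have "2 * \<dots> = QE * (4 * tA l z) + (4 * emb (cpar l)) * tB l z"
    unfolding C tB tA by (simp add: algebra_simps fg)
  also have "\<dots> = 4 * (QE * tA l z + emb (cpar l) * tB l z)" by (simp only: algebra_simps)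
  finally show "tA l (P1K \<otimes>\<^bsub>KH\<^esub> z) = QE * tA l z + emb (cpar l) * tB l z" by (rule mult_four_cancel)
qed

text \<open>Tested on P_2, where \<open>tA\<close> vanishes, and then on the unit. The values of
  \<open>tB\<close> and \<open>tA\<close> there are nonzero because the weight is neither 1 nor
  -1.\<close>

lemma tAB_independent:
  assumes l: "l \<in> labels2 m k" and zero: "\<And>z. z \<in> carrier KH \<Longrightarrow> a * tA l z + b * tB l z = 0"
  shows "a = 0" "b = 0"
proof -
  have 1: "tA l \<one>\<^bsub>KH\<^esub> = - (QE * (1 + wt l))" "tB l \<one>\<^bsub>KH\<^esub> = 2"
    by (simp_all add: tA_def tB_def PhK_one[OF wv(1)[OF l]] algebra_simps)
  have P2: "tA l P2K = 0" "tB l P2K = QE * (1 - wt l)"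
    using tAB_P(3,4)[OF l KH.one_closed] unfolding 1 by (simp_all add: algebra_simps)
  have "b * (QE * (1 - wt l)) = 0" using zero[OF PK_closed(2)] unfolding P2 by simp
  moreover have "QE * (1 - wt l) \<noteq> 0"
    using QE_nonzero wt_nontrivial(1)[OF l] no_zero_divisors[of QE "1 - wt l"] right_minus_eq by metis
  ultimately show b: "b = 0" using mult_eq_0_iff by blast
  have "a * (QE * (1 + wt l)) = 0" using zero[OF KH.one_closed] unfolding 1 b by simp
  moreover have "1 + wt l \<noteq> 0" using wt_nontrivial(2)[OF l] by (metis add.commute eq_neg_iff_add_eq_0)
  ultimately show "a = 0" using QE_nonzero mult_eq_0_iff by blast
qed

text \<open>The functionals have values in the closure while the matrix has entries in K. Existence
  on generators together with uniqueness then yields a homomorphism to matrices over K.\<close>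

definition acts :: "label2 \<Rightarrow> 'k^2^2 \<Rightarrow> ('k, 'h) KH_elem \<Rightarrow> bool" where
  "acts l A z \<longleftrightarrow> (\<forall>z'\<in>carrier KH.
     tA l (z \<otimes>\<^bsub>KH\<^esub> z') = emb (A$1$1) * tA l z' + emb (A$1$2) * tB l z' \<and>
     tB l (z \<otimes>\<^bsub>KH\<^esub> z') = emb (A$2$1) * tA l z' + emb (A$2$2) * tB l z')"

lemma acts_unique:
  assumes l: "l \<in> labels2 m k" and A: "acts l A z" and B: "acts l B z"
  shows "A = B"
proof -
  have "emb (A$1$1) - emb (B$1$1) = 0 \<and> emb (A$1$2) - emb (B$1$2) = 0"
    by (intro conjI tAB_independent[OF l, of "emb (A$1$1) - emb (B$1$1)" "emb (A$1$2) - emb (B$1$2)"])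
      (use A B in \<open>force simp: acts_def algebra_simps\<close>)+
  moreover have "emb (A$2$1) - emb (B$2$1) = 0 \<and> emb (A$2$2) - emb (B$2$2) = 0"
    by (intro conjI tAB_independent[OF l, of "emb (A$2$1) - emb (B$2$1)" "emb (A$2$2) - emb (B$2$2)"])
      (use A B in \<open>force simp: acts_def algebra_simps\<close>)+
  ultimately show ?thesis by (simp add: vec_eq_iff forall_2)
qed

lemma acts_kap: "l \<in> labels2 m k \<Longrightarrow> acts l (mat c) (kap c)"
  by (simp add: acts_def tAB_linear mat_def)

lemma acts_P:
  assumes "l \<in> labels2 m k"
  shows "acts l (X_mat1 qK (cpar l)) P1K" "acts l (X_mat2 qK) P2K"
  using tAB_P[OF assms] by (simp_all add: acts_def X_mat1_def X_mat2_def del: emb_simps(9) phi_simps)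

lemma acts_add:
  assumes "l \<in> labels2 m k" "y \<in> carrier KH" "z \<in> carrier KH" "acts l A y" "acts l B z"
  shows "acts l (A + B) (y \<oplus>\<^bsub>KH\<^esub> z)"
  using assms by (simp add: acts_def KH.l_distr tAB_linear) (simp add: algebra_simps)

lemma acts_mult:
  assumes "l \<in> labels2 m k" "y \<in> carrier KH" "z \<in> carrier KH" "acts l A y" "acts l B z"
  shows "acts l (A ** B) (y \<otimes>\<^bsub>KH\<^esub> z)"
  using assms by (simp add: acts_def KH.m_assoc matrix_matrix_mult_def sum_2) (simp add: algebra_simps)

definition RM :: "label2 \<Rightarrow> ('k, 'h) KH_elem \<Rightarrow> 'k^2^2" where "RM l z = (THE A. acts l A z)"

lemma RM_eq: "l \<in> labels2 m k \<Longrightarrow> acts l A z \<Longrightarrow> RM l z = A"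
  unfolding RM_def by (rule the_equality) (auto dest: acts_unique)

lemma acts_RM: "l \<in> labels2 m k \<Longrightarrow> z \<in> carrier KH \<Longrightarrow> acts l (RM l z) z"
proof -
  assume l: "l \<in> labels2 m k"
  have "z \<in> carrier KH \<Longrightarrow> \<exists>A. acts l A z"
    by (induction z rule: KH_gen_induct) (blast intro: acts_kap acts_P acts_add acts_mult l)+
  then show "z \<in> carrier KH \<Longrightarrow> acts l (RM l z) z" using RM_eq[OF l] by blast
qed

definition R :: "label2 \<Rightarrow> ('k, 'h) KH_elem \<Rightarrow> 'k^2 \<Rightarrow> 'k^2" where "R l z v = RM l z *v v"

lemma R_P:
  assumes "l \<in> labels2 m k"
  shows "R l P1K = (\<lambda>v. X_mat1 qK (cpar l) *v v)" "R l P2K = (\<lambda>v. X_mat2 qK *v v)"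
  unfolding R_def RM_eq[OF assms acts_P(1)[OF assms]] RM_eq[OF assms acts_P(2)[OF assms]] by (rule refl)+

lemma mat_vector_mult: "mat c *v (v :: 'a::field^2) = c *s v"
  by (simp add: vec_eq_iff forall_2 matrix_vector_mult_def mat_def sum_2)

lemma is_rep_R:
  assumes l: "l \<in> labels2 m k"
  shows "is_rep kap KH (*s) (R l)"
  unfolding is_rep_def
proof (intro conjI ballI allI)
  show "vector_space ((*s) :: 'k \<Rightarrow> 'k^2 \<Rightarrow> 'k^2)" by (rule vec.vector_space_axioms)
  show "Vector_Spaces.linear (*s) (*s) (R l z)" for z
    unfolding R_def[abs_def] by (rule matrix_vector_mul_linear_gen)
  fix y z assume yz: "y \<in> carrier KH" "z \<in> carrier KH"
  note A = acts_RM[OF l yz(1)] acts_RM[OF l yz(2)]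
  show "R l (y \<oplus>\<^bsub>KH\<^esub> z) v = R l y v + R l z v" for v
    unfolding R_def RM_eq[OF l acts_add[OF l yz A]] by (rule matrix_vector_mult_add_rdistrib)
  show "R l (y \<otimes>\<^bsub>KH\<^esub> z) v = R l y (R l z v)" for v
    unfolding R_def RM_eq[OF l acts_mult[OF l yz A]] by (rule matrix_vector_mul_assoc[symmetric])
next
  show K: "R l (kap c) v = c *s v" for c v
    unfolding R_def RM_eq[OF l acts_kap[OF l]] by (rule mat_vector_mult)
  show "R l \<one>\<^bsub>KH\<^esub> v = v" for v unfolding kap_hom(3)[symmetric] K by simp
qed

text \<open>With weight M, c = q^2 (1 + M)^2 / (4M) and q^2 - c = -q^2 (1 - M)^2 / (4M). Zero and
  q^2 are exactly the parameters at which X(c) is reducible.\<close>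

lemma cpar_nonzero:
  assumes l: "l \<in> labels2 m k"
  shows "cpar l \<noteq> 0" "cpar l \<noteq> qK * qK"
proof -
  define f g where "f = wt l" and "g = inverse (wt l)"
  have fg: "f * g = 1" using wt_nontrivial(3)[OF l] by (simp add: f_def g_def)
  have C: "f * (4 * emb (cpar l)) = QE * QE * ((1 + f) * (1 + f))"
  proof -
    have "f * (2 + f + g) = (1 + f) * (1 + f)" using fg by (simp add: algebra_simps)
    moreover have "f * (4 * emb (cpar l)) = QE * QE * (f * (2 + f + g))"
      unfolding cpar_wt f_def g_def by (simp only: mult_ac)
    ultimately show ?thesis by (simp only:)
  qed
  have nz: "1 + f \<noteq> 0" "f - 1 \<noteq> 0"
    using wt_nontrivial(1,2)[OF l] by (simp_all add: f_def add_eq_0_iff2 add.commute[of 1])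
  show "cpar l \<noteq> 0"
  proof
    assume "cpar l = 0"
    then have "QE * QE * ((1 + f) * (1 + f)) = 0" using C by simp
    then show False using QE_nonzero nz(1) no_zero_divisors by metis
  qed
  show "cpar l \<noteq> qK * qK"
  proof
    assume "cpar l = qK * qK"
    then have "f * (4 * (QE * QE)) = QE * QE * ((1 + f) * (1 + f))" using C emb_simps(4) by simp
    then have "QE * QE * ((f - 1) * (f - 1)) = 0" by (simp add: algebra_simps)
    then show False using QE_nonzero nz(2) no_zero_divisors by metis
  qed
qed

lemma X_mat_mult:
  "X_mat1 q c *v v = vector [q * v$1 + c * v$2, 0 :: 'a::field]"
  "X_mat2 q *v v = vector [0, v$1 + q * v$2]"
  by (simp_all add: vec_eq_iff forall_2 matrix_vector_mult_def sum_2 X_mat1_def X_mat2_def)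

text \<open>P_2 maps v to a multiple of the second unit vector. If that multiple is zero, P_1 maps v
  to a nonzero multiple of the first one, because c differs from q^2. Either unit vector yields the
  other, as c is nonzero.\<close>

lemma irreducible_R:
  assumes l: "l \<in> labels2 m k"
  shows "irreducible_rep kap KH (*s) (R l)"
  unfolding irreducible_rep_def
proof (intro conjI allI impI)
  show "is_rep kap KH (*s) (R l)" by (rule is_rep_R[OF l])
  show "\<exists>v::'k^2. v \<noteq> 0" by (rule exI[of _ 1]) (simp add: vec_eq_iff)
  fix U :: "('k^2) set"
  assume U: "vec.subspace U \<and> (\<forall>x\<in>carrier KH. \<forall>v\<in>U. R l x v \<in> U)"
  have P: "vector [qK * v$1 + cpar l * v$2, 0] \<in> U" "vector [0, v$1 + qK * v$2] \<in> U" if "v \<in> U" for v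
  proof -
    have "R l P1K v \<in> U" "R l P2K v \<in> U" using U that PK_closed by blast+
    then show "vector [qK * v$1 + cpar l * v$2, 0] \<in> U" "vector [0, v$1 + qK * v$2] \<in> U"
      unfolding R_P[OF l] X_mat_mult by blast+
  qed
  have S: "c *s v \<in> U" if "v \<in> U" for c v using U that by (simp add: vec.subspace_scale)
  define e1 e2 :: "'k^2" where "e1 = vector [1, 0]" and "e2 = vector [0, 1]"
  note cn = cpar_nonzero[OF l]
  have e1_e2: "e2 \<in> U" if "e1 \<in> U" using P(2)[OF that] by (simp add: e1_def e2_def)
  have e2_e1: "e1 \<in> U" if "e2 \<in> U"
  proof -
    have "inverse (cpar l) *s vector [qK * e2$1 + cpar l * e2$2, 0] \<in> U" by (intro S P that)
    also have "inverse (cpar l) *s vector [qK * e2$1 + cpar l * e2$2, 0] = e1"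
      using cn(1) by (simp add: vec_eq_iff forall_2 e1_def e2_def)
    finally show ?thesis .
  qed
  show "U = {0} \<or> U = UNIV"
  proof (cases "U = {0}")
    case False
    then obtain v where v: "v \<in> U" "v \<noteq> 0" using U vec.subspace_0 by blast
    have "e2 \<in> U"
    proof (cases "v$1 + qK * v$2 = 0")
      case True
      then have v1: "v$1 = - (qK * v$2)" by (simp add: eq_neg_iff_add_eq_0)
      then have "v$2 \<noteq> 0" using v(2) by (auto simp: vec_eq_iff forall_2)
      then have d: "(cpar l - qK * qK) * v$2 \<noteq> 0" using cn(2) mult_eq_0_iff right_minus_eq by blast
      have e: "qK * v$1 + cpar l * v$2 = (cpar l - qK * qK) * v$2" unfolding v1 by (simp add: algebra_simps)
      have "inverse ((cpar l - qK * qK) * v$2) *s vector [qK * v$1 + cpar l * v$2, 0] \<in> U" by (intro S P v)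
      also have "inverse ((cpar l - qK * qK) * v$2) *s vector [qK * v$1 + cpar l * v$2, 0] = e1"
        using left_inverse[OF d] unfolding e
        by (simp only: vec_eq_iff forall_2 e1_def vector_smult_component vector_2 mult_zero_right simp_thms)
      finally show ?thesis by (rule e1_e2)
    next
      case False
      have "inverse (v$1 + qK * v$2) *s vector [0, v$1 + qK * v$2] \<in> U" by (intro S P v)
      also have "inverse (v$1 + qK * v$2) *s vector [0, v$1 + qK * v$2] = e2"
        using False by (simp add: vec_eq_iff forall_2 e2_def)
      finally show ?thesis .
    qed
    have "x \<in> U" for x
    proof -
      have "x$1 *s e1 + x$2 *s e2 \<in> U"
        using U S[OF \<open>e2 \<in> U\<close>] S[OF e2_e1[OF \<open>e2 \<in> U\<close>]] by (simp add: vec.subspace_add)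
      also have "x$1 *s e1 + x$2 *s e2 = x" by (simp add: vec_eq_iff forall_2 e1_def e2_def)
      finally show ?thesis .
    qed
    then show ?thesis by blast
  qed simp
qed

end

section \<open>The one-dimensional representations\<close>

lemma alt_commute:
  assumes "\<And>x. f (g x) = g (f x)"
  shows "alt (2 * i) f g v = alt (2 * i) g f v"
  by (induction i) (simp_all add: assms)

lemma vector_space_field: "vector_space ((*) :: 'a::field \<Rightarrow> 'a \<Rightarrow> 'a)"
  by unfold_locales (simp_all add: algebra_simps)

lemma linear_field: "Vector_Spaces.linear (*) (*) (\<lambda>v :: 'a::field. a * v)"
  by unfold_locales (simp_all add: algebra_simps)

lemma field_subspace:
  assumes "module.subspace ((*) :: 'a::field \<Rightarrow> 'a \<Rightarrow> 'a) U"
  shows "U = {0} \<or> U = UNIV"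
proof -
  have M: "Modules.module ((*) :: 'a \<Rightarrow> 'a \<Rightarrow> 'a)" by unfold_locales (simp_all add: algebra_simps)
  have "x \<in> U" if "v \<in> U" "v \<noteq> 0" for v x
    using Modules.module.subspace_scale[OF M assms that(1), of "x / v"] that(2) by simp
  then show ?thesis using Modules.module.subspace_0[OF M assms] by blast
qed

lemma rep_iso_refl:
  assumes "vector_space sc"
  shows "rep_iso B sc \<rho> sc \<rho>"
  unfolding rep_iso_def
  using vector_space.linear_id[OF assms] by (intro exI[of _ id]) simp

context nonstandard
begin

definition dK :: 'k where "dK = \<phi> (u_pow 1 - u_pow (-1)) / 2"
definition bK :: 'k where "bK = \<phi> quantum_two / 2"

lemma two_K: "emb 2 = 2" "(2 :: 'k) \<noteq> 0"
proof -
  show two: "emb 2 = 2" using emb_simps(3)[of 1 1] by simp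
  show "(2 :: 'k) \<noteq> 0" using two two_four_E(1) emb_simps(1) by metis
qed

lemma two_dK: "2 * dK = \<phi> (u_pow 1 - u_pow (-1))" and two_bK: "2 * bK = \<phi> quantum_two"
  using two_K(2) by (simp_all add: dK_def bK_def del: phi_simps(6))

lemma bK_square: "bK * bK = dK * dK + 1"
proof -
  have "emb dK = dH" "emb bK = bH" by (simp_all only: dK_def dH_def bK_def bH_def emb_simps(8) two_K(1))
  then have "emb (bK * bK) = emb (dK * dK + 1)" using bH_square by simp
  then show ?thesis by (simp only: emb_simps(11))
qed

text \<open>\<open>\<mu>1\<close> and \<open>\<mu>2\<close> are the values of r_1 and r_2, so C'_s
  goes to [2] (1 + \<mu>)/2, which is [2] or 0.\<close>

definition chr :: "'k \<Rightarrow> 'k \<Rightarrow> 'h \<Rightarrow> 'k" where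
  "chr \<mu>1 \<mu>2 = (SOME v. (\<forall>h\<in>carrier H. \<forall>h'\<in>carrier H. v (h \<oplus>\<^bsub>H\<^esub> h') = v h + v h') \<and>
     (\<forall>a. \<forall>h\<in>carrier H. v (\<eta> a \<otimes>\<^bsub>H\<^esub> h) = \<phi> a * v h) \<and>
     (\<forall>h\<in>carrier H. v (T s1 \<otimes>\<^bsub>H\<^esub> h) = (dK + \<mu>1 * bK) * v h) \<and>
     (\<forall>h\<in>carrier H. v (T s2 \<otimes>\<^bsub>H\<^esub> h) = (dK + \<mu>2 * bK) * v h) \<and> v \<one>\<^bsub>H\<^esub> = 1)"

text \<open>For odd m the two reflections are conjugate, which forces equal signs.\<close>

definition admissible :: "'k \<Rightarrow> 'k \<Rightarrow> bool" where
  "admissible \<mu>1 \<mu>2 \<longleftrightarrow> \<mu>1 * \<mu>1 = 1 \<and> \<mu>2 * \<mu>2 = 1 \<and> (\<mu>1 = \<mu>2 \<or> even m)"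

lemma chr:
  assumes "admissible \<mu>1 \<mu>2"
  shows "h \<in> carrier H \<Longrightarrow> h' \<in> carrier H \<Longrightarrow> chr \<mu>1 \<mu>2 (h \<oplus>\<^bsub>H\<^esub> h') = chr \<mu>1 \<mu>2 h + chr \<mu>1 \<mu>2 h'"
    "h \<in> carrier H \<Longrightarrow> chr \<mu>1 \<mu>2 (\<eta> a \<otimes>\<^bsub>H\<^esub> h) = \<phi> a * chr \<mu>1 \<mu>2 h"
    "h \<in> carrier H \<Longrightarrow> chr \<mu>1 \<mu>2 (T s1 \<otimes>\<^bsub>H\<^esub> h) = (dK + \<mu>1 * bK) * chr \<mu>1 \<mu>2 h"
    "h \<in> carrier H \<Longrightarrow> chr \<mu>1 \<mu>2 (T s2 \<otimes>\<^bsub>H\<^esub> h) = (dK + \<mu>2 * bK) * chr \<mu>1 \<mu>2 h"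
    "chr \<mu>1 \<mu>2 \<one>\<^bsub>H\<^esub> = 1"
proof -
  have mu: "\<mu>1 * \<mu>1 = 1" "\<mu>2 * \<mu>2 = 1" "\<mu>1 = \<mu>2 \<or> even m" using assms by (simp_all add: admissible_def)
  define sc where "sc a x = \<phi> a * x" for a and x :: 'k
  define M1 M2 where "M1 x = (dK + \<mu>1 * bK) * x" and "M2 x = (dK + \<mu>2 * bK) * x" for x
  have hom: "Modules.module_hom sc sc (\<lambda>x. c * x)" for c
    by unfold_locales (simp_all add: sc_def algebra_simps)
  have sq: "(dK + \<mu> * bK) * ((dK + \<mu> * bK) * x) = sc (u_pow 1 - u_pow (-1)) ((dK + \<mu> * bK) * x) + x"
    if "\<mu> * \<mu> = 1" for \<mu> x
  proof -
    have "(dK + \<mu> * bK) * (dK + \<mu> * bK) = 2 * dK * (dK + \<mu> * bK) + (\<mu> * \<mu> * (bK * bK) - dK * dK)"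
      by (simp add: algebra_simps)
    also have "\<dots> = 2 * dK * (dK + \<mu> * bK) + 1" unfolding that bK_square by simp
    finally have sq: "(dK + \<mu> * bK) * (dK + \<mu> * bK) = 2 * dK * (dK + \<mu> * bK) + 1" .
    show ?thesis unfolding sc_def two_dK[symmetric] mult.assoc[symmetric] sq by (simp only: distrib_right mult_1_left)
  qed
  have br: "alt m M1 M2 1 = alt m M2 M1 1"
  proof (cases "\<mu>1 = \<mu>2")
    case False
    then obtain i where "m = 2 * i" using mu(3) by (auto elim: evenE)
    moreover have "M1 (M2 x) = M2 (M1 x)" for x by (simp add: M1_def M2_def mult_ac)
    ultimately show ?thesis using alt_commute[of M1 M2] by simp
  qed (simp add: M1_def[abs_def] M2_def[abs_def])
  obtain v where v: "\<And>h h'. h \<in> carrier H \<Longrightarrow> h' \<in> carrier H \<Longrightarrow> v (h \<oplus>\<^bsub>H\<^esub> h') = v h + v h'"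
    "\<And>a h. h \<in> carrier H \<Longrightarrow> v (\<eta> a \<otimes>\<^bsub>H\<^esub> h) = sc a (v h)"
    "\<And>h. h \<in> carrier H \<Longrightarrow> v (T s1 \<otimes>\<^bsub>H\<^esub> h) = M1 (v h)"
    "\<And>h. h \<in> carrier H \<Longrightarrow> v (T s2 \<otimes>\<^bsub>H\<^esub> h) = M2 (v h)" "v \<one>\<^bsub>H\<^esub> = 1"
    by (rule module_map_exists[of sc M1 M2 1])
      (use hom sq[OF mu(1)] sq[OF mu(2)] br in \<open>auto simp: M1_def[abs_def] M2_def[abs_def]\<close>)
  have "\<exists>v. (\<forall>h\<in>carrier H. \<forall>h'\<in>carrier H. v (h \<oplus>\<^bsub>H\<^esub> h') = v h + v h') \<and>
     (\<forall>a. \<forall>h\<in>carrier H. v (\<eta> a \<otimes>\<^bsub>H\<^esub> h) = \<phi> a * v h) \<and>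
     (\<forall>h\<in>carrier H. v (T s1 \<otimes>\<^bsub>H\<^esub> h) = (dK + \<mu>1 * bK) * v h) \<and>
     (\<forall>h\<in>carrier H. v (T s2 \<otimes>\<^bsub>H\<^esub> h) = (dK + \<mu>2 * bK) * v h) \<and> v \<one>\<^bsub>H\<^esub> = 1"
    using v unfolding sc_def M1_def M2_def by (intro exI[of _ v]) simp
  note * = someI_ex[OF this, folded chr_def]
  show "h \<in> carrier H \<Longrightarrow> h' \<in> carrier H \<Longrightarrow> chr \<mu>1 \<mu>2 (h \<oplus>\<^bsub>H\<^esub> h') = chr \<mu>1 \<mu>2 h + chr \<mu>1 \<mu>2 h'"
    "h \<in> carrier H \<Longrightarrow> chr \<mu>1 \<mu>2 (\<eta> a \<otimes>\<^bsub>H\<^esub> h) = \<phi> a * chr \<mu>1 \<mu>2 h"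
    "h \<in> carrier H \<Longrightarrow> chr \<mu>1 \<mu>2 (T s1 \<otimes>\<^bsub>H\<^esub> h) = (dK + \<mu>1 * bK) * chr \<mu>1 \<mu>2 h"
    "h \<in> carrier H \<Longrightarrow> chr \<mu>1 \<mu>2 (T s2 \<otimes>\<^bsub>H\<^esub> h) = (dK + \<mu>2 * bK) * chr \<mu>1 \<mu>2 h"
    "chr \<mu>1 \<mu>2 \<one>\<^bsub>H\<^esub> = 1"
    using * by simp_all
qed

lemma T_gens_closed: "T s1 \<in> carrier H" "T s2 \<in> carrier H"
  using T_closed s1_closed s2_closed by simp_all

lemma chr_mult:
  assumes "admissible \<mu>1 \<mu>2" "h \<in> carrier H" "h' \<in> carrier H"
  shows "chr \<mu>1 \<mu>2 (h \<otimes>\<^bsub>H\<^esub> h') = chr \<mu>1 \<mu>2 h * chr \<mu>1 \<mu>2 h'"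
  using assms(2)
proof (induction h rule: H_induct)
  case one
  then show ?case using assms by (simp add: chr)
next
  case (scale a h)
  have "\<eta> a \<otimes>\<^bsub>H\<^esub> h \<otimes>\<^bsub>H\<^esub> h' = \<eta> a \<otimes>\<^bsub>H\<^esub> (h \<otimes>\<^bsub>H\<^esub> h')" using scale assms(3) by (simp add: H.m_assoc)
  then show ?case using scale assms by (simp add: chr)
next
  case (add h1 h2)
  then show ?case using assms by (simp add: chr H.l_distr algebra_simps)
next
  case (T1 h)
  have "T s1 \<otimes>\<^bsub>H\<^esub> h \<otimes>\<^bsub>H\<^esub> h' = T s1 \<otimes>\<^bsub>H\<^esub> (h \<otimes>\<^bsub>H\<^esub> h')" using T1 assms(3) T_gens_closed by (simp add: H.m_assoc)
  then show ?case using T1 assms by (simp add: chr)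
next
  case (T2 h)
  have "T s2 \<otimes>\<^bsub>H\<^esub> h \<otimes>\<^bsub>H\<^esub> h' = T s2 \<otimes>\<^bsub>H\<^esub> (h \<otimes>\<^bsub>H\<^esub> h')" using T2 assms(3) T_gens_closed by (simp add: H.m_assoc)
  then show ?case using T2 assms by (simp add: chr)
qed

lemma chr_eta:
  assumes "admissible \<mu>1 \<mu>2"
  shows "chr \<mu>1 \<mu>2 (\<eta> a) = \<phi> a"
  using chr(2)[OF assms H.one_closed, of a] chr(5)[OF assms] by simp

lemma is_character_chr:
  assumes "admissible \<mu>1 \<mu>2"
  shows "is_character \<phi> H \<eta> (chr \<mu>1 \<mu>2)"
  unfolding is_character_def ring_hom_def
  by (simp add: chr[OF assms] chr_mult[OF assms] chr_eta[OF assms])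

lemma chr_C_plus:
  assumes "admissible \<mu>1 \<mu>2"
  shows "2 * chr \<mu>1 \<mu>2 (C_plus H \<eta> T s1) = (1 + \<mu>1) * \<phi> quantum_two"
    "2 * chr \<mu>1 \<mu>2 (C_plus H \<eta> T s2) = (1 + \<mu>2) * \<phi> quantum_two"
proof -
  have "\<phi> (u_pow 1 - u_pow (-1)) + 2 * \<phi> (u_pow (-1)) = \<phi> quantum_two"
    by (simp add: quantum_two_def)
  then have e: "2 * dK + 2 * \<phi> (u_pow (-1)) = 2 * bK" unfolding two_dK two_bK .
  have T: "chr \<mu>1 \<mu>2 (T s1) = dK + \<mu>1 * bK" "chr \<mu>1 \<mu>2 (T s2) = dK + \<mu>2 * bK"
    using chr(3,4)[OF assms H.one_closed] chr(5)[OF assms] T_gens_closed by simp_all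
  have "2 * (dK + \<mu> * bK + \<phi> (u_pow (-1))) = (1 + \<mu>) * \<phi> quantum_two" for \<mu>
    unfolding two_bK[symmetric] using e by (simp add: algebra_simps)
  then show "2 * chr \<mu>1 \<mu>2 (C_plus H \<eta> T s1) = (1 + \<mu>1) * \<phi> quantum_two"
    "2 * chr \<mu>1 \<mu>2 (C_plus H \<eta> T s2) = (1 + \<mu>2) * \<phi> quantum_two"
    unfolding C_plus_def by (simp_all only: chr(1)[OF assms] T_gens_closed eta_closed T chr_eta[OF assms])
qed

section \<open>Characters of the tensor power and of its scalar extension\<close>

fun sgn1 :: "label1 \<Rightarrow> 'k" where
  "sgn1 EpsPlus = 1" | "sgn1 EpsMinus = - 1" | "sgn1 Eps1 = 1" | "sgn1 Eps2 = - 1"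

fun sgn2 :: "label1 \<Rightarrow> 'k" where
  "sgn2 EpsPlus = 1" | "sgn2 EpsMinus = - 1" | "sgn2 Eps1 = - 1" | "sgn2 Eps2 = 1"

lemma admissible_labels: "l \<in> labels1 m \<Longrightarrow> admissible (sgn1 l) (sgn2 l)" "admissible 1 1"
  by (auto simp: labels1_def admissible_def split: if_splits)

text \<open>Only the product of the signs over all positions matters for P_s, so a single position
  can realise all four characters; the other positions carry \<epsilon>_+.\<close>

definition fam :: "label1 \<Rightarrow> nat \<Rightarrow> 'h \<Rightarrow> 'k" where
  "fam l i = (if i = 1 then chr (sgn1 l) (sgn2 l) else chr 1 1)"

lemma fam:
  assumes "l \<in> labels1 m"
  shows "semilinear_family \<phi> (fam l)"
    "h \<in> carrier H \<Longrightarrow> h' \<in> carrier H \<Longrightarrow> fam l i (h \<otimes>\<^bsub>H\<^esub> h') = fam l i h * fam l i h'"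
    "fam l i \<one>\<^bsub>H\<^esub> = 1"
    "h \<in> carrier H \<Longrightarrow> fam l i (T s1 \<otimes>\<^bsub>H\<^esub> h) = (dK + (if i = 1 then sgn1 l else 1) * bK) * fam l i h"
    "h \<in> carrier H \<Longrightarrow> fam l i (T s2 \<otimes>\<^bsub>H\<^esub> h) = (dK + (if i = 1 then sgn2 l else 1) * bK) * fam l i h"
  using chr[OF admissible_labels(1)[OF assms]] chr[OF admissible_labels(2)]
    chr_mult[OF admissible_labels(1)[OF assms]] chr_mult[OF admissible_labels(2)]
  by (simp_all add: fam_def semilinear_family_def semilinear_def)

lemma tfun_fam_one:
  assumes "l \<in> labels1 m"
  shows "tfun (fam l) \<one>\<^bsub>TT\<^esub> = 1"
  unfolding pur_one[symmetric] by (subst tfun(2)[OF fam(1)[OF assms]]) (simp_all add: fam(3)[OF assms])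

lemma tfun_fam_mult:
  assumes l: "l \<in> labels1 m" and x: "x \<in> carrier TT" and y: "y \<in> carrier TT"
  shows "tfun (fam l) (x \<otimes>\<^bsub>TT\<^esub> y) = tfun (fam l) x * tfun (fam l) y"
proof -
  note A = additiveD[OF tfun(1)[OF fam(1)[OF l]]] and V = tfun(2)[OF fam(1)[OF l]]
  show ?thesis
    using x
  proof (induction x rule: TT_induct)
    case (pur g)
    show ?case
      using y
    proof (induction y rule: TT_induct)
      case (pur h)
      have "(\<lambda>i. g i \<otimes>\<^bsub>H\<^esub> h i) \<in> {1..k} \<rightarrow> carrier H"
        using pur \<open>g \<in> _\<close> by (auto intro!: H.m_closed)
      then have "tfun (fam l) (pur g \<otimes>\<^bsub>TT\<^esub> pur h) = (\<Prod>i=1..k. fam l i (g i \<otimes>\<^bsub>H\<^esub> h i))"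
        using pur \<open>g \<in> _\<close> by (simp add: pur_mult V)
      also have "\<dots> = (\<Prod>i=1..k. fam l i (g i) * fam l i (h i))"
        using pur \<open>g \<in> _\<close> by (intro prod.cong fam(2)[OF l]) auto
      finally show ?case using pur \<open>g \<in> _\<close> by (simp add: V prod.distrib)
    next
      case (add x y)
      then show ?case using pur by (simp add: TT.r_distr A algebra_simps)
    next
      case (neg x)
      then show ?case using pur by (simp add: TT.r_minus A)
    qed
  next
    case (add x x')
    then show ?case using y by (simp add: TT.l_distr A algebra_simps)
  next
    case (neg x)
    then show ?case using y by (simp add: TT.l_minus A)
  qed
qed

lemma tfun_fam_P:
  assumes l: "l \<in> labels1 m"
  shows "2 * tfun (fam l) p1 = (1 + sgn1 l) * qK" "2 * tfun (fam l) p2 = (1 + sgn2 l) * qK"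
proof -
  have pr: "(\<Prod>i=1..k. 2 * ((if i = 1 then \<sigma> else 1) * bK)) = \<sigma> * qK" for \<sigma>
  proof -
    have "(\<Prod>i=1..k. 2 * ((if i = 1 then \<sigma> else 1) * bK)) = (\<Prod>i=1..k. (if i = 1 then \<sigma> else 1) * \<phi> quantum_two)"
      by (simp add: two_bK[symmetric] mult_ac)
    also have "\<dots> = (\<Prod>i=1..k. if i = 1 then \<sigma> else 1) * qK" by (simp add: prod.distrib)
    also have "(\<Prod>i=1..k. if i = 1 then \<sigma> else 1) = \<sigma>" using k_pos by (simp add: prod.delta)
    finally show ?thesis .
  qed
  have g: "2 * dK = \<phi> (u_pow 1) - \<phi> (u_pow (-1))" unfolding two_dK by simp
  have "2 * tfun (fam l) (p1 \<otimes>\<^bsub>TT\<^esub> \<one>\<^bsub>TT\<^esub>) = \<phi> quantum_two ^ k * tfun (fam l) \<one>\<^bsub>TT\<^esub> +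
      (\<Prod>i=1..k. 2 * ((if i = 1 then sgn1 l else 1) * bK)) * tfun (fam l) \<one>\<^bsub>TT\<^esub>"
    by (rule tfun_nsP[OF fam(1)[OF l] fam(1)[OF l], where \<gamma> = "\<lambda>_. dK"])
      (simp_all add: fam(4)[OF l] g distrib_right)
  then show "2 * tfun (fam l) p1 = (1 + sgn1 l) * qK"
    unfolding pr tfun_fam_one[OF l] by (simp add: algebra_simps)
  have "2 * tfun (fam l) (p2 \<otimes>\<^bsub>TT\<^esub> \<one>\<^bsub>TT\<^esub>) = \<phi> quantum_two ^ k * tfun (fam l) \<one>\<^bsub>TT\<^esub> +
      (\<Prod>i=1..k. 2 * ((if i = 1 then sgn2 l else 1) * bK)) * tfun (fam l) \<one>\<^bsub>TT\<^esub>"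
    by (rule tfun_nsP[OF fam(1)[OF l] fam(1)[OF l], where \<gamma> = "\<lambda>_. dK"])
      (simp_all add: fam(5)[OF l] g distrib_right)
  then show "2 * tfun (fam l) p2 = (1 + sgn2 l) * qK"
    unfolding pr tfun_fam_one[OF l] by (simp add: algebra_simps)
qed

lemma two_cancel_K: "2 * x = 2 * (y :: 'k) \<Longrightarrow> x = y"
  using two_K(2) mult_left_cancel by blast

lemma tfun_fam_eps:
  assumes "l \<in> labels1 m"
  shows "tfun (fam l) p1 = eps_val1 qK l" "tfun (fam l) p2 = eps_val2 qK l"
proof -
  have "2 * tfun (fam l) p1 = 2 * eps_val1 qK l" unfolding tfun_fam_P[OF assms] by (cases l) simp_all
  then show "tfun (fam l) p1 = eps_val1 qK l" by (rule two_cancel_K)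
  have "2 * tfun (fam l) p2 = 2 * eps_val2 qK l" unfolding tfun_fam_P[OF assms] by (cases l) simp_all
  then show "tfun (fam l) p2 = eps_val2 qK l" by (rule two_cancel_K)
qed

definition ev :: "label1 \<Rightarrow> ('k, 'h) KH_elem \<Rightarrow> 'k" where
  "ev l = (SOME F. kadditive F \<and> (\<forall>c. \<forall>x\<in>carrier NH. F (kp c x) = c * tfun (fam l) x))"

lemma ev:
  assumes "l \<in> labels1 m"
  shows "kadditive (ev l)" "x \<in> carrier NH \<Longrightarrow> ev l (kp c x) = c * tfun (fam l) x"
proof -
  have "\<exists>F. kadditive F \<and> (\<forall>c. \<forall>x\<in>carrier NH. F (kp c x) = c * tfun (fam l) x)"
    by (rule K_functional_exists[where j = "\<lambda>c. c"])
      (simp_all add: tfun(1)[OF fam(1)[OF assms]] tfun_scal[OF fam(1)[OF assms]])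
  from someI_ex[OF this, folded ev_def] show "kadditive (ev l)" "x \<in> carrier NH \<Longrightarrow> ev l (kp c x) = c * tfun (fam l) x"
    by blast+
qed

lemma ev_mult:
  assumes l: "l \<in> labels1 m" and y: "y \<in> carrier KH" and z: "z \<in> carrier KH"
  shows "ev l (y \<otimes>\<^bsub>KH\<^esub> z) = ev l y * ev l z"
proof -
  note A = kadditiveD(1)[OF ev(1)[OF l]] and V = ev(2)[OF l]
  show ?thesis
    using y
  proof (induction y rule: KH_induct)
    case (kp c x)
    show ?case
      using z
    proof (induction z rule: KH_induct)
      case (kp d y)
      have "x \<otimes>\<^bsub>TT\<^esub> y \<in> carrier NH" using NH.m_closed[of x y] kp \<open>x \<in> _\<close> by simp
      then show ?case
        using kp \<open>x \<in> _\<close> by (simp add: kp_mult V tfun_fam_mult[OF l] NH_subset mult_ac)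
    next
      case (add y z)
      then show ?case using kp by (simp add: KH.r_distr A algebra_simps)
    qed
  next
    case (add y y')
    then show ?case using z by (simp add: KH.l_distr A algebra_simps)
  qed
qed

definition E :: "label1 \<Rightarrow> ('k, 'h) KH_elem \<Rightarrow> 'k \<Rightarrow> 'k" where "E l z v = ev l z * v"

lemma ev_kap: "l \<in> labels1 m \<Longrightarrow> ev l (kap c) = c"
  unfolding kap_eq by (simp add: ev one_NH tfun_fam_one)

lemma E_P:
  assumes "l \<in> labels1 m"
  shows "E l P1K = (\<lambda>v. eps_val1 qK l * v)" "E l P2K = (\<lambda>v. eps_val2 qK l * v)"
  by (simp_all add: E_def[abs_def] ev[OF assms] NH_mem tfun_fam_eps[OF assms])

lemma is_rep_E:
  assumes l: "l \<in> labels1 m"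
  shows "is_rep kap KH (*) (E l)"
  unfolding is_rep_def
proof (intro conjI ballI allI)
  show "vector_space ((*) :: 'k \<Rightarrow> 'k \<Rightarrow> 'k)" by (rule vector_space_field)
  show "Vector_Spaces.linear (*) (*) (E l z)" for z
    unfolding E_def[abs_def] by (rule linear_field)
  show "E l \<one>\<^bsub>KH\<^esub> v = v" for v unfolding kap_hom(3)[symmetric] E_def ev_kap[OF l] by simp
qed (simp_all add: E_def kadditiveD(1)[OF ev(1)[OF l]] ev_mult[OF l] ev_kap[OF l] algebra_simps)

lemma irreducible_E:
  assumes "l \<in> labels1 m"
  shows "irreducible_rep kap KH (*) (E l)"
  unfolding irreducible_rep_def
  using is_rep_E[OF assms] field_subspace by (auto intro: exI[of _ 1])

lemma is_tensor_module_E: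
  assumes l: "l \<in> labels1 m"
  shows "is_tensor_module \<phi> H \<eta> T k s1 s2 (\<lambda>i. if i = 1 then chr (sgn1 l) (sgn2 l) else chr 1 1) (E l)"
  unfolding is_tensor_module_def fam_def[symmetric]
proof (intro conjI bexI[of _ "tfun (fam l)"] ballI allI)
  show "is_rep kap KH (*) (E l)" by (rule is_rep_E[OF l])
  show "tfun (fam l) (pur h) = (\<Prod>i=1..k. fam l i (h i))" if "h \<in> {1..k} \<rightarrow> carrier H" for h
    by (rule tfun(2)[OF fam(1)[OF l] that])
  show "E l (kp c x) v = c * tfun (fam l) x * v" if "x \<in> carrier NH" for c v x
    using that by (simp add: E_def ev[OF l])
  show "tfun (fam l) \<in> ring_hom TT univ_ring"
    unfolding ring_hom_def
    by (simp add: tfun_fam_mult[OF l] tfun_fam_one[OF l] additiveD(1)[OF tfun(1)[OF fam(1)[OF l]]])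
qed

end

section \<open>Classification\<close>

context nonstandard
begin

lemma repD:
  assumes "is_rep kap KH sc \<rho>"
  shows "vector_space sc" "y \<in> carrier KH \<Longrightarrow> \<rho> y (v + w) = \<rho> y v + \<rho> y w"
    "y \<in> carrier KH \<Longrightarrow> \<rho> y (sc a v) = sc a (\<rho> y v)" "y \<in> carrier KH \<Longrightarrow> \<rho> y 0 = 0"
    "y \<in> carrier KH \<Longrightarrow> \<rho> y (v - w) = \<rho> y v - \<rho> y w"
    "y \<in> carrier KH \<Longrightarrow> z \<in> carrier KH \<Longrightarrow> \<rho> (y \<oplus>\<^bsub>KH\<^esub> z) v = \<rho> y v + \<rho> z v"
    "y \<in> carrier KH \<Longrightarrow> z \<in> carrier KH \<Longrightarrow> \<rho> (y \<otimes>\<^bsub>KH\<^esub> z) v = \<rho> y (\<rho> z v)"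
    "\<rho> \<one>\<^bsub>KH\<^esub> v = v" "\<rho> (kap a) v = sc a v"
proof -
  note * = assms[unfolded is_rep_def]
  show "vector_space sc" using * by blast
  have "Modules.module_hom sc sc (\<rho> y)" if "y \<in> carrier KH" for y
    using * that unfolding linear_iff_module_hom by blast
  note M = Modules.module_hom.add[OF this] Modules.module_hom.scale[OF this]
    Modules.module_hom.zero[OF this] Modules.module_hom.diff[OF this]
  show "y \<in> carrier KH \<Longrightarrow> \<rho> y (v + w) = \<rho> y v + \<rho> y w" by (rule M(1))
  show "y \<in> carrier KH \<Longrightarrow> \<rho> y (sc a v) = sc a (\<rho> y v)" by (rule M(2))
  show "y \<in> carrier KH \<Longrightarrow> \<rho> y 0 = 0" by (rule M(3))
  show "y \<in> carrier KH \<Longrightarrow> \<rho> y (v - w) = \<rho> y v - \<rho> y w" by (rule M(4))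
qed (use assms in \<open>simp_all add: is_rep_def\<close>)

lemma rep_minus:
  assumes "is_rep kap KH sc \<rho>" "y \<in> carrier KH" "z \<in> carrier KH"
  shows "\<rho> (y \<ominus>\<^bsub>KH\<^esub> z) v = \<rho> y v - \<rho> z v"
proof -
  have "\<rho> ((y \<ominus>\<^bsub>KH\<^esub> z) \<oplus>\<^bsub>KH\<^esub> z) v = \<rho> (y \<ominus>\<^bsub>KH\<^esub> z) v + \<rho> z v"
    using assms by (simp add: repD(6)[OF assms(1)])
  moreover have "(y \<ominus>\<^bsub>KH\<^esub> z) \<oplus>\<^bsub>KH\<^esub> z = y"
    using assms(2,3) by (simp add: a_minus_def KH.a_assoc KH.l_neg)
  ultimately show ?thesis by (simp add: eq_diff_eq)
qed

lemma rep_YK: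
  assumes rep: "is_rep kap KH sc \<rho>"
  shows "\<rho> YK v = sc qK (\<rho> P1K v + \<rho> P2K v) - (\<rho> P1K (\<rho> P2K v) + \<rho> P2K (\<rho> P1K v))"
  unfolding YK_def by (simp add: rep_minus[OF rep] repD(6,7,9)[OF rep] del: phi_simps)

lemma rep_P_square:
  assumes rep: "is_rep kap KH sc \<rho>"
  shows "\<rho> P1K (\<rho> P1K v) = sc qK (\<rho> P1K v)" "\<rho> P2K (\<rho> P2K v) = sc qK (\<rho> P2K v)"
  using repD(7)[OF rep, of P1K P1K v] repD(7)[OF rep, of P2K P2K v]
    repD(7)[OF rep, of "kap qK" P1K v] repD(7)[OF rep, of "kap qK" P2K v]
  unfolding P_square by (simp_all add: repD(9)[OF rep])

lemma intertwiner:
  assumes rep: "is_rep kap KH sc \<rho>" and rep': "is_rep kap KH sc' \<rho>'"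
    and add: "\<And>v w. f (v + w) = f v + f w" and scale: "\<And>a v. f (sc a v) = sc' a (f v)"
    and P1: "\<And>v. f (\<rho> P1K v) = \<rho>' P1K (f v)" and P2: "\<And>v. f (\<rho> P2K v) = \<rho>' P2K (f v)"
    and z: "z \<in> carrier KH"
  shows "f (\<rho> z v) = \<rho>' z (f v)"
  using z
proof (induction z arbitrary: v rule: KH_gen_induct)
  case (kap c)
  then show ?case by (simp add: repD(9)[OF rep] repD(9)[OF rep'] scale)
next
  case P1
  then show ?case by (rule assms(5))
next
  case P2
  then show ?case by (rule assms(6))
next
  case (add y z)
  then show ?case by (simp add: repD(6)[OF rep] repD(6)[OF rep'] assms(3))
next
  case (mult y z)
  then show ?case by (simp add: repD(7)[OF rep] repD(7)[OF rep'])
qed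

lemma irreducibleD:
  fixes sc :: "'k \<Rightarrow> 'v::ab_group_add \<Rightarrow> 'v"
  assumes "irreducible_rep kap KH sc \<rho>"
  shows "is_rep kap KH sc \<rho>" "\<exists>v::'v. v \<noteq> 0"
    "module.subspace sc U \<Longrightarrow> \<forall>z\<in>carrier KH. \<forall>v\<in>U. \<rho> z v \<in> U \<Longrightarrow> v \<in> U \<Longrightarrow> v \<noteq> 0 \<Longrightarrow> U = UNIV"
  using assms unfolding irreducible_rep_def by blast+

text \<open>Kernel and range are invariant subspaces, and one nonzero value rules out the zero map.
  \<open>intertwiner\<close> reduces compatibility to the two generators.\<close>

lemma schur:
  assumes irr: "irreducible_rep kap KH sc \<rho>" and irr': "irreducible_rep kap KH sc' \<rho>'"
    and add: "\<And>v w. f (v + w) = f v + f w" and scale: "\<And>a v. f (sc a v) = sc' a (f v)"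
    and P1: "\<And>v. f (\<rho> P1K v) = \<rho>' P1K (f v)" and P2: "\<And>v. f (\<rho> P2K v) = \<rho>' P2K (f v)"
    and nz: "f w \<noteq> 0"
  shows "rep_iso KH sc \<rho> sc' \<rho>'"
proof -
  note rep = irreducibleD(1)[OF irr] and rep' = irreducibleD(1)[OF irr']
  note V = repD(1)[OF rep] and V' = repD(1)[OF rep']
  have M: "Modules.module sc" "Modules.module sc'" using V V' by (simp_all add: module_iff_vector_space)
  have int: "f (\<rho> z v) = \<rho>' z (f v)" if "z \<in> carrier KH" for z v
    by (rule intertwiner[where f = f, OF rep rep' _ _ _ _ that]) (rule add, rule scale, rule P1, rule P2)
  have lin: "Modules.module_hom sc sc' f"
    using M add scale by (simp add: module_hom_def module_hom_axioms_def)
  have zero: "v = 0" if "f v = 0" for v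
  proof (rule ccontr)
    assume "v \<noteq> 0"
    have "{v. f v = 0} = UNIV"
    proof (rule irreducibleD(3)[OF irr Modules.module_hom.subspace_kernel[OF lin] _ _ \<open>v \<noteq> 0\<close>])
      show "\<forall>z\<in>carrier KH. \<forall>v\<in>{v. f v = 0}. \<rho> z v \<in> {v. f v = 0}"
        by (simp add: int repD(4)[OF rep'])
      show "v \<in> {v. f v = 0}" using that by simp
    qed
    then show False using nz by blast
  qed
  have "inj f"
  proof (rule injI)
    fix x y assume "f x = f y"
    then have "f (x - y) = 0" using Modules.module_hom.diff[OF lin, of x y] by simp
    from zero[OF this] show "x = y" by simp
  qed
  moreover have "range f = UNIV"
  proof (rule irreducibleD(3)[OF irr' _ _ _ nz])
    show "module.subspace sc' (range f)"
      by (rule Modules.module_hom.subspace_image[OF lin Modules.module.subspace_UNIV[OF M(1)]])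
    show "\<forall>z\<in>carrier KH. \<forall>v\<in>range f. \<rho>' z v \<in> range f"
      by (auto simp flip: int)
  qed (rule rangeI)
  ultimately have "bij f" by (simp add: bij_def)
  then show ?thesis unfolding rep_iso_def using lin int by (intro exI[of _ f]) (simp add: linear_iff_module_hom)
qed

text \<open>Apply the factors one after another: the last vector before the product becomes zero is
  an eigenvector of Y.\<close>

lemma eigenvector_exists:
  assumes rep: "is_rep kap KH sc \<rho>"
  shows "v \<noteq> 0 \<Longrightarrow> \<rho> (annihilator ys) v = 0 \<Longrightarrow> \<exists>y\<in>set ys. \<exists>w. w \<noteq> 0 \<and> \<rho> YK w = sc y w"
proof (induction ys)
  case Nil
  then show ?case by (simp add: repD(8)[OF rep])
next
  case (Cons y ys)
  let ?w = "\<rho> (annihilator ys) v"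
  show ?case
  proof (cases "?w = 0")
    case True
    then show ?thesis using Cons.IH[OF Cons.prems(1)] by auto
  next
    case False
    have "\<rho> (annihilator (y # ys)) v = \<rho> YK ?w - sc y ?w"
      by (simp add: repD(7)[OF rep] rep_minus[OF rep] repD(9)[OF rep])
    then have "\<rho> YK ?w = sc y ?w" using Cons.prems(2) by simp
    then show ?thesis using False by auto
  qed
qed

text \<open>The vanishing annihilator supplies an eigenvector, and its eigenspace is invariant
  because Y is central. This takes the place of Schur's lemma over an algebraically closed
  field.\<close>

lemma YK_scalar:
  fixes sc :: "'k \<Rightarrow> 'v::ab_group_add \<Rightarrow> 'v"
  assumes irr: "irreducible_rep kap KH sc \<rho>"
  shows "\<exists>y. eigenvalue y \<and> (\<forall>v. \<rho> YK v = sc y v)"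
proof -
  note rep = irreducibleD(1)[OF irr]
  interpret V: vector_space sc by (rule repD(1)[OF rep])
  obtain v :: 'v where v: "v \<noteq> 0" using irreducibleD(2)[OF irr] ..
  obtain ys where ys: "\<forall>y\<in>set ys. eigenvalue y" "annihilator ys = \<zero>\<^bsub>KH\<^esub>" using annihilator_exists by blast
  have "\<rho> \<zero>\<^bsub>KH\<^esub> v = 0" using repD(6)[OF rep KH.zero_closed KH.zero_closed, of v] by simp
  then obtain y w where y: "y \<in> set ys" "w \<noteq> 0" "\<rho> YK w = sc y w"
    using eigenvector_exists[OF rep v, of ys, unfolded ys(2)] by blast
  have "{v. \<rho> YK v = sc y v} = UNIV"
  proof (rule irreducibleD(3)[OF irr _ _ _ y(2)])
    show "V.subspace {v. \<rho> YK v = sc y v}"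
      by (intro V.subspaceI) (simp_all add: repD(2-4)[OF rep] V.scale_right_distrib V.scale_left_commute)
    have "\<rho> YK (\<rho> z u) = sc y (\<rho> z u)" if z: "z \<in> carrier KH" and "\<rho> YK u = sc y u" for z u
    proof -
      have "\<rho> z (\<rho> YK u) = sc y (\<rho> z u)" using that by (simp add: repD(3)[OF rep z])
      then show ?thesis
        unfolding repD(7)[OF rep z YK_closed, symmetric] repD(7)[OF rep YK_closed z, symmetric] YK_central[OF z] .
    qed
    then show "\<forall>z\<in>carrier KH. \<forall>u\<in>{v. \<rho> YK v = sc y v}. \<rho> z u \<in> {v. \<rho> YK v = sc y v}" by blast
  qed (use y in simp_all)
  then show ?thesis using ys(1) y(1) by blast
qed

lemma common_eigenvector_iso:
  assumes irr: "irreducible_rep kap KH sc \<rho>" and l: "l \<in> labels1 m" and v: "v \<noteq> 0"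
    and P: "\<rho> P1K v = sc (eps_val1 qK l) v" "\<rho> P2K v = sc (eps_val2 qK l) v"
  shows "rep_iso KH (*) (E l) sc \<rho>"
proof -
  note rep = irreducibleD(1)[OF irr]
  interpret V: vector_space sc by (rule repD(1)[OF rep])
  show ?thesis
    by (rule schur[OF irreducible_E[OF l] irr, of "\<lambda>a. sc a v" 1])
      (simp_all add: V.scale_left_distrib E_P[OF l] repD(3)[OF rep] P mult.commute v del: phi_simps)
qed

text \<open>For y = q^2 the alternative y = 0 fails because q is nonzero, and y = q^2 - c fails
  because c is nonzero; only the alternative with even m remains.\<close>

lemma mixed_label:
  assumes "eigenvalue (qK * qK)" shows "Eps1 \<in> labels1 m" "Eps2 \<in> labels1 m"
proof -
  have "even m"
    using assms cpar_nonzero(1) qK_nonzero unfolding eigenvalue_def by (auto simp del: phi_simps phi_eq_0)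
  then show "Eps1 \<in> labels1 m" "Eps2 \<in> labels1 m" by (simp_all add: labels1_def)
qed

text \<open>If P_1 acts as zero, some vector is a common eigenvector. Otherwise a vector v0 in the
  image of P_1 and v1 = P_2 v0 carry the matrices of X(q^2 - y), where y is the scalar of Y. For y =
  0 or y = q^2 this module is reducible and a common eigenvector is exhibited instead.\<close>

lemma classification:
  fixes sc :: "'k \<Rightarrow> 'v::ab_group_add \<Rightarrow> 'v"
  assumes irr: "irreducible_rep kap KH sc \<rho>"
  shows "(\<exists>l\<in>labels1 m. rep_iso KH (*) (E l) sc \<rho>) \<or> (\<exists>l\<in>labels2 m k. rep_iso KH (*s) (R l) sc \<rho>)"
proof -
  note rep = irreducibleD(1)[OF irr]
  interpret V: vector_space sc by (rule repD(1)[OF rep])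
  define q where "q = qK"
  have q0: "q \<noteq> 0" unfolding q_def by (rule qK_nonzero)
  define p r where "p = \<rho> P1K" and "r = \<rho> P2K"
  have p: "p (p v) = sc q (p v)" "p (sc a v) = sc a (p v)" "p (v + w) = p v + p w" "p (v - w) = p v - p w" "p 0 = 0"
    and r: "r (r v) = sc q (r v)" "r (sc a v) = sc a (r v)" "r (v + w) = r v + r w" "r (v - w) = r v - r w" "r 0 = 0"
    for a v w
    by (simp_all only: p_def r_def q_def rep_P_square[OF rep] repD(2-5)[OF rep] PK_closed)
  obtain y where y: "eigenvalue y" "\<And>v. \<rho> YK v = sc y v" using YK_scalar[OF irr] by blast
  have rel: "sc q (p v + r v) - (p (r v) + r (p v)) = sc y v" for v
    using rep_YK[OF rep, of v] unfolding y p_def r_def q_def by simp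
  note iso = common_eigenvector_iso[OF irr, folded p_def r_def q_def]
  have plus: "rep_iso KH (*) (E EpsPlus) sc \<rho>" if "v \<noteq> 0" "p v = sc q v" "r v = sc q v" for v
    using iso[OF _ that(1), of EpsPlus] that by (simp add: labels1_def)
  have minus: "rep_iso KH (*) (E EpsMinus) sc \<rho>" if "v \<noteq> 0" "p v = 0" "r v = 0" for v
    using iso[OF _ that(1), of EpsMinus] that by (simp add: labels1_def)
  have scq: "y = q * q" if "v \<noteq> 0" "sc q (sc q v) = sc y v" for v
    using that V.scale_cancel_right[of "q * q" v y] by simp
  have mixed1: "\<exists>l\<in>labels1 m. rep_iso KH (*) (E l) sc \<rho>" if v: "v \<noteq> 0" "p v = sc q v" "r v = 0" for v
  proof -
    have "y = q * q" using rel[of v] v by (intro scq[of v]) (simp_all add: p r)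
    then have "Eps1 \<in> labels1 m" using mixed_label y(1) unfolding q_def by blast
    then show ?thesis using iso[OF _ v(1), of Eps1] v by (intro bexI[of _ Eps1]) simp_all
  qed
  have mixed2: "\<exists>l\<in>labels1 m. rep_iso KH (*) (E l) sc \<rho>" if v: "v \<noteq> 0" "p v = 0" "r v = sc q v" for v
  proof -
    have "y = q * q" using rel[of v] v by (intro scq[of v]) (simp_all add: p r)
    then have "Eps2 \<in> labels1 m" using mixed_label y(1) unfolding q_def by blast
    then show ?thesis using iso[OF _ v(1), of Eps2] v by (intro bexI[of _ Eps2]) simp_all
  qed
  have l1: "EpsPlus \<in> labels1 m" "EpsMinus \<in> labels1 m" by (simp_all add: labels1_def)
  show ?thesis
  proof (cases "\<forall>w. p w = 0")
    case True
    obtain w :: 'v where w: "w \<noteq> 0" using irreducibleD(2)[OF irr] ..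
    show ?thesis
    proof (cases "r w = 0")
      case False
      then show ?thesis using mixed2[OF False] True r(1) by blast
    qed (use minus[OF w] True l1 in blast)
  next
    case False
    then obtain w where w: "p w \<noteq> 0" by blast
    define v0 v1 where "v0 = p w" and "v1 = r v0"
    have v: "v0 \<noteq> 0" "p v0 = sc q v0" "r v0 = v1" "r v1 = sc q v1"
      using w p(1) r(1) by (simp_all add: v0_def v1_def)
    have "sc q (sc q v0 + v1) - (p v1 + sc q v1) = sc y v0" using rel[of v0] unfolding v r by simp
    \<comment> \<open>On \<open>v0\<close> the relation for Y leaves P_1 v1 as its only unknown
      term, and the coefficient q^2 - y is the parameter c of X(c).\<close>
    then have pv1: "p v1 = sc (q * q - y) v0"
      by (simp add: V.scale_right_distrib V.scale_left_diff_distrib diff_eq_eq eq_diff_eq algebra_simps)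
    consider "y = 0" | "y = q * q" | l where "l \<in> labels2 m k" "y = q * q - cpar l"
      using y(1) unfolding eigenvalue_def q_def by blast
    then show ?thesis
    proof cases
      case 1
      show ?thesis
      proof (cases "sc q v0 - v1 = 0")
        case True
        then show ?thesis using plus[OF v(1,2)] v(3) l1 by auto
      next
        case False
        \<comment> \<open>For y = 0 the parameter is q^2, and this vector spans the common kernel of
          the two matrices of X(q^2).\<close>
        have "p (sc q v0 - v1) = 0" "r (sc q v0 - v1) = 0"
          by (simp_all add: p r v pv1 1)
        then show ?thesis using minus[OF False] l1 by blast
      qed
    next
      case 2
      show ?thesis
      proof (cases "v1 = 0")
        case True
        then show ?thesis using mixed1[OF v(1,2)] v(3) by simp
      next
        case False
        have "p v1 = 0" using pv1 2 by simp
        then show ?thesis using mixed2[OF False] v(4) by blast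
      qed
    next
      case (3 l)
      have pv1': "p v1 = sc (cpar l) v0" using pv1 3 by simp
      define f where "f a = sc (a$1) v0 + sc (a$2) v1" for a :: "'k^2"
      have "rep_iso KH (*s) (R l) sc \<rho>"
      proof (rule schur[OF irreducible_R[OF 3(1)] irr, of f "vector [1, 0]"])
        show "f (a + b) = f a + f b" for a b
          by (simp add: f_def V.scale_left_distrib)
        show "f (c *s a) = sc c (f a)" for c a
          by (simp add: f_def V.scale_right_distrib)
        show "f (R l P1K a) = \<rho> P1K (f a)" for a
          unfolding R_P[OF 3(1)] X_mat_mult p_def[symmetric] q_def[symmetric]
          by (simp add: f_def p v pv1' V.scale_left_distrib mult.commute)
        show "f (R l P2K a) = \<rho> P2K (f a)" for a
          unfolding R_P[OF 3(1)] X_mat_mult r_def[symmetric] q_def[symmetric]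
          by (simp add: f_def r v V.scale_left_distrib mult.commute)
        show "f (vector [1, 0]) \<noteq> 0" by (simp add: f_def v)
      qed
      then show ?thesis using 3(1) by blast
    qed
  qed
qed

section \<open>Distinctness and explicit form of the listed modules\<close>

lemma E_not_iso:
  assumes l: "l \<in> labels1 m" "l' \<in> labels1 m" and iso: "rep_iso KH (*) (E l) (*) (E l')"
  shows "l = l'"
proof -
  obtain f where f: "Modules.module_hom (*) (*) f" "bij f" "\<forall>x\<in>carrier KH. \<forall>v. f (E l x v) = E l' x (f v)"
    using iso unfolding rep_iso_def linear_iff_module_hom by blast
  have "f 1 \<noteq> f 0" unfolding inj_eq[OF bij_is_inj[OF f(2)]] by simp
  then have f1: "f 1 \<noteq> 0" unfolding Modules.module_hom.zero[OF f(1)] .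
  have s: "f a = a * f 1" for a using Modules.module_hom.scale[OF f(1), of a 1] by simp
  have "eps_val1 qK l * f 1 = eps_val1 qK l' * f 1" "eps_val2 qK l * f 1 = eps_val2 qK l' * f 1"
    using f(3)[rule_format, OF PK_closed(1), of 1] f(3)[rule_format, OF PK_closed(2), of 1]
    unfolding E_P[OF l(1)] E_P[OF l(2)] mult_1_right s[of "eps_val1 qK l"] s[of "eps_val2 qK l"] .
  then have "eps_val1 qK l = eps_val1 qK l'" "eps_val2 qK l = eps_val2 qK l'"
    using f1 mult_right_cancel by blast+
  then show ?thesis using qK_nonzero by (cases l; cases l') simp_all
qed

lemma R_YK:
  assumes l: "l \<in> labels2 m k"
  shows "R l YK v = (qK * qK - cpar l) *s v"
  unfolding rep_YK[OF is_rep_R[OF l]] R_P[OF l] X_mat_mult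
  by (simp add: vec_eq_iff forall_2) (simp add: algebra_simps)

text \<open>The scalar by which Y acts is an isomorphism invariant and recovers
  \<open>cpar\<close>.\<close>

lemma R_not_iso:
  assumes l: "l \<in> labels2 m k" "l' \<in> labels2 m k" and iso: "rep_iso KH (*s) (R l) (*s) (R l')"
  shows "l = l'"
proof -
  obtain f where f: "Modules.module_hom (*s) (*s) f" "bij f" "\<forall>x\<in>carrier KH. \<forall>v. f (R l x v) = R l' x (f v)"
    using iso unfolding rep_iso_def linear_iff_module_hom by blast
  have "f 1 \<noteq> f 0" unfolding inj_eq[OF bij_is_inj[OF f(2)]] by (simp add: vec_eq_iff)
  then have f1: "f 1 \<noteq> 0" unfolding Modules.module_hom.zero[OF f(1)] .
  have "(qK * qK - cpar l) *s f 1 = (qK * qK - cpar l') *s f 1"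
    using f(3)[rule_format, OF YK_closed, of 1] unfolding R_YK[OF l(1)] R_YK[OF l(2)]
      Modules.module_hom.scale[OF f(1)] .
  then have "qK * qK - cpar l = qK * qK - cpar l'" using f1 vec.scale_cancel_right by blast
  then show ?thesis by (intro cpar_inject[OF l]) simp
qed

lemma E_R_not_iso: "\<not> rep_iso KH (*) (E l) (*s) (R l')"
proof
  assume "rep_iso KH (*) (E l) (*s) (R l')"
  then obtain f :: "'k \<Rightarrow> 'k^2" where f: "Modules.module_hom (*) (*s) f" "bij f"
    unfolding rep_iso_def linear_iff_module_hom by blast
  have s: "f a = a *s f 1" for a using Modules.module_hom.scale[OF f(1), of a 1] by simp
  obtain a b where "f a = vector [1, 0]" "f b = vector [0, 1]" using surjD[OF bij_is_surj[OF f(2)]] by metis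
  then have "a * f 1 $ 1 = 1" "a * f 1 $ 2 = 0" "b * f 1 $ 2 = 1"
    unfolding s[of a] s[of b] by (simp_all add: vec_eq_iff forall_2)
  then show False by auto
qed

lemma R_LabN:
  assumes \<gamma>: "\<gamma> \<in> SComp_le n k" "c \<in> \<gamma>"
  shows "R (LabN \<gamma>) P1K = (\<lambda>v. X_mat1 qK ((qK * a_val \<phi> sw sf n c)\<^sup>2) *v v)"
    "R (LabN \<gamma>) P2K = (\<lambda>v. X_mat2 qK *v v)"
proof -
  have l: "LabN \<gamma> \<in> labels2 m k" using \<gamma> by (simp add: labels2_def n_def)
  obtain N where "\<gamma> \<in> SComp n N" using \<gamma>(1) by (auto simp: SComp_le_def)
  show "R (LabN \<gamma>) P1K = (\<lambda>v. X_mat1 qK ((qK * a_val \<phi> sw sf n c)\<^sup>2) *v v)"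
    "R (LabN \<gamma>) P2K = (\<lambda>v. X_mat2 qK *v v)"
    by (simp_all only: R_P[OF l] cpar_class(1)[OF \<open>\<gamma> \<in> SComp n N\<close> \<gamma>(2)])
qed

lemma R_LabN1:
  assumes "even m" and \<gamma>: "\<gamma> \<in> SComp_less n k" "c \<in> \<gamma>"
  shows "R (LabN1 \<gamma>) P1K = (\<lambda>v. X_mat1 qK ((qK * a1_val \<phi> sw sf n c)\<^sup>2) *v v)"
    "R (LabN1 \<gamma>) P2K = (\<lambda>v. X_mat2 qK *v v)"
proof -
  have l: "LabN1 \<gamma> \<in> labels2 m k" using assms by (simp add: labels2_def n_def)
  obtain N where "\<gamma> \<in> SComp n N" using \<gamma>(1) by (auto simp: SComp_less_def)
  show "R (LabN1 \<gamma>) P1K = (\<lambda>v. X_mat1 qK ((qK * a1_val \<phi> sw sf n c)\<^sup>2) *v v)"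
    "R (LabN1 \<gamma>) P2K = (\<lambda>v. X_mat2 qK *v v)"
    by (simp_all only: R_P[OF l] cpar_class(2)[OF \<open>\<gamma> \<in> SComp n N\<close> \<gamma>(2)])
qed

text \<open>The modules \<open>E Eps1\<close> and \<open>E Eps2\<close> were built from the
  characters with signs (1, -1) and (-1, 1) in the first position, so they are the tensor products
  themselves and the isomorphisms are identities.\<close>

lemma E_tensor_products:
  assumes "even m"
  shows "\<exists>ep e1 e2 \<rho>1 \<rho>2.
    is_character \<phi> H \<eta> ep \<and> is_character \<phi> H \<eta> e1 \<and> is_character \<phi> H \<eta> e2 \<and>
    ep (C_plus H \<eta> T s1) = \<phi> quantum_two \<and> ep (C_plus H \<eta> T s2) = \<phi> quantum_two \<and>
    e1 (C_plus H \<eta> T s1) = \<phi> quantum_two \<and> e1 (C_plus H \<eta> T s2) = 0 \<and>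
    e2 (C_plus H \<eta> T s1) = 0 \<and> e2 (C_plus H \<eta> T s2) = \<phi> quantum_two \<and>
    is_tensor_module \<phi> H \<eta> T k s1 s2 (\<lambda>i. if i = 1 then e1 else ep) \<rho>1 \<and>
    is_tensor_module \<phi> H \<eta> T k s1 s2 (\<lambda>i. if i = 1 then e2 else ep) \<rho>2 \<and>
    rep_iso KH (*) (E Eps1) (*) \<rho>1 \<and> rep_iso KH (*) (E Eps2) (*) \<rho>2"
proof -
  have l: "Eps1 \<in> labels1 m" "Eps2 \<in> labels1 m" using assms by (simp_all add: labels1_def)
  have adm: "admissible 1 1" "admissible 1 (- 1)" "admissible (- 1) 1"
    using assms by (simp_all add: admissible_def)
  have val: "chr 1 1 (C_plus H \<eta> T s1) = \<phi> quantum_two" "chr 1 1 (C_plus H \<eta> T s2) = \<phi> quantum_two"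
    "chr 1 (- 1) (C_plus H \<eta> T s1) = \<phi> quantum_two" "chr 1 (- 1) (C_plus H \<eta> T s2) = 0"
    "chr (- 1) 1 (C_plus H \<eta> T s1) = 0" "chr (- 1) 1 (C_plus H \<eta> T s2) = \<phi> quantum_two"
    by (rule two_cancel_K; simp add: chr_C_plus adm del: mult_cancel_left)+
  show ?thesis
    using val is_character_chr[OF adm(1)] is_character_chr[OF adm(2)] is_character_chr[OF adm(3)]
      is_tensor_module_E[OF l(1), unfolded sgn1.simps sgn2.simps]
      is_tensor_module_E[OF l(2), unfolded sgn1.simps sgn2.simps]
      rep_iso_refl[OF vector_space_field, of KH "E Eps1"] rep_iso_refl[OF vector_space_field, of KH "E Eps2"]
    by (intro exI[of _ "chr 1 1"] exI[of _ "chr 1 (- 1)"] exI[of _ "chr (- 1) 1"]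
        exI[of _ "E Eps1"] exI[of _ "E Eps2"] conjI)
qed

end

theorem theorem4p6:
  fixes m k n :: nat
    and W :: "('w, 'x) monoid_scheme" and s1 s2 :: 'w
    and H :: "('h, 'y) ring_scheme" and \<eta> :: "laurent \<Rightarrow> 'h" and T :: "'w \<Rightarrow> 'h"
    and \<phi> :: "laurent \<Rightarrow> 'k::field" and \<iota> :: "'k \<Rightarrow> 'l::field" and \<zeta> :: 'l
    and sw sf :: "nat \<Rightarrow> 'k"
  assumes m: "m \<ge> 2" and k: "k \<ge> 1" and n: "n = half_index m"
    and W: "dihedral W m s1 s2"
    and H: "hecke_algebra W {s1, s2} H \<eta> T"
    and K: "splitting_field m n \<phi> \<iota> \<zeta> sw sf"
  defines "KH \<equiv> K_nonstandard_hecke \<phi> H \<eta> T k s1 s2"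
    and "\<kappa> \<equiv> K_scalar \<phi> H \<eta> T k s1 s2"
    and "P1 \<equiv> K_pure \<phi> H \<eta> T k s1 s2 1 (nsP H \<eta> T k s1)"
    and "P2 \<equiv> K_pure \<phi> H \<eta> T k s1 s2 1 (nsP H \<eta> T k s2)"
    and "b \<equiv> \<phi> quantum_two"
    and "q \<equiv> \<phi> quantum_two ^ k"
  shows "\<exists>(E :: label1 \<Rightarrow> ('k, 'h) KH_elem \<Rightarrow> 'k \<Rightarrow> 'k)
          (R :: label2 \<Rightarrow> ('k, 'h) KH_elem \<Rightarrow> 'k^2 \<Rightarrow> 'k^2).
    \<comment> \<open>the listed modules\<close>
    (\<forall>l\<in>labels1 m. E l P1 = (\<lambda>v. eps_val1 q l * v) \<and> E l P2 = (\<lambda>v. eps_val2 q l * v)) \<and>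
    (\<forall>\<gamma>\<in>SComp_le n k. \<forall>k'\<in>\<gamma>.
       R (LabN \<gamma>) P1 = (\<lambda>v. X_mat1 q ((q * a_val \<phi> sw sf n k')\<^sup>2) *v v) \<and>
       R (LabN \<gamma>) P2 = (\<lambda>v. X_mat2 q *v v)) \<and>
    (even m \<longrightarrow> (\<forall>\<gamma>\<in>SComp_less n k. \<forall>k'\<in>\<gamma>.
       R (LabN1 \<gamma>) P1 = (\<lambda>v. X_mat1 q ((q * a1_val \<phi> sw sf n k')\<^sup>2) *v v) \<and>
       R (LabN1 \<gamma>) P2 = (\<lambda>v. X_mat2 q *v v))) \<and>
    \<comment> \<open>they are irreducible\<close>
    (\<forall>l\<in>labels1 m. irreducible_rep \<kappa> KH (*) (E l)) \<and>
    (\<forall>l\<in>labels2 m k. irreducible_rep \<kappa> KH (*s) (R l)) \<and>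
    \<comment> \<open>and pairwise non-isomorphic\<close>
    (\<forall>l\<in>labels1 m. \<forall>l'\<in>labels1 m. l \<noteq> l' \<longrightarrow> \<not> rep_iso KH (*) (E l) (*) (E l')) \<and>
    (\<forall>l\<in>labels2 m k. \<forall>l'\<in>labels2 m k. l \<noteq> l' \<longrightarrow> \<not> rep_iso KH (*s) (R l) (*s) (R l')) \<and>
    (\<forall>l\<in>labels1 m. \<forall>l'\<in>labels2 m k. \<not> rep_iso KH (*) (E l) (*s) (R l')) \<and>
    \<comment> \<open>every irreducible representation is isomorphic to one of them\<close>
    (\<forall>(sc :: 'k \<Rightarrow> 'v::ab_group_add \<Rightarrow> 'v) \<rho>. irreducible_rep \<kappa> KH sc \<rho> \<longrightarrow>
       (\<exists>l\<in>labels1 m. rep_iso KH (*) (E l) sc \<rho>) \<or>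
       (\<exists>l\<in>labels2 m k. rep_iso KH (*s) (R l) sc \<rho>)) \<and>
    \<comment> \<open>the tensor product description of the two additional one-dimensional modules\<close>
    (even m \<longrightarrow>
       (\<exists>ep e1 e2 \<rho>1 \<rho>2.
          is_character \<phi> H \<eta> ep \<and> is_character \<phi> H \<eta> e1 \<and> is_character \<phi> H \<eta> e2 \<and>
          ep (C_plus H \<eta> T s1) = b \<and> ep (C_plus H \<eta> T s2) = b \<and>
          e1 (C_plus H \<eta> T s1) = b \<and> e1 (C_plus H \<eta> T s2) = 0 \<and>
          e2 (C_plus H \<eta> T s1) = 0 \<and> e2 (C_plus H \<eta> T s2) = b \<and>
          is_tensor_module \<phi> H \<eta> T k s1 s2 (\<lambda>i. if i = 1 then e1 else ep) \<rho>1 \<and>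
          is_tensor_module \<phi> H \<eta> T k s1 s2 (\<lambda>i. if i = 1 then e2 else ep) \<rho>2 \<and>
          rep_iso KH (*) (E Eps1) (*) \<rho>1 \<and> rep_iso KH (*) (E Eps2) (*) \<rho>2))"
proof -
  have "dihedral_hecke W m s1 s2 H \<eta> T"
    using m W H by (simp add: dihedral_hecke_def finite_dihedral_def finite_dihedral_axioms_def)
  then interpret N: nonstandard W m s1 s2 H \<eta> T k n \<phi> \<iota> \<zeta> sw sf
    using k n K by (simp add: nonstandard_def nonstandard_axioms_def tensor_hecke_def tensor_hecke_axioms_def)
  show ?thesis
    unfolding KH_def \<kappa>_def P1_def P2_def b_def q_def
  proof (rule exI[of _ N.E], rule exI[of _ N.R], intro conjI ballI allI impI, goal_cases)
    case (1 l) then show ?case by (rule N.E_P(1))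
  next
    case (2 l) then show ?case by (rule N.E_P(2))
  next
    case (3 \<gamma> c) then show ?case by (rule N.R_LabN(1))
  next
    case (4 \<gamma> c) then show ?case by (rule N.R_LabN(2))
  next
    case (5 \<gamma> c) then show ?case by (rule N.R_LabN1(1))
  next
    case (6 \<gamma> c) then show ?case by (rule N.R_LabN1(2))
  next
    case (7 l) then show ?case by (rule N.irreducible_E)
  next
    case (8 l) then show ?case by (rule N.irreducible_R)
  next
    case (9 l l') then show ?case using N.E_not_iso by blast
  next
    case (10 l l') then show ?case using N.R_not_iso by blast
  next
    case (11 l l') show ?case by (rule N.E_R_not_iso)
  next
    case (12 sc \<rho>) then show ?case by (rule N.classification)
  next
    case 13 then show ?case by (rule N.E_tensor_products)
  qed
qed

end
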